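(* Let $d\ge2$ be an integer, and let $p\in(1,\infty)$ and $m>0$ satisfy $m(p-1)>1$ and $dp>d+1$. Let $o\in\mathbb{R}^d$ and $r^o(y):=|y-o|$. Then for every $x\in\mathbb{R}^d\setminus\{o\}$ and every probabilistically weak solution $X$ (as defined in the context) starting at $x$, on a stochastic basis $(\Omega,\mathscr{F},\mathscr{F}_\bullet,\mathbf{P}^x)$, there is a standard one-dimensional $\mathscr{F}_\bullet$-Brownian motion $B$ such that, $\mathbf{P}^x$-a.s. (in integrated form over $[0,t]$ for all $t\ge0$), $$\mathrm{d}r^o(X_t)=\sqrt{2a(t,|X_t-x|)}\,\mathrm{d}B_t+a(t,|X_t-x|)\,\frac{d-1}{r^o(X_t)}\,\mathrm{d}t+a_r(t,|X_t-x|)\,\mathrm{sgn}(X_t-x)\cdot\mathrm{sgn}(X_t-o)\,\mathrm{d}t$$ $$=\sqrt{2a(t,|X_t-x|)}\,\mathrm{d}B_t+\mathsf{L}_{p,m}^x r^o(X_t)\,\mathrm{d}t.$$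
   Context: Parameters: $\beta:=p+d(m(p-1)-1)$, $\gamma:=\frac{p-1}{m(p-1)-1}$, $\kappa:=\frac{m(p-1)-1}{mp}\beta^{-1/(p-1)}$, all positive. $\omega_{d-1}$ is the area of the unit sphere in $\mathbb{R}^d$. Barenblatt profile: for $t>0$, $r\ge 0$, $S(t,r):=C-\kappa[t^{-1/\beta}r]^{p/(p-1)}$ and $U(t,r):=t^{-d/\beta}\,\max\{S(t,r),0\}^\gamma$, where $C>0$ is the unique constant (depending only on $d,p,m$) such that $\omega_{d-1}\int_0^\infty U(t,r)r^{d-1}\,\mathrm{d}r=1$ for every $t>0$. Put $\rho:=(C/\kappa)^{(p-1)/p}$; the support of $U(t,\cdot)$ is $[0,\rho t^{1/\beta}]$. The Barenblatt solution is $w^x(t,y):=U(t,|y-x|)$. Coefficients: for $0<r<\rho t^{1/\beta}$ let $a(t,r):=m^{p-1}|\partial_rU(t,r)|^{p-2}U(t,r)^{(m-1)(p-1)}$ and $a_r:=\partial_r a$; set $a(t,r):=a_r(t,r):=0$ for $r\ge\rho t^{1/\beta}$ and for $r=0$. For $z\in\mathbb{R}^d$, $\mathrm{sgn}\,z:=z/|z|$ if $z\ne0$, $\mathrm{sgn}\,0:=0$. Generator: for a function $u$ on $(0,\infty)\times\mathbb{R}^d$ (or on $\mathbb{R}^d$), $\mathsf{L}_{p,m}^xu:=m^{p-1}\Delta[|\nabla w^x|^{p-2}(w^x)^{(m-1)(p-1)}u]-m^{p-1}\mathrm{div}[\nabla[|\nabla w^x|^{p-2}(w^x)^{(m-1)(p-1)}]\,u]$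 whenever this makes sense; here $m^{p-1}|\nabla w^x(t,y)|^{p-2}w^x(t,y)^{(m-1)(p-1)}$ means $a(t,|y-x|)$. In the claim, $\mathsf{L}^x_{p,m}r^o(X_t)$ is the pointwise value at time $t$ and position $y=X_t$, with $y\notin\{x,o\}$ and $|y-x|\ne\rho t^{1/\beta}$ (the remaining points are visited only for a set of times of zero Lebesgue measure, a.s.). A stochastic basis is a complete probability space $(\Omega,\mathscr{F},\mathbf{P}^x)$ with a right-continuous filtration $\mathscr{F}_\bullet$ augmented by null sets; $\mathbf{E}^x$ denotes expectation. A probabilistically weak solution starting at $x\in\mathbb{R}^d$ is a continuous $\mathscr{F}_\bullet$-adapted $\mathbb{R}^d$-valued process $X$ on a stochastic basis carrying a standard $d$-dimensional $\mathscr{F}_\bullet$-Brownian motion $W$ such that (a) $\mathbf{E}^x[\int_0^t a(s,|X_s-x|)\,\mathrm{d}s]<\infty$ and $\mathbf{E}^x[\int_0^t|a_r(s,|X_s-x|)|\,\mathrm{d}s]<\infty$ for every $t>0$; (b) $\mathbf{P}^x$-a.s., for all $t\ge0$, $X_t=X_0+\int_0^t\sqrt{2a(s,|X_s-x|)}\,\mathrm{d}W_s+\int_0^t a_r(s,|X_s-x|)\,\mathrm{sgn}(X_s-x)\,\mathrm{d}s$; (c) for every $t>0$ the law of $X_t$ is $w^x(t,\cdot)\,\mathscr{L}^d$ ($\mathscr{L}^d$ Lebesgue measure); consequently $X_0=x$ a.s. *)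

theory Defs
  imports "HOL-Probability.Probability"
begin

section \<open>The Barenblatt profile and the coefficients\<close>

definition bb_beta :: "nat \<Rightarrow> real \<Rightarrow> real \<Rightarrow> real" where
  "bb_beta d p m = p + real d * (m * (p - 1) - 1)"

definition bb_gamma :: "real \<Rightarrow> real \<Rightarrow> real" where
  "bb_gamma p m = (p - 1) / (m * (p - 1) - 1)"

definition bb_kappa :: "nat \<Rightarrow> real \<Rightarrow> real \<Rightarrow> real" where
  "bb_kappa d p m = (m * (p - 1) - 1) / (m * p) * bb_beta d p m powr (- 1 / (p - 1))"

text \<open>The area of the unit sphere in dimension \<open>d\<close> is \<open>d\<close> times the volume of the unit ball.\<close>

definition unit_sphere_area :: "nat \<Rightarrow> real" where
  "unit_sphere_area d = real d * unit_ball_vol (real d)"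

definition profile :: "nat \<Rightarrow> real \<Rightarrow> real \<Rightarrow> real \<Rightarrow> real \<Rightarrow> real \<Rightarrow> real" where
  "profile d p m C t r =
     t powr (- real d / bb_beta d p m) *
     max (C - bb_kappa d p m * (t powr (- 1 / bb_beta d p m) * r) powr (p / (p - 1))) 0
       powr bb_gamma p m"

definition bb_C :: "nat \<Rightarrow> real \<Rightarrow> real \<Rightarrow> real" where
  "bb_C d p m = (THE C. C > 0 \<and>
     (\<forall>t>0. unit_sphere_area d * (LINT r:{0..}|lborel. profile d p m C t r * r ^ (d - 1)) = 1))"

definition bb_U :: "nat \<Rightarrow> real \<Rightarrow> real \<Rightarrow> real \<Rightarrow> real \<Rightarrow> real" where
  "bb_U d p m = profile d p m (bb_C d p m)"

definition bb_rho :: "nat \<Rightarrow> real \<Rightarrow> real \<Rightarrow> real" where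
  "bb_rho d p m = (bb_C d p m / bb_kappa d p m) powr ((p - 1) / p)"

text \<open>The radius of the free boundary at time \<open>t\<close>.\<close>

definition bb_radius :: "nat \<Rightarrow> real \<Rightarrow> real \<Rightarrow> real \<Rightarrow> real" where
  "bb_radius d p m t = bb_rho d p m * t powr (1 / bb_beta d p m)"

definition coeff_a :: "nat \<Rightarrow> real \<Rightarrow> real \<Rightarrow> real \<Rightarrow> real \<Rightarrow> real" where
  "coeff_a d p m t r =
     (if 0 < r \<and> r < bb_radius d p m t
      then m powr (p - 1) * \<bar>deriv (bb_U d p m t) r\<bar> powr (p - 2)
             * bb_U d p m t r powr ((m - 1) * (p - 1))
      else 0)"

definition coeff_ar :: "nat \<Rightarrow> real \<Rightarrow> real \<Rightarrow> real \<Rightarrow> real \<Rightarrow> real" where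
  "coeff_ar d p m t r =
     (if 0 < r \<and> r < bb_radius d p m t then deriv (coeff_a d p m t) r else 0)"

definition barenblatt :: "real \<Rightarrow> real \<Rightarrow> 'a::euclidean_space \<Rightarrow> real \<Rightarrow> 'a \<Rightarrow> real" where
  "barenblatt p m x t y = bb_U DIM('a) p m t (norm (y - x))"

section \<open>The generator\<close>

definition grad :: "('a::euclidean_space \<Rightarrow> real) \<Rightarrow> 'a \<Rightarrow> 'a" where
  "grad f y = (\<Sum>b\<in>Basis. frechet_derivative f (at y) b *\<^sub>R b)"

definition dvg :: "('a::euclidean_space \<Rightarrow> 'a) \<Rightarrow> 'a \<Rightarrow> real" where
  "dvg G y = (\<Sum>b\<in>Basis. frechet_derivative G (at y) b \<bullet> b)"

definition laplace :: "('a::euclidean_space \<Rightarrow> real) \<Rightarrow> 'a \<Rightarrow> real" where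
  "laplace f = dvg (grad f)"

text \<open>The pointwise value at time \<open>t\<close> and position \<open>y\<close> of the generator applied to the spatial
  function \<open>u\<close>. It is meaningful only where the functions involved are differentiable; elsewhere
  \<^const>\<open>frechet_derivative\<close>, and hence the value, is unspecified.\<close>

definition generator ::
  "real \<Rightarrow> real \<Rightarrow> 'a::euclidean_space \<Rightarrow> real \<Rightarrow> ('a \<Rightarrow> real) \<Rightarrow> 'a \<Rightarrow> real" where
  "generator p m x t u y =
     laplace (\<lambda>z. coeff_a DIM('a) p m t (norm (z - x)) * u z) y
     - dvg (\<lambda>z. u z *\<^sub>R grad (\<lambda>z'. coeff_a DIM('a) p m t (norm (z' - x))) z) y"

section \<open>Stochastic bases and Brownian motion\<close>

text \<open>Time is the half-line \<open>{0..}\<close>; values of filtrations and processes at negative times are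
  irrelevant throughout.\<close>

locale stochastic_basis = prob_space M + complete_measure M
  for M :: "'w measure" +
  fixes F :: "real \<Rightarrow> 'w measure"
  assumes subalgebra_F: "0 \<le> t \<Longrightarrow> subalgebra M (F t)"
    and mono_F: "0 \<le> s \<Longrightarrow> s \<le> t \<Longrightarrow> sets (F s) \<subseteq> sets (F t)"
    and right_continuous_F: "0 \<le> s \<Longrightarrow> sets (F s) = (\<Inter>t\<in>{s<..}. sets (F t))"
    and null_sets_F: "0 \<le> t \<Longrightarrow> null_sets M \<subseteq> sets (F t)"

definition continuous_adapted ::
  "'w measure \<Rightarrow> (real \<Rightarrow> 'w measure) \<Rightarrow> (real \<Rightarrow> 'w \<Rightarrow> 'b::euclidean_space) \<Rightarrow> bool" where
  "continuous_adapted M F X \<longleftrightarrow>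
     (\<forall>t\<ge>0. X t \<in> borel_measurable (F t)) \<and>
     (\<forall>\<omega>\<in>space M. continuous_on {0..} (\<lambda>t. X t \<omega>))"

definition brownian_motion ::
  "'w measure \<Rightarrow> (real \<Rightarrow> 'w measure) \<Rightarrow> (real \<Rightarrow> 'w \<Rightarrow> 'b::euclidean_space) \<Rightarrow> bool" where
  "brownian_motion M F W \<longleftrightarrow>
     continuous_adapted M F W \<and>
     (AE \<omega> in M. W 0 \<omega> = 0) \<and>
     (\<forall>s t. 0 \<le> s \<and> s < t \<longrightarrow>
        prob_space.indep_set M (sets (F s))
          (sets (vimage_algebra (space M) (\<lambda>\<omega>. W t \<omega> - W s \<omega>) borel)) \<and>
        distributed M lborel (\<lambda>\<omega>. W t \<omega> - W s \<omega>)
          (\<lambda>z. ennreal (\<Prod>b\<in>Basis. normal_density 0 (sqrt (t - s)) (z \<bullet> b))))"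

section \<open>The Ito integral of a scalar integrand\<close>

definition progressive ::
  "(real \<Rightarrow> 'w measure) \<Rightarrow> (real \<Rightarrow> 'w \<Rightarrow> real) \<Rightarrow> bool" where
  "progressive F H \<longleftrightarrow>
     (\<forall>T\<ge>0. (\<lambda>(s, \<omega>). H s \<omega>) \<in> borel_measurable (restrict_space borel {0..T} \<Otimes>\<^sub>M F T))"

text \<open>The data \<open>n\<close>, \<open>\<tau>\<close>, \<open>\<xi>\<close> stand for the simple integrand that equals \<open>\<xi> i\<close> on
  \<open>{\<tau> i<..\<tau> (Suc i)}\<close> for \<open>i < n\<close>, where \<open>\<xi> i\<close> is bounded and known at time \<open>\<tau> i\<close>.\<close>

definition simple_integrand ::
  "'w measure \<Rightarrow> (real \<Rightarrow> 'w measure) \<Rightarrow> nat \<Rightarrow> (nat \<Rightarrow> real) \<Rightarrow> (nat \<Rightarrow> 'w \<Rightarrow> real) \<Rightarrow> bool" where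
  "simple_integrand M F n \<tau> \<xi> \<longleftrightarrow>
     0 \<le> \<tau> 0 \<and>
     (\<forall>i<n. \<tau> i \<le> \<tau> (Suc i) \<and> \<xi> i \<in> borel_measurable (F (\<tau> i)) \<and>
            (\<exists>K. \<forall>\<omega>\<in>space M. \<bar>\<xi> i \<omega>\<bar> \<le> K))"

definition simple_process ::
  "nat \<Rightarrow> (nat \<Rightarrow> real) \<Rightarrow> (nat \<Rightarrow> 'w \<Rightarrow> real) \<Rightarrow> real \<Rightarrow> 'w \<Rightarrow> real" where
  "simple_process n \<tau> \<xi> s \<omega> = (\<Sum>i<n. \<xi> i \<omega> * indicator {\<tau> i<..\<tau> (Suc i)} s)"

definition simple_integral ::
  "nat \<Rightarrow> (nat \<Rightarrow> real) \<Rightarrow> (nat \<Rightarrow> 'w \<Rightarrow> real) \<Rightarrow> (real \<Rightarrow> 'w \<Rightarrow> 'b::real_normed_vector) \<Rightarrow>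
   real \<Rightarrow> 'w \<Rightarrow> 'b" where
  "simple_integral n \<tau> \<xi> W t \<omega> =
     (\<Sum>i<n. \<xi> i \<omega> *\<^sub>R (W (min t (\<tau> (Suc i))) \<omega> - W (min t (\<tau> i)) \<omega>))"

text \<open>\<open>I\<close> is a continuous version of the process \<open>\<integral>\<^sub>0\<^sup>t H dW\<close>, obtained as limit in mean
  square of integrals of simple integrands. The convergence forces
  \<open>E \<integral>\<^sub>0\<^sup>T H\<^sup>2 ds\<close> to be finite for all \<open>T\<close>; by the first moment condition in the definition
  of \<open>weak_solution\<close> below, this class contains all integrands that occur. The integrand is scalar
  and \<open>W\<close> may be vector-valued, so the same notion serves for \<open>d\<close>-dimensional and for
  one-dimensional Brownian motion. Any two such \<open>I\<close> are indistinguishable.\<close>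

definition ito_integral ::
  "'w measure \<Rightarrow> (real \<Rightarrow> 'w measure) \<Rightarrow> (real \<Rightarrow> 'w \<Rightarrow> 'b::euclidean_space) \<Rightarrow>
   (real \<Rightarrow> 'w \<Rightarrow> real) \<Rightarrow> (real \<Rightarrow> 'w \<Rightarrow> 'b) \<Rightarrow> bool" where
  "ito_integral M F W H I \<longleftrightarrow>
     progressive F H \<and> continuous_adapted M F I \<and>
     (\<forall>T>0. \<exists>n \<tau> \<xi>.
        (\<forall>k. simple_integrand M F (n k) (\<tau> k) (\<xi> k)) \<and>
        (\<lambda>k. \<integral>\<^sup>+\<omega>. (\<integral>\<^sup>+s\<in>{0..T}. ennreal ((H s \<omega> - simple_process (n k) (\<tau> k) (\<xi> k) s \<omega>)\<^sup>2)
                      \<partial>lborel) \<partial>M) \<longlonglongrightarrow> 0 \<and>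
        (\<forall>t\<in>{0..T}.
           (\<lambda>k. \<integral>\<^sup>+\<omega>. ennreal ((norm (I t \<omega> - simple_integral (n k) (\<tau> k) (\<xi> k) W t \<omega>))\<^sup>2)
                      \<partial>M) \<longlonglongrightarrow> 0))"

text \<open>\<open>dY = \<sigma> dW + b dt\<close>, almost surely, in integrated form on all intervals \<open>{0..t}\<close>.\<close>

definition has_ito_differential ::
  "'w measure \<Rightarrow> (real \<Rightarrow> 'w measure) \<Rightarrow> (real \<Rightarrow> 'w \<Rightarrow> 'b::euclidean_space) \<Rightarrow>
   (real \<Rightarrow> 'w \<Rightarrow> 'b) \<Rightarrow> (real \<Rightarrow> 'w \<Rightarrow> real) \<Rightarrow> (real \<Rightarrow> 'w \<Rightarrow> 'b) \<Rightarrow> bool" where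
  "has_ito_differential M F Y W \<sigma> b \<longleftrightarrow>
     (\<exists>I. ito_integral M F W \<sigma> I \<and>
        (AE \<omega> in M. \<forall>t\<ge>0.
           set_integrable lebesgue {0..t} (\<lambda>s. b s \<omega>) \<and>
           Y t \<omega> = Y 0 \<omega> + I t \<omega> + (LINT s:{0..t}|lebesgue. b s \<omega>)))"

section \<open>Probabilistically weak solutions\<close>

definition weak_solution ::
  "real \<Rightarrow> real \<Rightarrow> 'a::euclidean_space \<Rightarrow> 'w measure \<Rightarrow> (real \<Rightarrow> 'w measure) \<Rightarrow>
   (real \<Rightarrow> 'w \<Rightarrow> 'a) \<Rightarrow> bool" where
  "weak_solution p m x M F X \<longleftrightarrow>
     stochastic_basis M F \<and> continuous_adapted M F X \<and>
     (\<forall>t>0. (\<integral>\<^sup>+\<omega>. (\<integral>\<^sup>+s\<in>{0..t}. ennreal (coeff_a DIM('a) p m s (norm (X s \<omega> - x)))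
               \<partial>lborel) \<partial>M) < \<infinity>) \<and>
     (\<forall>t>0. (\<integral>\<^sup>+\<omega>. (\<integral>\<^sup>+s\<in>{0..t}. ennreal \<bar>coeff_ar DIM('a) p m s (norm (X s \<omega> - x))\<bar>
               \<partial>lborel) \<partial>M) < \<infinity>) \<and>
     (\<exists>W :: real \<Rightarrow> 'w \<Rightarrow> 'a. brownian_motion M F W \<and>
        has_ito_differential M F X W
          (\<lambda>s \<omega>. sqrt (2 * coeff_a DIM('a) p m s (norm (X s \<omega> - x))))
          (\<lambda>s \<omega>. coeff_ar DIM('a) p m s (norm (X s \<omega> - x)) *\<^sub>R sgn (X s \<omega> - x))) \<and>
     (\<forall>t>0. distributed M lborel (X t) (\<lambda>y. ennreal (barenblatt p m x t y)))"

end

theory Submission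
  imports Defs
begin

text \<open>
  Put \<open>Y = X - o\<close>, \<open>\<sigma> = sqrt (2 * a)\<close> and \<open>e = sgn Y\<close>. Stochastic integrals are mean square limits
  of sums over dyadic grids; \<open>B = \<integral> e \<bullet> dW\<close> is a Brownian motion because its approximating sums with
  unit step integrands are exactly Gaussian with independent increments, and \<open>\<integral> \<sigma> dB = \<integral> (\<sigma> e) \<bullet> dW\<close>
  since this holds for step integrands \<open>\<sigma>\<close>. Ito's formula is first shown for the smooth function
  \<open>sqrt (|z|\<^sup>2 + \<epsilon>\<^sup>2)\<close> and step integrands \<open>\<sigma>\<close>, by a Taylor expansion along the grid, and then
  for general \<open>\<sigma>\<close> by approximation. In dimension at least \<open>2\<close> the second order term of this formula
  is nonnegative, and \<open>Y\<close> is bounded because the laws of \<open>X\<close> have compact support; taking expectations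
  thus bounds \<open>E \<integral> \<sigma>\<^sup>2 / |Y| dt\<close>, and \<open>\<epsilon> \<rightarrow> 0\<close> is a case of dominated convergence. That \<open>X\<close> avoids
  \<open>o\<close>, \<open>x\<close> and the free boundary at almost all times follows from Fubini's theorem, as the law of
  \<open>X\<^sub>t\<close> is absolutely continuous. Inside the support \<open>a\<close> is an explicit smooth function of
  the radius, and \<open>L u = div (a \<nabla>u)\<close>.
\<close>

section \<open>Dyadic grids and step integrals\<close>

text \<open>The drift is known only to be integrable over time and chance, so the remainders of the
  Taylor expansion cannot be controlled in mean square. Two devices deal with this. The drift part
  of a cell is estimated by convexity of the regularised norm, which asks for no smallness of the
  drift increment. And a limit of stochastic integrals is identified in mean of first order: by the
  isometry the approximating integrals already converge in mean square once their integrands do, and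
  the two limits agree (\<open>l2int_closure\<close>). Dyadic grids are chosen because they are
  nested: a step integrand on one grid is one on every finer grid, and two of them have a common
  grid. A Gaussian increment tested against a unit vector integrates out to a deterministic factor,
  which is why the approximating sums of \<open>B\<close> are exactly Gaussian; it also forces an
  arbitrary unit vector in place of \<open>e\<close> where \<open>Y\<close> vanishes. Positivity of
  the normalising constant of the profile is read off from the law of the solution at time
  \<open>1\<close>.\<close>

definition dyadic :: "nat \<Rightarrow> nat \<Rightarrow> real" where
  "dyadic n i = real i / 2 ^ n"

definition dindex :: "nat \<Rightarrow> real \<Rightarrow> nat" where
  "dindex n s = nat \<lfloor>s * 2 ^ n\<rfloor>"

definition dfloor :: "nat \<Rightarrow> real \<Rightarrow> real" where
  "dfloor n s = dyadic n (dindex n s)"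

lemma dyadic_0 [simp]: "dyadic n 0 = 0"
  by (simp add: dyadic_def)

lemma dyadic_nonneg [simp]: "0 \<le> dyadic n i"
  by (simp add: dyadic_def)

lemma dyadic_mono: "i \<le> j \<Longrightarrow> dyadic n i \<le> dyadic n j"
  by (simp add: dyadic_def divide_right_mono)

lemma dyadic_less_Suc: "dyadic n i < dyadic n (Suc i)"
  by (simp add: dyadic_def divide_strict_right_mono)

lemma dyadic_Suc: "dyadic n (Suc i) = dyadic n i + 1 / 2 ^ n"
  by (simp add: dyadic_def add_divide_distrib)

lemma dyadic_double: "dyadic (Suc n) (2 * i) = dyadic n i"
  by (simp add: dyadic_def)

lemma dfloor_nonneg [simp]: "0 \<le> dfloor n s"
  by (simp add: dfloor_def)

lemma dfloor_le: "0 \<le> s \<Longrightarrow> dfloor n s \<le> s"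
  by (simp add: dfloor_def dyadic_def dindex_def divide_simps)

lemma less_dyadic_Suc_dindex: "s < dyadic n (Suc (dindex n s))"
proof -
  have "s * 2 ^ n < real (nat \<lfloor>s * 2 ^ n\<rfloor>) + 1" by linarith
  then show ?thesis by (simp add: dyadic_def dindex_def field_simps)
qed

lemma dfloor_gt: "s - 1 / 2 ^ n < dfloor n s"
  using less_dyadic_Suc_dindex[of s n] by (simp add: dfloor_def dyadic_Suc)

lemma dindex_eqI: "dyadic n i \<le> s \<Longrightarrow> s < dyadic n (Suc i) \<Longrightarrow> dindex n s = i"
proof -
  assume "dyadic n i \<le> s" "s < dyadic n (Suc i)"
  then have "\<lfloor>s * 2 ^ n\<rfloor> = int i" by (intro floor_unique) (auto simp: dyadic_def field_simps)
  then show ?thesis by (simp add: dindex_def)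
qed

lemma dindex_dyadic [simp]: "dindex n (dyadic n i) = i"
  by (rule dindex_eqI) (auto simp: dyadic_less_Suc)

lemma dfloor_dyadic [simp]: "dfloor n (dyadic n i) = dyadic n i"
  by (simp add: dfloor_def)

lemma dfloor_eqI: "dyadic n i \<le> s \<Longrightarrow> s < dyadic n (Suc i) \<Longrightarrow> dfloor n s = dyadic n i"
  by (simp add: dfloor_def dindex_eqI)

lemma dindex_mono: "s \<le> t \<Longrightarrow> dindex n s \<le> dindex n t"
  by (simp add: dindex_def nat_mono floor_mono)

text \<open>A coarse grid point is a fine one with doubled index, so the fine floor of
  \<open>s\<close> stays at or above the coarse floor; being at most \<open>s\<close>, it also stays
  below the next coarse point.\<close>

lemma dfloor_dfloor_Suc:
  assumes "0 \<le> s" shows "dfloor n (dfloor (Suc n) s) = dfloor n s"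
proof (rule dfloor_eqI[of n "dindex n s", folded dfloor_def])
  have "dyadic (Suc n) (2 * dindex n s) \<le> s"
    using dfloor_le[OF assms] by (simp add: dyadic_double dfloor_def)
  then have "2 * dindex n s \<le> dindex (Suc n) s" using dindex_mono[of "dyadic (Suc n) (2 * dindex n s)" s "Suc n"] by simp
  from dyadic_mono[OF this, of "Suc n"] show "dfloor n s \<le> dfloor (Suc n) s"
    by (simp add: dfloor_def dyadic_double)
  show "dfloor (Suc n) s < dyadic n (Suc (dindex n s))"
    using dfloor_le[OF assms, of "Suc n"] less_dyadic_Suc_dindex[of s n] by linarith
qed

lemma dfloor_dfloor:
  assumes "0 \<le> s" "n \<le> k" shows "dfloor n (dfloor k s) = dfloor n s"
  using assms(2,1)
proof (induction k arbitrary: s rule: dec_induct)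
  case base show ?case by (simp add: dfloor_def)
next
  case (step k)
  show ?case using step.IH[of "dfloor (Suc k) s"] step.IH[of s] step.prems
    by (simp add: dfloor_dfloor_Suc)
qed

lemma dfloor_tendsto: "0 \<le> s \<Longrightarrow> (\<lambda>n. dfloor n s) \<longlonglongrightarrow> s"
proof (rule real_tendsto_sandwich[of "\<lambda>n. s - (1/2) ^ n" _ _ "\<lambda>_. s"])
  show "(\<lambda>n. s - (1/2) ^ n) \<longlonglongrightarrow> s"
    using tendsto_diff[OF tendsto_const LIMSEQ_power_zero[of "1/2::real"], of s] by simp
qed (use dfloor_gt[of s] dfloor_le[of s] in \<open>auto intro!: always_eventually less_imp_le simp: power_one_over\<close>)

text \<open>The inner product covers both uses: \<open>Z = W\<close> with a vector integrand, and
  real \<open>Z\<close> with a scalar integrand. Grid times are cut off at \<open>t\<close>, so the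
  index \<open>dindex n t\<close>, whose cell contains \<open>t\<close>, contributes the last,
  incomplete increment; later indices would add zero.\<close>

definition step_integral ::
  "nat \<Rightarrow> (real \<Rightarrow> 'w \<Rightarrow> 'c::euclidean_space) \<Rightarrow> (real \<Rightarrow> 'w \<Rightarrow> 'c) \<Rightarrow> real \<Rightarrow> 'w \<Rightarrow> real" where
  "step_integral n H Z t \<omega> = (\<Sum>i<Suc (dindex n t).
     H (dyadic n i) \<omega> \<bullet> (Z (min t (dyadic n (Suc i))) \<omega> - Z (min t (dyadic n i)) \<omega>))"

lemma dyadic_ge_of_dindex: "Suc (dindex n t) \<le> i \<Longrightarrow> t \<le> dyadic n i"
  using less_dyadic_Suc_dindex[of t n] dyadic_mono[of "Suc (dindex n t)" i n] by linarith

lemma step_integral_extend: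
  assumes "Suc (dindex n t) \<le> N"
  shows "step_integral n H Z t \<omega> = (\<Sum>i<N.
     H (dyadic n i) \<omega> \<bullet> (Z (min t (dyadic n (Suc i))) \<omega> - Z (min t (dyadic n i)) \<omega>))"
  unfolding step_integral_def
proof (rule sum.mono_neutral_left)
  show "\<forall>i\<in>{..<N} - {..<Suc (dindex n t)}. H (dyadic n i) \<omega> \<bullet>
      (Z (min t (dyadic n (Suc i))) \<omega> - Z (min t (dyadic n i)) \<omega>) = 0"
  proof
    fix i assume "i \<in> {..<N} - {..<Suc (dindex n t)}"
    then have "t \<le> dyadic n i" "t \<le> dyadic n (Suc i)"
      by (auto intro: dyadic_ge_of_dindex)
    then show "H (dyadic n i) \<omega> \<bullet> (Z (min t (dyadic n (Suc i))) \<omega> - Z (min t (dyadic n i)) \<omega>) = 0"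
      by (simp add: min_absorb1)
  qed
qed (use assms in auto)

text \<open>The fine sum is grouped in pairs. \<open>H\<close> takes the same value at both grid
  points of a coarse cell, so the two increments of \<open>Z\<close> add up to the coarse
  one.\<close>

lemma step_integral_refine_Suc:
  assumes "\<And>s. 0 \<le> s \<Longrightarrow> H s = H (dfloor n s)"
  shows "step_integral (Suc n) H Z t \<omega> = step_integral n H Z t \<omega>"
proof -
  let ?N = "Suc (dindex n t)"
  let ?g = "\<lambda>i. H (dyadic (Suc n) i) \<omega> \<bullet>
     (Z (min t (dyadic (Suc n) (Suc i))) \<omega> - Z (min t (dyadic (Suc n) i)) \<omega>)"
  have "Suc (dindex (Suc n) t) \<le> ?N * 2"
  proof (rule ccontr)
    assume "\<not> ?thesis"
    then have "?N * 2 \<le> dindex (Suc n) t" by simp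
    then have "dyadic (Suc n) (2 * ?N) \<le> dfloor (Suc n) t"
      unfolding dfloor_def by (intro dyadic_mono) simp
    \<comment> \<open>\<open>dfloor_le\<close> asks for a nonnegative time. For negative
      \<open>t\<close> the index is \<open>0\<close>, by the definition through \<open>nat\<close>,
      which contradicts the lower bound just assumed.\<close>
    moreover have "0 \<le> t"
    proof (rule ccontr)
      assume "\<not> 0 \<le> t"
      then have "t * 2 ^ Suc n \<le> 0" by (intro mult_nonpos_nonneg) auto
      then have "dindex (Suc n) t = 0" unfolding dindex_def by linarith
      with \<open>?N * 2 \<le> dindex (Suc n) t\<close> show False by simp
    qed
    ultimately show False
      using dfloor_le[of t "Suc n"] less_dyadic_Suc_dindex[of t n] unfolding dyadic_double by linarith
  qed
  then have "step_integral (Suc n) H Z t \<omega> = sum ?g {..<?N * 2}"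
    by (rule step_integral_extend)
  also have "\<dots> = (\<Sum>i<?N. sum ?g {i * 2..<i * 2 + 2})"
    by (rule sum.nat_group[symmetric])
  also have "\<dots> = step_integral n H Z t \<omega>"
    unfolding step_integral_def
  proof (rule sum.cong[OF refl])
    fix i
    have e: "dyadic (Suc n) (i * 2) = dyadic n i" "dyadic (Suc n) (Suc (Suc (i * 2))) = dyadic n (Suc i)"
      by (auto simp: dyadic_def field_simps)
    have "H (dyadic (Suc n) (Suc (i * 2))) = H (dyadic n i)"
      by (subst assms, simp) (subst dfloor_eqI[of n i], auto simp: dyadic_def field_simps)
    then show "sum ?g {i * 2..<i * 2 + 2} = H (dyadic n i) \<omega> \<bullet>
        (Z (min t (dyadic n (Suc i))) \<omega> - Z (min t (dyadic n i)) \<omega>)"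
    proof -
      assume H: "H (dyadic (Suc n) (Suc (i * 2))) = H (dyadic n i)"
      have "{i * 2..<i * 2 + 2} = {i * 2, Suc (i * 2)}" by auto
      then show ?thesis by (simp only: sum.insert[OF finite.insertI[OF finite.emptyI]] sum.empty
          insert_iff empty_iff n_not_Suc_n simp_thms H e inner_add_right[symmetric] inner_diff_right
          finite.emptyI sum.insert) 
    qed
  qed
  finally show ?thesis .
qed

lemma step_integral_refine:
  assumes "\<And>s. 0 \<le> s \<Longrightarrow> H s = H (dfloor n s)" and "n \<le> k"
  shows "step_integral k H Z t \<omega> = step_integral n H Z t \<omega>"
  using assms(2)
proof (induction k rule: dec_induct)
  case (step k)
  have "H s = H (dfloor k s)" if "0 \<le> s" for s
  proof -
    have "H (dfloor k s) = H (dfloor n (dfloor k s))" by (rule assms(1)) simp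
    also have "\<dots> = H s"
      using assms(1)[OF that] by (simp only: dfloor_dfloor[OF that step.hyps(1)])
    finally show ?thesis ..
  qed
  then have "step_integral (Suc k) H Z t \<omega> = step_integral k H Z t \<omega>"
    by (rule step_integral_refine_Suc)
  then show ?case using step.IH by (rule trans)
qed simp

text \<open>In this form the grid times are clamped into \<open>[s, t]\<close>, so every increment
  of \<open>Z\<close> lies after \<open>s\<close>, as conditioning on \<open>F s\<close>
  demands.\<close>

lemma step_integral_diff_times:
  assumes "0 \<le> s" "s \<le> t" 
  shows "step_integral n H Z t \<omega> - step_integral n H Z s \<omega> = (\<Sum>i<Suc (dindex n t).
     H (dyadic n i) \<omega> \<bullet> (Z (max s (min t (dyadic n (Suc i)))) \<omega> - Z (max s (min t (dyadic n i))) \<omega>))"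
proof -
  \<comment> \<open>If \<open>g\<close> is at most \<open>s\<close>, both sides vanish; otherwise
    \<open>min s g = s\<close>.\<close>
  have *: "Z (min t g) \<omega> - Z (min s g) \<omega> = Z (max s (min t g)) \<omega> - Z s \<omega>" for g
    using assms by (cases "g \<le> s"; auto simp: min_def max_def)
  have "a \<bullet> (Z (min t g') \<omega> - Z (min t g) \<omega>) - a \<bullet> (Z (min s g') \<omega> - Z (min s g) \<omega>)
      = a \<bullet> (Z (max s (min t g')) \<omega> - Z (max s (min t g)) \<omega>)" for a g g'
  proof -
    have "Z (min t g') \<omega> - Z (min t g) \<omega> - (Z (min s g') \<omega> - Z (min s g) \<omega>)
        = Z (max s (min t g')) \<omega> - Z (max s (min t g)) \<omega>"
    proof -
      have "x1 - x2 - (x3 - x4) = x5 - x6" if "x1 - x3 = x5 - z" "x2 - x4 = x6 - z"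
        for x1 x2 x3 x4 x5 x6 z :: 'b
      proof -
        have "x1 - x2 - (x3 - x4) = (x1 - x3) - (x2 - x4)" by simp
        then show ?thesis unfolding that by simp
      qed
      from this[OF *[of g'] *[of g]] show ?thesis .
    qed
    then show ?thesis by (simp only: inner_diff_right[symmetric])
  qed
  then show ?thesis
    unfolding step_integral_def[of n H Z t]
    by (subst step_integral_extend[of n s "Suc (dindex n t)"])
      (simp_all only: sum_subtractf[symmetric] Suc_le_mono dindex_mono[OF assms(2)])
qed

text \<open>Associativity of integration on one cell: an integrand multiplied with an increment of a
  step integral can be absorbed into \<open>H\<close>.\<close>

lemma step_integral_one_step:
  assumes "0 \<le> t"
  shows "step_integral n H Z (min t (dyadic n (Suc j))) \<omega> - step_integral n H Z (min t (dyadic n j)) \<omega>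
    = H (dyadic n j) \<omega> \<bullet> (Z (min t (dyadic n (Suc j))) \<omega> - Z (min t (dyadic n j)) \<omega>)"
proof -
  let ?t = "min t (dyadic n (Suc j))" and ?s = "min t (dyadic n j)"
  let ?f = "\<lambda>i. H (dyadic n i) \<omega> \<bullet> (Z (max ?s (min ?t (dyadic n (Suc i)))) \<omega> - Z (max ?s (min ?t (dyadic n i))) \<omega>)"
  have m: "dyadic n j < dyadic n (Suc j)" by (rule dyadic_less_Suc)
  have "step_integral n H Z ?t \<omega> - step_integral n H Z ?s \<omega> = (\<Sum>i<Suc (dindex n ?t). ?f i)"
    by (rule step_integral_diff_times) (use assms m in auto)
  also have "\<dots> = (\<Sum>i\<in>{j}. ?f i)"
  proof (rule sum.mono_neutral_cong)
    fix i assume "i \<in> {..<Suc (dindex n ?t)} - {j}"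
    then consider "i < j" | "j < i" by fastforce
    then show "?f i = 0"
    proof cases
      case 1
      then have "dyadic n (Suc i) \<le> dyadic n j" "dyadic n i \<le> dyadic n j"
        by (auto intro: dyadic_mono)
      then have "max ?s (min ?t (dyadic n (Suc i))) = ?s" "max ?s (min ?t (dyadic n i)) = ?s"
        using m by auto
      then show ?thesis by simp
    next
      case 2
      then have "dyadic n (Suc j) \<le> dyadic n (Suc i)" "dyadic n (Suc j) \<le> dyadic n i"
        by (auto intro: dyadic_mono)
      then have "max ?s (min ?t (dyadic n (Suc i))) = ?t" "max ?s (min ?t (dyadic n i)) = ?t"
        using m by auto
      then show ?thesis by simp
    qed
  next
    \<comment> \<open>The index \<open>j\<close> can lie outside the range of summation only if its
      cell begins at or after the end \<open>?t\<close>; then the two cut-off times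
      coincide.\<close>
    fix i assume "i \<in> {j} - {..<Suc (dindex n ?t)}"
    then have "Suc (dindex n ?t) \<le> i" "i = j" by auto
    then have "?t \<le> dyadic n j" using dyadic_ge_of_dindex by blast
    then have "?t = ?s" using m by (auto simp: min_def split: if_splits)
    then show "?f i = 0" using \<open>i = j\<close> m by (auto simp: min_def max_def)
  qed (auto)
  also have "\<dots> = H (dyadic n j) \<omega> \<bullet> (Z ?t \<omega> - Z ?s \<omega>)"
    using m by (auto simp: min_def max_def)
  finally show ?thesis .
qed

section \<open>Gaussian increments\<close>

text \<open>The centred normal law with covariance \<open>h\<close> times the identity. Its density
  is that of \<open>brownian_motion\<close>, so the law of an increment can be read off from that
  definition.\<close>

definition gauss :: "real \<Rightarrow> 'a::euclidean_space measure" where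
  "gauss h = density lborel (\<lambda>z. ennreal (\<Prod>b\<in>Basis. normal_density 0 (sqrt h) (z \<bullet> b)))"

lemma sets_gauss [simp, measurable_cong]: "sets (gauss h) = sets borel"
  and space_gauss [simp]: "space (gauss h) = UNIV"
  by (simp_all add: gauss_def)

lemma prob_space_gauss:
  assumes "0 < h" shows "prob_space (gauss h :: 'a::euclidean_space measure)"
proof
  have "emeasure (gauss h :: 'a measure) UNIV =
      (\<integral>\<^sup>+z. (\<Prod>b\<in>Basis. ennreal (normal_density 0 (sqrt h) ((z::'a) \<bullet> b))) \<partial>lborel)"
    by (simp add: gauss_def emeasure_density prod_ennreal)
  also have "\<dots> = (\<Prod>b\<in>(Basis::'a set). (\<integral>\<^sup>+x. ennreal (normal_density 0 (sqrt h) x) \<partial>lborel))"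
    by (rule nn_integral_lborel_prod) auto
  also have "\<dots> = 1"
    using assms by (subst nn_integral_eq_integral) auto
  finally show "emeasure (gauss h :: 'a measure) (space (gauss h)) = 1" by simp
qed

lemma iexp_normal_density:
  assumes "0 < \<sigma>"
  shows "(LINT x|lborel. normal_density 0 \<sigma> x *\<^sub>R iexp (\<theta> * x)) = exp (- ((\<sigma> * \<theta>)\<^sup>2) / 2)"
proof -
  have "(LINT x|lborel. normal_density 0 \<sigma> x *\<^sub>R iexp (\<theta> * x))
      = \<bar>\<sigma>\<bar> *\<^sub>R (LINT x|lborel. normal_density 0 \<sigma> (0 + \<sigma> * x) *\<^sub>R iexp (\<theta> * (0 + \<sigma> * x)))"
    using assms by (intro lborel_integral_real_affine) simp
  also have "\<dots> = (LINT x|lborel. std_normal_density x *\<^sub>R iexp (\<sigma> * \<theta> * x))"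
    using assms unfolding integral_scaleR_right[symmetric]
    by (intro Bochner_Integration.integral_cong refl)
      (simp add: normal_density_def real_sqrt_mult power_mult_distrib mult_ac)
  also have "\<dots> = char std_normal_distribution (\<sigma> * \<theta>)"
    unfolding char_def by (subst integral_density) (auto simp: normal_density_nonneg)
  finally show ?thesis by (simp add: char_std_normal_distribution)
qed

lemma norm2_Basis: "(norm z)\<^sup>2 = (\<Sum>b\<in>Basis. (b \<bullet> z)\<^sup>2)"
  by (subst power2_norm_eq_inner, subst euclidean_inner) (simp add: power2_eq_square inner_commute)

text \<open>In coordinates both the density and the exponential factorise, so the characteristic
  function is a product of one-dimensional ones.\<close>

lemma gauss_iexp:
  fixes v :: "'a::euclidean_space"
  assumes "0 < h"
  shows "(CLINT z|gauss h. iexp (v \<bullet> z)) = exp (- h * (norm v)\<^sup>2 / 2)"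
proof -
  interpret product_sigma_finite "\<lambda>_::'a. lborel :: real measure" ..
  let ?g = "\<lambda>b x. normal_density 0 (sqrt h) x *\<^sub>R iexp (v \<bullet> b * x) :: complex"
  have int: "integrable lborel (?g b)" for b
    by (rule Bochner_Integration.integrable_bound[where f="normal_density 0 (sqrt h)"])
      (use assms in \<open>auto simp: norm_mult\<close>)
  have "(CLINT z|gauss h. iexp (v \<bullet> z)) =
      (LINT z|lborel. (\<Prod>b\<in>Basis. normal_density 0 (sqrt h) (z \<bullet> b)) *\<^sub>R iexp (v \<bullet> z))"
    unfolding gauss_def by (rule integral_density) (auto intro!: prod_nonneg)
  also have "\<dots> = (LINT z|lborel. (\<Prod>b\<in>Basis. ?g b (z \<bullet> b)))"
  proof (intro Bochner_Integration.integral_cong refl)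
    fix z :: 'a
    have "v \<bullet> z = (\<Sum>b\<in>Basis. v \<bullet> b * (z \<bullet> b))" by (rule euclidean_inner)
    then have "iexp (v \<bullet> z) = (\<Prod>b\<in>Basis. iexp (v \<bullet> b * (z \<bullet> b)))"
      by (simp add: exp_sum sum_distrib_left del: of_real_mult)
    then show "(\<Prod>b\<in>Basis. normal_density 0 (sqrt h) (z \<bullet> b)) *\<^sub>R iexp (v \<bullet> z) = (\<Prod>b\<in>Basis. ?g b (z \<bullet> b))"
      by (simp add: scaleR_conv_of_real prod.distrib)
  qed
  also have "\<dots> = (LINT f|(\<Pi>\<^sub>M b\<in>Basis. lborel). (\<Prod>b\<in>(Basis::'a set). ?g b (f b)))"
    by (subst lborel_eq, subst integral_distr)
      (auto simp: inner_sum_left inner_Basis if_distrib sum.delta cong: if_cong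
        intro!: Bochner_Integration.integral_cong prod.cong)
  also have "\<dots> = (\<Prod>b\<in>Basis. integral\<^sup>L lborel (?g b))"
    by (rule product_integral_prod[OF finite_Basis int])
  also have "\<dots> = (\<Prod>b\<in>Basis. of_real (exp (- h * (v \<bullet> b)\<^sup>2 / 2)))"
    using assms by (intro prod.cong refl, subst iexp_normal_density) (auto simp: power_mult_distrib)
  also have "\<dots> = of_real (exp (\<Sum>b\<in>Basis. - h * (v \<bullet> b)\<^sup>2 / 2))"
    by (simp add: exp_sum)
  also have "(\<Sum>b\<in>Basis. - h * (v \<bullet> b)\<^sup>2 / 2) = - h * (norm v)\<^sup>2 / 2"
    by (simp add: norm2_Basis inner_commute sum_distrib_left sum_divide_distrib sum_negf)
  finally show ?thesis by simp
qed

text \<open>A projection has the characteristic function of a one-dimensional normal law; its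
  moments then come from the known one-dimensional ones. The case \<open>v = 0\<close> is excluded
  because the normal density with deviation \<open>0\<close> is no probability density.\<close>

lemma distr_gauss_inner:
  fixes v :: "'a::euclidean_space"
  assumes "0 < h" "v \<noteq> 0"
  shows "distr (gauss h) borel (\<lambda>z. v \<bullet> z) = density lborel (normal_density 0 (sqrt h * norm v))"
proof (rule Levy_uniqueness)
  interpret G: prob_space "gauss h :: 'a measure" by (rule prob_space_gauss) fact
  have s: "0 < sqrt h * norm v" using assms by simp
  show "real_distribution (distr (gauss h) borel (\<lambda>z. v \<bullet> z))"
    by (rule G.real_distribution_distr) simp
  show "real_distribution (density lborel (normal_density 0 (sqrt h * norm v)))"
    using prob_space_normal_density[OF s] unfolding real_distribution_def real_distribution_axioms_def by simp
  show "char (distr (gauss h) borel (\<lambda>z. v \<bullet> z)) = char (density lborel (normal_density 0 (sqrt h * norm v)))"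
  proof
    fix \<theta>
    have "char (distr (gauss h) borel (\<lambda>z. v \<bullet> z)) \<theta> = (CLINT z|gauss h. iexp ((\<theta> *\<^sub>R v) \<bullet> z))"
      by (simp add: char_def integral_distr)
    also have "\<dots> = exp (- h * (norm (\<theta> *\<^sub>R v))\<^sup>2 / 2)" by (rule gauss_iexp) fact
    also have "\<dots> = (LINT x|lborel. normal_density 0 (sqrt h * norm v) x *\<^sub>R iexp (\<theta> * x))"
      using assms by (subst iexp_normal_density[OF s]) (simp add: power_mult_distrib mult_ac)
    also have "\<dots> = char (density lborel (normal_density 0 (sqrt h * norm v))) \<theta>"
      unfolding char_def by (subst integral_density) (auto simp: normal_density_nonneg)
    finally show "char (distr (gauss h) borel (\<lambda>z. v \<bullet> z)) \<theta> = \<dots>" .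
  qed
qed

lemma gauss_power:
  fixes v :: "'a::euclidean_space"
  assumes "0 < h" "has_bochner_integral lborel (\<lambda>x. normal_density 0 (sqrt h * norm v) x * x ^ k) c"
    and "v \<noteq> 0"
  shows "has_bochner_integral (gauss h) (\<lambda>z. (v \<bullet> z) ^ k) c"
proof -
  have "has_bochner_integral (density lborel (normal_density 0 (sqrt h * norm v))) (\<lambda>x. x ^ k) c"
    using assms(2) by (intro has_bochner_integral_density) auto
  then show ?thesis
    unfolding distr_gauss_inner[OF assms(1,3), symmetric]
    by (subst (asm) has_bochner_integral_iff)
       (simp add: has_bochner_integral_iff integrable_distr_eq integral_distr)
qed

lemma gauss_mean:
  fixes v :: "'a::euclidean_space"
  assumes "0 < h" shows "has_bochner_integral (gauss h) (\<lambda>z. v \<bullet> z) 0"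
proof (cases "v = 0")
  case False
  then have s: "0 < sqrt h * norm v" using assms by simp
  show ?thesis using gauss_power[of h v 1 0] normal_moment_odd[OF s, of 0 0] assms False by simp
qed (simp add: has_bochner_integral_zero)

lemma gauss_second_moment:
  fixes v :: "'a::euclidean_space"
  assumes "0 < h" shows "has_bochner_integral (gauss h) (\<lambda>z. (v \<bullet> z)\<^sup>2) (h * (norm v)\<^sup>2)"
proof (cases "v = 0")
  case False
  then have s: "0 < sqrt h * norm v" using assms by simp
  show ?thesis using gauss_power[of h v 2] normal_moment_even[OF s, of 0 1] assms False
    by (simp add: power_mult_distrib)
qed (simp add: has_bochner_integral_zero)

lemma gauss_fourth_moment:
  fixes v :: "'a::euclidean_space"
  assumes "0 < h" shows "has_bochner_integral (gauss h) (\<lambda>z. (v \<bullet> z) ^ 4) (3 * h\<^sup>2 * (norm v) ^ 4)"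
proof (cases "v = 0")
  case False
  then have s: "0 < sqrt h * norm v" using assms by simp
  have "fact (2 * 2) / ((2 / (sqrt h * norm v)\<^sup>2) ^ 2 * fact 2) = 3 * h\<^sup>2 * (norm v) ^ 4"
    using assms False by (simp add: fact_numeral field_simps power_mult_distrib)
  then show ?thesis using gauss_power[of h v 4] normal_moment_even[OF s, of 0 2] assms False
    by simp
qed (simp add: has_bochner_integral_zero)

lemma gauss_norm2:
  assumes "0 < h"
  shows "has_bochner_integral (gauss h) (\<lambda>z::'a::euclidean_space. (norm z)\<^sup>2) (real DIM('a) * h)"
proof -
  have "has_bochner_integral (gauss h) (\<lambda>z::'a. \<Sum>b\<in>Basis. (b \<bullet> z)\<^sup>2) (\<Sum>b\<in>(Basis::'a set). h * (norm b)\<^sup>2)"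
    by (intro has_bochner_integral_sum gauss_second_moment assms)
  then show ?thesis by (simp add: norm2_Basis)
qed

text \<open>Cauchy-Schwarz over the coordinates replaces mixed moments by fourth powers, each of
  mean \<open>3 * h\<^sup>2\<close>. The aim is an upper bound of order
  \<open>h\<^sup>2\<close>.\<close>

lemma gauss_norm4:
  assumes "0 < h"
  shows "(\<integral>\<^sup>+z. ennreal ((norm (z::'a::euclidean_space)) ^ 4) \<partial>gauss h) \<le> ennreal (3 * (real DIM('a))\<^sup>2 * h\<^sup>2)"
proof -
  have "(norm z) ^ 4 \<le> real DIM('a) * (\<Sum>b\<in>Basis. (b \<bullet> z) ^ 4)" for z :: 'a
  proof -
    have "(norm z) ^ 4 = ((norm z)\<^sup>2)\<^sup>2" by simp
    also have "(norm z)\<^sup>2 = (\<Sum>b\<in>Basis. (b \<bullet> z)\<^sup>2)"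
      by (rule norm2_Basis)
    also have "\<dots>\<^sup>2 \<le> (\<Sum>b\<in>(Basis::'a set). ((b \<bullet> z)\<^sup>2)\<^sup>2) * real DIM('a)"
      by (rule sum_squared_le_sum_of_squares)
    finally show ?thesis by (simp add: mult.commute)
  qed
  then have "(\<integral>\<^sup>+z. ennreal ((norm (z::'a)) ^ 4) \<partial>gauss h) \<le>
      (\<integral>\<^sup>+z. ennreal (real DIM('a) * (\<Sum>b\<in>Basis. (b \<bullet> (z::'a)) ^ 4)) \<partial>gauss h)"
    by (intro nn_integral_mono ennreal_leI)
  also have "(\<integral>\<^sup>+z. ennreal (real DIM('a) * (\<Sum>b\<in>Basis. (b \<bullet> (z::'a)) ^ 4)) \<partial>gauss h)
      = ennreal (real DIM('a) * (\<Sum>b\<in>(Basis::'a set). 3 * h\<^sup>2 * (norm b) ^ 4))"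
  proof -
    have "has_bochner_integral (gauss h) (\<lambda>z::'a. real DIM('a) * (\<Sum>b\<in>Basis. (b \<bullet> z) ^ 4))
        (real DIM('a) * (\<Sum>b\<in>(Basis::'a set). 3 * h\<^sup>2 * (norm b) ^ 4))"
      by (intro has_bochner_integral_mult_right has_bochner_integral_sum gauss_fourth_moment assms)
    then show ?thesis
      by (subst nn_integral_eq_integral)
        (auto simp: has_bochner_integral_iff intro!: mult_nonneg_nonneg sum_nonneg)
  qed
  finally show ?thesis by (simp add: power2_eq_square mult_ac)
qed

section \<open>Conditioning on the past of a Brownian motion\<close>

locale brownian_basis = stochastic_basis M F
  for M :: "'w measure" and F :: "real \<Rightarrow> 'w measure" +
  fixes W :: "real \<Rightarrow> 'w \<Rightarrow> 'a::euclidean_space"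
  assumes brownian: "brownian_motion M F W"

context stochastic_basis
begin

lemma space_F [simp]: "0 \<le> t \<Longrightarrow> space (F t) = space M"
  using subalgebra_F by (auto simp: subalgebra_def)

lemma measurable_F_M: "0 \<le> t \<Longrightarrow> f \<in> measurable (F t) N \<Longrightarrow> f \<in> measurable M N"
  using measurable_from_subalg[OF subalgebra_F] .

lemma measurable_F_mono: "0 \<le> s \<Longrightarrow> s \<le> t \<Longrightarrow> f \<in> measurable (F s) N \<Longrightarrow> f \<in> measurable (F t) N"
  using measurable_from_subalg[of "F t" "F s"] mono_F[of s t] by (auto simp: subalgebra_def)

end

context brownian_basis
begin

lemma W_adapted: "0 \<le> t \<Longrightarrow> W t \<in> borel_measurable (F t)"
  and W_continuous: "\<omega> \<in> space M \<Longrightarrow> continuous_on {0..} (\<lambda>t. W t \<omega>)"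
  and W_zero: "AE \<omega> in M. W 0 \<omega> = 0"
  using brownian by (auto simp: brownian_motion_def continuous_adapted_def)

lemma W_measurable: "0 \<le> t \<Longrightarrow> W t \<in> borel_measurable M"
  using W_adapted measurable_F_M by blast

lemma W_increment_adapted:
  "0 \<le> s \<Longrightarrow> s \<le> u \<Longrightarrow> 0 \<le> t \<Longrightarrow> t \<le> u \<Longrightarrow> (\<lambda>\<omega>. W t \<omega> - W s \<omega>) \<in> borel_measurable (F u)"
  using measurable_F_mono W_adapted by (intro borel_measurable_diff) blast+

lemma distr_increment:
  assumes "0 \<le> s" "s < t" shows "distr M borel (\<lambda>\<omega>. W t \<omega> - W s \<omega>) = gauss (t - s)"
proof -
  have "distr M lborel (\<lambda>\<omega>. W t \<omega> - W s \<omega>) = gauss (t - s)"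
    using brownian assms unfolding brownian_motion_def distributed_def gauss_def by auto
  then show ?thesis by (subst (asm) distr_cong[OF refl sets_lborel refl])
qed

text \<open>Independence is restated as a product law for the pair of the sample point, seen only
  through \<open>F s\<close>, and the increment. Conditioning on the past then becomes Fubini's
  theorem.\<close>

lemma distr_past_increment:
  assumes "0 \<le> s" "s < t"
  shows "distr M (F s \<Otimes>\<^sub>M borel) (\<lambda>\<omega>. (\<omega>, W t \<omega> - W s \<omega>)) = distr M (F s) (\<lambda>\<omega>. \<omega>) \<Otimes>\<^sub>M gauss (t - s)"
proof -
  have [measurable]: "(\<lambda>\<omega>. W t \<omega> - W s \<omega>) \<in> borel_measurable M"
    using assms by (intro borel_measurable_diff W_measurable) auto
  have i: "indep_set (sets (F s)) (sets (vimage_algebra (space M) (\<lambda>\<omega>. W t \<omega> - W s \<omega>) borel))"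
    using brownian assms unfolding brownian_motion_def by auto
  have id: "(\<lambda>\<omega>. \<omega>) \<in> measurable M (F s)"
    using measurable_F_M[OF assms(1), of "\<lambda>\<omega>. \<omega>" "F s"] by simp
  interpret G: prob_space "gauss (t - s) :: 'a measure" using assms by (intro prob_space_gauss) simp
  interpret D: prob_space "distr M (F s) (\<lambda>\<omega>. \<omega>)" by (rule prob_space_distr[OF id])
  have m: "(\<lambda>\<omega>. (\<omega>, W t \<omega> - W s \<omega>)) \<in> measurable M (F s \<Otimes>\<^sub>M borel)"
    by (intro measurable_Pair id) simp
  have "distr M (F s) (\<lambda>\<omega>. \<omega>) \<Otimes>\<^sub>M gauss (t - s) = distr M (F s \<Otimes>\<^sub>M borel) (\<lambda>\<omega>. (\<omega>, W t \<omega> - W s \<omega>))"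
  proof (rule pair_measure_eqI)
    fix A B assume AB: "A \<in> sets (distr M (F s) (\<lambda>\<omega>. \<omega>))" "B \<in> sets (gauss (t - s) :: 'a measure)"
    have A: "A \<in> sets M" "(\<lambda>\<omega>. \<omega>) -` A \<inter> space M = A" "A \<subseteq> space M"
      using AB subalgebra_F[OF assms(1)] sets.sets_into_space[of A "F s"] assms
      by (auto simp: subalgebra_def)
    let ?C = "(\<lambda>\<omega>. W t \<omega> - W s \<omega>) -` B \<inter> space M"
    have C: "?C \<in> sets (vimage_algebra (space M) (\<lambda>\<omega>. W t \<omega> - W s \<omega>) borel)"
      using AB by (intro in_vimage_algebra) simp
    have "emeasure (distr M (F s) (\<lambda>\<omega>. \<omega>)) A * emeasure (gauss (t - s)) B = emeasure M A * emeasure M ?C"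
      using AB A id unfolding distr_increment[OF assms, symmetric] by (simp add: emeasure_distr)
    also have "\<dots> = emeasure M (A \<inter> ?C)"
      using i C AB unfolding indep_sets2_eq by (simp add: emeasure_eq_measure ennreal_mult)
    also have "A \<inter> ?C = (\<lambda>\<omega>. (\<omega>, W t \<omega> - W s \<omega>)) -` (A \<times> B) \<inter> space M"
      using A by auto
    also have "emeasure M \<dots> = emeasure (distr M (F s \<Otimes>\<^sub>M borel) (\<lambda>\<omega>. (\<omega>, W t \<omega> - W s \<omega>))) (A \<times> B)"
      using AB by (subst emeasure_distr[OF m]) auto
    finally show "emeasure (distr M (F s) (\<lambda>\<omega>. \<omega>)) A * emeasure (gauss (t - s)) B = \<dots>" .
  qed (auto intro: D.sigma_finite_measure_axioms G.sigma_finite_measure_axioms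
      cong: sets_pair_measure_cong)
  then show ?thesis ..
qed

text \<open>The past is frozen and the increment replaced by an independent Gaussian variable. Since
  the first argument of \<open>f\<close> is the sample point itself, \<open>f\<close> may depend on
  the whole past.\<close>

lemma nn_integral_past_increment:
  assumes "0 \<le> s" "s < t" and f: "f \<in> borel_measurable (F s \<Otimes>\<^sub>M borel)"
  shows "(\<integral>\<^sup>+\<omega>. f (\<omega>, W t \<omega> - W s \<omega>) \<partial>M) = (\<integral>\<^sup>+\<omega>. \<integral>\<^sup>+z. f (\<omega>, z) \<partial>gauss (t - s) \<partial>M)"
proof -
  interpret G: prob_space "gauss (t - s) :: 'a measure" using assms by (intro prob_space_gauss) simp
  have id: "(\<lambda>\<omega>. \<omega>) \<in> measurable M (F s)"
    using measurable_F_M[OF assms(1), of "\<lambda>\<omega>. \<omega>" "F s"] by simp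
  have m: "(\<lambda>\<omega>. (\<omega>, W t \<omega> - W s \<omega>)) \<in> measurable M (F s \<Otimes>\<^sub>M borel)"
    using assms by (intro measurable_Pair id borel_measurable_diff W_measurable) auto
  have f': "f \<in> borel_measurable (F s \<Otimes>\<^sub>M gauss (t - s))"
    using f by (simp cong: measurable_cong_sets)
  have f'': "f \<in> borel_measurable (distr M (F s) (\<lambda>\<omega>. \<omega>) \<Otimes>\<^sub>M gauss (t - s))"
    using f by (simp cong: measurable_cong_sets)
  have "(\<integral>\<^sup>+\<omega>. f (\<omega>, W t \<omega> - W s \<omega>) \<partial>M) = integral\<^sup>N (distr M (F s \<Otimes>\<^sub>M borel) (\<lambda>\<omega>. (\<omega>, W t \<omega> - W s \<omega>))) f"
    using m f by (simp add: nn_integral_distr)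
  also have "\<dots> = (\<integral>\<^sup>+\<omega>. \<integral>\<^sup>+z. f (\<omega>, z) \<partial>gauss (t - s) \<partial>distr M (F s) (\<lambda>\<omega>. \<omega>))"
    unfolding distr_past_increment[OF assms(1,2)] by (rule G.nn_integral_fst[symmetric]) (rule f'')
  also have "\<dots> = (\<integral>\<^sup>+\<omega>. \<integral>\<^sup>+z. f (\<omega>, z) \<partial>gauss (t - s) \<partial>M)"
    by (rule nn_integral_distr[OF id]) (use G.borel_measurable_nn_integral_fst[OF f'] in simp)
  finally show ?thesis .
qed

lemma integral_past_increment:
  fixes f :: "_ \<Rightarrow> 'b::{banach, second_countable_topology}"
  assumes "0 \<le> s" "s < t" and f: "f \<in> borel_measurable (F s \<Otimes>\<^sub>M borel)"
    and int: "integrable M (\<lambda>\<omega>. f (\<omega>, W t \<omega> - W s \<omega>))"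
  shows "(\<integral>\<omega>. f (\<omega>, W t \<omega> - W s \<omega>) \<partial>M) = (\<integral>\<omega>. \<integral>z. f (\<omega>, z) \<partial>gauss (t - s) \<partial>M)"
proof -
  interpret G: prob_space "gauss (t - s) :: 'a measure" using assms by (intro prob_space_gauss) simp
  have id: "(\<lambda>\<omega>. \<omega>) \<in> measurable M (F s)"
    using measurable_F_M[OF assms(1), of "\<lambda>\<omega>. \<omega>" "F s"] by simp
  interpret D: prob_space "distr M (F s) (\<lambda>\<omega>. \<omega>)" by (rule prob_space_distr[OF id])
  interpret P: pair_sigma_finite "distr M (F s) (\<lambda>\<omega>. \<omega>)" "gauss (t - s) :: 'a measure" ..
  have m: "(\<lambda>\<omega>. (\<omega>, W t \<omega> - W s \<omega>)) \<in> measurable M (F s \<Otimes>\<^sub>M borel)"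
    using assms by (intro measurable_Pair id borel_measurable_diff W_measurable) auto
  have f': "f \<in> borel_measurable (F s \<Otimes>\<^sub>M gauss (t - s))"
    using f by (simp cong: measurable_cong_sets)
  have "(\<integral>\<omega>. f (\<omega>, W t \<omega> - W s \<omega>) \<partial>M) = integral\<^sup>L (distr M (F s \<Otimes>\<^sub>M borel) (\<lambda>\<omega>. (\<omega>, W t \<omega> - W s \<omega>))) f"
    using m f by (simp add: integral_distr)
  also have "\<dots> = (\<integral>\<omega>. \<integral>z. f (\<omega>, z) \<partial>gauss (t - s) \<partial>distr M (F s) (\<lambda>\<omega>. \<omega>))"
    unfolding distr_past_increment[OF assms(1,2)]
  proof (rule P.integral_fst'[symmetric])
    show "integrable (distr M (F s) (\<lambda>\<omega>. \<omega>) \<Otimes>\<^sub>M gauss (t - s)) f"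
      unfolding distr_past_increment[OF assms(1,2), symmetric]
      using int m f by (simp add: integrable_distr_eq)
  qed
  also have "\<dots> = (\<integral>\<omega>. \<integral>z. f (\<omega>, z) \<partial>gauss (t - s) \<partial>M)"
    by (rule integral_distr[OF id]) (rule G.borel_measurable_lebesgue_integral, use f' in simp)
  finally show ?thesis .
qed

end

section \<open>Martingale differences\<close>

lemma integrable_mult_square:
  fixes Y Z :: "'w \<Rightarrow> real"
  assumes [measurable]: "Y \<in> borel_measurable M" "Z \<in> borel_measurable M"
    and int: "integrable M (\<lambda>\<omega>. (Y \<omega>)\<^sup>2)" "integrable M (\<lambda>\<omega>. (Z \<omega>)\<^sup>2)"
  shows "integrable M (\<lambda>\<omega>. Y \<omega> * Z \<omega>)"
proof (rule Bochner_Integration.integrable_bound[OF Bochner_Integration.integrable_add[OF int]])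
  have "\<bar>a * b\<bar> \<le> a\<^sup>2 + b\<^sup>2" for a b :: real
  proof -
    have "0 \<le> (\<bar>a\<bar> - \<bar>b\<bar>)\<^sup>2" by simp
    then have "2 * \<bar>a * b\<bar> \<le> a\<^sup>2 + b\<^sup>2" by (simp add: power2_diff abs_mult)
    then show ?thesis by simp
  qed
  then show "AE \<omega> in M. norm (Y \<omega> * Z \<omega>) \<le> norm ((Y \<omega>)\<^sup>2 + (Z \<omega>)\<^sup>2)" by simp
qed simp

context stochastic_basis
begin

text \<open>The martingale property is expressed as orthogonality to all square integrable functions
  of the past. This is the form in which it is applied, and it is visibly stable under
  multiplication with indicators of past events.\<close>

definition mart_diff :: "(nat \<Rightarrow> real) \<Rightarrow> (nat \<Rightarrow> 'w \<Rightarrow> real) \<Rightarrow> bool" where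
  "mart_diff c D \<longleftrightarrow> (\<forall>i. 0 \<le> c i \<and> c i \<le> c (Suc i) \<and>
     D i \<in> borel_measurable (F (c (Suc i))) \<and> integrable M (\<lambda>\<omega>. (D i \<omega>)\<^sup>2) \<and>
     (\<forall>Y \<in> borel_measurable (F (c i)). integrable M (\<lambda>\<omega>. (Y \<omega>)\<^sup>2) \<longrightarrow> (\<integral>\<omega>. Y \<omega> * D i \<omega> \<partial>M) = 0))"

lemma mart_diffD:
  assumes "mart_diff c D"
  shows "0 \<le> c i" "c i \<le> c (Suc i)" "D i \<in> borel_measurable (F (c (Suc i)))"
    "integrable M (\<lambda>\<omega>. (D i \<omega>)\<^sup>2)"
    "Y \<in> borel_measurable (F (c i)) \<Longrightarrow> integrable M (\<lambda>\<omega>. (Y \<omega>)\<^sup>2) \<Longrightarrow> (\<integral>\<omega>. Y \<omega> * D i \<omega> \<partial>M) = 0"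
proof -
  note * = assms[unfolded mart_diff_def, rule_format, of i]
  show "0 \<le> c i" "c i \<le> c (Suc i)" "D i \<in> borel_measurable (F (c (Suc i)))"
    "integrable M (\<lambda>\<omega>. (D i \<omega>)\<^sup>2)" using * by blast+
  show "Y \<in> borel_measurable (F (c i)) \<Longrightarrow> integrable M (\<lambda>\<omega>. (Y \<omega>)\<^sup>2) \<Longrightarrow> (\<integral>\<omega>. Y \<omega> * D i \<omega> \<partial>M) = 0"
    using * by blast
qed

text \<open>Pythagoras: the partial sum is known at time \<open>c N\<close>, so its product with
  \<open>D N\<close> has mean zero.\<close>

lemma mart_diff_sum:
  assumes md: "mart_diff c D"
  shows "(\<lambda>\<omega>. \<Sum>i<N. D i \<omega>) \<in> borel_measurable (F (c N)) \<and>
    integrable M (\<lambda>\<omega>. (\<Sum>i<N. D i \<omega>)\<^sup>2) \<and>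
    (\<integral>\<omega>. (\<Sum>i<N. D i \<omega>)\<^sup>2 \<partial>M) = (\<Sum>i<N. \<integral>\<omega>. (D i \<omega>)\<^sup>2 \<partial>M)"
proof (induction N)
  case (Suc N)
  let ?S = "\<lambda>\<omega>. \<Sum>i<N. D i \<omega>"
  note c = mart_diffD(1,2)[OF md, of N] and D = mart_diffD(3)[OF md, of N]
    and D2 = mart_diffD(4)[OF md, of N]
  have o: "(\<integral>\<omega>. ?S \<omega> * D N \<omega> \<partial>M) = 0"
    by (rule mart_diffD(5)[OF md]) (use Suc in blast)+
  have S: "?S \<in> borel_measurable (F (c (Suc N)))" by (rule measurable_F_mono[OF c]) (use Suc in blast)
  have m: "?S \<in> borel_measurable M" "D N \<in> borel_measurable M"
    using S D measurable_F_M[OF mart_diffD(1)[OF md, of "Suc N"]] by blast+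
  have i: "integrable M (\<lambda>\<omega>. ?S \<omega> * D N \<omega>)"
    by (rule integrable_mult_square[OF m]) (use Suc D2 in blast)+
  have sq: "(\<Sum>i<Suc N. D i \<omega>)\<^sup>2 = (?S \<omega>)\<^sup>2 + (D N \<omega>)\<^sup>2 + 2 * (?S \<omega> * D N \<omega>)" for \<omega>
    by (simp add: power2_sum mult.assoc)
  show ?case
  proof (intro conjI)
    show "(\<lambda>\<omega>. \<Sum>i<Suc N. D i \<omega>) \<in> borel_measurable (F (c (Suc N)))"
      using S D by simp
    show "integrable M (\<lambda>\<omega>. (\<Sum>i<Suc N. D i \<omega>)\<^sup>2)"
      unfolding sq using Suc i D2 by (intro Bochner_Integration.integrable_add integrable_mult_right) blast+
    show "(\<integral>\<omega>. (\<Sum>i<Suc N. D i \<omega>)\<^sup>2 \<partial>M) = (\<Sum>i<Suc N. \<integral>\<omega>. (D i \<omega>)\<^sup>2 \<partial>M)"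
      unfolding sq using Suc i D2 o by simp
  qed
qed (simp)

text \<open>The indicator of an event known at \<open>c i\<close> can be moved to the test function
  \<open>Y\<close>.\<close>

lemma mart_diff_stopped:
  assumes md: "mart_diff c D" and A: "\<And>i. A i \<in> sets (F (c i))"
  shows "mart_diff c (\<lambda>i \<omega>. indicator (A i) \<omega> * D i \<omega>)"
  unfolding mart_diff_def
proof (intro allI conjI ballI impI)
  fix i
  note c = mart_diffD(1,2)[OF md, of i] and D = mart_diffD(3)[OF md, of i]
    and D2 = mart_diffD(4)[OF md, of i] and o = mart_diffD(5)[OF md, of _ i]
  show "0 \<le> c i" "c i \<le> c (Suc i)" by fact+
  have "A i \<in> sets (F (c (Suc i)))" using A[of i] mono_F[OF c] by auto
  then show "(\<lambda>\<omega>. indicator (A i) \<omega> * D i \<omega>) \<in> borel_measurable (F (c (Suc i)))"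
    using D by measurable
  have AM: "A i \<in> sets M" using A[of i] subalgebra_F[OF c(1)] by (auto simp: subalgebra_def)
  have sq: "(indicator (A i) \<omega> * y)\<^sup>2 = indicator (A i) \<omega> * y\<^sup>2" for \<omega> and y :: real
    by (simp add: indicator_def)
  show "integrable M (\<lambda>\<omega>. (indicator (A i) \<omega> * D i \<omega>)\<^sup>2)"
    unfolding sq using AM D2 by (intro integrable_real_mult_indicator[of _ _ "\<lambda>\<omega>. (D i \<omega>)\<^sup>2", simplified mult.commute])
  fix Y :: "'w \<Rightarrow> real"
  assume Y: "Y \<in> borel_measurable (F (c i))" "integrable M (\<lambda>\<omega>. (Y \<omega>)\<^sup>2)"
  have "(\<integral>\<omega>. (indicator (A i) \<omega> * Y \<omega>) * D i \<omega> \<partial>M) = 0"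
  proof (rule o)
    show "(\<lambda>\<omega>. indicator (A i) \<omega> * Y \<omega>) \<in> borel_measurable (F (c i))"
      using A[of i] Y by measurable
    show "integrable M (\<lambda>\<omega>. (indicator (A i) \<omega> * Y \<omega>)\<^sup>2)"
      unfolding sq using AM Y by (intro integrable_real_mult_indicator[of _ _ "\<lambda>\<omega>. (Y \<omega>)\<^sup>2", simplified mult.commute])
  qed
  then show "(\<integral>\<omega>. Y \<omega> * (indicator (A i) \<omega> * D i \<omega>) \<partial>M) = 0" by (simp add: mult_ac)
qed

text \<open>Kolmogorov's inequality by stopping: a difference is added only while all partial sums
  so far are at most \<open>r\<close> in modulus. The stopped sum ends at the first value beyond
  \<open>r\<close>, and its second moment is at most that of the full sum.\<close>

lemma mart_diff_maximal:
  assumes md: "mart_diff c D" and r: "0 < r"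
  shows "{\<omega>\<in>space M. \<exists>k\<le>N. r < \<bar>\<Sum>i<k. D i \<omega>\<bar>} \<in> sets M" (is "?E \<in> _")
    and "measure M {\<omega>\<in>space M. \<exists>k\<le>N. r < \<bar>\<Sum>i<k. D i \<omega>\<bar>} \<le> (\<Sum>i<N. \<integral>\<omega>. (D i \<omega>)\<^sup>2 \<partial>M) / r\<^sup>2"
proof -
  define S where "S k \<omega> = (\<Sum>i<k. D i \<omega>)" for k \<omega>
  have c: "0 \<le> c i" for i by (rule mart_diffD(1)[OF md])
  have c_mono: "i \<le> j \<Longrightarrow> c i \<le> c j" for i j
    by (rule lift_Suc_mono_le[of c, OF mart_diffD(2)[OF md]])
  have S: "S k \<in> borel_measurable (F (c k))" for k
    using mart_diff_sum[OF md, of k] by (simp add: S_def[abs_def])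
  have SM[measurable]: "S k \<in> borel_measurable M" for k using S c measurable_F_M by blast
  show E: "?E \<in> sets M" unfolding S_def[symmetric] by measurable
  define A where "A i = {\<omega>\<in>space M. \<forall>j\<le>i. \<bar>S j \<omega>\<bar> \<le> r}" for i
  have A: "A i \<in> sets (F (c i))" for i
  proof -
    have [measurable]: "S j \<in> borel_measurable (F (c i))" if "j \<le> i" for j
      using S[of j] c[of j] c_mono[OF that] measurable_F_mono by blast
    have "A i = {\<omega>\<in>space (F (c i)). \<forall>j\<in>{..i}. \<bar>S j \<omega>\<bar> \<le> r}"
      using c by (auto simp: A_def)
    also have "\<dots> \<in> sets (F (c i))"
      by (intro sets.sets_Collect_finite_All') auto
    finally show ?thesis .
  qed
  let ?D = "\<lambda>i \<omega>. indicator (A i) \<omega> * D i \<omega>"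
  have md': "mart_diff c ?D" using mart_diff_stopped[OF md A] .
  define T where "T \<omega> = (\<Sum>i<N. ?D i \<omega>)" for \<omega>
  have T: "T \<in> borel_measurable M" "integrable M (\<lambda>\<omega>. (T \<omega>)\<^sup>2)"
      "(\<integral>\<omega>. (T \<omega>)\<^sup>2 \<partial>M) = (\<Sum>i<N. \<integral>\<omega>. (?D i \<omega>)\<^sup>2 \<partial>M)"
    using mart_diff_sum[OF md', of N] c measurable_F_M unfolding T_def[abs_def] by blast+
  have sub: "?E \<subseteq> {\<omega>\<in>space M. r\<^sup>2 \<le> (T \<omega>)\<^sup>2}"
  proof safe
    fix \<omega> k assume \<omega>: "\<omega> \<in> space M" and k: "k \<le> N" "r < \<bar>\<Sum>i<k. D i \<omega>\<bar>"
    \<comment> \<open>The first index of excess. The differences below \<open>l\<close> are kept and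
      those from \<open>l\<close> on are dropped, so the stopped sum equals
      \<open>S l\<close>.\<close>
    define l where "l = (LEAST k. r < \<bar>S k \<omega>\<bar>)"
    have l: "r < \<bar>S l \<omega>\<bar>" "l \<le> k"
      unfolding l_def using k LeastI[of "\<lambda>k. r < \<bar>S k \<omega>\<bar>" k] Least_le[of "\<lambda>k. r < \<bar>S k \<omega>\<bar>" k]
      by (auto simp: S_def)
    have less: "\<bar>S j \<omega>\<bar> \<le> r" if "j < l" for j
      using not_less_Least[of j "\<lambda>k. r < \<bar>S k \<omega>\<bar>"] that unfolding l_def by auto
    have "T \<omega> = (\<Sum>i<l. D i \<omega>)"
      unfolding T_def
    proof (rule sum.mono_neutral_cong_right)
      show "\<forall>i\<in>{..<N} - {..<l}. ?D i \<omega> = 0" using l by (auto simp: A_def indicator_def)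
      show "?D i \<omega> = D i \<omega>" if "i \<in> {..<l}" for i
        using that less \<omega> by (auto simp: A_def indicator_def)
    qed (use l k in auto)
    then have "r \<le> \<bar>T \<omega>\<bar>" using l by (simp add: S_def)
    then show "r\<^sup>2 \<le> (T \<omega>)\<^sup>2" using r by (metis abs_of_pos abs_le_square_iff)
  qed
  have "measure M ?E \<le> measure M {\<omega>\<in>space M. r\<^sup>2 \<le> (T \<omega>)\<^sup>2}"
    using T by (intro finite_measure_mono sub) measurable
  also have "\<dots> \<le> (\<integral>\<omega>. (T \<omega>)\<^sup>2 \<partial>M) / r\<^sup>2"
    using r T by (intro integral_Markov_inequality_measure[where A="{}"]) auto
  also have "(\<integral>\<omega>. (T \<omega>)\<^sup>2 \<partial>M) \<le> (\<Sum>i<N. \<integral>\<omega>. (D i \<omega>)\<^sup>2 \<partial>M)"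
    unfolding T(3)
    by (intro sum_mono integral_mono mart_diffD(4)[OF md] mart_diffD(4)[OF md']) (auto simp: indicator_def)
  finally show "measure M ?E \<le> (\<Sum>i<N. \<integral>\<omega>. (D i \<omega>)\<^sup>2 \<partial>M) / r\<^sup>2"
    using r by (simp add: divide_right_mono)
qed

end

section \<open>The isometry and the maximal inequality for step integrals\<close>

lemma continuous_on_halfline:
  fixes f :: "real \<Rightarrow> 'b::topological_space"
  assumes "\<And>T. continuous_on {0..<T} f" shows "continuous_on {0..} f"
  unfolding continuous_on_eq_continuous_within
proof
  fix t :: real assume "t \<in> {0..}"
  then have "continuous (at t within {0..<t + 1}) f"
    using assms[of "t + 1"] by (auto simp: continuous_on_eq_continuous_within)
  moreover have "at t within {0..<t + 1} = at t within {0..}"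
    by (rule at_within_nhd[of _ "{..<t + 1}"]) auto
  ultimately show "continuous (at t within {0..}) f" by simp
qed

text \<open>The integrand is constant on half-open cells, so its integral is a finite sum.
  Measurability is part of the conclusion: except at the single point \<open>t\<close> the integrand
  equals a finite combination of indicators.\<close>

lemma has_integral_dyadic:
  fixes u :: "real \<Rightarrow> 'b::{banach, second_countable_topology}"
  assumes "0 \<le> t" and u: "\<And>s. 0 \<le> s \<Longrightarrow> s \<le> t \<Longrightarrow> u s = u (dfloor n s)"
  shows "has_bochner_integral lborel (\<lambda>s. indicator {0..t} s *\<^sub>R u s)
    (\<Sum>i<Suc (dindex n t). (min t (dyadic n (Suc i)) - min t (dyadic n i)) *\<^sub>R u (dyadic n i))"
proof -
  let ?c = "\<lambda>i. min t (dyadic n i)"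
  let ?v = "\<lambda>s. \<Sum>i<Suc (dindex n t). indicator {?c i..<?c (Suc i)} s *\<^sub>R u (dyadic n i)"
  have v: "has_bochner_integral lborel ?v (\<Sum>i<Suc (dindex n t). (?c (Suc i) - ?c i) *\<^sub>R u (dyadic n i))"
  proof (rule has_bochner_integral_sum)
    fix i
    have "?c i \<le> ?c (Suc i)" using dyadic_less_Suc[of n i] by auto
    then have "has_bochner_integral lborel (indicator {?c i..<?c (Suc i)} :: real \<Rightarrow> real) (?c (Suc i) - ?c i)"
      using has_bochner_integral_real_indicator[of "{?c i..<?c (Suc i)}" lborel] by simp
    then show "has_bochner_integral lborel (\<lambda>s. indicator {?c i..<?c (Suc i)} s *\<^sub>R u (dyadic n i))
        ((?c (Suc i) - ?c i) *\<^sub>R u (dyadic n i))"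
      by (rule has_bochner_integral_scaleR_left)
  qed
  have eq: "indicator {0..t} s *\<^sub>R u s = ?v s" if "s \<noteq> t" for s
  proof (cases "0 \<le> s \<and> s < t")
    case True
    let ?i = "dindex n s"
    have "?v s = (\<Sum>i\<in>{?i}. indicator {?c i..<?c (Suc i)} s *\<^sub>R u (dyadic n i))"
    proof (rule sum.mono_neutral_cong_right)
      show "{?i} \<subseteq> {..<Suc (dindex n t)}" using True dindex_mono[of s t n] by auto
      show "\<forall>i\<in>{..<Suc (dindex n t)} - {?i}. indicator {?c i..<?c (Suc i)} s *\<^sub>R u (dyadic n i) = 0"
        using True dindex_eqI[of n _ s] by (auto simp: indicator_def min_def split: if_splits)
    qed auto
    also have "\<dots> = u (dyadic n ?i)"
      using True less_dyadic_Suc_dindex[of s n] dfloor_le[of s n, unfolded dfloor_def]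
      by (simp add: indicator_def)
    finally show ?thesis using True u[of s] by (simp add: dfloor_def)
  next
    case False
    have "indicator {?c i..<?c (Suc i)} s = (0::real)" for i
    proof -
      have "0 \<le> ?c i" "?c (Suc i) \<le> t" using assms by auto
      then have "\<not> (?c i \<le> s \<and> s < ?c (Suc i))" using False by linarith
      then show ?thesis by (simp add: indicator_def)
    qed
    then have "?v s = 0" by (simp only: scaleR_zero_left sum.neutral_const)
    moreover have "indicator {0..t} s = (0::real)" using False that by (auto simp: indicator_def)
    ultimately show ?thesis by simp
  qed
  have "AE s in lborel. s \<noteq> t" by (rule AE_lborel_singleton)
  then have ae: "AE s in lborel. ?v s = indicator {0..t} s *\<^sub>R u s" by eventually_elim (simp add: eq)
  have m: "?v \<in> borel_measurable lborel"
    using v unfolding has_bochner_integral_iff by (intro borel_measurable_integrable) blast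
  have "(\<lambda>s. indicator {0..t} s *\<^sub>R u s) = (\<lambda>s. if s = t then u t else ?v s)"
    using eq assms by (auto simp: fun_eq_iff)
  also have "\<dots> \<in> borel_measurable lborel" by (intro measurable_If m measurable_const) auto
  finally show ?thesis using has_bochner_integral_cong_AE[OF m _ ae] v by blast
qed

context stochastic_basis
begin

text \<open>On each half-open cell a step integrand has its value at the left end. Constancy is
  written through \<open>dfloor\<close> as an equation between random variables, so that passing to
  a finer grid is a rewriting with nested floors. The bound is uniform in time and chance.\<close>

definition stepwise :: "nat \<Rightarrow> (real \<Rightarrow> 'w \<Rightarrow> 'c::euclidean_space) \<Rightarrow> bool" where
  "stepwise n H \<longleftrightarrow> (\<forall>s\<ge>0. H s = H (dfloor n s)) \<and> (\<forall>s\<ge>0. H s \<in> borel_measurable (F s)) \<and>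
     (\<exists>K. \<forall>s\<ge>0. \<forall>\<omega>\<in>space M. norm (H s \<omega>) \<le> K)"

lemma stepwiseD:
  assumes "stepwise n H"
  shows "0 \<le> s \<Longrightarrow> H s = H (dfloor n s)" and "0 \<le> s \<Longrightarrow> H s \<in> borel_measurable (F s)"
    and "0 \<le> s \<Longrightarrow> H s \<in> borel_measurable M"
proof -
  show "0 \<le> s \<Longrightarrow> H s = H (dfloor n s)" and a: "0 \<le> s \<Longrightarrow> H s \<in> borel_measurable (F s)"
    using assms unfolding stepwise_def by blast+
  show "0 \<le> s \<Longrightarrow> H s \<in> borel_measurable M" using measurable_F_M[OF _ a] by blast
qed

lemma stepwise_bounded:
  assumes "stepwise n H"
  obtains K where "0 < K" "\<And>s \<omega>. 0 \<le> s \<Longrightarrow> \<omega> \<in> space M \<Longrightarrow> norm (H s \<omega>) \<le> K"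
proof -
  obtain K where K: "\<forall>s\<ge>0. \<forall>\<omega>\<in>space M. norm (H s \<omega>) \<le> K" using assms unfolding stepwise_def by blast
  show ?thesis
  proof (rule that[of "\<bar>K\<bar> + 1"])
    show "norm (H s \<omega>) \<le> \<bar>K\<bar> + 1" if "0 \<le> s" "\<omega> \<in> space M" for s \<omega>
      using K[rule_format, OF that] by linarith
  qed simp
qed

lemma stepwise_refine:
  assumes "stepwise n H" "n \<le> k" shows "stepwise k H"
  unfolding stepwise_def
proof (intro conjI allI impI)
  fix s :: real assume s: "0 \<le> s"
  have "H (dfloor k s) = H (dfloor n (dfloor k s))" by (rule stepwiseD(1)[OF assms(1)]) simp
  also have "\<dots> = H (dfloor n s)" by (simp only: dfloor_dfloor[OF s assms(2)])
  also have "\<dots> = H s" by (rule stepwiseD(1)[OF assms(1) s, symmetric])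
  finally show "H s = H (dfloor k s)" ..
next
  show "\<exists>K. \<forall>s\<ge>0. \<forall>\<omega>\<in>space M. norm (H s \<omega>) \<le> K"
    using assms(1) unfolding stepwise_def by blast
qed (rule stepwiseD(2)[OF assms(1)])

lemma stepwise_map2:
  assumes H: "stepwise n H" and G: "stepwise n G"
    and f: "(\<lambda>z. f (fst z) (snd z)) \<in> borel_measurable borel"
    and b: "\<And>K. \<exists>L. \<forall>x y. norm x \<le> K \<longrightarrow> norm y \<le> K \<longrightarrow> norm (f x y) \<le> L"
  shows "stepwise n (\<lambda>s \<omega>. f (H s \<omega>) (G s \<omega>))"
  unfolding stepwise_def
proof (intro conjI allI impI)
  fix s :: real assume s: "0 \<le> s"
  show "(\<lambda>\<omega>. f (H s \<omega>) (G s \<omega>)) = (\<lambda>\<omega>. f (H (dfloor n s) \<omega>) (G (dfloor n s) \<omega>))"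
    using stepwiseD(1)[OF H s] stepwiseD(1)[OF G s] by metis
  have "(\<lambda>\<omega>. (H s \<omega>, G s \<omega>)) \<in> borel_measurable (F s)"
    using stepwiseD(2)[OF H s] stepwiseD(2)[OF G s] by (rule borel_measurable_Pair)
  from measurable_compose[OF this f] show "(\<lambda>\<omega>. f (H s \<omega>) (G s \<omega>)) \<in> borel_measurable (F s)"
    by simp
next
  obtain K L where KL: "\<And>s \<omega>. 0 \<le> s \<Longrightarrow> \<omega> \<in> space M \<Longrightarrow> norm (H s \<omega>) \<le> K"
    "\<And>s \<omega>. 0 \<le> s \<Longrightarrow> \<omega> \<in> space M \<Longrightarrow> norm (G s \<omega>) \<le> L"
    using stepwise_bounded[OF H] stepwise_bounded[OF G] by metis
  obtain L' where "\<forall>x y. norm x \<le> max K L \<longrightarrow> norm y \<le> max K L \<longrightarrow> norm (f x y) \<le> L'" using b by blast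
  then show "\<exists>K. \<forall>s\<ge>0. \<forall>\<omega>\<in>space M. norm (f (H s \<omega>) (G s \<omega>)) \<le> K"
    using KL by (meson max.coboundedI1 max.coboundedI2)
qed

lemma stepwise_diff:
  fixes H G :: "real \<Rightarrow> 'w \<Rightarrow> 'c::euclidean_space"
  assumes "stepwise n H" "stepwise n G" shows "stepwise n (\<lambda>s \<omega>. H s \<omega> - G s \<omega>)"
  using assms
proof (rule stepwise_map2[where f="(-)"])
  fix K :: real show "\<exists>L. \<forall>x y :: 'c. norm x \<le> K \<longrightarrow> norm y \<le> K \<longrightarrow> norm (x - y) \<le> L"
    by (intro exI[of _ "K + K"]) (metis add_mono norm_triangle_ineq4 order_trans)
qed (auto simp: borel_prod[symmetric])

lemma stepwise_scaleR:
  fixes H :: "real \<Rightarrow> 'w \<Rightarrow> real" and G :: "real \<Rightarrow> 'w \<Rightarrow> 'c::euclidean_space"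
  assumes "stepwise n H" "stepwise n G" shows "stepwise n (\<lambda>s \<omega>. H s \<omega> *\<^sub>R G s \<omega>)"
  using assms
proof (rule stepwise_map2[where f="(*\<^sub>R)"])
  fix K :: real show "\<exists>L. \<forall>x. \<forall>y :: 'c. norm x \<le> K \<longrightarrow> norm y \<le> K \<longrightarrow> norm (x *\<^sub>R y) \<le> L"
  proof (intro exI[of _ "K * K"] allI impI)
    fix x :: real and y :: 'c assume xy: "norm x \<le> K" "norm y \<le> K"
    then have "0 \<le> K" using norm_ge_zero[of y] by linarith
    with xy show "norm (x *\<^sub>R y) \<le> K * K" by (auto intro!: mult_mono)
  qed
qed (auto simp: borel_prod[symmetric])

lemma stepwise_const: "stepwise n (\<lambda>s \<omega>. b)"
  unfolding stepwise_def by auto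

text \<open>The squared norm of \<open>L\<^sup>2\<close> on \<open>[0, T]\<close> times the sample
  space; taking values in \<open>ennreal\<close>, it can be written down before integrability is
  known.\<close>

definition qnorm :: "real \<Rightarrow> (real \<Rightarrow> 'w \<Rightarrow> 'c::euclidean_space) \<Rightarrow> ennreal" where
  "qnorm T \<Theta> = (\<integral>\<^sup>+\<omega>. (\<integral>\<^sup>+s\<in>{0..T}. ennreal ((norm (\<Theta> s \<omega>))\<^sup>2) \<partial>lborel) \<partial>M)"

lemma qnorm_mono: "T \<le> T' \<Longrightarrow> qnorm T \<Theta> \<le> qnorm T' \<Theta>"
  unfolding qnorm_def by (intro nn_integral_mono) (auto simp: indicator_def)

text \<open>Along each path the squared length is a step function, so the time integral is a finite
  sum; in particular the value is finite.\<close>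

lemma qnorm_stepwise:
  assumes H: "stepwise n H" and t: "0 \<le> t"
  shows "qnorm t H = ennreal (\<Sum>i<Suc (dindex n t). (min t (dyadic n (Suc i)) - min t (dyadic n i)) *
      (\<integral>\<omega>. (norm (H (dyadic n i) \<omega>))\<^sup>2 \<partial>M))"
proof -
  let ?d = "\<lambda>i. min t (dyadic n (Suc i)) - min t (dyadic n i)"
  have d: "0 \<le> ?d i" for i using dyadic_less_Suc[of n i] by auto
  obtain K where K: "0 < K" "\<And>s \<omega>. 0 \<le> s \<Longrightarrow> \<omega> \<in> space M \<Longrightarrow> norm (H s \<omega>) \<le> K"
    using stepwise_bounded[OF H] by blast
  have int: "integrable M (\<lambda>\<omega>. (norm (H (dyadic n i) \<omega>))\<^sup>2)" for i
    by (rule integrable_const_bound[of _ "K\<^sup>2"])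
      (use K stepwiseD(3)[OF H] in \<open>auto intro!: AE_I2 power_mono simp del: power_mono_iff\<close>)
  have "(\<integral>\<^sup>+s\<in>{0..t}. ennreal ((norm (H s \<omega>))\<^sup>2) \<partial>lborel) =
      ennreal (\<Sum>i<Suc (dindex n t). ?d i * (norm (H (dyadic n i) \<omega>))\<^sup>2)" for \<omega>
  proof -
    have "has_bochner_integral lborel (\<lambda>s. indicator {0..t} s *\<^sub>R (norm (H s \<omega>))\<^sup>2)
      (\<Sum>i<Suc (dindex n t). ?d i *\<^sub>R (norm (H (dyadic n i) \<omega>))\<^sup>2)"
      by (rule has_integral_dyadic[OF t]) (metis stepwiseD(1)[OF H])
    then have "(\<integral>\<^sup>+s. ennreal (indicator {0..t} s *\<^sub>R (norm (H s \<omega>))\<^sup>2) \<partial>lborel) =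
        ennreal (\<Sum>i<Suc (dindex n t). ?d i *\<^sub>R (norm (H (dyadic n i) \<omega>))\<^sup>2)"
      by (subst nn_integral_eq_integral) (auto simp: has_bochner_integral_iff)
    then show ?thesis by (simp add: ennreal_mult' ennreal_indicator mult.commute del: sum.lessThan_Suc)
  qed
  then have "qnorm t H = (\<integral>\<^sup>+\<omega>. ennreal (\<Sum>i<Suc (dindex n t). ?d i * (norm (H (dyadic n i) \<omega>))\<^sup>2) \<partial>M)"
    by (simp add: qnorm_def del: sum.lessThan_Suc)
  also have "\<dots> = ennreal (\<integral>\<omega>. (\<Sum>i<Suc (dindex n t). ?d i * (norm (H (dyadic n i) \<omega>))\<^sup>2) \<partial>M)"
    by (rule nn_integral_eq_integral)
      (use int d in \<open>auto intro!: AE_I2 sum_nonneg mult_nonneg_nonneg Bochner_Integration.integrable_sum simp del: sum.lessThan_Suc\<close>)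
  finally show ?thesis using int by (simp add: Bochner_Integration.integral_sum del: sum.lessThan_Suc)
qed

end

context brownian_basis
begin

text \<open>Freezing the past turns the expectation into an iterated integral whose inner part
  vanishes by \<open>mean\<close>.\<close>

lemma increment_orthogonal:
  fixes q :: "'w \<times> 'a \<Rightarrow> real" and Y :: "'w \<Rightarrow> real"
  assumes "0 \<le> s" "s < t" and q[measurable]: "q \<in> borel_measurable (F s \<Otimes>\<^sub>M borel)"
    and L2: "integrable M (\<lambda>\<omega>. (q (\<omega>, W t \<omega> - W s \<omega>))\<^sup>2)"
    and mean: "\<And>\<omega>. \<omega> \<in> space M \<Longrightarrow> (\<integral>z. q (\<omega>, z) \<partial>gauss (t - s)) = 0"
    and Y[measurable]: "Y \<in> borel_measurable (F s)" and Y2: "integrable M (\<lambda>\<omega>. (Y \<omega>)\<^sup>2)"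
  shows "(\<integral>\<omega>. Y \<omega> * q (\<omega>, W t \<omega> - W s \<omega>) \<partial>M) = 0"
proof -
  have m: "(\<lambda>\<omega>. (\<omega>, W t \<omega> - W s \<omega>)) \<in> measurable M (F s \<Otimes>\<^sub>M borel)"
    using assms measurable_F_M[OF assms(1), of "\<lambda>\<omega>. \<omega>" "F s"]
    by (intro measurable_Pair borel_measurable_diff W_measurable) auto
  have "integrable M (\<lambda>\<omega>. Y \<omega> * q (\<omega>, W t \<omega> - W s \<omega>))"
    by (rule integrable_mult_square[OF measurable_F_M[OF assms(1) Y] measurable_compose[OF m q] Y2 L2])
  then have "(\<integral>\<omega>. Y \<omega> * q (\<omega>, W t \<omega> - W s \<omega>) \<partial>M) = (\<integral>\<omega>. \<integral>z. Y \<omega> * q (\<omega>, z) \<partial>gauss (t - s) \<partial>M)"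
    using integral_past_increment[of s t "\<lambda>(\<omega>, z). Y \<omega> * q (\<omega>, z)"] assms(1,2) by simp
  also have "\<dots> = (\<integral>\<omega>. 0 \<partial>M)"
    by (rule Bochner_Integration.integral_cong) (use mean in auto)
  finally show ?thesis by simp
qed

text \<open>Ito's isometry for one cell: given the past, \<open>D\<close> is centred Gaussian with
  variance \<open>(t - s) * (norm (g \<omega>))\<^sup>2\<close>.\<close>

lemma inner_increment:
  fixes g :: "'w \<Rightarrow> 'a" and Y :: "'w \<Rightarrow> real"
  assumes st: "0 \<le> s" "s \<le> t" and g: "g \<in> borel_measurable (F s)"
    and K: "\<And>\<omega>. \<omega> \<in> space M \<Longrightarrow> norm (g \<omega>) \<le> K"
  defines "D \<equiv> \<lambda>\<omega>. g \<omega> \<bullet> (W t \<omega> - W s \<omega>)"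
  shows "D \<in> borel_measurable (F t)" and "integrable M (\<lambda>\<omega>. (D \<omega>)\<^sup>2)"
    and "(\<integral>\<omega>. (D \<omega>)\<^sup>2 \<partial>M) = (t - s) * (\<integral>\<omega>. (norm (g \<omega>))\<^sup>2 \<partial>M)"
    and "Y \<in> borel_measurable (F s) \<Longrightarrow> integrable M (\<lambda>\<omega>. (Y \<omega>)\<^sup>2) \<Longrightarrow> (\<integral>\<omega>. Y \<omega> * D \<omega> \<partial>M) = 0"
proof -
  have gM: "g \<in> borel_measurable M" using g st measurable_F_M by blast
  show D: "D \<in> borel_measurable (F t)"
    unfolding D_def
    by (rule borel_measurable_inner[OF measurable_F_mono[OF st g] W_increment_adapted]) (use st in simp_all)
  have DM: "D \<in> borel_measurable M" by (rule measurable_F_M[OF _ D]) (use st in simp)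
  have g2: "integrable M (\<lambda>\<omega>. (norm (g \<omega>))\<^sup>2)"
    by (rule integrable_const_bound[of _ "K\<^sup>2"])
      (use K gM in \<open>auto intro!: AE_I2 power_mono simp del: power_mono_iff\<close>)
  have "integrable M (\<lambda>\<omega>. (D \<omega>)\<^sup>2) \<and> (\<integral>\<omega>. (D \<omega>)\<^sup>2 \<partial>M) = (t - s) * (\<integral>\<omega>. (norm (g \<omega>))\<^sup>2 \<partial>M) \<and>
    (Y \<in> borel_measurable (F s) \<longrightarrow> integrable M (\<lambda>\<omega>. (Y \<omega>)\<^sup>2) \<longrightarrow> (\<integral>\<omega>. Y \<omega> * D \<omega> \<partial>M) = 0)"
  proof (cases "s = t")
    case True then show ?thesis by (simp add: D_def)
  next
    case False
    then have st': "s < t" using st by simp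
    have q: "(\<lambda>(\<omega>, z). g \<omega> \<bullet> z) \<in> borel_measurable (F s \<Otimes>\<^sub>M borel)"
      using g by measurable
    have q2: "(\<lambda>(\<omega>, z). ennreal ((g \<omega> \<bullet> z)\<^sup>2)) \<in> borel_measurable (F s \<Otimes>\<^sub>M borel)"
      using g by measurable
    have "(\<integral>\<^sup>+\<omega>. ennreal ((D \<omega>)\<^sup>2) \<partial>M) = (\<integral>\<^sup>+\<omega>. \<integral>\<^sup>+z. ennreal ((g \<omega> \<bullet> z)\<^sup>2) \<partial>gauss (t - s) \<partial>M)"
      using nn_integral_past_increment[OF st(1) st' q2] by (simp add: D_def)
    also have "\<dots> = (\<integral>\<^sup>+\<omega>. ennreal ((t - s) * (norm (g \<omega>))\<^sup>2) \<partial>M)"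
      using gauss_second_moment[of "t - s"] st'
      by (intro nn_integral_cong, subst nn_integral_eq_integral) (auto simp: has_bochner_integral_iff)
    also have "\<dots> = ennreal ((t - s) * (\<integral>\<omega>. (norm (g \<omega>))\<^sup>2 \<partial>M))"
      using g2 st by (subst nn_integral_eq_integral) auto
    finally have nn: "(\<integral>\<^sup>+\<omega>. ennreal ((D \<omega>)\<^sup>2) \<partial>M) = ennreal ((t - s) * (\<integral>\<omega>. (norm (g \<omega>))\<^sup>2 \<partial>M))" .
    have int: "integrable M (\<lambda>\<omega>. (D \<omega>)\<^sup>2)"
      by (rule integrableI_bounded) (use DM nn in auto)
    moreover have "(\<integral>\<omega>. (D \<omega>)\<^sup>2 \<partial>M) = (t - s) * (\<integral>\<omega>. (norm (g \<omega>))\<^sup>2 \<partial>M)"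
      using nn st DM by (subst integral_eq_nn_integral) (auto intro!: mult_nonneg_nonneg)
    moreover have "(\<integral>\<omega>. Y \<omega> * D \<omega> \<partial>M) = 0"
      if "Y \<in> borel_measurable (F s)" "integrable M (\<lambda>\<omega>. (Y \<omega>)\<^sup>2)"
      using increment_orthogonal[OF st(1) st' q _ _ that] int gauss_mean[of "t - s"] st'
      by (auto simp: D_def has_bochner_integral_iff)
    ultimately show ?thesis by blast
  qed
  then show "integrable M (\<lambda>\<omega>. (D \<omega>)\<^sup>2)" "(\<integral>\<omega>. (D \<omega>)\<^sup>2 \<partial>M) = (t - s) * (\<integral>\<omega>. (norm (g \<omega>))\<^sup>2 \<partial>M)"
    "Y \<in> borel_measurable (F s) \<Longrightarrow> integrable M (\<lambda>\<omega>. (Y \<omega>)\<^sup>2) \<Longrightarrow> (\<integral>\<omega>. Y \<omega> * D \<omega> \<partial>M) = 0" by blast+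
qed

lemma mart_diff_step:
  assumes H: "stepwise n H" and t: "0 \<le> t"
  defines "c \<equiv> \<lambda>i. min t (dyadic n i)"
  defines "D \<equiv> \<lambda>i \<omega>. H (dyadic n i) \<omega> \<bullet> (W (c (Suc i)) \<omega> - W (c i) \<omega>)"
  shows "mart_diff c D"
    and "(\<integral>\<omega>. (D i \<omega>)\<^sup>2 \<partial>M) = (c (Suc i) - c i) * (\<integral>\<omega>. (norm (H (dyadic n i) \<omega>))\<^sup>2 \<partial>M)"
proof -
  obtain K where K: "\<And>s \<omega>. 0 \<le> s \<Longrightarrow> \<omega> \<in> space M \<Longrightarrow> norm (H s \<omega>) \<le> K"
    using stepwise_bounded[OF H] by blast
  have c: "0 \<le> c i" "c i \<le> c (Suc i)" for i
    using t dyadic_less_Suc[of n i] by (auto simp: c_def)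
  have *: "D i \<in> borel_measurable (F (c (Suc i))) \<and> integrable M (\<lambda>\<omega>. (D i \<omega>)\<^sup>2) \<and>
    (\<integral>\<omega>. (D i \<omega>)\<^sup>2 \<partial>M) = (c (Suc i) - c i) * (\<integral>\<omega>. (norm (H (dyadic n i) \<omega>))\<^sup>2 \<partial>M) \<and>
    (\<forall>Y \<in> borel_measurable (F (c i)). integrable M (\<lambda>\<omega>. (Y \<omega>)\<^sup>2) \<longrightarrow> (\<integral>\<omega>. Y \<omega> * D i \<omega> \<partial>M) = 0)" for i
  \<comment> \<open>If the cell has begun by time \<open>t\<close>, then \<open>c i\<close> is the
    grid point at which \<open>H\<close> is evaluated, so \<open>H\<close> is known there. Otherwise
    both cut-off times equal \<open>t\<close> and the difference vanishes.\<close>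
  proof (cases "dyadic n i \<le> t")
    case True
    then have ci: "c i = dyadic n i" by (simp add: c_def)
    have g: "H (dyadic n i) \<in> borel_measurable (F (c i))" unfolding ci by (rule stepwiseD(2)[OF H]) simp
    show ?thesis unfolding D_def
      using inner_increment[OF c g K[OF dyadic_nonneg]] by (simp add: ci)
  next
    case False
    then have "c i = t" "c (Suc i) = t" using dyadic_less_Suc[of n i] by (auto simp: c_def)
    then show ?thesis by (simp add: D_def)
  qed
  then show "mart_diff c D" using c by (auto simp: mart_diff_def)
  show "(\<integral>\<omega>. (D i \<omega>)\<^sup>2 \<partial>M) = (c (Suc i) - c i) * (\<integral>\<omega>. (norm (H (dyadic n i) \<omega>))\<^sup>2 \<partial>M)"
    using * by blast
qed

text \<open>Pythagoras for the martingale differences of the cells, together with the finite-sum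
  form of \<open>qnorm\<close>, gives the isometry; testing each difference against the constant
  \<open>1\<close> gives mean zero.\<close>

lemma step_integral_L2:
  assumes H: "stepwise n H" and t: "0 \<le> t"
  shows "step_integral n H W t \<in> borel_measurable (F t)"
    and "step_integral n H W t \<in> borel_measurable M"
    and "integrable M (\<lambda>\<omega>. (step_integral n H W t \<omega>)\<^sup>2)"
    and "(\<integral>\<^sup>+\<omega>. ennreal ((step_integral n H W t \<omega>)\<^sup>2) \<partial>M) = qnorm t H"
    and "(\<integral>\<omega>. step_integral n H W t \<omega> \<partial>M) = 0"
proof -
  let ?N = "Suc (dindex n t)"
  let ?c = "\<lambda>i. min t (dyadic n i)"
  let ?D = "\<lambda>i \<omega>. H (dyadic n i) \<omega> \<bullet> (W (?c (Suc i)) \<omega> - W (?c i) \<omega>)"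
  note md = mart_diff_step[OF H t]
  have cN: "?c ?N = t" using less_dyadic_Suc_dindex[of t n] by simp
  have S: "step_integral n H W t = (\<lambda>\<omega>. \<Sum>i<?N. ?D i \<omega>)" by (simp add: step_integral_def fun_eq_iff)
  note s = mart_diff_sum[OF md(1), of ?N, folded S, unfolded cN]
  show "step_integral n H W t \<in> borel_measurable (F t)"
    and i: "integrable M (\<lambda>\<omega>. (step_integral n H W t \<omega>)\<^sup>2)" using s S by auto
  then show "step_integral n H W t \<in> borel_measurable M" using measurable_F_M[OF t] by blast
  have "(\<integral>\<^sup>+\<omega>. ennreal ((step_integral n H W t \<omega>)\<^sup>2) \<partial>M) = ennreal (\<integral>\<omega>. (step_integral n H W t \<omega>)\<^sup>2 \<partial>M)"
    using i by (rule nn_integral_eq_integral) simp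
  also have "\<dots> = qnorm t H" using s S md(2) by (simp add: qnorm_stepwise[OF H t] fun_eq_iff del: sum.lessThan_Suc)
  finally show "(\<integral>\<^sup>+\<omega>. ennreal ((step_integral n H W t \<omega>)\<^sup>2) \<partial>M) = qnorm t H" .
  have "(\<integral>\<omega>. ?D i \<omega> \<partial>M) = 0" for i
    using mart_diffD(5)[OF md(1), of "\<lambda>_. 1" i] by simp
  moreover have "integrable M (?D i)" for i
  proof (rule square_integrable_imp_integrable)
    show "?D i \<in> borel_measurable M" "integrable M (\<lambda>\<omega>. (?D i \<omega>)\<^sup>2)"
      using mart_diffD(3,4)[OF md(1), of i] mart_diffD(1)[OF md(1), of "Suc i"] measurable_F_M[of "?c (Suc i)" "?D i"]
      by blast+
  qed
  ultimately show "(\<integral>\<omega>. step_integral n H W t \<omega> \<partial>M) = 0"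
    unfolding S by (simp add: Bochner_Integration.integral_sum del: sum.lessThan_Suc)
qed

lemma step_integral_diff:
  assumes "stepwise n H" "stepwise n G"
  shows "step_integral n (\<lambda>s \<omega>. H s \<omega> - G s \<omega>) Z t \<omega> = step_integral n H Z t \<omega> - step_integral n G Z t \<omega>"
  by (simp add: step_integral_def inner_diff_left sum_subtractf del: sum.lessThan_Suc)

text \<open>On \<open>[0, T)\<close> one range of summation serves all times, and each summand is
  continuous in \<open>t\<close>.\<close>

lemma step_integral_continuous:
  assumes Z: "continuous_on {0..} (\<lambda>t. Z t \<omega>)"
  shows "continuous_on {0..} (\<lambda>t. step_integral n H Z t \<omega>)"
proof -
  have "continuous_on {0..<T} (\<lambda>t. step_integral n H Z t \<omega>)" for T
  proof -
    let ?N = "Suc (dindex n T)"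
    have "continuous_on {0..<T} (\<lambda>t. \<Sum>i<?N. H (dyadic n i) \<omega> \<bullet>
        (Z (min t (dyadic n (Suc i))) \<omega> - Z (min t (dyadic n i)) \<omega>))"
      by (intro continuous_intros continuous_on_compose2[OF Z]) auto
    then show ?thesis
      by (rule continuous_on_eq) (intro step_integral_extend[symmetric], auto intro: dindex_mono)
  qed
  then show ?thesis by (rule continuous_on_halfline)
qed

end

section \<open>Mean square limits of step integrals\<close>

context stochastic_basis
begin

text \<open>Only joint measurability is recorded; adaptedness enters through the step integrands
  that approximate a process. Times are restricted to \<open>{0..}\<close> because values at
  negative times are arbitrary.\<close>

definition path_measurable :: "(real \<Rightarrow> 'w \<Rightarrow> 'c::euclidean_space) \<Rightarrow> bool" where
  "path_measurable \<Theta> \<longleftrightarrow> (\<lambda>z. \<Theta> (fst z) (snd z)) \<in> borel_measurable (restrict_space borel {0..} \<Otimes>\<^sub>M M)"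

definition Q :: "real \<Rightarrow> (real \<times> 'w) measure" where
  "Q T = restrict_space lborel {0..T} \<Otimes>\<^sub>M M"

lemma finite_time: "finite_measure (restrict_space lborel {0..T::real})"
  by (rule finite_measureI) (auto simp: emeasure_restrict_space space_restrict_space emeasure_lborel_Icc_eq)

lemma pair_Q: "pair_sigma_finite (restrict_space lborel {0..T::real}) M"
proof -
  interpret T: finite_measure "restrict_space lborel {0..T::real}" by (rule finite_time)
  show ?thesis ..
qed

lemma finite_measure_Q: "finite_measure (Q T)"
  unfolding Q_def by (rule finite_measure_pair_measure[OF finite_measure_axioms finite_time])

lemma space_Q: "space (Q T) = {0..T} \<times> space M"
  by (simp add: Q_def space_pair_measure)

lemma measurable_Q:
  assumes "f \<in> measurable (restrict_space borel {0..} \<Otimes>\<^sub>M M) N" shows "f \<in> measurable (Q T) N"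
proof -
  have "(\<lambda>s. s) \<in> measurable (restrict_space lborel {0..T}) (restrict_space borel {0::real..})"
    by (rule measurable_restrict_space3) auto
  from measurable_compose[OF measurable_fst this]
  have "(\<lambda>z. (fst z, snd z)) \<in> measurable (Q T) (restrict_space borel {0..} \<Otimes>\<^sub>M M)"
    unfolding Q_def by (intro measurable_Pair) auto
  from measurable_compose[OF this assms] show ?thesis by simp
qed

lemma path_measurable_Q:
  "path_measurable \<Theta> \<Longrightarrow> (\<lambda>z. \<Theta> (fst z) (snd z)) \<in> borel_measurable (Q T)"
  unfolding path_measurable_def by (rule measurable_Q)

lemma nn_integral_Q:
  assumes "f \<in> borel_measurable (Q T)"
  shows "(\<integral>\<^sup>+z. f z \<partial>Q T) = (\<integral>\<^sup>+\<omega>. (\<integral>\<^sup>+s\<in>{0..T}. f (s, \<omega>) \<partial>lborel) \<partial>M)"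
proof -
  interpret pair_sigma_finite "restrict_space lborel {0..T}" M by (rule pair_Q)
  show ?thesis
    using nn_integral_snd[of f] assms unfolding Q_def
    by (simp add: nn_integral_restrict_space)
qed

lemma qnorm_Q:
  "path_measurable \<Theta> \<Longrightarrow> qnorm T \<Theta> = (\<integral>\<^sup>+z. ennreal ((norm (\<Theta> (fst z) (snd z)))\<^sup>2) \<partial>Q T)"
  using path_measurable_Q[of \<Theta> T] unfolding qnorm_def by (subst nn_integral_Q) auto

lemma path_measurable_diff [intro]:
  "path_measurable \<Theta> \<Longrightarrow> path_measurable \<Theta>' \<Longrightarrow> path_measurable (\<lambda>s \<omega>. \<Theta> s \<omega> - \<Theta>' s \<omega>)"
  unfolding path_measurable_def by simp

lemma path_measurable_scaleR [intro]:
  "path_measurable R \<Longrightarrow> path_measurable \<Theta> \<Longrightarrow> path_measurable (\<lambda>s \<omega>. R s \<omega> *\<^sub>R \<Theta> s \<omega>)"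
  unfolding path_measurable_def by simp

lemma path_measurable_compose:
  "path_measurable \<Theta> \<Longrightarrow> f \<in> borel_measurable borel \<Longrightarrow> path_measurable (\<lambda>s \<omega>. f (\<Theta> s \<omega>))"
  unfolding path_measurable_def by (rule measurable_compose)

lemma path_measurable_const [intro]: "path_measurable (\<lambda>s \<omega>. b)"
  unfolding path_measurable_def by simp

lemma path_measurable_LIMSEQ:
  fixes \<Theta> :: "nat \<Rightarrow> real \<Rightarrow> 'w \<Rightarrow> 'c::euclidean_space"
  assumes "\<And>n. path_measurable (\<Theta> n)"
    and "\<And>s \<omega>. 0 \<le> s \<Longrightarrow> \<omega> \<in> space M \<Longrightarrow> (\<lambda>n. \<Theta> n s \<omega>) \<longlonglongrightarrow> \<Theta>' s \<omega>"
  shows "path_measurable \<Theta>'"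
  unfolding path_measurable_def
  by (rule borel_measurable_LIMSEQ_metric[OF assms(1)[unfolded path_measurable_def]])
    (use assms(2) in \<open>auto simp: space_pair_measure space_restrict_space\<close>)

text \<open>\<open>dindex n\<close> takes countably many values, so the process is a countable case
  distinction between random variables.\<close>

lemma path_measurable_grid:
  assumes "\<And>i. G i \<in> borel_measurable M"
  shows "path_measurable (\<lambda>s. G (dindex n s))"
  unfolding path_measurable_def
proof (rule measurable_compose_countable[where f="\<lambda>i z. G i (snd z)"])
  show "(\<lambda>z. G i (snd z)) \<in> borel_measurable (restrict_space borel {0..} \<Otimes>\<^sub>M M)" for i
    using assms[of i] by measurable
  have "dindex n \<in> measurable (restrict_space borel {0..}) (count_space UNIV)"
    unfolding dindex_def[abs_def] by (intro measurable_restrict_space1) measurable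
  then show "(\<lambda>z. dindex n (fst z)) \<in> measurable (restrict_space borel {0..} \<Otimes>\<^sub>M M) (count_space UNIV)"
    by (rule measurable_compose[OF measurable_fst])
qed

lemma path_measurable_dfloor:
  assumes "\<And>s. 0 \<le> s \<Longrightarrow> X s \<in> borel_measurable M"
  shows "path_measurable (\<lambda>s. X (dfloor n s))"
  unfolding dfloor_def by (rule path_measurable_grid) (simp add: assms)

lemma path_measurable_cong:
  assumes "path_measurable \<Theta>" "\<And>s \<omega>. 0 \<le> s \<Longrightarrow> \<omega> \<in> space M \<Longrightarrow> \<Theta>' s \<omega> = \<Theta> s \<omega>"
  shows "path_measurable \<Theta>'"
  using assms(1) unfolding path_measurable_def
  by (subst measurable_cong[where g="\<lambda>z. \<Theta> (fst z) (snd z)"])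
    (auto simp: space_pair_measure space_restrict_space assms(2))

lemma path_measurable_stepwise: "stepwise n H \<Longrightarrow> path_measurable H"
  by (rule path_measurable_cong[OF path_measurable_dfloor[of H n]])
    (auto dest: stepwiseD(3) fun_cong[OF stepwiseD(1)])

lemma dfloor_tendsto_path:
  fixes x :: "real \<Rightarrow> 'c::topological_space"
  assumes "continuous_on {0..} x" "0 \<le> s"
  shows "(\<lambda>n. x (dfloor n s)) \<longlonglongrightarrow> x s"
  by (rule continuous_on_tendsto_compose[OF assms(1) dfloor_tendsto[OF assms(2)]]) (use assms(2) in auto)

text \<open>A continuous process is the pointwise limit of its values at
  \<open>dfloor n s\<close>.\<close>

lemma path_measurable_continuous:
  fixes X :: "real \<Rightarrow> 'w \<Rightarrow> 'c::euclidean_space"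
  assumes "\<And>s. 0 \<le> s \<Longrightarrow> X s \<in> borel_measurable M" "\<And>\<omega>. \<omega> \<in> space M \<Longrightarrow> continuous_on {0..} (\<lambda>s. X s \<omega>)"
  shows "path_measurable X"
  by (rule path_measurable_LIMSEQ[OF path_measurable_dfloor[OF assms(1)]])
    (auto intro: dfloor_tendsto_path assms(2))

section \<open>Mean square distances and almost sure limits\<close>

definition sqn :: "('w \<Rightarrow> real) \<Rightarrow> ennreal" where
  "sqn J = (\<integral>\<^sup>+\<omega>. ennreal ((J \<omega>)\<^sup>2) \<partial>M)"

lemma norm_diff_triangle_square:
  fixes x y z :: "'c::real_normed_vector"
  shows "ennreal ((norm (x - z))\<^sup>2) \<le> 2 * ennreal ((norm (x - y))\<^sup>2) + 2 * ennreal ((norm (y - z))\<^sup>2)"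
proof -
  have "(norm (x - z))\<^sup>2 \<le> (norm (x - y) + norm (y - z))\<^sup>2"
    using norm_triangle_ineq[of "x - y" "y - z"] by (intro power_mono) auto
  also have "\<dots> \<le> 2 * (norm (x - y))\<^sup>2 + 2 * (norm (y - z))\<^sup>2"
    using sum_squares_bound[of "norm (x - y)" "norm (y - z)"] by (simp add: power2_sum)
  finally have "ennreal ((norm (x - z))\<^sup>2) \<le> ennreal (2 * (norm (x - y))\<^sup>2 + 2 * (norm (y - z))\<^sup>2)"
    by (rule ennreal_leI)
  then show ?thesis by (simp add: ennreal_mult')
qed

text \<open>Squared distances obey the triangle inequality up to a factor \<open>2\<close>. This
  avoids square roots in \<open>ennreal\<close>, at the price of constants such as \<open>16\<close>
  that accumulate below.\<close>

lemma qnorm_triangle: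
  assumes "path_measurable \<Theta>1" "path_measurable \<Theta>2" "path_measurable \<Theta>3"
  shows "qnorm T (\<lambda>s \<omega>. \<Theta>1 s \<omega> - \<Theta>3 s \<omega>)
    \<le> 2 * qnorm T (\<lambda>s \<omega>. \<Theta>1 s \<omega> - \<Theta>2 s \<omega>) + 2 * qnorm T (\<lambda>s \<omega>. \<Theta>2 s \<omega> - \<Theta>3 s \<omega>)"
proof -
  note [measurable] = assms[THEN path_measurable_Q, of T]
  have "qnorm T (\<lambda>s \<omega>. \<Theta>1 s \<omega> - \<Theta>3 s \<omega>) \<le> (\<integral>\<^sup>+z. 2 * ennreal ((norm (\<Theta>1 (fst z) (snd z) - \<Theta>2 (fst z) (snd z)))\<^sup>2)
     + 2 * ennreal ((norm (\<Theta>2 (fst z) (snd z) - \<Theta>3 (fst z) (snd z)))\<^sup>2) \<partial>Q T)"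
    using assms by (subst qnorm_Q) (auto intro!: nn_integral_mono norm_diff_triangle_square)
  also have "\<dots> = 2 * qnorm T (\<lambda>s \<omega>. \<Theta>1 s \<omega> - \<Theta>2 s \<omega>) + 2 * qnorm T (\<lambda>s \<omega>. \<Theta>2 s \<omega> - \<Theta>3 s \<omega>)"
    using assms by (simp add: qnorm_Q path_measurable_diff nn_integral_add nn_integral_cmult)
  finally show ?thesis .
qed

lemma sqn_triangle:
  assumes [measurable]: "J1 \<in> borel_measurable M" "J2 \<in> borel_measurable M" "J3 \<in> borel_measurable M"
  shows "sqn (\<lambda>\<omega>. J1 \<omega> - J3 \<omega>) \<le> 2 * sqn (\<lambda>\<omega>. J1 \<omega> - J2 \<omega>) + 2 * sqn (\<lambda>\<omega>. J2 \<omega> - J3 \<omega>)"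
proof -
  have "sqn (\<lambda>\<omega>. J1 \<omega> - J3 \<omega>) \<le> (\<integral>\<^sup>+\<omega>. 2 * ennreal ((J1 \<omega> - J2 \<omega>)\<^sup>2) + 2 * ennreal ((J2 \<omega> - J3 \<omega>)\<^sup>2) \<partial>M)"
    unfolding sqn_def
    by (intro nn_integral_mono) (metis norm_diff_triangle_square power2_abs real_norm_def)
  also have "\<dots> = 2 * sqn (\<lambda>\<omega>. J1 \<omega> - J2 \<omega>) + 2 * sqn (\<lambda>\<omega>. J2 \<omega> - J3 \<omega>)"
    by (simp add: sqn_def nn_integral_add nn_integral_cmult)
  finally show ?thesis .
qed

lemma sqn_commute: "sqn (\<lambda>\<omega>. J \<omega> - G \<omega>) = sqn (\<lambda>\<omega>. G \<omega> - J \<omega>)"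
  by (simp add: sqn_def power2_commute)

lemma qnorm_commute: "qnorm T (\<lambda>s \<omega>. J s \<omega> - G s \<omega>) = qnorm T (\<lambda>s \<omega>. G s \<omega> - J s \<omega>)"
  by (simp add: qnorm_def norm_minus_commute)

text \<open>Fatou's lemma for the squared distances to \<open>G\<close>; it turns a Cauchy estimate
  into an estimate for the almost sure limit.\<close>

lemma sqn_Fatou:
  assumes [measurable]: "\<And>j. J j \<in> borel_measurable M" "G \<in> borel_measurable M"
    and lim: "AE \<omega> in M. (\<lambda>j. J j \<omega>) \<longlonglongrightarrow> J' \<omega>" and le: "\<And>j. j \<ge> k \<Longrightarrow> sqn (\<lambda>\<omega>. J j \<omega> - G \<omega>) \<le> B"
  shows "sqn (\<lambda>\<omega>. J' \<omega> - G \<omega>) \<le> B"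
proof -
  have "sqn (\<lambda>\<omega>. J' \<omega> - G \<omega>) = (\<integral>\<^sup>+\<omega>. liminf (\<lambda>j. ennreal ((J j \<omega> - G \<omega>)\<^sup>2)) \<partial>M)"
    unfolding sqn_def
  proof (rule nn_integral_cong_AE, use lim in eventually_elim)
    case (elim \<omega>)
    then have "(\<lambda>j. ennreal ((J j \<omega> - G \<omega>)\<^sup>2)) \<longlonglongrightarrow> ennreal ((J' \<omega> - G \<omega>)\<^sup>2)"
      by (intro tendsto_intros)
    from lim_imp_Liminf[OF _ this] show ?case by simp
  qed
  also have "\<dots> \<le> liminf (\<lambda>j. sqn (\<lambda>\<omega>. J j \<omega> - G \<omega>))"
    unfolding sqn_def by (rule nn_integral_liminf) measurable
  also have "\<dots> \<le> liminf (\<lambda>j. B)"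
    by (intro Liminf_mono eventually_sequentiallyI[of k] le)
  finally show ?thesis by (simp add: Liminf_const)
qed

text \<open>Here completeness enters: \<open>v\<close> differs from a limit of
  \<open>F t\<close>-measurable functions only on a null set, and every subset of that null set
  belongs to \<open>F t\<close>.\<close>

lemma borel_measurable_F_AE_limit:
  fixes u :: "nat \<Rightarrow> 'w \<Rightarrow> real"
  assumes t: "0 \<le> t" and u: "\<And>j. u j \<in> borel_measurable (F t)" and lim: "AE \<omega> in M. (\<lambda>j. u j \<omega>) \<longlonglongrightarrow> v \<omega>"
  shows "v \<in> borel_measurable (F t)"
proof -
  obtain N where N: "N \<in> null_sets M" "{\<omega>\<in>space M. \<not> (\<lambda>j. u j \<omega>) \<longlonglongrightarrow> v \<omega>} \<subseteq> N"
    using lim by (auto simp: eventually_ae_filter)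
  have null: "A \<in> sets (F t)" if "A \<subseteq> N" for A
  proof -
    have "A \<in> null_sets M" using complete2[of A N] N that null_sets_subset by blast
    then show ?thesis using null_sets_F[OF t] by blast
  qed
  have NF: "N \<in> sets (F t)" by (rule null) simp
  have "(\<lambda>\<omega>. lim (\<lambda>j. if \<omega> \<in> N then 0 else u j \<omega>)) \<in> borel_measurable (F t)"
    by (intro borel_measurable_lim_metric measurable_If_set u) (use NF in auto)
  then have 1: "(\<lambda>\<omega>. if \<omega> \<in> N then 0 else v \<omega>) \<in> borel_measurable (F t)"
    by (rule measurable_cong[THEN iffD1, rotated]) (use N t in \<open>auto intro!: limI\<close>)
  show ?thesis
  proof (rule measurableI)
    fix A :: "real set" assume A: "A \<in> sets borel"
    have "v -` A \<inter> space (F t) = ((\<lambda>\<omega>. if \<omega> \<in> N then 0 else v \<omega>) -` A \<inter> space (F t) - N) \<union> (v -` A \<inter> space (F t) \<inter> N)"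
      by (auto split: if_splits)
    also have "\<dots> \<in> sets (F t)"
      by (intro sets.Un sets.Diff measurable_sets[OF 1 A] NF null) auto
    finally show "v -` A \<inter> space (F t) \<in> sets (F t)" .
  qed simp
qed

end

section \<open>Dominated convergence and time integrals of processes\<close>

context stochastic_basis
begin

lemma qnorm_tendsto_0:
  fixes \<Theta> :: "nat \<Rightarrow> real \<Rightarrow> 'w \<Rightarrow> 'c::euclidean_space"
  assumes m: "\<And>n. path_measurable (\<Theta> n)" "path_measurable \<Theta>'"
    and lim: "AE z in Q T. (\<lambda>n. \<Theta> n (fst z) (snd z)) \<longlonglongrightarrow> \<Theta>' (fst z) (snd z)"
    and bound: "\<And>n. AE z in Q T. (norm (\<Theta>' (fst z) (snd z) - \<Theta> n (fst z) (snd z)))\<^sup>2 \<le> w z"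
    and w: "(\<lambda>z. w z) \<in> borel_measurable (Q T)" "(\<integral>\<^sup>+z. ennreal (w z) \<partial>Q T) < \<infinity>"
  shows "(\<lambda>n. qnorm T (\<lambda>s \<omega>. \<Theta>' s \<omega> - \<Theta> n s \<omega>)) \<longlonglongrightarrow> 0"
proof -
  note [measurable] = path_measurable_Q[OF m(1), where T=T] path_measurable_Q[OF m(2), where T=T] w(1)
  have "(\<lambda>n. \<integral>\<^sup>+z. ennreal ((norm (\<Theta>' (fst z) (snd z) - \<Theta> n (fst z) (snd z)))\<^sup>2) \<partial>Q T) \<longlonglongrightarrow> (\<integral>\<^sup>+z. 0 \<partial>Q T)"
  proof (rule nn_integral_dominated_convergence[where w="\<lambda>z. ennreal (w z)"])
    show "AE z in Q T. ennreal ((norm (\<Theta>' (fst z) (snd z) - \<Theta> n (fst z) (snd z)))\<^sup>2) \<le> ennreal (w z)" for n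
      using bound[of n] by eventually_elim (rule ennreal_leI)
    show "AE z in Q T. (\<lambda>n. ennreal ((norm (\<Theta>' (fst z) (snd z) - \<Theta> n (fst z) (snd z)))\<^sup>2)) \<longlonglongrightarrow> 0"
      using lim
    proof eventually_elim
      case (elim z)
      from tendsto_power[OF tendsto_norm[OF tendsto_diff[OF tendsto_const[of "\<Theta>' (fst z) (snd z)"] elim]], of 2]
      have "(\<lambda>n. (norm (\<Theta>' (fst z) (snd z) - \<Theta> n (fst z) (snd z)))\<^sup>2) \<longlonglongrightarrow> 0" by simp
      then show ?case by (subst ennreal_0[symmetric], subst tendsto_ennreal_iff) auto
    qed
  qed (use w(2) in auto)
  then show ?thesis using m by (simp add: qnorm_Q path_measurable_diff)
qed

lemma nn_integral_Q_tendsto_0: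
  fixes R :: "nat \<Rightarrow> real \<Rightarrow> 'w \<Rightarrow> real"
  assumes m: "\<And>n. path_measurable (R n)" "path_measurable R'"
    and lim: "AE z in Q T. (\<lambda>n. R n (fst z) (snd z)) \<longlonglongrightarrow> R' (fst z) (snd z)"
    and bound: "\<And>n. AE z in Q T. \<bar>R' (fst z) (snd z) - R n (fst z) (snd z)\<bar> \<le> w z"
    and w: "(\<lambda>z. w z) \<in> borel_measurable (Q T)" "(\<integral>\<^sup>+z. ennreal (w z) \<partial>Q T) < \<infinity>"
  shows "(\<lambda>n. \<integral>\<^sup>+z. ennreal \<bar>R' (fst z) (snd z) - R n (fst z) (snd z)\<bar> \<partial>Q T) \<longlonglongrightarrow> 0"
proof -
  note [measurable] = path_measurable_Q[OF m(1), where T=T] path_measurable_Q[OF m(2), where T=T] w(1)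
  have "(\<lambda>n. \<integral>\<^sup>+z. ennreal \<bar>R' (fst z) (snd z) - R n (fst z) (snd z)\<bar> \<partial>Q T) \<longlonglongrightarrow> (\<integral>\<^sup>+z. 0 \<partial>Q T)"
  proof (rule nn_integral_dominated_convergence[where w="\<lambda>z. ennreal (w z)"])
    show "AE z in Q T. ennreal \<bar>R' (fst z) (snd z) - R n (fst z) (snd z)\<bar> \<le> ennreal (w z)" for n
      using bound[of n] by eventually_elim (rule ennreal_leI)
    show "AE z in Q T. (\<lambda>n. ennreal \<bar>R' (fst z) (snd z) - R n (fst z) (snd z)\<bar>) \<longlonglongrightarrow> 0"
      using lim
    proof eventually_elim
      case (elim z)
      from tendsto_rabs[OF tendsto_diff[OF tendsto_const[of "R' (fst z) (snd z)"] elim]]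
      have "(\<lambda>n. \<bar>R' (fst z) (snd z) - R n (fst z) (snd z)\<bar>) \<longlonglongrightarrow> 0" by simp
      then show ?case by (subst ennreal_0[symmetric], subst tendsto_ennreal_iff) auto
    qed
  qed (use w(2) in auto)
  then show ?thesis by simp
qed

text \<open>The integral is taken over the restricted time measure, which is a factor of
  \<open>Q T\<close>, so that Fubini's theorem applies directly.\<close>

definition tint :: "real \<Rightarrow> (real \<Rightarrow> 'w \<Rightarrow> real) \<Rightarrow> 'w \<Rightarrow> real" where
  "tint T R \<omega> = (\<integral>s. R s \<omega> \<partial>restrict_space lborel {0..T})"

lemma tint_measurable:
  assumes "path_measurable R" shows "tint T R \<in> borel_measurable M"
proof -
  interpret pair_sigma_finite M "restrict_space lborel {0..T}"
    using pair_Q[of T] by (simp add: pair_sigma_finite_def)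
  have "(\<lambda>z. R (snd z) (fst z)) \<in> borel_measurable (M \<Otimes>\<^sub>M restrict_space lborel {0..T})"
    using measurable_compose[OF measurable_pair_swap' path_measurable_Q[OF assms, of T, unfolded Q_def]]
    by (simp add: case_prod_unfold)
  then have "(\<lambda>\<omega>. \<integral>s. R s \<omega> \<partial>restrict_space lborel {0..T}) \<in> borel_measurable M"
    by (intro M2.borel_measurable_lebesgue_integral) (simp add: case_prod_unfold)
  then show ?thesis by (simp add: tint_def[abs_def])
qed

lemma AE_path_integrable:
  fixes R :: "real \<Rightarrow> 'w \<Rightarrow> 'c::euclidean_space"
  assumes R: "path_measurable R" and fin: "(\<integral>\<^sup>+z. ennreal (norm (R (fst z) (snd z))) \<partial>Q T) < \<infinity>"
  shows "AE \<omega> in M. integrable (restrict_space lborel {0..T}) (\<lambda>s. R s \<omega>)"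
proof -
  note m[measurable] = path_measurable_Q[OF R, of T]
  have "(\<integral>\<^sup>+\<omega>. (\<integral>\<^sup>+s\<in>{0..T}. ennreal (norm (R s \<omega>)) \<partial>lborel) \<partial>M) < \<infinity>"
    using fin by (subst (asm) nn_integral_Q) auto
  moreover have "(\<lambda>\<omega>. \<integral>\<^sup>+s\<in>{0..T}. ennreal (norm (R s \<omega>)) \<partial>lborel) \<in> borel_measurable M"
  proof -
    interpret pair_sigma_finite M "restrict_space lborel {0..T}"
      using pair_Q[of T] by (simp add: pair_sigma_finite_def)
    have "(\<lambda>z. ennreal (norm (R (snd z) (fst z)))) \<in> borel_measurable (M \<Otimes>\<^sub>M restrict_space lborel {0..T})"
      using measurable_compose[OF measurable_pair_swap' m[unfolded Q_def]]
      by (simp add: case_prod_unfold)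
    from M2.borel_measurable_nn_integral_fst[OF this] show ?thesis
      by (simp add: nn_integral_restrict_space)
  qed
  ultimately have "AE \<omega> in M. (\<integral>\<^sup>+s\<in>{0..T}. ennreal (norm (R s \<omega>)) \<partial>lborel) \<noteq> \<infinity>"
    by (intro nn_integral_PInf_AE) auto
  with AE_space show ?thesis
  proof eventually_elim
    case (elim \<omega>)
    have "(\<lambda>s. R s \<omega>) \<in> borel_measurable (restrict_space lborel {0..T})"
      using measurable_compose[OF measurable_Pair2'[OF elim(1)] m[unfolded Q_def]] by simp
    then show ?case
      using elim(2) by (intro integrableI_bounded) (auto simp: nn_integral_restrict_space less_top)
  qed
qed

text \<open>The two finiteness conditions make almost all paths integrable; without this the
  difference of two Bochner integrals need not be the integral of the difference.\<close>

lemma tint_diff_L1: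
  assumes R: "path_measurable R" "path_measurable R'"
    and fin: "(\<integral>\<^sup>+z. ennreal \<bar>R (fst z) (snd z)\<bar> \<partial>Q T) < \<infinity>" "(\<integral>\<^sup>+z. ennreal \<bar>R' (fst z) (snd z)\<bar> \<partial>Q T) < \<infinity>"
  shows "(\<integral>\<^sup>+\<omega>. ennreal \<bar>tint T R \<omega> - tint T R' \<omega>\<bar> \<partial>M) \<le> (\<integral>\<^sup>+z. ennreal \<bar>R (fst z) (snd z) - R' (fst z) (snd z)\<bar> \<partial>Q T)"
proof -
  note m[measurable] = path_measurable_Q[OF R(1), of T] path_measurable_Q[OF R(2), of T]
  have "(\<integral>\<^sup>+\<omega>. ennreal \<bar>tint T R \<omega> - tint T R' \<omega>\<bar> \<partial>M) \<le>
      (\<integral>\<^sup>+\<omega>. (\<integral>\<^sup>+s\<in>{0..T}. ennreal \<bar>R s \<omega> - R' s \<omega>\<bar> \<partial>lborel) \<partial>M)"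
  proof (rule nn_integral_mono_AE, use AE_path_integrable[OF R(1) fin(1)[folded real_norm_def]] AE_path_integrable[OF R(2) fin(2)[folded real_norm_def]] in eventually_elim)
    case (elim \<omega>)
    have "tint T R \<omega> - tint T R' \<omega> = (\<integral>s. R s \<omega> - R' s \<omega> \<partial>restrict_space lborel {0..T})"
      using elim by (simp add: tint_def)
    also have "ennreal (norm \<dots>) \<le> (\<integral>\<^sup>+s. ennreal (norm (R s \<omega> - R' s \<omega>)) \<partial>restrict_space lborel {0..T})"
      using elim by (intro integral_norm_bound_ennreal) simp
    finally show ?case by (simp add: nn_integral_restrict_space)
  qed
  also have "\<dots> = (\<integral>\<^sup>+z. ennreal \<bar>R (fst z) (snd z) - R' (fst z) (snd z)\<bar> \<partial>Q T)"
    by (subst nn_integral_Q) auto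
  finally show ?thesis .
qed

end

section \<open>Mean square stochastic integrals, their isometry and closedness\<close>

context brownian_basis
begin

text \<open>\<open>l2int T \<Theta> J\<close> says that \<open>J\<close> is a version of the scalar \<open>\<integral>\<^sub>0\<^sup>T \<Theta> \<bullet> dW\<close>.\<close>

definition l2int :: "real \<Rightarrow> (real \<Rightarrow> 'w \<Rightarrow> 'a) \<Rightarrow> ('w \<Rightarrow> real) \<Rightarrow> bool" where
  "l2int T \<Theta> J \<longleftrightarrow> path_measurable \<Theta> \<and> J \<in> borel_measurable M \<and>
     (\<forall>\<epsilon>>0. \<exists>n H. stepwise n H \<and> qnorm T (\<lambda>s \<omega>. \<Theta> s \<omega> - H s \<omega>) \<le> ennreal \<epsilon> \<and>
        sqn (\<lambda>\<omega>. J \<omega> - step_integral n H W T \<omega>) \<le> ennreal \<epsilon>)"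

lemma l2intD:
  assumes "l2int T \<Theta> J" "0 < \<epsilon>"
  obtains n H where "stepwise n H" "qnorm T (\<lambda>s \<omega>. \<Theta> s \<omega> - H s \<omega>) \<le> ennreal \<epsilon>"
    "sqn (\<lambda>\<omega>. J \<omega> - step_integral n H W T \<omega>) \<le> ennreal \<epsilon>"
  using assms unfolding l2int_def by blast

lemma l2int_measurable: "l2int T \<Theta> J \<Longrightarrow> path_measurable \<Theta>" "l2int T \<Theta> J \<Longrightarrow> J \<in> borel_measurable M"
  unfolding l2int_def by blast+

lemma l2int_stepwise:
  assumes "stepwise n H" "0 \<le> T" shows "l2int T H (step_integral n H W T)"
  unfolding l2int_def using step_integral_L2(2)[OF assms] path_measurable_stepwise[OF assms(1)] assms
  by (auto intro!: exI[of _ n] exI[of _ H] simp: qnorm_def sqn_def)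

text \<open>Both integrands live on the finer of the two grids, and there the difference of the
  integrals is the integral of the difference.\<close>

lemma step_integral_dist:
  assumes H: "stepwise n H" and G: "stepwise k G" and T: "0 \<le> T"
  shows "sqn (\<lambda>\<omega>. step_integral n H W T \<omega> - step_integral k G W T \<omega>) = qnorm T (\<lambda>s \<omega>. H s \<omega> - G s \<omega>)"
proof -
  let ?m = "max n k"
  have m: "stepwise ?m H" "stepwise ?m G" using H G by (auto intro: stepwise_refine)
  have "step_integral ?m H W T \<omega> = step_integral n H W T \<omega>" for \<omega>
    by (rule step_integral_refine, erule stepwiseD(1)[OF H]) simp
  moreover have "step_integral ?m G W T \<omega> = step_integral k G W T \<omega>" for \<omega>
    by (rule step_integral_refine, erule stepwiseD(1)[OF G]) simp
  ultimately have "sqn (\<lambda>\<omega>. step_integral n H W T \<omega> - step_integral k G W T \<omega>)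
      = sqn (step_integral ?m (\<lambda>s \<omega>. H s \<omega> - G s \<omega>) W T)"
    by (simp add: sqn_def step_integral_diff[OF m])
  also have "\<dots> = qnorm T (\<lambda>s \<omega>. H s \<omega> - G s \<omega>)"
    unfolding sqn_def by (rule step_integral_L2(4)[OF stepwise_diff[OF m] T])
  finally show ?thesis .
qed

text \<open>The isometry passes from step integrands to limits, up to a constant. Each side is
  compared with a step approximation; the triangle inequality with factor \<open>2\<close> is
  applied four times, which produces \<open>16 = 2 ^ 4\<close>.\<close>

lemma l2int_dist:
  assumes J: "l2int T \<Theta> J" and J': "l2int T \<Theta>' J'" and T: "0 \<le> T"
  shows "sqn (\<lambda>\<omega>. J \<omega> - J' \<omega>) \<le> 16 * qnorm T (\<lambda>s \<omega>. \<Theta> s \<omega> - \<Theta>' s \<omega>)"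
proof (rule ennreal_le_epsilon)
  fix e :: real assume e: "0 < e"
  \<comment> \<open>All approximation errors together amount to \<open>30 * \<epsilon>\<close>,
    which is below \<open>e\<close>.\<close>
  define \<epsilon> where "\<epsilon> = e / 40"
  have \<epsilon>: "0 < \<epsilon>" using e by (simp add: \<epsilon>_def)
  obtain n H where H: "stepwise n H" "qnorm T (\<lambda>s \<omega>. \<Theta> s \<omega> - H s \<omega>) \<le> ennreal \<epsilon>"
    "sqn (\<lambda>\<omega>. J \<omega> - step_integral n H W T \<omega>) \<le> ennreal \<epsilon>" using l2intD[OF J \<epsilon>] .
  obtain n' H' where H': "stepwise n' H'" "qnorm T (\<lambda>s \<omega>. \<Theta>' s \<omega> - H' s \<omega>) \<le> ennreal \<epsilon>"
    "sqn (\<lambda>\<omega>. J' \<omega> - step_integral n' H' W T \<omega>) \<le> ennreal \<epsilon>" using l2intD[OF J' \<epsilon>] .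
  note m = l2int_measurable[OF J] l2int_measurable[OF J'] path_measurable_stepwise[OF H(1)]
    path_measurable_stepwise[OF H'(1)] step_integral_L2(2)[OF H(1) T] step_integral_L2(2)[OF H'(1) T]
  let ?q = "qnorm T (\<lambda>s \<omega>. \<Theta> s \<omega> - \<Theta>' s \<omega>)"
  have "qnorm T (\<lambda>s \<omega>. H s \<omega> - H' s \<omega>) \<le> 2 * qnorm T (\<lambda>s \<omega>. H s \<omega> - \<Theta> s \<omega>) + 2 * qnorm T (\<lambda>s \<omega>. \<Theta> s \<omega> - H' s \<omega>)"
    by (intro qnorm_triangle m)
  also have "\<dots> \<le> 2 * qnorm T (\<lambda>s \<omega>. \<Theta> s \<omega> - H s \<omega>) + 2 * (2 * ?q + 2 * qnorm T (\<lambda>s \<omega>. \<Theta>' s \<omega> - H' s \<omega>))"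
    by (subst qnorm_commute) (intro add_left_mono mult_left_mono qnorm_triangle m, simp)
  also have "\<dots> \<le> 2 * ennreal \<epsilon> + 2 * (2 * ?q + 2 * ennreal \<epsilon>)"
    by (intro add_mono mult_left_mono H H') auto
  finally have q: "qnorm T (\<lambda>s \<omega>. H s \<omega> - H' s \<omega>) \<le> 2 * ennreal \<epsilon> + 2 * (2 * ?q + 2 * ennreal \<epsilon>)" .
  have "sqn (\<lambda>\<omega>. J \<omega> - J' \<omega>) \<le> 2 * sqn (\<lambda>\<omega>. J \<omega> - step_integral n H W T \<omega>) + 2 * sqn (\<lambda>\<omega>. step_integral n H W T \<omega> - J' \<omega>)"
    by (intro sqn_triangle m)
  also have "\<dots> \<le> 2 * sqn (\<lambda>\<omega>. J \<omega> - step_integral n H W T \<omega>)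
    + 2 * (2 * sqn (\<lambda>\<omega>. step_integral n H W T \<omega> - step_integral n' H' W T \<omega>) + 2 * sqn (\<lambda>\<omega>. step_integral n' H' W T \<omega> - J' \<omega>))"
    by (intro add_left_mono mult_left_mono sqn_triangle m) simp
  also have "\<dots> \<le> 2 * ennreal \<epsilon> + 2 * (2 * (2 * ennreal \<epsilon> + 2 * (2 * ?q + 2 * ennreal \<epsilon>)) + 2 * ennreal \<epsilon>)"
    unfolding step_integral_dist[OF H(1) H'(1) T] using H'(3)[unfolded sqn_commute[of J']]
    by (intro add_mono mult_left_mono H q) auto
  also have "\<dots> = 16 * ?q + 30 * ennreal \<epsilon>"
  proof -
    have "2 * ennreal \<epsilon> + 4 * ennreal \<epsilon> + 8 * ennreal \<epsilon> + 16 * ennreal \<epsilon> = 30 * ennreal \<epsilon>"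
      by (simp only: distrib_right[symmetric]) simp
    from this[symmetric] show ?thesis
      by (simp only: distrib_left mult.assoc[symmetric] numeral_times_numeral num.simps mult_num_simps add_ac)
  qed
  also have "30 * ennreal \<epsilon> = ennreal (30 * \<epsilon>)" using \<epsilon> by (simp add: ennreal_mult)
  also have "16 * ?q + ennreal (30 * \<epsilon>) \<le> 16 * ?q + ennreal e"
    by (intro add_left_mono ennreal_leI) (use e in \<open>simp add: \<epsilon>_def\<close>)
  finally show "sqn (\<lambda>\<omega>. J \<omega> - J' \<omega>) \<le> 16 * ?q + ennreal e" .
qed

lemma l2int_sequence:
  assumes "l2int T \<Theta> J" and T: "0 \<le> T"
  shows "\<exists>n H. \<forall>k. stepwise (n k) (H k) \<and> qnorm T (\<lambda>s \<omega>. \<Theta> s \<omega> - H k s \<omega>) \<le> ennreal (1 / Suc k) \<and>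
    sqn (\<lambda>\<omega>. J \<omega> - step_integral (n k) (H k) W T \<omega>) \<le> ennreal (1 / Suc k)"
proof -
  have "\<forall>k. \<exists>n H. stepwise n H \<and> qnorm T (\<lambda>s \<omega>. \<Theta> s \<omega> - H s \<omega>) \<le> ennreal (1 / Suc k) \<and>
        sqn (\<lambda>\<omega>. J \<omega> - step_integral n H W T \<omega>) \<le> ennreal (1 / Suc k)"
    using assms unfolding l2int_def by simp
  from choice[OF this] obtain n where "\<forall>k. \<exists>H. stepwise (n k) H \<and> qnorm T (\<lambda>s \<omega>. \<Theta> s \<omega> - H s \<omega>) \<le> ennreal (1 / Suc k) \<and>
        sqn (\<lambda>\<omega>. J \<omega> - step_integral (n k) H W T \<omega>) \<le> ennreal (1 / Suc k)" ..
  from choice[OF this] obtain H where "\<forall>k. stepwise (n k) (H k) \<and> qnorm T (\<lambda>s \<omega>. \<Theta> s \<omega> - H k s \<omega>) \<le> ennreal (1 / Suc k) \<and>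
        sqn (\<lambda>\<omega>. J \<omega> - step_integral (n k) (H k) W T \<omega>) \<le> ennreal (1 / Suc k)" ..
  then show ?thesis by blast
qed

lemma integrable_of_sqn:
  assumes [measurable]: "J \<in> borel_measurable M" and "sqn J < \<infinity>"
  shows "integrable M (\<lambda>\<omega>. (J \<omega>)\<^sup>2)" "integrable M J"
proof -
  show *: "integrable M (\<lambda>\<omega>. (J \<omega>)\<^sup>2)"
    by (rule integrableI_bounded) (use assms in \<open>auto simp: sqn_def\<close>)
  show "integrable M J" by (rule square_integrable_imp_integrable[OF _ *]) simp
qed

text \<open>Cauchy-Schwarz in the form \<open>\<bar>x\<bar> \<le> (x\<^sup>2 / e + e) / 2\<close>,
  integrated against a probability measure.\<close>

lemma nn_integral_abs_le_sqn:
  assumes [measurable]: "J \<in> borel_measurable M" and "sqn J \<le> ennreal (e\<^sup>2)" "0 < e"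
  shows "(\<integral>\<^sup>+\<omega>. ennreal \<bar>J \<omega>\<bar> \<partial>M) \<le> ennreal e"
proof -
  have "\<bar>x\<bar> \<le> (x\<^sup>2 / e + e) / 2" for x :: real
  proof -
    have "0 \<le> (\<bar>x\<bar> - e)\<^sup>2 / e" using assms by simp
    also have "(\<bar>x\<bar> - e)\<^sup>2 / e = x\<^sup>2 / e + e - 2 * \<bar>x\<bar>"
      using assms by (simp add: power2_diff field_simps power2_eq_square)
    finally show ?thesis by simp
  qed
  then have "(\<integral>\<^sup>+\<omega>. ennreal \<bar>J \<omega>\<bar> \<partial>M) \<le> (\<integral>\<^sup>+\<omega>. ennreal (1 / (2 * e)) * ennreal ((J \<omega>)\<^sup>2) + ennreal (e / 2) \<partial>M)"
    using assms by (intro nn_integral_mono)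
      (simp add: ennreal_mult'[symmetric] ennreal_plus[symmetric] field_simps del: ennreal_plus)
  also have "\<dots> = ennreal (1 / (2 * e)) * sqn J + ennreal (e / 2)"
    by (simp add: nn_integral_add nn_integral_cmult sqn_def emeasure_space_1)
  also have "\<dots> \<le> ennreal (1 / (2 * e)) * ennreal (e\<^sup>2) + ennreal (e / 2)"
    by (intro add_right_mono mult_left_mono assms) simp
  also have "\<dots> = ennreal e"
    using assms by (simp add: ennreal_mult'[symmetric] ennreal_plus[symmetric] power2_eq_square del: ennreal_plus)
  finally show ?thesis .
qed

lemma l2int_sqn_finite:
  assumes J: "l2int T \<Theta> J" and T: "0 \<le> T" shows "sqn J < \<infinity>"
proof -
  obtain n H where H: "stepwise n H" "qnorm T (\<lambda>s \<omega>. \<Theta> s \<omega> - H s \<omega>) \<le> ennreal 1"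
    "sqn (\<lambda>\<omega>. J \<omega> - step_integral n H W T \<omega>) \<le> ennreal 1"
    using l2intD[OF J zero_less_one] .
  have "sqn (\<lambda>\<omega>. J \<omega> - 0) \<le> 2 * sqn (\<lambda>\<omega>. J \<omega> - step_integral n H W T \<omega>) + 2 * sqn (\<lambda>\<omega>. step_integral n H W T \<omega> - 0)"
    by (intro sqn_triangle l2int_measurable[OF J] step_integral_L2(2)[OF H(1) T]) simp
  also have "sqn (\<lambda>\<omega>. step_integral n H W T \<omega> - 0) = qnorm T H"
    using step_integral_L2(4)[OF H(1) T] by (simp add: sqn_def)
  also have "2 * sqn (\<lambda>\<omega>. J \<omega> - step_integral n H W T \<omega>) + 2 * qnorm T H < \<infinity>"
  proof -
    obtain c where c: "qnorm T H = ennreal c" using qnorm_stepwise[OF H(1) T] by blast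
    have "2 * sqn (\<lambda>\<omega>. J \<omega> - step_integral n H W T \<omega>) + 2 * qnorm T H \<le> ennreal 2 * ennreal 1 + ennreal 2 * ennreal c"
      unfolding c using H(3) by (intro add_mono mult_mono) auto
    also have "\<dots> < \<infinity>" by (simp only: ennreal_mult'[symmetric, of 2]) simp
    finally show ?thesis .
  qed
  finally show ?thesis by simp
qed

lemma l2int_mean:
  assumes J: "l2int T \<Theta> J" and T: "0 \<le> T" shows "integrable M J" "(\<integral>\<omega>. J \<omega> \<partial>M) = 0"
proof -
  show int: "integrable M J"
    using integrable_of_sqn[OF l2int_measurable(2)[OF J] l2int_sqn_finite[OF J T]] by blast
  have "\<bar>\<integral>\<omega>. J \<omega> \<partial>M\<bar> \<le> e" if e: "0 < e" for e
  proof -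
    obtain n H where H: "stepwise n H" "qnorm T (\<lambda>s \<omega>. \<Theta> s \<omega> - H s \<omega>) \<le> ennreal (e\<^sup>2)"
      "sqn (\<lambda>\<omega>. J \<omega> - step_integral n H W T \<omega>) \<le> ennreal (e\<^sup>2)"
      using l2intD[OF J zero_less_power[OF e]] .
    note S = step_integral_L2[OF H(1) T]
    have iS: "integrable M (step_integral n H W T)"
      using S(2,3) by (rule square_integrable_imp_integrable)
    have "(\<integral>\<omega>. J \<omega> \<partial>M) = (\<integral>\<omega>. J \<omega> - step_integral n H W T \<omega> \<partial>M)"
      using int iS S(5) by simp
    also have "ennreal (norm \<dots>) \<le> (\<integral>\<^sup>+\<omega>. ennreal (norm (J \<omega> - step_integral n H W T \<omega>)) \<partial>M)"
      using int iS by (intro integral_norm_bound_ennreal) simp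
    also have "\<dots> \<le> ennreal e"
      using nn_integral_abs_le_sqn[OF _ H(3) e] l2int_measurable[OF J] S(2) by simp
    finally show ?thesis using e by simp
  qed
  then have "\<bar>\<integral>\<omega>. J \<omega> \<partial>M\<bar> \<le> 0" by (rule field_le_epsilon) simp
  then show "(\<integral>\<omega>. J \<omega> \<partial>M) = 0" by simp
qed

text \<open>The values \<open>J'\<close> approach \<open>J\<close> only in mean of first order.
  Since their integrands converge, \<open>l2int_dist\<close> makes them a Cauchy sequence in mean
  square; a subsequence converges to \<open>J\<close> almost surely, and Fatou's lemma shows that
  \<open>J\<close> is the mean square limit as well.\<close>

lemma l2int_closure:
  assumes \<Theta>: "path_measurable \<Theta>" and J: "J \<in> borel_measurable M" and T: "0 \<le> T"
    and approx: "\<And>\<epsilon>. 0 < \<epsilon> \<Longrightarrow> \<exists>\<Theta>' J'. l2int T \<Theta>' J' \<and> qnorm T (\<lambda>s \<omega>. \<Theta> s \<omega> - \<Theta>' s \<omega>) \<le> ennreal \<epsilon> \<and>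
        (\<integral>\<^sup>+\<omega>. ennreal \<bar>J \<omega> - J' \<omega>\<bar> \<partial>M) \<le> ennreal \<epsilon>"
  shows "l2int T \<Theta> J"
proof -
  have "\<forall>k. \<exists>\<Theta>' J'. l2int T \<Theta>' J' \<and> qnorm T (\<lambda>s \<omega>. \<Theta> s \<omega> - \<Theta>' s \<omega>) \<le> ennreal (1 / Suc k) \<and>
        (\<integral>\<^sup>+\<omega>. ennreal \<bar>J \<omega> - J' \<omega>\<bar> \<partial>M) \<le> ennreal (1 / Suc k)"
    by (intro allI approx) simp
  from choice[OF this] obtain \<Theta>' where "\<forall>k. \<exists>J'. l2int T (\<Theta>' k) J' \<and> qnorm T (\<lambda>s \<omega>. \<Theta> s \<omega> - \<Theta>' k s \<omega>) \<le> ennreal (1 / Suc k) \<and>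
        (\<integral>\<^sup>+\<omega>. ennreal \<bar>J \<omega> - J' \<omega>\<bar> \<partial>M) \<le> ennreal (1 / Suc k)" ..
  from choice[OF this] obtain J' where l: "\<And>k. l2int T (\<Theta>' k) (J' k)"
    and q: "\<And>k. qnorm T (\<lambda>s \<omega>. \<Theta> s \<omega> - \<Theta>' k s \<omega>) \<le> ennreal (1 / Suc k)"
    and L1: "\<And>k. (\<integral>\<^sup>+\<omega>. ennreal \<bar>J \<omega> - J' k \<omega>\<bar> \<partial>M) \<le> ennreal (1 / Suc k)" by blast
  note m = l2int_measurable[OF l]
  let ?u = "\<lambda>k \<omega>. J \<omega> - J' k \<omega>"
  have iu: "integrable M (?u k)" for k
    by (rule integrableI_bounded) (use J m(2)[of k] L1[of k] in \<open>auto simp: le_less_trans[OF _ ennreal_less_top]\<close>)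
  have "(\<lambda>k. \<integral>\<omega>. norm (?u k \<omega>) \<partial>M) \<longlonglongrightarrow> 0"
  proof (rule tendsto_sandwich[of "\<lambda>_. 0" _ _ "\<lambda>k. 1 / Suc k"])
    have "(\<integral>\<omega>. norm (?u k \<omega>) \<partial>M) \<le> 1 / Suc k" for k
    proof -
      have "ennreal (\<integral>\<omega>. norm (?u k \<omega>) \<partial>M) = (\<integral>\<^sup>+\<omega>. ennreal \<bar>?u k \<omega>\<bar> \<partial>M)"
        using iu[of k] by (subst nn_integral_eq_integral) auto
      also have "\<dots> \<le> ennreal (1 / Suc k)" by (rule L1)
      finally show ?thesis by (subst (asm) ennreal_le_iff) auto
    qed
    then show "\<forall>\<^sub>F k in sequentially. (\<integral>\<omega>. norm (?u k \<omega>) \<partial>M) \<le> 1 / Suc k" by simp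
    show "(\<lambda>k. 1 / real (Suc k)) \<longlonglongrightarrow> 0" using LIMSEQ_inverse_real_of_nat by (simp add: inverse_eq_divide)
  qed auto
  from tendsto_L1_AE_subseq[OF iu this] obtain r where r: "strict_mono r"
    and ae: "AE \<omega> in M. (\<lambda>k. ?u (r k) \<omega>) \<longlonglongrightarrow> 0" by blast
  have lim: "AE \<omega> in M. (\<lambda>k. J' (r k) \<omega>) \<longlonglongrightarrow> J \<omega>"
    using ae
  proof eventually_elim
    case (elim \<omega>)
    from tendsto_diff[OF tendsto_const[of "J \<omega>"] elim] show ?case by simp
  qed
  \<comment> \<open>\<open>64 = 16 * (2 + 2)\<close>: the constant of \<open>l2int_dist\<close>
    times the two distances from \<open>\<Theta>\<close>, each weighted with
    \<open>2\<close>.\<close>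
  have sq: "sqn (\<lambda>\<omega>. J \<omega> - J' k \<omega>) \<le> ennreal (64 / Suc k)" for k
  proof (rule sqn_Fatou[where J="\<lambda>j. J' (r j)" and k=k, OF m(2) m(2) lim])
    fix j assume "j \<ge> k"
    then have rj: "k \<le> r j" using seq_suble[OF r, of j] by simp
    have "sqn (\<lambda>\<omega>. J' (r j) \<omega> - J' k \<omega>) \<le> 16 * qnorm T (\<lambda>s \<omega>. \<Theta>' (r j) s \<omega> - \<Theta>' k s \<omega>)"
      by (rule l2int_dist[OF l l T])
    also have "\<dots> \<le> 16 * (2 * qnorm T (\<lambda>s \<omega>. \<Theta>' (r j) s \<omega> - \<Theta> s \<omega>) + 2 * qnorm T (\<lambda>s \<omega>. \<Theta> s \<omega> - \<Theta>' k s \<omega>))"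
      by (intro mult_left_mono qnorm_triangle m \<Theta>) simp
    also have "\<dots> \<le> 16 * (2 * ennreal (1 / Suc k) + 2 * ennreal (1 / Suc k))"
    proof (intro mult_left_mono add_mono q)
      have "qnorm T (\<lambda>s \<omega>. \<Theta>' (r j) s \<omega> - \<Theta> s \<omega>) \<le> ennreal (1 / Suc (r j))"
        by (subst qnorm_commute) (rule q)
      also have "\<dots> \<le> ennreal (1 / Suc k)" using rj by (intro ennreal_leI) (simp add: frac_le)
      finally show "qnorm T (\<lambda>s \<omega>. \<Theta>' (r j) s \<omega> - \<Theta> s \<omega>) \<le> ennreal (1 / Suc k)" .
    qed auto
    also have "\<dots> = ennreal (64 / Suc k)"
    proof -
      have "16 * (2 * ennreal (1 / Suc k) + 2 * ennreal (1 / Suc k)) = ennreal 64 * ennreal (1 / Suc k)"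
        by (simp add: distrib_left mult.assoc[symmetric]) (simp add: distrib_right[symmetric])
      then show ?thesis by (subst (asm) ennreal_mult[symmetric]) auto
    qed
    finally show "sqn (\<lambda>\<omega>. J' (r j) \<omega> - J' k \<omega>) \<le> ennreal (64 / Suc k)" .
  qed
  show ?thesis unfolding l2int_def
  proof (intro conjI \<Theta> J allI impI)
    fix \<epsilon> :: real assume \<epsilon>: "0 < \<epsilon>"
    \<comment> \<open>Both \<open>64 / Suc k\<close> and \<open>1 / Suc k\<close> have to be at most
      \<open>\<epsilon> / 4\<close>.\<close>
    obtain k where k: "inverse (real (Suc k)) < \<epsilon> / 256" using reals_Archimedean[of "\<epsilon> / 256"] \<epsilon> by auto
    then have k1: "64 / real (Suc k) \<le> \<epsilon> / 4" "1 / real (Suc k) \<le> \<epsilon> / 4"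
      using \<epsilon> by (auto simp: inverse_eq_divide field_simps)
    have e4: "0 < \<epsilon> / 4" using \<epsilon> by simp
    obtain n H where H: "stepwise n H" "qnorm T (\<lambda>s \<omega>. \<Theta>' k s \<omega> - H s \<omega>) \<le> ennreal (\<epsilon> / 4)"
      "sqn (\<lambda>\<omega>. J' k \<omega> - step_integral n H W T \<omega>) \<le> ennreal (\<epsilon> / 4)" using l2intD[OF l[of k] e4] .
    have add: "2 * ennreal (\<epsilon> / 4) + 2 * ennreal (\<epsilon> / 4) = ennreal \<epsilon>"
    proof -
      have "2 * ennreal (\<epsilon> / 4) + 2 * ennreal (\<epsilon> / 4) = ennreal 4 * ennreal (\<epsilon> / 4)"
        by (simp add: distrib_right[symmetric])
      then show ?thesis using \<epsilon> by (subst (asm) ennreal_mult[symmetric]) auto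
    qed
    have "qnorm T (\<lambda>s \<omega>. \<Theta> s \<omega> - H s \<omega>) \<le> 2 * qnorm T (\<lambda>s \<omega>. \<Theta> s \<omega> - \<Theta>' k s \<omega>) + 2 * qnorm T (\<lambda>s \<omega>. \<Theta>' k s \<omega> - H s \<omega>)"
      by (intro qnorm_triangle \<Theta> m path_measurable_stepwise[OF H(1)])
    also have "\<dots> \<le> 2 * ennreal (\<epsilon> / 4) + 2 * ennreal (\<epsilon> / 4)"
      by (intro add_mono mult_left_mono H order_trans[OF q] ennreal_leI k1) auto
    finally have 1: "qnorm T (\<lambda>s \<omega>. \<Theta> s \<omega> - H s \<omega>) \<le> ennreal \<epsilon>" unfolding add .
    have "sqn (\<lambda>\<omega>. J \<omega> - step_integral n H W T \<omega>) \<le> 2 * sqn (\<lambda>\<omega>. J \<omega> - J' k \<omega>) + 2 * sqn (\<lambda>\<omega>. J' k \<omega> - step_integral n H W T \<omega>)"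
      by (intro sqn_triangle J m step_integral_L2(2)[OF H(1) T])
    also have "\<dots> \<le> 2 * ennreal (\<epsilon> / 4) + 2 * ennreal (\<epsilon> / 4)"
      by (intro add_mono mult_left_mono H order_trans[OF sq] ennreal_leI k1) auto
    finally have "sqn (\<lambda>\<omega>. J \<omega> - step_integral n H W T \<omega>) \<le> ennreal \<epsilon>" unfolding add .
    with 1 H(1) show "\<exists>n H. stepwise n H \<and> qnorm T (\<lambda>s \<omega>. \<Theta> s \<omega> - H s \<omega>) \<le> ennreal \<epsilon> \<and>
        sqn (\<lambda>\<omega>. J \<omega> - step_integral n H W T \<omega>) \<le> ennreal \<epsilon>" by blast
  qed
qed

lemma sqn_AE_subseq:
  assumes J: "J \<in> borel_measurable M" and m: "\<And>k. S k \<in> borel_measurable M"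
    and le: "\<And>k. sqn (\<lambda>\<omega>. J \<omega> - S k \<omega>) \<le> ennreal (1 / Suc k)"
  obtains r where "strict_mono r" "AE \<omega> in M. (\<lambda>k. S (r k) \<omega>) \<longlonglongrightarrow> J \<omega>"
proof -
  let ?u = "\<lambda>k \<omega>. (J \<omega> - S k \<omega>)\<^sup>2"
  have nn: "(\<integral>\<^sup>+\<omega>. ennreal (?u k \<omega>) \<partial>M) \<le> ennreal (1 / Suc k)" for k using le[of k] by (simp add: sqn_def)
  have iu: "integrable M (?u k)" for k
    by (rule integrableI_bounded) (use J m[of k] nn[of k] in \<open>auto simp: le_less_trans[OF _ ennreal_less_top]\<close>)
  have "(\<lambda>k. \<integral>\<omega>. norm (?u k \<omega>) \<partial>M) \<longlonglongrightarrow> 0"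
  proof (rule tendsto_sandwich[of "\<lambda>_. 0" _ _ "\<lambda>k. 1 / Suc k"])
    have "(\<integral>\<omega>. norm (?u k \<omega>) \<partial>M) \<le> 1 / Suc k" for k
    proof -
      have "ennreal (\<integral>\<omega>. norm (?u k \<omega>) \<partial>M) = (\<integral>\<^sup>+\<omega>. ennreal (?u k \<omega>) \<partial>M)"
        using iu[of k] by (subst nn_integral_eq_integral) auto
      also have "\<dots> \<le> ennreal (1 / Suc k)" by (rule nn)
      finally show ?thesis by (subst (asm) ennreal_le_iff) auto
    qed
    then show "\<forall>\<^sub>F k in sequentially. (\<integral>\<omega>. norm (?u k \<omega>) \<partial>M) \<le> 1 / Suc k" by simp
    show "(\<lambda>k. 1 / real (Suc k)) \<longlonglongrightarrow> 0" using LIMSEQ_inverse_real_of_nat by (simp add: inverse_eq_divide)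
  qed auto
  from tendsto_L1_AE_subseq[OF iu this] obtain r where r: "strict_mono r"
    and ae: "AE \<omega> in M. (\<lambda>k. ?u (r k) \<omega>) \<longlonglongrightarrow> 0" by blast
  have "AE \<omega> in M. (\<lambda>k. S (r k) \<omega>) \<longlonglongrightarrow> J \<omega>"
    using ae
  proof eventually_elim
    case (elim \<omega>)
    have "(\<lambda>k. \<bar>J \<omega> - S (r k) \<omega>\<bar>) \<longlonglongrightarrow> 0" using tendsto_real_sqrt[OF elim] by simp
    then have "(\<lambda>k. J \<omega> - S (r k) \<omega>) \<longlonglongrightarrow> 0" by (rule tendsto_rabs_zero_cancel)
    from tendsto_diff[OF tendsto_const[of "J \<omega>"] this] show ?case by simp
  qed
  with r show ?thesis by (rule that)
qed

text \<open>Along a subsequence the value is an almost sure limit of adapted step integrals, and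
  \<open>F T\<close> contains the null sets.\<close>

lemma l2int_adapted:
  assumes J: "l2int T \<Theta> J" and T: "0 \<le> T" shows "J \<in> borel_measurable (F T)"
proof -
  obtain n H where H: "\<And>k. stepwise (n k) (H k)"
    "\<And>k. qnorm T (\<lambda>s \<omega>. \<Theta> s \<omega> - H k s \<omega>) \<le> ennreal (1 / Suc k)"
    "\<And>k. sqn (\<lambda>\<omega>. J \<omega> - step_integral (n k) (H k) W T \<omega>) \<le> ennreal (1 / Suc k)"
    using l2int_sequence[OF J T] by blast
  obtain r where r: "strict_mono r" and ae: "AE \<omega> in M. (\<lambda>k. step_integral (n (r k)) (H (r k)) W T \<omega>) \<longlonglongrightarrow> J \<omega>"
    using sqn_AE_subseq[OF l2int_measurable(2)[OF J] step_integral_L2(2)[OF H(1) T] H(3)] .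
  from ae show ?thesis by (rule borel_measurable_F_AE_limit[OF T step_integral_L2(1)[OF H(1) T]])
qed

end

section \<open>Continuous versions and Brownian motions obtained by rotation\<close>

context brownian_basis
begin

lemma step_integral_0: "step_integral n H Z 0 \<omega> = 0"
  by (simp add: step_integral_def)

lemma step_integral_partial_sum:
  assumes "0 \<le> t"
  shows "(\<Sum>i<k. H (dyadic n i) \<omega> \<bullet> (Z (min t (dyadic n (Suc i))) \<omega> - Z (min t (dyadic n i)) \<omega>))
    = step_integral n H Z (min t (dyadic n k)) \<omega>"
proof -
  have "(\<Sum>i<k. H (dyadic n i) \<omega> \<bullet> (Z (min t (dyadic n (Suc i))) \<omega> - Z (min t (dyadic n i)) \<omega>))
    = (\<Sum>i<k. step_integral n H Z (min t (dyadic n (Suc i))) \<omega> - step_integral n H Z (min t (dyadic n i)) \<omega>)"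
    by (simp only: step_integral_one_step[OF assms])
  also have "\<dots> = step_integral n H Z (min t (dyadic n k)) \<omega> - step_integral n H Z (min t (dyadic n 0)) \<omega>"
    by (rule sum_lessThan_telescope)
  finally show ?thesis using assms by (simp add: step_integral_0)
qed

text \<open>The discrete maximal inequality holds on every refined grid with the same bound, because
  refinement changes neither the integral nor \<open>qnorm T H\<close>. The exceptional events
  increase under refinement, and continuity of paths extends the estimate from dyadic times to all
  times.\<close>

lemma step_integral_maximal:
  assumes H: "stepwise n H" and T: "0 \<le> T" and r: "0 < r"
  shows "\<exists>A\<in>sets M. emeasure M A \<le> qnorm T H / ennreal (r\<^sup>2) \<and>
    (\<forall>\<omega>\<in>space M - A. \<forall>t\<in>{0..T}. \<bar>step_integral n H W t \<omega>\<bar> \<le> r)"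
proof -
  define A where "A l = {\<omega>\<in>space M. \<exists>k. r < \<bar>step_integral n H W (min T (dyadic (n + l) k)) \<omega>\<bar>}" for l
  have main: "A l \<in> sets M \<and> emeasure M (A l) \<le> qnorm T H / ennreal (r\<^sup>2)" for l
  proof -
    let ?m = "n + l" let ?N = "Suc (dindex (n + l) T)"
    have Hm: "stepwise ?m H" by (rule stepwise_refine[OF H]) simp
    have eq: "step_integral ?m H W t \<omega> = step_integral n H W t \<omega>" for t \<omega>
      by (rule step_integral_refine, erule stepwiseD(1)[OF H]) simp
    let ?D = "\<lambda>i \<omega>. H (dyadic ?m i) \<omega> \<bullet> (W (min T (dyadic ?m (Suc i))) \<omega> - W (min T (dyadic ?m i)) \<omega>)"
    have S: "(\<Sum>i<k. ?D i \<omega>) = step_integral n H W (min T (dyadic ?m k)) \<omega>" for k \<omega>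
      using step_integral_partial_sum[OF T, of H ?m \<omega> W k] by (simp only: eq)
    have A: "A l = {\<omega>\<in>space M. \<exists>k\<le>?N. r < \<bar>\<Sum>i<k. ?D i \<omega>\<bar>}"
    proof -
      \<comment> \<open>Grid points beyond \<open>T\<close> are all cut off to \<open>T\<close>, so
        finitely many indices represent every \<open>k\<close>.\<close>
      have "\<exists>k'\<le>?N. min T (dyadic ?m k') = min T (dyadic ?m k)" for k
      proof (cases "k \<le> ?N")
        case False
        then have "T \<le> dyadic ?m k" "T \<le> dyadic ?m ?N" by (auto intro!: dyadic_ge_of_dindex simp del: dindex_dyadic)
        then show ?thesis by (intro exI[of _ ?N]) simp
      qed blast
      then show ?thesis unfolding A_def S by (intro Collect_cong) metis
    qed
    note md = mart_diff_step[OF Hm T]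
    have "measure M (A l) \<le> (\<Sum>i<?N. \<integral>\<omega>. (?D i \<omega>)\<^sup>2 \<partial>M) / r\<^sup>2"
      unfolding A by (rule mart_diff_maximal(2)[OF md(1) r])
    also have "(\<Sum>i<?N. \<integral>\<omega>. (?D i \<omega>)\<^sup>2 \<partial>M) = (\<Sum>i<?N. (min T (dyadic ?m (Suc i)) - min T (dyadic ?m i)) * (\<integral>\<omega>. (norm (H (dyadic ?m i) \<omega>))\<^sup>2 \<partial>M))"
      by (simp only: md(2))
    finally have "ennreal (measure M (A l)) \<le> ennreal ((\<Sum>i<?N. (min T (dyadic ?m (Suc i)) - min T (dyadic ?m i)) * (\<integral>\<omega>. (norm (H (dyadic ?m i) \<omega>))\<^sup>2 \<partial>M)) / r\<^sup>2)"
      by (rule ennreal_leI)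
    also have "\<dots> = qnorm T H / ennreal (r\<^sup>2)"
    proof -
      have "0 \<le> (\<Sum>i<?N. (min T (dyadic ?m (Suc i)) - min T (dyadic ?m i)) * (\<integral>\<omega>. (norm (H (dyadic ?m i) \<omega>))\<^sup>2 \<partial>M))"
      proof (intro sum_nonneg mult_nonneg_nonneg)
        show "0 \<le> min T (dyadic ?m (Suc i)) - min T (dyadic ?m i)" for i
          using dyadic_less_Suc[of ?m i] by linarith
      qed simp
      then show ?thesis using r by (simp only: qnorm_stepwise[OF Hm T] divide_ennreal zero_less_power)
    qed
    finally show ?thesis
      using mart_diff_maximal(1)[OF md(1) r, of ?N] A by (simp only: emeasure_eq_measure)
  qed
  have inc: "incseq A"
  proof (rule incseq_SucI, rule subsetI)
    fix l \<omega> assume "\<omega> \<in> A l"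
    then obtain k where k: "\<omega> \<in> space M" "r < \<bar>step_integral n H W (min T (dyadic (n + l) k)) \<omega>\<bar>"
      by (auto simp: A_def)
    then have "r < \<bar>step_integral n H W (min T (dyadic (n + Suc l) (2 * k))) \<omega>\<bar>"
      by (simp add: dyadic_double)
    then show "\<omega> \<in> A (Suc l)" using k(1) unfolding A_def by blast
  qed
  have "emeasure M (\<Union>l. A l) = (SUP l. emeasure M (A l))"
    using main inc by (intro SUP_emeasure_incseq[symmetric]) auto
  also have "\<dots> \<le> qnorm T H / ennreal (r\<^sup>2)" using main by (intro SUP_least) blast
  finally have 1: "emeasure M (\<Union>l. A l) \<le> qnorm T H / ennreal (r\<^sup>2)" .
  show ?thesis
  proof (intro bexI[of _ "\<Union>l. A l"] conjI 1 ballI)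
    show "(\<Union>l. A l) \<in> sets M" using main by blast
    fix \<omega> t assume \<omega>: "\<omega> \<in> space M - (\<Union>l. A l)" and t: "t \<in> {0..T}"
    have "(\<lambda>l. step_integral n H W (dfloor l t) \<omega>) \<longlonglongrightarrow> step_integral n H W t \<omega>"
      using \<omega> t by (intro dfloor_tendsto_path step_integral_continuous W_continuous) auto
    then have "(\<lambda>l. step_integral n H W (dfloor (l + n) t) \<omega>) \<longlonglongrightarrow> step_integral n H W t \<omega>"
      by (rule LIMSEQ_ignore_initial_segment)
    then have "(\<lambda>l. \<bar>step_integral n H W (dfloor (l + n) t) \<omega>\<bar>) \<longlonglongrightarrow> \<bar>step_integral n H W t \<omega>\<bar>"
      by (rule tendsto_rabs)
    then show "\<bar>step_integral n H W t \<omega>\<bar> \<le> r"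
    proof (rule LIMSEQ_le_const2, intro exI[of _ 0] allI impI)
      fix l
      have "min T (dyadic (n + l) (dindex (n + l) t)) = dfloor (l + n) t"
        using t dfloor_le[of t "n + l"] by (simp add: dfloor_def add.commute)
      moreover have "\<not> r < \<bar>step_integral n H W (min T (dyadic (n + l) (dindex (n + l) t))) \<omega>\<bar>"
        using \<omega> unfolding A_def by blast
      ultimately show "\<bar>step_integral n H W (dfloor (l + n) t) \<omega>\<bar> \<le> r" by simp
    qed
  qed
qed

text \<open>A subsequence is chosen whose squared distance to \<open>\<Theta>\<close> on
  \<open>[0, j]\<close> is below \<open>(1 / 16) ^ j\<close>. By the maximal inequality consecutive
  step integrals differ by more than \<open>(1 / 2) ^ j\<close> somewhere on \<open>[0, j]\<close>
  with probability at most \<open>4 * (1 / 4) ^ j\<close>. This is summable, so by Borel-Cantelli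
  they converge locally uniformly almost surely. The subsequence \<open>r\<close> appears in the
  conclusion because the Gaussian law of the limit is later read off from it.\<close>

lemma continuous_l2int:
  assumes E: "\<And>n. stepwise n (E n)" and \<Theta>: "path_measurable \<Theta>"
    and lim: "\<And>T. 0 \<le> T \<Longrightarrow> (\<lambda>n. qnorm T (\<lambda>s \<omega>. \<Theta> s \<omega> - E n s \<omega>)) \<longlonglongrightarrow> 0"
  shows "\<exists>B r. continuous_adapted M F B \<and> (\<forall>\<omega>. B 0 \<omega> = 0) \<and> (\<forall>t\<ge>0. l2int t \<Theta> (B t)) \<and>
    (\<forall>t\<ge>0. AE \<omega> in M. (\<lambda>j. step_integral (r j) (E (r j)) W t \<omega>) \<longlonglongrightarrow> B t \<omega>)"
proof -
  have "\<exists>n. qnorm (real j) (\<lambda>s \<omega>. \<Theta> s \<omega> - E n s \<omega>) < ennreal ((1 / 16) ^ j)" for j :: nat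
  proof -
    have "\<forall>\<^sub>F n in sequentially. qnorm (real j) (\<lambda>s \<omega>. \<Theta> s \<omega> - E n s \<omega>) < ennreal ((1 / 16) ^ j)"
      using lim[of "real j"] by (intro order_tendstoD(2)) auto
    then show ?thesis by (auto simp: eventually_sequentially)
  qed
  then obtain r where r: "\<And>j. qnorm (real j) (\<lambda>s \<omega>. \<Theta> s \<omega> - E (r j) s \<omega>) < ennreal ((1 / 16) ^ j)" by metis
  define S where "S j t \<omega> = step_integral (r j) (E (r j)) W t \<omega>" for j t \<omega>
  have pm: "path_measurable (E n)" for n by (rule path_measurable_stepwise[OF E])
  have rq: "qnorm t (\<lambda>s \<omega>. E (r i) s \<omega> - E (r j) s \<omega>) \<le> ennreal (4 * (1 / 16) ^ j)" if "t \<le> real j" "j \<le> i" for t i j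
  proof -
    have "qnorm t (\<lambda>s \<omega>. E (r i) s \<omega> - E (r j) s \<omega>) \<le> qnorm (real j) (\<lambda>s \<omega>. E (r i) s \<omega> - E (r j) s \<omega>)"
      by (rule qnorm_mono) fact
    also have "\<dots> \<le> 2 * qnorm (real j) (\<lambda>s \<omega>. E (r i) s \<omega> - \<Theta> s \<omega>) + 2 * qnorm (real j) (\<lambda>s \<omega>. \<Theta> s \<omega> - E (r j) s \<omega>)"
      by (intro qnorm_triangle pm \<Theta>)
    also have "\<dots> \<le> 2 * ennreal ((1 / 16) ^ j) + 2 * ennreal ((1 / 16) ^ j)"
    proof (intro add_mono mult_left_mono less_imp_le[OF r])
      have "qnorm (real j) (\<lambda>s \<omega>. E (r i) s \<omega> - \<Theta> s \<omega>) \<le> qnorm (real i) (\<lambda>s \<omega>. \<Theta> s \<omega> - E (r i) s \<omega>)"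
        by (subst qnorm_commute) (rule qnorm_mono, use that in simp)
      also have "\<dots> \<le> ennreal ((1 / 16) ^ i)" by (rule less_imp_le[OF r])
      also have "\<dots> \<le> ennreal ((1 / 16) ^ j)" using that by (intro ennreal_leI power_decreasing) auto
      finally show "qnorm (real j) (\<lambda>s \<omega>. E (r i) s \<omega> - \<Theta> s \<omega>) \<le> ennreal ((1 / 16) ^ j)" .
    qed auto
    also have "\<dots> = ennreal (4 * (1 / 16) ^ j)"
    proof -
      have "2 * ennreal ((1 / 16) ^ j) + 2 * ennreal ((1 / 16) ^ j) = ennreal 4 * ennreal ((1 / 16) ^ j)"
        by (simp add: distrib_right[symmetric])
      then show ?thesis by (simp add: ennreal_mult')
    qed
    finally show ?thesis .
  qed
  have "\<exists>A\<in>sets M. emeasure M A \<le> ennreal (4 * (1 / 4) ^ j) \<and>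
    (\<forall>\<omega>\<in>space M - A. \<forall>t\<in>{0..real j}. \<bar>S (Suc j) t \<omega> - S j t \<omega>\<bar> \<le> (1 / 2) ^ j)" for j
  proof -
    let ?m = "max (r (Suc j)) (r j)" let ?H = "\<lambda>s \<omega>. E (r (Suc j)) s \<omega> - E (r j) s \<omega>"
    have m: "stepwise ?m (E (r (Suc j)))" "stepwise ?m (E (r j))" by (auto intro: stepwise_refine[OF E])
    have "step_integral ?m (E (r j)) W t \<omega> = S j t \<omega>" for t \<omega>
      unfolding S_def by (rule step_integral_refine, erule stepwiseD(1)[OF E]) simp
    moreover have "step_integral ?m (E (r (Suc j))) W t \<omega> = S (Suc j) t \<omega>" for t \<omega>
      unfolding S_def by (rule step_integral_refine, erule stepwiseD(1)[OF E]) simp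
    ultimately have eq: "step_integral ?m ?H W t \<omega> = S (Suc j) t \<omega> - S j t \<omega>" for t \<omega>
      by (simp add: step_integral_diff[OF m])
    obtain A where A: "A \<in> sets M" "emeasure M A \<le> qnorm (real j) ?H / ennreal (((1 / 2) ^ j)\<^sup>2)"
      "\<forall>\<omega>\<in>space M - A. \<forall>t\<in>{0..real j}. \<bar>step_integral ?m ?H W t \<omega>\<bar> \<le> (1 / 2) ^ j"
      using step_integral_maximal[OF stepwise_diff[OF m], of "real j" "(1 / 2) ^ j"] by auto
    have "emeasure M A \<le> ennreal (4 * (1 / 16) ^ j) / ennreal (((1 / 2) ^ j)\<^sup>2)"
      using A(2) divide_right_mono_ennreal[OF rq[of "real j" j "Suc j"]] by (meson order_refl order_trans le_SucI)
    also have "\<dots> = ennreal (4 * (1 / 16) ^ j / ((1 / 2) ^ j)\<^sup>2)" by (subst divide_ennreal) auto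
    also have "4 * (1 / 16) ^ j / ((1 / 2) ^ j)\<^sup>2 = 4 * (1 / 4 :: real) ^ j"
      by (simp add: power2_eq_square power_mult_distrib[symmetric] field_simps)
    finally show ?thesis using A(1,3) unfolding eq by blast
  qed
  then obtain A where A: "\<And>j. A j \<in> sets M" "\<And>j. emeasure M (A j) \<le> ennreal (4 * (1 / 4) ^ j)"
    "\<And>j \<omega> t. \<omega> \<in> space M - A j \<Longrightarrow> t \<in> {0..real j} \<Longrightarrow> \<bar>S (Suc j) t \<omega> - S j t \<omega>\<bar> \<le> (1 / 2) ^ j"
    by metis
  have mA: "measure M (A j) \<le> 4 * (1 / 4) ^ j" for j
    using A(2)[of j] by (simp add: emeasure_eq_measure)
  have "AE \<omega> in M. \<forall>\<^sub>F j in sequentially. \<omega> \<in> space M - A j"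
  proof (rule borel_cantelli_AE1[OF A(1)])
    show "summable (\<lambda>j. measure M (A j))"
      by (rule summable_comparison_test'[of "\<lambda>j. 4 * (1 / 4) ^ j" 0])
        (auto intro!: summable_mult summable_geometric mA)
  qed (simp add: emeasure_eq_measure)
  then obtain N where N: "N \<in> null_sets M" "{\<omega>\<in>space M. \<not> (\<forall>\<^sub>F j in sequentially. \<omega> \<in> space M - A j)} \<subseteq> N"
    unfolding eventually_ae_filter by blast
  define G where "G = space M - N"
  have G: "\<forall>\<^sub>F j in sequentially. \<omega> \<in> space M - A j" if "\<omega> \<in> G" for \<omega> using that N unfolding G_def by blast
  \<comment> \<open>As a telescoping series the limit falls under the Weierstrass test. Off the good
    event \<open>B\<close> is set to \<open>0\<close>, so that all paths are continuous and start at
    \<open>0\<close>.\<close>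
  define B where "B t \<omega> = (if \<omega> \<in> G then S 0 t \<omega> + (\<Sum>i. S (Suc i) t \<omega> - S i t \<omega>) else 0)" for t \<omega>
  have unif: "uniform_limit {0..T} (\<lambda>n t. \<Sum>i<n. S (Suc i) t \<omega> - S i t \<omega>) (\<lambda>t. \<Sum>i. S (Suc i) t \<omega> - S i t \<omega>) sequentially"
    if "\<omega> \<in> G" for \<omega> T
  proof (rule Weierstrass_m_test_ev[where M="\<lambda>j. (1 / 2) ^ j"])
    obtain k where k: "T \<le> real k" using real_arch_simple by blast
    show "\<forall>\<^sub>F j in sequentially. \<forall>t\<in>{0..T}. norm (S (Suc j) t \<omega> - S j t \<omega>) \<le> (1 / 2) ^ j"
      using G[OF that] eventually_ge_at_top[of k]
    proof eventually_elim
      case (elim j)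
      then show ?case using A(3)[of \<omega> j] k by auto
    qed
  qed (rule summable_geometric, simp)
  have lim_B: "(\<lambda>n. S n t \<omega>) \<longlonglongrightarrow> B t \<omega>" if "\<omega> \<in> G" "0 \<le> t" for t \<omega>
  proof -
    have "(\<lambda>n. \<Sum>i<n. S (Suc i) t \<omega> - S i t \<omega>) \<longlonglongrightarrow> (\<Sum>i. S (Suc i) t \<omega> - S i t \<omega>)"
      by (rule tendsto_uniform_limitI[OF unif[OF that(1), of t]]) (use that in simp)
    from tendsto_add[OF tendsto_const[of "S 0 t \<omega>"] this] show ?thesis
      using that by (simp add: B_def sum_lessThan_telescope[of "\<lambda>i. S i t \<omega>"])
  qed
  have AE_B: "AE \<omega> in M. (\<lambda>n. S n t \<omega>) \<longlonglongrightarrow> B t \<omega>" if "0 \<le> t" for t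
  proof -
    have "AE \<omega> in M. \<omega> \<in> G" using AE_not_in[OF N(1)] AE_space by eventually_elim (simp add: G_def)
    then show ?thesis by eventually_elim (rule lim_B[OF _ that])
  qed
  have SF: "S j t \<in> borel_measurable (F t)" and SM: "S j t \<in> borel_measurable M" if "0 \<le> t" for j t
    using step_integral_L2(1,2)[OF E that, of "r j"] by (auto simp: S_def[abs_def])
  have BF: "B t \<in> borel_measurable (F t)" if "0 \<le> t" for t
    by (rule borel_measurable_F_AE_limit[OF that SF[OF that] AE_B[OF that]])
  have "continuous_adapted M F B"
    unfolding continuous_adapted_def
  proof (intro conjI allI impI ballI BF)
    fix \<omega> assume \<omega>: "\<omega> \<in> space M"
    show "continuous_on {0..} (\<lambda>t. B t \<omega>)"
    proof (cases "\<omega> \<in> G")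
      case True
      have Sc: "continuous_on {0..} (\<lambda>t. S j t \<omega>)" for j
        unfolding S_def by (intro step_integral_continuous W_continuous \<omega>)
      have "continuous_on {0..T} (\<lambda>t. \<Sum>i. S (Suc i) t \<omega> - S i t \<omega>)" for T
        by (rule uniform_limit_theorem[OF always_eventually unif[OF True]])
          (auto intro!: continuous_intros continuous_on_subset[OF Sc])
      then have "continuous_on {0..} (\<lambda>t. \<Sum>i. S (Suc i) t \<omega> - S i t \<omega>)"
        by (intro continuous_on_halfline continuous_on_subset[of "{0..T}" _ "{0..<T}" for T]) auto
      with Sc[of 0] True show ?thesis by (simp add: B_def continuous_on_add)
    qed (simp add: B_def)
  qed
  moreover have "\<forall>\<omega>. B 0 \<omega> = 0" by (simp add: B_def S_def step_integral_0)
  moreover have "l2int t \<Theta> (B t)" if t: "0 \<le> t" for t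
  proof (rule l2int_closure[OF \<Theta> measurable_F_M[OF t BF[OF t]] t])
    fix \<epsilon> :: real assume \<epsilon>: "0 < \<epsilon>"
    have "(\<lambda>j. 4 * (1 / 16 :: real) ^ j) \<longlonglongrightarrow> 4 * 0"
      by (intro tendsto_mult_left LIMSEQ_power_zero) simp
    \<comment> \<open>The bound by \<open>\<epsilon>\<^sup>2\<close> yields the first-order distance
      \<open>\<epsilon>\<close> of the values, the bound by \<open>\<epsilon>\<close> the distance
      of the integrands.\<close>
    then have "\<forall>\<^sub>F j in sequentially. 4 * (1 / 16 :: real) ^ j < min (\<epsilon>\<^sup>2) \<epsilon>"
      using \<epsilon> by (intro order_tendstoD(2)) auto
    then have "\<forall>\<^sub>F j in sequentially. 4 * (1 / 16 :: real) ^ j < min (\<epsilon>\<^sup>2) \<epsilon> \<and> nat \<lceil>t\<rceil> \<le> j"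
      using eventually_ge_at_top[of "nat \<lceil>t\<rceil>"] by (rule eventually_conj)
    then obtain j where j: "4 * (1 / 16 :: real) ^ j < min (\<epsilon>\<^sup>2) \<epsilon>" "nat \<lceil>t\<rceil> \<le> j"
      unfolding eventually_sequentially by blast
    have tj: "t \<le> real j" using j(2) by linarith
    have "sqn (\<lambda>\<omega>. B t \<omega> - S j t \<omega>) \<le> ennreal (4 * (1 / 16) ^ j)"
    proof (rule sqn_Fatou[where k=j, OF SM[OF t] SM[OF t] AE_B[OF t]])
      fix i assume "j \<le> i"
      then show "sqn (\<lambda>\<omega>. S i t \<omega> - S j t \<omega>) \<le> ennreal (4 * (1 / 16) ^ j)"
        unfolding S_def step_integral_dist[OF E E t] by (rule rq[OF tj])
    qed
    also have "\<dots> \<le> ennreal (\<epsilon>\<^sup>2)" using j by (intro ennreal_leI) simp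
    finally have "(\<integral>\<^sup>+\<omega>. ennreal \<bar>B t \<omega> - S j t \<omega>\<bar> \<partial>M) \<le> ennreal \<epsilon>"
      by (intro nn_integral_abs_le_sqn \<epsilon> borel_measurable_diff SM[OF t] measurable_F_M[OF t BF[OF t]])
    moreover have "qnorm t (\<lambda>s \<omega>. \<Theta> s \<omega> - E (r j) s \<omega>) \<le> ennreal \<epsilon>"
    proof -
      have "qnorm t (\<lambda>s \<omega>. \<Theta> s \<omega> - E (r j) s \<omega>) \<le> qnorm (real j) (\<lambda>s \<omega>. \<Theta> s \<omega> - E (r j) s \<omega>)"
        by (rule qnorm_mono[OF tj])
      also have "\<dots> \<le> ennreal ((1 / 16) ^ j)" by (rule less_imp_le[OF r])
      also have "\<dots> \<le> ennreal \<epsilon>" proof (intro ennreal_leI)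
        have "0 \<le> (1 / 16 :: real) ^ j" by simp
        then show "(1 / 16) ^ j \<le> \<epsilon>" using j(1) by linarith
      qed
      finally show ?thesis .
    qed
    moreover have "l2int t (E (r j)) (S j t)" using l2int_stepwise[OF E t, of "r j"] by (simp add: S_def[abs_def])
    ultimately show "\<exists>\<Theta>' J'. l2int t \<Theta>' J' \<and> qnorm t (\<lambda>s \<omega>. \<Theta> s \<omega> - \<Theta>' s \<omega>) \<le> ennreal \<epsilon> \<and>
        (\<integral>\<^sup>+\<omega>. ennreal \<bar>B t \<omega> - J' \<omega>\<bar> \<partial>M) \<le> ennreal \<epsilon>" by blast
  qed
  ultimately show ?thesis using AE_B unfolding S_def by blast
qed

text \<open>Induction over the cells. Given the past, the last increment is Gaussian, and since
  \<open>H\<close> is a unit vector it contributes the deterministic factor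
  \<open>exp (- h * \<theta>\<^sup>2 / 2)\<close>, \<open>h\<close> being the length of the clamped
  cell. The factors multiply up to the normal characteristic function, whatever the past event
  \<open>A\<close>.\<close>

lemma step_integral_char:
  assumes H: "stepwise n H" and unit: "\<And>s \<omega>. 0 \<le> s \<Longrightarrow> \<omega> \<in> space M \<Longrightarrow> norm (H s \<omega>) = 1"
    and st: "0 \<le> s" "s \<le> t" and A: "A \<in> sets (F s)"
  shows "(\<integral>\<omega>. indicator A \<omega> * iexp (\<theta> * (step_integral n H W t \<omega> - step_integral n H W s \<omega>)) \<partial>M)
    = measure M A * exp (- (t - s) * \<theta>\<^sup>2 / 2)"
proof -
  let ?c = "\<lambda>i. max s (min t (dyadic n i))"
  let ?D = "\<lambda>i \<omega>. H (dyadic n i) \<omega> \<bullet> (W (?c (Suc i)) \<omega> - W (?c i) \<omega>)"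
  have AM: "A \<in> sets M" using A subalgebra_F[OF st(1)] by (auto simp: subalgebra_def)
  have c: "0 \<le> ?c i" "s \<le> ?c i" "?c i \<le> ?c (Suc i)" for i
    using st dyadic_less_Suc[of n i] by (auto simp: max_def min_def)
  have cmono: "i \<le> k \<Longrightarrow> ?c i \<le> ?c k" for i k by (rule lift_Suc_mono_le[of ?c, OF c(3)])
  have *: "(\<integral>\<omega>. indicator A \<omega> * iexp (\<theta> * (\<Sum>i<k. ?D i \<omega>)) \<partial>M) = measure M A * exp (- (?c k - s) * \<theta>\<^sup>2 / 2)" for k
  proof (induction k)
    case 0
    have "?c 0 = s" using st by simp
    moreover have "(\<integral>\<omega>. (indicator A \<omega> :: complex) \<partial>M) = measure M A"
    proof -
      have "(\<lambda>\<omega>. indicator A \<omega> :: complex) = (\<lambda>\<omega>. complex_of_real (indicator A \<omega>))"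
        by (auto simp: indicator_def fun_eq_iff)
      then show ?thesis using AM by (simp only: integral_complex_of_real) simp
    qed
    ultimately show ?case by (simp del: of_bool_eq)
  next
    case (Suc k)
    show ?case
    proof (cases "?c (Suc k) = ?c k")
      case True
      then have "?D k \<omega> = 0" for \<omega> by simp
      then have "(\<Sum>i<Suc k. ?D i \<omega>) = (\<Sum>i<k. ?D i \<omega>)" for \<omega> by simp
      then show ?thesis using Suc True by simp
    next
      case False
      have lt: "?c k < ?c (Suc k)" by (rule le_neq_trans[OF c(3) False[symmetric]])
      \<comment> \<open>A cell of positive clamped length begins at a grid point no later than
        \<open>?c k\<close>, so the integrand is known at that time.\<close>
      have dk: "dyadic n k \<le> ?c k" using lt dyadic_less_Suc[of n k] by (auto simp: max_def min_def split: if_splits)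
      have Hk: "H (dyadic n i) \<in> borel_measurable (F (?c k))" if "i \<le> k" for i
        by (rule measurable_F_mono[OF _ _ stepwiseD(2)[OF H]]) (use dyadic_mono[OF that, of n] dk in \<open>auto intro: order_trans\<close>)
      have Dk: "?D i \<in> borel_measurable (F (?c k))" if "i < k" for i
        by (rule borel_measurable_inner[OF Hk W_increment_adapted])
          (use that c(1) cmono[of i k] cmono[of "Suc i" k] in \<open>simp_all only: less_imp_le Suc_leI\<close>)
      have Ak: "A \<in> sets (F (?c k))" using A mono_F[OF st(1) c(2)] by blast
      have [measurable]: "(\<lambda>\<omega>. \<Sum>i<k. ?D i \<omega>) \<in> borel_measurable (F (?c k))"
        by (rule borel_measurable_sum) (simp add: Dk)
      note [measurable] = Ak Hk[OF order_refl]
      let ?f = "\<lambda>(\<omega>, z). (indicator A \<omega> * iexp (\<theta> * (\<Sum>i<k. ?D i \<omega>))) * iexp ((\<theta> *\<^sub>R H (dyadic n k) \<omega>) \<bullet> z) :: complex"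
      have fm: "?f \<in> borel_measurable (F (?c k) \<Otimes>\<^sub>M borel)" by measurable
      have eq: "indicator A \<omega> * iexp (\<theta> * (\<Sum>i<Suc k. ?D i \<omega>)) = ?f (\<omega>, W (?c (Suc k)) \<omega> - W (?c k) \<omega>)" for \<omega>
        by (simp add: distrib_left exp_add mult.assoc)
      have int: "integrable M (\<lambda>\<omega>. ?f (\<omega>, W (?c (Suc k)) \<omega> - W (?c k) \<omega>))"
      proof (rule integrable_const_bound[of _ 1])
        have "(\<lambda>\<omega>. (\<omega>, W (?c (Suc k)) \<omega> - W (?c k) \<omega>)) \<in> measurable M (F (?c k) \<Otimes>\<^sub>M borel)"
          by (intro measurable_Pair borel_measurable_diff W_measurable c(1) measurable_F_M[OF c(1)[of k], of "\<lambda>\<omega>. \<omega>"]) simp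
        from measurable_compose[OF this fm]
        show "(\<lambda>\<omega>. ?f (\<omega>, W (?c (Suc k)) \<omega> - W (?c k) \<omega>)) \<in> borel_measurable M" .
      qed (auto simp: norm_mult indicator_def)
      have "(\<integral>\<omega>. indicator A \<omega> * iexp (\<theta> * (\<Sum>i<Suc k. ?D i \<omega>)) \<partial>M)
          = (\<integral>\<omega>. \<integral>z. ?f (\<omega>, z) \<partial>gauss (?c (Suc k) - ?c k) \<partial>M)"
        unfolding eq by (rule integral_past_increment[OF c(1) lt fm int])
      also have "\<dots> = (\<integral>\<omega>. (indicator A \<omega> * iexp (\<theta> * (\<Sum>i<k. ?D i \<omega>))) * of_real (exp (- (?c (Suc k) - ?c k) * \<theta>\<^sup>2 / 2)) \<partial>M)"
      proof (rule Bochner_Integration.integral_cong[OF refl])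
        fix \<omega> assume \<omega>: "\<omega> \<in> space M"
        have "(\<integral>z. ?f (\<omega>, z) \<partial>gauss (?c (Suc k) - ?c k)) = (indicator A \<omega> * iexp (\<theta> * (\<Sum>i<k. ?D i \<omega>))) *
            (CLINT z|gauss (?c (Suc k) - ?c k). iexp ((\<theta> *\<^sub>R H (dyadic n k) \<omega>) \<bullet> z))"
          unfolding split_conv by (rule integral_mult_right_zero)
        moreover have h: "0 < ?c (Suc k) - ?c k" using lt by linarith
        moreover have n: "(norm (\<theta> *\<^sub>R H (dyadic n k) \<omega>))\<^sup>2 = \<theta>\<^sup>2"
          using unit[OF dyadic_nonneg \<omega>] by simp
        ultimately show "(\<integral>z. ?f (\<omega>, z) \<partial>gauss (?c (Suc k) - ?c k)) = (indicator A \<omega> * iexp (\<theta> * (\<Sum>i<k. ?D i \<omega>))) * of_real (exp (- (?c (Suc k) - ?c k) * \<theta>\<^sup>2 / 2))"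
          by (simp only: gauss_iexp[OF h] n)
      qed
      also have "\<dots> = complex_of_real (measure M A * exp (- (?c k - s) * \<theta>\<^sup>2 / 2)) * of_real (exp (- (?c (Suc k) - ?c k) * \<theta>\<^sup>2 / 2))"
        by (subst integral_mult_left_zero) (simp only: Suc)
      also have "\<dots> = measure M A * exp (- (?c (Suc k) - s) * \<theta>\<^sup>2 / 2)"
      proof -
        have "exp (- (?c k - s) * \<theta>\<^sup>2 / 2) * exp (- (?c (Suc k) - ?c k) * \<theta>\<^sup>2 / 2) = exp (- (?c (Suc k) - s) * \<theta>\<^sup>2 / 2)"
          by (subst exp_add[symmetric]) (simp add: algebra_simps add_divide_distrib diff_divide_distrib)
        then show ?thesis by (simp only: of_real_mult[symmetric] mult.assoc)
      qed
      finally show ?thesis .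
    qed
  qed
  have cN: "?c (Suc (dindex n t)) = t" using st less_dyadic_Suc_dindex[of t n] by simp
  show ?thesis using *[of "Suc (dindex n t)"] unfolding cN step_integral_diff_times[OF st] .
qed

text \<open>Characteristic functions restricted to a past event \<open>A\<close> pass to the limit
  by bounded convergence. Normalised, they belong to the law of the increment under the conditional
  probability given \<open>A\<close>, which by uniqueness is the same normal law for every
  \<open>A\<close> of positive probability. Independence and the law of the increment follow
  together.\<close>

lemma rotated_brownian_motion:
  assumes E: "\<And>n. stepwise n (E n)" and unit: "\<And>n s \<omega>. 0 \<le> s \<Longrightarrow> \<omega> \<in> space M \<Longrightarrow> norm (E n s \<omega>) = 1"
    and B: "continuous_adapted M F B" "\<And>\<omega>. B 0 \<omega> = 0"
    and lim: "\<And>t. 0 \<le> t \<Longrightarrow> AE \<omega> in M. (\<lambda>j. step_integral (r j) (E (r j)) W t \<omega>) \<longlonglongrightarrow> B t \<omega>"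
  shows "brownian_motion M F (B :: real \<Rightarrow> 'w \<Rightarrow> real)"
  unfolding brownian_motion_def
proof (intro conjI allI impI B(1))
  show "AE \<omega> in M. B 0 \<omega> = 0" by (simp add: B)
  fix s t :: real assume "0 \<le> s \<and> s < t"
  then have st: "0 \<le> s" "s < t" "0 \<le> t" by auto
  have BM: "B u \<in> borel_measurable M" if "0 \<le> u" for u
    using B(1) that measurable_F_M unfolding continuous_adapted_def by blast
  let ?X = "\<lambda>\<omega>. B t \<omega> - B s \<omega>"
  let ?N = "density lborel (normal_density 0 (sqrt (t - s)))"
  note [measurable] = BM[OF st(1)] BM[OF st(3)]
  have X[measurable]: "?X \<in> borel_measurable M" using BM st by simp
  have char: "(\<integral>\<omega>. indicator A \<omega> * iexp (\<theta> * ?X \<omega>) \<partial>M) = measure M A * exp (- (t - s) * \<theta>\<^sup>2 / 2)"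
    if A: "A \<in> sets (F s)" for A \<theta>
  proof -
    let ?S = "\<lambda>j t. step_integral (r j) (E (r j)) W t"
    have AM[measurable]: "A \<in> sets M" using A subalgebra_F[OF st(1)] by (auto simp: subalgebra_def)
    have [measurable]: "?S j t \<in> borel_measurable M" "?S j s \<in> borel_measurable M" for j
      using step_integral_L2(2)[OF E] st by auto
    have "(\<lambda>j. \<integral>\<omega>. indicator A \<omega> * iexp (\<theta> * (?S j t \<omega> - ?S j s \<omega>)) \<partial>M) \<longlonglongrightarrow> (\<integral>\<omega>. indicator A \<omega> * iexp (\<theta> * ?X \<omega>) \<partial>M)"
    proof (rule integral_dominated_convergence[where w="\<lambda>_. 1"])
      show "AE \<omega> in M. (\<lambda>j. indicator A \<omega> * iexp (\<theta> * (?S j t \<omega> - ?S j s \<omega>))) \<longlonglongrightarrow> indicator A \<omega> * iexp (\<theta> * ?X \<omega>)"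
        using lim[OF st(1)] lim[OF st(3)] by eventually_elim (intro tendsto_intros)
    qed (auto simp: norm_mult indicator_def)
    moreover have "(\<integral>\<omega>. indicator A \<omega> * iexp (\<theta> * (?S j t \<omega> - ?S j s \<omega>)) \<partial>M) = measure M A * exp (- (t - s) * \<theta>\<^sup>2 / 2)" for j
      by (rule step_integral_char[OF E unit st(1) less_imp_le[OF st(2)] A])
    ultimately show ?thesis by (simp only: LIMSEQ_const_iff)
  qed
  have N: "0 < sqrt (t - s)" using st by simp
  have rN: "real_distribution ?N"
    using prob_space_normal_density[OF N] unfolding real_distribution_def real_distribution_axioms_def by simp
  have char_N: "char ?N \<theta> = exp (- (t - s) * \<theta>\<^sup>2 / 2)" for \<theta>
  proof -
    have "char ?N \<theta> = (LINT x|lborel. normal_density 0 (sqrt (t - s)) x *\<^sub>R iexp (\<theta> * x))"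
      unfolding char_def by (subst integral_density) auto
    also have "\<dots> = exp (- (t - s) * \<theta>\<^sup>2 / 2)"
      using st by (subst iexp_normal_density[OF N]) (simp add: power_mult_distrib algebra_simps)
    finally show ?thesis .
  qed
  have joint: "measure M (A \<inter> (?X -` C \<inter> space M)) = measure M A * measure ?N C"
    if A: "A \<in> sets (F s)" and C: "C \<in> sets borel" for A C
  \<comment> \<open>Conditioning needs a positive probability; for a null event both sides
    vanish.\<close>
  proof (cases "measure M A = 0")
    case True
    have AM: "A \<in> sets M" using A subalgebra_F[OF st(1)] by (auto simp: subalgebra_def)
    have "measure M (A \<inter> (?X -` C \<inter> space M)) \<le> measure M A"
      using AM by (intro finite_measure_mono) auto
    then show ?thesis using True measure_nonneg[of M "A \<inter> (?X -` C \<inter> space M)"] by simp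
  next
    case False
    have AM[measurable]: "A \<in> sets M" using A subalgebra_F[OF st(1)] by (auto simp: subalgebra_def)
    define c where "c = measure M A"
    have c: "0 < c" using False measure_nonneg[of M A] unfolding c_def by linarith
    let ?A = "density M (\<lambda>\<omega>. ennreal (indicator A \<omega> / c))"
    have em: "emeasure ?A D = ennreal (measure M (A \<inter> D) / c)" if "D \<in> sets M" for D
    proof -
      have "emeasure ?A D = (\<integral>\<^sup>+\<omega>. ennreal (1 / c) * indicator (A \<inter> D) \<omega> \<partial>M)"
        using that c by (subst emeasure_density) (auto intro!: nn_integral_cong simp: indicator_def)
      also have "\<dots> = ennreal (1 / c) * emeasure M (A \<inter> D)"
        using that by (intro nn_integral_cmult_indicator) auto
      finally show ?thesis using c by (simp add: emeasure_eq_measure ennreal_mult'[symmetric])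
    qed
    interpret A: prob_space ?A
    proof
      have "A \<inter> space M = A" using sets.sets_into_space[OF AM] by auto
      then show "emeasure ?A (space ?A) = 1" using em[of "space M"] c by (simp add: c_def)
    qed
    have "distr ?A borel ?X = ?N"
    proof (rule Levy_uniqueness[OF A.real_distribution_distr rN])
      show "char (distr ?A borel ?X) = char ?N"
      proof
        fix \<theta>
        have "char (distr ?A borel ?X) \<theta> = (\<integral>\<omega>. iexp (\<theta> * ?X \<omega>) \<partial>?A)"
          unfolding char_def by (subst integral_distr) auto
        also have "\<dots> = (\<integral>\<omega>. (indicator A \<omega> / c) *\<^sub>R iexp (\<theta> * ?X \<omega>) \<partial>M)"
          using c by (subst integral_density) auto
        also have "\<dots> = (\<integral>\<omega>. of_real (1 / c) * (indicator A \<omega> * iexp (\<theta> * ?X \<omega>)) \<partial>M)"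
          by (intro Bochner_Integration.integral_cong) (auto simp: scaleR_conv_of_real indicator_def)
        also have "\<dots> = complex_of_real (1 / c) * complex_of_real (measure M A * exp (- (t - s) * \<theta>\<^sup>2 / 2))"
          by (subst integral_mult_right_zero) (simp only: char[OF A])
        also have "\<dots> = char ?N \<theta>" using c by (simp add: char_N c_def)
        finally show "char (distr ?A borel ?X) \<theta> = char ?N \<theta>" .
      qed
    qed simp
    then have "emeasure ?N C = emeasure (distr ?A borel ?X) C" by simp
    also have "\<dots> = ennreal (measure M (A \<inter> (?X -` C \<inter> space M)) / c)"
      using C by (subst emeasure_distr) (auto intro!: em)
    finally have "measure ?N C = measure M (A \<inter> (?X -` C \<inter> space M)) / c"
      using c by (simp add: measure_def)
    then show ?thesis using c by (simp add: c_def)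
  qed
  have sp: "space M \<in> sets (F s)" using sets.top[of "F s"] st by simp
  have law: "measure M (?X -` C \<inter> space M) = measure ?N C" if "C \<in> sets borel" for C
    using joint[OF sp that] prob_space by (simp add: Int_absorb1)
  show "indep_set (sets (F s)) (sets (vimage_algebra (space M) ?X borel))"
    unfolding indep_sets2_eq
  proof (intro conjI ballI)
    show "sets (F s) \<subseteq> events" using subalgebra_F[OF st(1)] by (auto simp: subalgebra_def)
    show "sets (vimage_algebra (space M) ?X borel) \<subseteq> events"
      using X by (auto simp: sets_vimage_algebra2 intro: measurable_sets)
    fix A D assume A: "A \<in> sets (F s)" and "D \<in> sets (vimage_algebra (space M) ?X borel)"
    then obtain C where C: "C \<in> sets borel" "D = ?X -` C \<inter> space M" by (auto simp: sets_vimage_algebra2)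
    show "prob (A \<inter> D) = prob A * prob D" unfolding C(2) law[OF C(1)] by (rule joint[OF A C(1)])
  qed
  have "distr M lborel ?X = ?N"
  proof (rule measure_eqI)
    fix C assume "C \<in> sets (distr M lborel ?X)"
    then have C: "C \<in> sets borel" by simp
    interpret N: real_distribution ?N by (rule rN)
    show "emeasure (distr M lborel ?X) C = emeasure ?N C"
      using C law[OF C] by (simp add: emeasure_distr emeasure_eq_measure N.emeasure_eq_measure)
  qed simp
  then show "distributed M lborel ?X (\<lambda>z. ennreal (\<Prod>b\<in>Basis. normal_density 0 (sqrt (t - s)) (z \<bullet> b)))"
    unfolding distributed_def by simp
qed

end

section \<open>A smooth approximation of the norm\<close>

definition soft_norm :: "real \<Rightarrow> 'a::euclidean_space \<Rightarrow> real" where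
  "soft_norm \<epsilon> z = sqrt ((norm z)\<^sup>2 + \<epsilon>\<^sup>2)"

definition soft_grad :: "real \<Rightarrow> 'a::euclidean_space \<Rightarrow> 'a" where
  "soft_grad \<epsilon> z = z /\<^sub>R soft_norm \<epsilon> z"

text \<open>The quadratic form of the second derivative of \<open>soft_norm \<epsilon>\<close> at
  \<open>z\<close>, evaluated at \<open>v\<close>.\<close>

definition soft_hess :: "real \<Rightarrow> 'a::euclidean_space \<Rightarrow> 'a \<Rightarrow> real" where
  "soft_hess \<epsilon> z v = (norm v)\<^sup>2 / soft_norm \<epsilon> z - (z \<bullet> v)\<^sup>2 / (soft_norm \<epsilon> z) ^ 3"

text \<open>The trace of the quadratic form \<open>soft_hess \<epsilon> z\<close>.\<close>

definition soft_laplace :: "real \<Rightarrow> 'a::euclidean_space \<Rightarrow> real" where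
  "soft_laplace \<epsilon> z = real DIM('a) / soft_norm \<epsilon> z - (norm z)\<^sup>2 / (soft_norm \<epsilon> z) ^ 3"

context
  fixes \<epsilon> :: real
  assumes \<epsilon>: "0 < \<epsilon>"
begin

lemma soft_norm_sq: "(soft_norm \<epsilon> z)\<^sup>2 = (norm z)\<^sup>2 + \<epsilon>\<^sup>2"
  by (simp add: soft_norm_def)

lemma soft_norm_ge: "\<epsilon> \<le> soft_norm \<epsilon> z" "norm z \<le> soft_norm \<epsilon> z"
  using \<epsilon> by (auto simp: soft_norm_def intro!: real_le_rsqrt)

lemma soft_norm_pos: "0 < soft_norm \<epsilon> z"
  using soft_norm_ge(1)[of z] \<epsilon> by linarith

lemma soft_norm_le: "soft_norm \<epsilon> z \<le> norm z + \<epsilon>"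
  using \<epsilon> unfolding soft_norm_def by (intro real_le_lsqrt) (auto simp: power2_sum)

lemma continuous_soft_norm: "continuous_on UNIV (soft_norm \<epsilon>)"
  unfolding soft_norm_def[abs_def] by (intro continuous_intros)

lemma continuous_soft_grad: "continuous_on UNIV (soft_grad \<epsilon> :: 'a::euclidean_space \<Rightarrow> 'a)"
  unfolding soft_grad_def[abs_def] by (intro continuous_intros continuous_soft_norm) (metis less_irrefl soft_norm_pos)

lemma continuous_soft_laplace: "continuous_on UNIV (soft_laplace \<epsilon> :: 'a::euclidean_space \<Rightarrow> real)"
  unfolding soft_laplace_def[abs_def]
  by (intro continuous_intros continuous_soft_norm) (metis less_irrefl soft_norm_pos power_not_zero)+

lemma norm_soft_grad: "norm (soft_grad \<epsilon> z) \<le> 1"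
  using soft_norm_ge(2)[of z] soft_norm_pos[of z] by (simp add: soft_grad_def field_simps)

text \<open>Since \<open>norm z\<close> is at most \<open>soft_norm \<epsilon> z\<close>, the
  subtracted term is at most \<open>1 / soft_norm \<epsilon> z\<close>. The lower bound gives the
  sign of the second order term; the upper bound by
  \<open>real DIM('a) / soft_norm \<epsilon> z\<close> survives
  \<open>\<epsilon> \<rightarrow> 0\<close> away from the origin, while the one by
  \<open>real DIM('a) / \<epsilon>\<close> serves for fixed \<open>\<epsilon>\<close>.\<close>

lemma soft_laplace_bounds:
  fixes z :: "'a::euclidean_space"
  shows "(real DIM('a) - 1) / soft_norm \<epsilon> z \<le> soft_laplace \<epsilon> z"
    and "0 \<le> soft_laplace \<epsilon> z" and "soft_laplace \<epsilon> z \<le> real DIM('a) / soft_norm \<epsilon> z"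
    and "soft_laplace \<epsilon> z \<le> real DIM('a) / \<epsilon>"
proof -
  let ?f = "soft_norm \<epsilon> z"
  have f: "0 < ?f" by (rule soft_norm_pos)
  have "(norm z)\<^sup>2 / ?f ^ 3 \<le> ?f\<^sup>2 / ?f ^ 3"
    using f by (intro divide_right_mono) (auto simp: soft_norm_sq)
  also have "\<dots> = 1 / ?f" using f by (simp add: power2_eq_square power3_eq_cube)
  finally have le: "(norm z)\<^sup>2 / ?f ^ 3 \<le> 1 / ?f" .
  show 1: "(real DIM('a) - 1) / ?f \<le> soft_laplace \<epsilon> z"
    using le by (simp add: soft_laplace_def diff_divide_distrib)
  have "1 \<le> real DIM('a)" by (simp add: Suc_leI)
  then have "0 \<le> (real DIM('a) - 1) / ?f" using f by simp
  then show "0 \<le> soft_laplace \<epsilon> z" using 1 by linarith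
  show 2: "soft_laplace \<epsilon> z \<le> real DIM('a) / ?f"
    using f by (simp add: soft_laplace_def)
  also have "\<dots> \<le> real DIM('a) / \<epsilon>" using soft_norm_ge(1)[of z] \<epsilon> by (intro divide_left_mono) auto
  finally show "soft_laplace \<epsilon> z \<le> real DIM('a) / \<epsilon>" .
qed

text \<open>Multiplied by \<open>soft_norm \<epsilon> z\<close>, the claim is Cauchy-Schwarz for the
  vectors \<open>(z, \<epsilon>)\<close> and \<open>(z + v, \<epsilon>)\<close> in one more
  dimension.\<close>

lemma soft_norm_convex: "soft_grad \<epsilon> z \<bullet> v \<le> soft_norm \<epsilon> (z + v) - soft_norm \<epsilon> z"
proof -
  let ?f = "soft_norm \<epsilon> z" and ?g = "soft_norm \<epsilon> (z + v)"
  have "z \<bullet> (z + v) + \<epsilon>\<^sup>2 \<le> ?f * ?g"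
  proof -
    have "z \<bullet> (z + v) + \<epsilon>\<^sup>2 \<le> norm z * norm (z + v) + \<epsilon> * \<epsilon>"
      using norm_cauchy_schwarz[of z "z + v"] by (simp add: power2_eq_square)
    also have "\<dots> \<le> ?f * ?g"
    proof (rule power2_le_imp_le)
      have "(a * b + \<epsilon> * \<epsilon>)\<^sup>2 \<le> (a\<^sup>2 + \<epsilon>\<^sup>2) * (b\<^sup>2 + \<epsilon>\<^sup>2)" for a b :: real
      proof -
        have "(a\<^sup>2 + \<epsilon>\<^sup>2) * (b\<^sup>2 + \<epsilon>\<^sup>2) - (a * b + \<epsilon> * \<epsilon>)\<^sup>2 = (a * \<epsilon> - b * \<epsilon>)\<^sup>2"
          by algebra
        then show ?thesis by (metis diff_ge_0_iff_ge zero_le_power2)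
      qed
      then show "(norm z * norm (z + v) + \<epsilon> * \<epsilon>)\<^sup>2 \<le> (?f * ?g)\<^sup>2"
        by (simp only: power_mult_distrib soft_norm_sq)
    qed (simp add: soft_norm_pos less_imp_le)
    finally show ?thesis .
  qed
  then have "z \<bullet> v \<le> ?f * ?g - ?f\<^sup>2"
    by (simp add: soft_norm_sq inner_add_right power2_norm_eq_inner)
  then have "z \<bullet> v \<le> (?g - ?f) * ?f" by (simp add: power2_eq_square algebra_simps)
  then show ?thesis
    using soft_norm_pos[of z] by (simp add: soft_grad_def divide_simps mult.commute)
qed

lemma soft_norm_lipschitz: "\<bar>soft_norm \<epsilon> z - soft_norm \<epsilon> w\<bar> \<le> norm (z - w)"
proof -
  have "soft_norm \<epsilon> z - soft_norm \<epsilon> w \<le> norm (z - w)" for z w :: 'a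
  proof -
    have "soft_norm \<epsilon> z - soft_norm \<epsilon> w \<le> soft_grad \<epsilon> z \<bullet> (z - w)"
      using soft_norm_convex[of z "w - z"] by (simp add: inner_diff_right)
    also have "\<dots> \<le> norm (soft_grad \<epsilon> z) * norm (z - w)" by (rule norm_cauchy_schwarz)
    also have "\<dots> \<le> 1 * norm (z - w)" by (intro mult_right_mono norm_soft_grad) simp
    finally show ?thesis by simp
  qed
  from this[of z w] this[of w z] show ?thesis by (simp add: norm_minus_commute abs_le_iff)
qed

text \<open>The increment \<open>w\<close> of the squared norm is a polynomial in \<open>v\<close>.
  Expanding \<open>sqrt (F\<^sup>2 + w)\<close> to second order in \<open>w\<close> leaves a
  remainder of exact algebraic form. The parts of \<open>w\<close> and \<open>w\<^sup>2\<close> of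
  order one and two in \<open>v\<close> are the gradient and Hessian terms; everything else has
  order three or four.\<close>

lemma soft_norm_taylor:
  "\<bar>soft_norm \<epsilon> (z + v) - soft_norm \<epsilon> z - soft_grad \<epsilon> z \<bullet> v - soft_hess \<epsilon> z v / 2\<bar>
    \<le> (2 / \<epsilon>\<^sup>2) * norm v ^ 3 + (1 / \<epsilon> ^ 3) * norm v ^ 4"
proof -
  define F where "F = soft_norm \<epsilon> z"
  define G where "G = soft_norm \<epsilon> (z + v)"
  define w where "w = 2 * (z \<bullet> v) + (norm v)\<^sup>2"
  have F: "\<epsilon> \<le> F" "0 < F" "norm z \<le> F" and G: "0 < G"
    using soft_norm_ge[of z] soft_norm_pos by (auto simp: F_def G_def)
  have w: "G\<^sup>2 - F\<^sup>2 = w"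
    by (simp add: F_def G_def soft_norm_sq w_def power2_norm_eq_inner inner_add_left inner_add_right inner_commute)
  then have GF: "(G - F) * (G + F) = w" by (simp add: power2_eq_square algebra_simps)
  have lip: "\<bar>G - F\<bar> \<le> norm v" using soft_norm_lipschitz[of "z + v" z] by (simp add: F_def G_def)
  have zv: "\<bar>z \<bullet> v\<bar> \<le> F * norm v"
    using Cauchy_Schwarz_ineq2[of z v] mult_right_mono[OF F(3), of "norm v"] by simp
  have wb: "\<bar>w\<bar> \<le> 2 * F * norm v + (norm v)\<^sup>2" 
    using zv abs_triangle_ineq[of "2 * (z \<bullet> v)" "(norm v)\<^sup>2"] by (simp add: w_def abs_mult mult.assoc)
  \<comment> \<open>\<open>F + w / (2 * F) - w\<^sup>2 / (8 * F ^ 3)\<close> is the second order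
    expansion of \<open>sqrt (F\<^sup>2 + w)\<close>, which is \<open>G\<close>; \<open>?q\<close>
    is the error of this expansion.\<close>
  let ?q = "(G - F) - w / (2 * F) + w\<^sup>2 / (8 * F ^ 3)"
  have qeq: "?q = (G - F)\<^sup>2 * w * (3 * F + G) / (8 * F ^ 3 * (G + F))"
  proof -
    have "?q * (8 * F ^ 3) = (G - F) * (8 * F ^ 3) - 4 * F\<^sup>2 * w + w\<^sup>2"
      using F by (simp add: field_simps power2_eq_square power3_eq_cube)
    also have "\<dots> = (G - F) ^ 3 * (3 * F + G)"
      unfolding GF[symmetric] by algebra
    also have "\<dots> = (G - F)\<^sup>2 * w * (3 * F + G) / (G + F)"
      using G F unfolding GF[symmetric] by (simp add: field_simps power2_eq_square power3_eq_cube)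
    finally have "?q * (8 * F ^ 3) = (G - F)\<^sup>2 * w * (3 * F + G) / (G + F)" .
    moreover have "8 * F ^ 3 \<noteq> 0" using F by simp
    ultimately have "?q = (G - F)\<^sup>2 * w * (3 * F + G) / (G + F) / (8 * F ^ 3)"
      by (rule eq_divide_imp[rotated])
    then show ?thesis by (simp only: divide_divide_eq_left mult.commute[of "G + F"])
  qed
  have "\<bar>?q\<bar> = (G - F)\<^sup>2 * \<bar>w\<bar> * ((3 * F + G) / (G + F)) / (8 * F ^ 3)"
  proof -
    have pos: "0 < 3 * F + G" "0 < 8 * F ^ 3 * (G + F)" using F G by auto
    have "\<bar>?q\<bar> = \<bar>(G - F)\<^sup>2 * w * (3 * F + G)\<bar> / (8 * F ^ 3 * (G + F))"
      by (simp only: qeq abs_divide) (simp only: abs_of_pos[OF pos(2)])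
    also have "\<bar>(G - F)\<^sup>2 * w * (3 * F + G)\<bar> = (G - F)\<^sup>2 * \<bar>w\<bar> * (3 * F + G)"
      by (simp only: abs_mult abs_of_pos[OF pos(1)] abs_power2)
    finally show ?thesis by (simp add: mult.commute)
  qed
  \<comment> \<open>The quotient \<open>(3 * F + G) / (G + F)\<close> is at most \<open>3\<close>,
    and \<open>G - F\<close> is at most \<open>norm v\<close> in modulus.\<close>
  also have "\<dots> \<le> (norm v)\<^sup>2 * (2 * F * norm v + (norm v)\<^sup>2) * 3 / (8 * F ^ 3)"
    using F G lip wb
    by (intro divide_right_mono mult_mono) (auto simp: field_simps abs_le_square_iff[symmetric])
  finally have q: "\<bar>?q\<bar> \<le> (norm v)\<^sup>2 * (2 * F * norm v + (norm v)\<^sup>2) * 3 / (8 * F ^ 3)" .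
  have id: "soft_norm \<epsilon> (z + v) - soft_norm \<epsilon> z - soft_grad \<epsilon> z \<bullet> v - soft_hess \<epsilon> z v / 2
      = ?q - (4 * (z \<bullet> v) * (norm v)\<^sup>2 + norm v ^ 4) / (8 * F ^ 3)"
    unfolding soft_grad_def soft_hess_def F_def[symmetric] G_def[symmetric] w_def
    using F by (simp add: field_simps power2_eq_square power3_eq_cube power4_eq_xxxx)
  have "\<bar>(4 * (z \<bullet> v) * (norm v)\<^sup>2 + norm v ^ 4) / (8 * F ^ 3)\<bar> \<le> (4 * (F * norm v) * (norm v)\<^sup>2 + norm v ^ 4) / (8 * F ^ 3)"
  proof -
    have "\<bar>4 * (z \<bullet> v) * (norm v)\<^sup>2 + norm v ^ 4\<bar> \<le> 4 * \<bar>z \<bullet> v\<bar> * (norm v)\<^sup>2 + norm v ^ 4"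
      by (rule order_trans[OF abs_triangle_ineq]) (simp add: abs_mult)
    also have "\<dots> \<le> 4 * (F * norm v) * (norm v)\<^sup>2 + norm v ^ 4"
      using zv by (intro add_right_mono mult_right_mono) auto
    finally show ?thesis using F by (simp add: divide_right_mono)
  qed
  with q have "\<bar>?q - (4 * (z \<bullet> v) * (norm v)\<^sup>2 + norm v ^ 4) / (8 * F ^ 3)\<bar>
    \<le> (norm v)\<^sup>2 * (2 * F * norm v + (norm v)\<^sup>2) * 3 / (8 * F ^ 3) + (4 * (F * norm v) * (norm v)\<^sup>2 + norm v ^ 4) / (8 * F ^ 3)"
    by linarith
  also have "\<dots> = (10 / 8) * (1 / F\<^sup>2) * norm v ^ 3 + (4 / 8) * (1 / F ^ 3) * norm v ^ 4"
    using F by (simp add: field_simps power2_eq_square power3_eq_cube power4_eq_xxxx)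
  also have "\<dots> \<le> 2 * (1 / \<epsilon>\<^sup>2) * norm v ^ 3 + 1 * (1 / \<epsilon> ^ 3) * norm v ^ 4"
    using F \<epsilon> by (intro add_mono mult_right_mono mult_mono divide_left_mono power_mono) auto
  finally show ?thesis unfolding id by simp
qed

lemma soft_hess_bound: "\<bar>soft_hess \<epsilon> z v\<bar> \<le> (norm v)\<^sup>2 / \<epsilon>"
proof -
  let ?f = "soft_norm \<epsilon> z"
  have f: "0 < ?f" by (rule soft_norm_pos)
  have "(z \<bullet> v)\<^sup>2 \<le> (norm z)\<^sup>2 * (norm v)\<^sup>2"
    using Cauchy_Schwarz_ineq[of z v] by (simp add: power2_norm_eq_inner)
  also have "\<dots> \<le> ?f\<^sup>2 * (norm v)\<^sup>2" by (intro mult_right_mono) (auto simp: soft_norm_sq)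
  finally have "(z \<bullet> v)\<^sup>2 / ?f ^ 3 \<le> ?f\<^sup>2 * (norm v)\<^sup>2 / ?f ^ 3" using f by (intro divide_right_mono) auto
  also have "\<dots> = (norm v)\<^sup>2 / ?f" using f by (simp add: power2_eq_square power3_eq_cube)
  finally have 1: "0 \<le> soft_hess \<epsilon> z v" by (simp add: soft_hess_def)
  have "soft_hess \<epsilon> z v \<le> (norm v)\<^sup>2 / ?f" using f by (simp add: soft_hess_def)
  also have "\<dots> \<le> (norm v)\<^sup>2 / \<epsilon>" using \<epsilon> soft_norm_ge(1)[of z] by (intro divide_left_mono) auto
  finally show ?thesis using 1 by simp
qed

lemma soft_hess_scaleR: "soft_hess \<epsilon> z (c *\<^sub>R v) = c\<^sup>2 * soft_hess \<epsilon> z v"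
  by (simp add: soft_hess_def power_mult_distrib algebra_simps)

lemma soft_hess_mean:
  fixes z :: "'a::euclidean_space"
  assumes "0 < h" shows "has_bochner_integral (gauss h) (soft_hess \<epsilon> z) (h * soft_laplace \<epsilon> z)"
proof -
  have "has_bochner_integral (gauss h) (\<lambda>v. (norm v)\<^sup>2 / soft_norm \<epsilon> z - (z \<bullet> v)\<^sup>2 / (soft_norm \<epsilon> z) ^ 3)
    (real DIM('a) * h / soft_norm \<epsilon> z - h * (norm z)\<^sup>2 / (soft_norm \<epsilon> z) ^ 3)"
    by (intro has_bochner_integral_diff has_bochner_integral_divide_zero gauss_norm2 gauss_second_moment assms)
  then show ?thesis by (simp add: soft_hess_def[abs_def] soft_laplace_def algebra_simps)
qed

end

section \<open>Ito's formula for step integrands\<close>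

lemma ennreal_mult_add:
  "0 \<le> x \<Longrightarrow> 0 \<le> y \<Longrightarrow> 0 \<le> z \<Longrightarrow> ennreal (x * y + z) = ennreal x * ennreal y + ennreal z"
  by (simp add: ennreal_mult)

lemma LINT_half_open:
  fixes f :: "real \<Rightarrow> 'b::{banach, second_countable_topology}"
  shows "(LINT s:{a..b}|lborel. f s) = (LINT s:{a..<b}|lborel. f s)"
  unfolding set_lebesgue_integral_def
  by (rule integral_discrete_difference[where X="{b}"]) (auto simp: indicator_def)

lemma LINT_partition:
  fixes f :: "real \<Rightarrow> 'b::{banach, second_countable_topology}"
  assumes c: "\<And>i. c i \<le> c (Suc i)" and f: "set_integrable lborel {c 0..<c N} f"
  shows "(\<Sum>i<N. LINT s:{c i..<c (Suc i)}|lborel. f s) = (LINT s:{c 0..<c N}|lborel. f s)"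
  using f
proof (induction N)
  case 0 then show ?case by (simp add: set_lebesgue_integral_def)
next
  case (Suc N)
  have c0: "c 0 \<le> c N" using lift_Suc_mono_le[of c, OF c] by simp
  have un: "{c 0..<c (Suc N)} = {c 0..<c N} \<union> {c N..<c (Suc N)}" using c0 c[of N] by auto
  have i: "set_integrable lborel {c 0..<c N} f" "set_integrable lborel {c N..<c (Suc N)} f"
    by (rule set_integrable_subset[OF Suc.prems]; use c0 c[of N] in auto)+
  show ?case unfolding un using Suc.IH[OF i(1)] i by (subst set_integral_Un) auto
qed

lemma abs_set_integral_le:
  fixes u v :: "real \<Rightarrow> real"
  assumes "set_integrable lborel A u" "set_integrable lborel A v" "\<And>s. s \<in> A \<Longrightarrow> \<bar>u s\<bar> \<le> v s"
  shows "\<bar>LINT s:A|lborel. u s\<bar> \<le> (LINT s:A|lborel. v s)"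
proof -
  have "norm (LINT s:A|lborel. u s) \<le> (LINT s|lborel. norm (indicator A s *\<^sub>R u s))"
    unfolding set_lebesgue_integral_def by (rule integral_norm_bound)
  also have "\<dots> \<le> (LINT s:A|lborel. v s)"
    unfolding set_lebesgue_integral_def
    by (rule integral_mono) (use assms in \<open>auto simp: set_integrable_def indicator_def abs_if[of "u _"] intro!: integrable_norm\<close>)
  finally show ?thesis by simp
qed

text \<open>The point \<open>p i\<close> is meant as the position after the martingale increment of
  the cell; the drift then leads from \<open>p i\<close> to \<open>y (c (Suc i))\<close>. For this
  second move convexity encloses the increment of \<open>soft_norm \<epsilon>\<close> between the
  gradients at its two ends, each applied to the drift increment. Both differ from the wanted
  integral by at most the integral of \<open>\<psi>\<close>, whose two terms belong to the two
  ends.\<close>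

lemma drift_estimate:
  fixes y b :: "real \<Rightarrow> 'a::euclidean_space" and p :: "nat \<Rightarrow> 'a" and n :: nat
  assumes \<epsilon>: "0 < \<epsilon>" and t: "0 \<le> t"
  defines "c \<equiv> \<lambda>i. min t (dyadic n i)" and "N \<equiv> Suc (dindex n t)"
  assumes y: "\<And>i. i < N \<Longrightarrow> y (c (Suc i)) = p i + (LINT s:{c i..<c (Suc i)}|lborel. b s)"
  defines "\<psi> \<equiv> \<lambda>s. norm (b s) * (norm (soft_grad \<epsilon> (p (dindex n s)) - soft_grad \<epsilon> (y s))
      + norm (soft_grad \<epsilon> (y (c (Suc (dindex n s)))) - soft_grad \<epsilon> (y s)))"
  assumes ib: "set_integrable lborel {0..t} b"
    and ig: "set_integrable lborel {0..t} (\<lambda>s. soft_grad \<epsilon> (y s) \<bullet> b s)"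
    and i\<psi>: "set_integrable lborel {0..t} \<psi>"
  shows "\<bar>(\<Sum>i<N. soft_norm \<epsilon> (y (c (Suc i))) - soft_norm \<epsilon> (p i)) - (LINT s:{0..t}|lborel. soft_grad \<epsilon> (y s) \<bullet> b s)\<bar>
    \<le> (LINT s:{0..t}|lborel. \<psi> s)"
proof -
  have c: "c i \<le> c (Suc i)" for i unfolding c_def using dyadic_less_Suc[of n i] by linarith
  have c0: "c 0 = 0" using t by (simp add: c_def)
  have cN: "c N = t" unfolding c_def N_def using less_dyadic_Suc_dindex[of t n] by simp
  have sub: "{c i..<c (Suc i)} \<subseteq> {0..t}" for i
  proof
    fix s assume "s \<in> {c i..<c (Suc i)}"
    moreover have "0 \<le> c i" "c (Suc i) \<le> t" using t by (auto simp: c_def)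
    ultimately show "s \<in> {0..t}" by simp
  qed
  note on_sub = set_integrable_subset[OF _ _ sub]
  have part: "(LINT s:{0..t}|lborel. f s) = (\<Sum>i<N. LINT s:{c i..<c (Suc i)}|lborel. f s)"
    if "set_integrable lborel {0..t} f" for f :: "real \<Rightarrow> real"
  proof -
    have "set_integrable lborel {0..<t} f" by (rule set_integrable_subset[OF that]) auto
    then show ?thesis using LINT_partition[of c N f, OF c] by (simp add: c0 cN LINT_half_open)
  qed
  have est: "\<bar>soft_norm \<epsilon> (y (c (Suc i))) - soft_norm \<epsilon> (p i) - (LINT s:{c i..<c (Suc i)}|lborel. soft_grad \<epsilon> (y s) \<bullet> b s)\<bar>
      \<le> (LINT s:{c i..<c (Suc i)}|lborel. \<psi> s)" if i: "i < N" for i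
  proof -
    let ?I = "{c i..<c (Suc i)}"
    let ?v = "LINT s:?I|lborel. b s"
    have di: "dindex n s = i" if "s \<in> ?I" for s
      using that by (intro dindex_eqI) (auto simp: c_def min_def split: if_splits)
    have ib': "set_integrable lborel ?I b" "set_integrable lborel ?I (\<lambda>s. soft_grad \<epsilon> (y s) \<bullet> b s)"
      "set_integrable lborel ?I \<psi>" by (rule on_sub; simp add: ib ig i\<psi>)+
    have one: "\<bar>g \<bullet> ?v - (LINT s:?I|lborel. soft_grad \<epsilon> (y s) \<bullet> b s)\<bar> \<le> (LINT s:?I|lborel. \<psi> s)"
      if g: "\<And>s. s \<in> ?I \<Longrightarrow> norm (g - soft_grad \<epsilon> (y s)) * norm (b s) \<le> \<psi> s" for g
    proof -
      have igb: "set_integrable lborel ?I (\<lambda>s. g \<bullet> b s)"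
        using ib'(1) integrable_inner_right[of g lborel "\<lambda>s. indicator ?I s *\<^sub>R b s"] by (simp add: set_integrable_def)
      have "g \<bullet> ?v = (LINT s:?I|lborel. g \<bullet> b s)"
        using integral_inner_right[of g lborel "\<lambda>s. indicator ?I s *\<^sub>R b s"] ib'(1)
        by (simp add: set_integrable_def set_lebesgue_integral_def)
      then have "g \<bullet> ?v - (LINT s:?I|lborel. soft_grad \<epsilon> (y s) \<bullet> b s)
          = (LINT s:?I|lborel. g \<bullet> b s - soft_grad \<epsilon> (y s) \<bullet> b s)"
        using igb ib'(2) by (simp add: set_integral_diff)
      also have "\<bar>\<dots>\<bar> \<le> (LINT s:?I|lborel. \<psi> s)"
      proof (rule abs_set_integral_le[OF set_integral_diff(1)[OF igb ib'(2)] ib'(3)])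
        fix s assume s: "s \<in> ?I"
        have "\<bar>g \<bullet> b s - soft_grad \<epsilon> (y s) \<bullet> b s\<bar> \<le> norm (g - soft_grad \<epsilon> (y s)) * norm (b s)"
          using Cauchy_Schwarz_ineq2[of "g - soft_grad \<epsilon> (y s)" "b s"] by (simp add: inner_diff_left)
        also have "\<dots> \<le> \<psi> s" by (rule g[OF s])
        finally show "\<bar>g \<bullet> b s - soft_grad \<epsilon> (y s) \<bullet> b s\<bar> \<le> \<psi> s" .
      qed
      finally show ?thesis .
    qed
    \<comment> \<open>The gradient at the start of the move bounds the increment from below, the
      gradient at its end from above.\<close>
    have 1: "soft_grad \<epsilon> (p i) \<bullet> ?v \<le> soft_norm \<epsilon> (y (c (Suc i))) - soft_norm \<epsilon> (p i)"
      unfolding y[OF i] by (rule soft_norm_convex[OF \<epsilon>])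
    have 2: "soft_norm \<epsilon> (y (c (Suc i))) - soft_norm \<epsilon> (p i) \<le> soft_grad \<epsilon> (y (c (Suc i))) \<bullet> ?v"
      using soft_norm_convex[OF \<epsilon>, of "y (c (Suc i))" "- ?v"] unfolding y[OF i] by simp
    have 3: "\<bar>soft_grad \<epsilon> (p i) \<bullet> ?v - (LINT s:?I|lborel. soft_grad \<epsilon> (y s) \<bullet> b s)\<bar> \<le> (LINT s:?I|lborel. \<psi> s)"
      by (rule one) (auto simp: \<psi>_def di mult.commute intro!: mult_left_mono)
    have 4: "\<bar>soft_grad \<epsilon> (y (c (Suc i))) \<bullet> ?v - (LINT s:?I|lborel. soft_grad \<epsilon> (y s) \<bullet> b s)\<bar> \<le> (LINT s:?I|lborel. \<psi> s)"
      by (rule one) (auto simp: \<psi>_def di mult.commute intro!: mult_left_mono)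
    show ?thesis using 1 2 3 4 by linarith
  qed
  have "\<bar>\<Sum>i<N. soft_norm \<epsilon> (y (c (Suc i))) - soft_norm \<epsilon> (p i) - (LINT s:{c i..<c (Suc i)}|lborel. soft_grad \<epsilon> (y s) \<bullet> b s)\<bar>
      \<le> (\<Sum>i<N. LINT s:{c i..<c (Suc i)}|lborel. \<psi> s)"
    by (rule order_trans[OF sum_abs sum_mono]) (simp add: est)
  then show ?thesis unfolding part[OF ig] part[OF i\<psi>] sum_subtractf .
qed

section \<open>Moments of increments and the quadratic variation\<close>

context brownian_basis
begin

text \<open>The coordinates are scalar integrals with integrands
  \<open>\<sigma> s \<omega> *\<^sub>R b\<close>, so that the results on
  \<open>step_integral\<close> cover the vector integral of a scalar integrand.\<close>

definition vector_step_integral :: "nat \<Rightarrow> (real \<Rightarrow> 'w \<Rightarrow> real) \<Rightarrow> real \<Rightarrow> 'w \<Rightarrow> 'a" where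
  "vector_step_integral n \<sigma> t \<omega> = (\<Sum>b\<in>Basis. step_integral n (\<lambda>s \<omega>. \<sigma> s \<omega> *\<^sub>R b) W t \<omega> *\<^sub>R b)"

lemma vector_step_integral_one_step:
  assumes "0 \<le> t"
  shows "vector_step_integral n \<sigma> (min t (dyadic n (Suc i))) \<omega> - vector_step_integral n \<sigma> (min t (dyadic n i)) \<omega>
    = \<sigma> (dyadic n i) \<omega> *\<^sub>R (W (min t (dyadic n (Suc i))) \<omega> - W (min t (dyadic n i)) \<omega>)"
proof -
  let ?D = "W (min t (dyadic n (Suc i))) \<omega> - W (min t (dyadic n i)) \<omega>"
  have "vector_step_integral n \<sigma> (min t (dyadic n (Suc i))) \<omega> - vector_step_integral n \<sigma> (min t (dyadic n i)) \<omega>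
      = (\<Sum>b\<in>Basis. (step_integral n (\<lambda>s \<omega>. \<sigma> s \<omega> *\<^sub>R b) W (min t (dyadic n (Suc i))) \<omega>
          - step_integral n (\<lambda>s \<omega>. \<sigma> s \<omega> *\<^sub>R b) W (min t (dyadic n i)) \<omega>) *\<^sub>R b)"
    by (simp add: vector_step_integral_def sum_subtractf scaleR_diff_left)
  also have "\<dots> = (\<Sum>b\<in>Basis. (\<sigma> (dyadic n i) \<omega> * (?D \<bullet> b)) *\<^sub>R b)"
    unfolding step_integral_one_step[OF assms] by (simp add: inner_commute)
  also have "\<dots> = \<sigma> (dyadic n i) \<omega> *\<^sub>R (\<Sum>b\<in>Basis. (?D \<bullet> b) *\<^sub>R b)" by (simp add: scaleR_sum_right)
  finally show ?thesis by (simp only: euclidean_representation)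
qed

lemma vector_step_integral_refine:
  assumes "stepwise n \<sigma>" "n \<le> k"
  shows "vector_step_integral k \<sigma> t \<omega> = vector_step_integral n \<sigma> t \<omega>"
proof -
  have "step_integral k (\<lambda>s \<omega>. \<sigma> s \<omega> *\<^sub>R b) W t \<omega> = step_integral n (\<lambda>s \<omega>. \<sigma> s \<omega> *\<^sub>R b) W t \<omega>" for b
    by (rule step_integral_refine[OF _ assms(2)])
      (rule stepwiseD(1)[OF stepwise_scaleR[OF assms(1) stepwise_const]])
  then show ?thesis by (simp add: vector_step_integral_def)
qed

lemma increment_moments:
  assumes "0 \<le> s" "s \<le> t"
  shows "(\<integral>\<^sup>+\<omega>. ennreal ((norm (W t \<omega> - W s \<omega>))\<^sup>2) \<partial>M) \<le> ennreal (real DIM('a) * (t - s))"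
    and "(\<integral>\<^sup>+\<omega>. ennreal (norm (W t \<omega> - W s \<omega>) ^ 4) \<partial>M) \<le> ennreal (3 * (real DIM('a))\<^sup>2 * (t - s)\<^sup>2)"
proof -
  have "(\<integral>\<^sup>+\<omega>. ennreal ((norm (W t \<omega> - W s \<omega>))\<^sup>2) \<partial>M) \<le> ennreal (real DIM('a) * (t - s)) \<and>
    (\<integral>\<^sup>+\<omega>. ennreal (norm (W t \<omega> - W s \<omega>) ^ 4) \<partial>M) \<le> ennreal (3 * (real DIM('a))\<^sup>2 * (t - s)\<^sup>2)"
  proof (cases "s = t")
    case False
    then have st: "s < t" using assms by simp
    have [measurable]: "(\<lambda>\<omega>. W t \<omega> - W s \<omega>) \<in> borel_measurable M"
      using assms by (intro borel_measurable_diff W_measurable) auto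
    have eq: "(\<integral>\<^sup>+\<omega>. f (W t \<omega> - W s \<omega>) \<partial>M) = (\<integral>\<^sup>+z. f z \<partial>gauss (t - s))" if "f \<in> borel_measurable borel" for f
      unfolding distr_increment[OF assms(1) st, symmetric] using that by (subst nn_integral_distr) auto
    have "(\<integral>\<^sup>+z. ennreal ((norm (z::'a))\<^sup>2) \<partial>gauss (t - s)) = ennreal (real DIM('a) * (t - s))"
      using gauss_norm2[of "t - s", where 'a='a] st by (subst nn_integral_eq_integral) (auto simp: has_bochner_integral_iff)
    then show ?thesis
      using gauss_norm4[of "t - s", where 'a='a] st eq[of "\<lambda>z. ennreal ((norm z)\<^sup>2)"] eq[of "\<lambda>z. ennreal ((norm z) ^ 4)"]
      by simp
  qed simp
  then show "(\<integral>\<^sup>+\<omega>. ennreal ((norm (W t \<omega> - W s \<omega>))\<^sup>2) \<partial>M) \<le> ennreal (real DIM('a) * (t - s))"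
    "(\<integral>\<^sup>+\<omega>. ennreal (norm (W t \<omega> - W s \<omega>) ^ 4) \<partial>M) \<le> ennreal (3 * (real DIM('a))\<^sup>2 * (t - s)\<^sup>2)" by blast+
qed

text \<open>Third moments are interpolated between second and fourth ones by
  \<open>x ^ 3 \<le> \<delta> * x\<^sup>2 + x ^ 4 / \<delta>\<close>. With
  \<open>\<delta> = sqrt h\<close> both parts have order \<open>(t - s) * sqrt h\<close>, so the sum
  over all cells vanishes with the mesh.\<close>

lemma cubic_remainder:
  fixes A B \<delta> h :: real
  assumes st: "0 \<le> s" "s \<le> t" "t - s \<le> h" and AB: "0 \<le> A" "0 \<le> B" and \<delta>: "0 < \<delta>" "\<delta>\<^sup>2 = h"
  shows "(\<integral>\<^sup>+\<omega>. ennreal (A * norm (W t \<omega> - W s \<omega>) ^ 3 + B * norm (W t \<omega> - W s \<omega>) ^ 4) \<partial>M)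
    \<le> ennreal ((t - s) * (A * \<delta> * (real DIM('a) + 3 * (real DIM('a))\<^sup>2) + B * (3 * (real DIM('a))\<^sup>2) * h))"
proof -
  let ?d = "real DIM('a)"
  have [measurable]: "W t \<in> borel_measurable M" "W s \<in> borel_measurable M"
    using st by (auto intro: W_measurable)
  have pw: "A * x ^ 3 + B * x ^ 4 \<le> (A * \<delta>) * x\<^sup>2 + (A / \<delta> + B) * x ^ 4" if "0 \<le> x" for x :: real
  proof -
    have "0 \<le> x\<^sup>2 * (x - \<delta>)\<^sup>2 + x ^ 3 * \<delta>" using that \<delta> by simp
    then have "x ^ 3 * \<delta> \<le> \<delta>\<^sup>2 * x\<^sup>2 + x ^ 4" by (simp add: power2_eq_square power3_eq_cube power4_eq_xxxx algebra_simps)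
    then have "x ^ 3 \<le> \<delta> * x\<^sup>2 + x ^ 4 / \<delta>" using \<delta> by (simp add: field_simps power2_eq_square)
    from mult_left_mono[OF this AB(1)] show ?thesis by (simp add: algebra_simps)
  qed
  have "(\<integral>\<^sup>+\<omega>. ennreal (A * norm (W t \<omega> - W s \<omega>) ^ 3 + B * norm (W t \<omega> - W s \<omega>) ^ 4) \<partial>M)
    \<le> (\<integral>\<^sup>+\<omega>. ennreal (A * \<delta>) * ennreal ((norm (W t \<omega> - W s \<omega>))\<^sup>2) + ennreal (A / \<delta> + B) * ennreal (norm (W t \<omega> - W s \<omega>) ^ 4) \<partial>M)"
    using AB \<delta> by (intro nn_integral_mono)
      (simp add: ennreal_mult'[symmetric] ennreal_plus[symmetric] pw del: ennreal_plus)
  also have "\<dots> = ennreal (A * \<delta>) * (\<integral>\<^sup>+\<omega>. ennreal ((norm (W t \<omega> - W s \<omega>))\<^sup>2) \<partial>M)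
      + ennreal (A / \<delta> + B) * (\<integral>\<^sup>+\<omega>. ennreal (norm (W t \<omega> - W s \<omega>) ^ 4) \<partial>M)"
    by (simp add: nn_integral_add nn_integral_cmult)
  also have "\<dots> \<le> ennreal (A * \<delta>) * ennreal (?d * (t - s)) + ennreal (A / \<delta> + B) * ennreal (3 * ?d\<^sup>2 * (t - s)\<^sup>2)"
    by (intro add_mono mult_left_mono increment_moments st) auto
  also have "\<dots> = ennreal (A * \<delta> * (?d * (t - s)) + (A / \<delta> + B) * (3 * ?d\<^sup>2 * (t - s)\<^sup>2))"
    using AB \<delta> st by (simp add: ennreal_mult'[symmetric] ennreal_plus[symmetric] del: ennreal_plus)
  also have "\<dots> \<le> ennreal ((t - s) * (A * \<delta> * (?d + 3 * ?d\<^sup>2) + B * (3 * ?d\<^sup>2) * h))"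
  proof (rule ennreal_leI)
    have "(A / \<delta> + B) * (3 * ?d\<^sup>2 * (t - s)\<^sup>2) \<le> (A / \<delta> + B) * (3 * ?d\<^sup>2 * ((t - s) * h))"
      using AB \<delta> st by (intro mult_left_mono) (auto simp: power2_eq_square intro!: mult_left_mono)
    also have "\<dots> = (t - s) * (A * \<delta> * (3 * ?d\<^sup>2) + B * (3 * ?d\<^sup>2) * h)"
      using \<delta>(1) unfolding \<delta>(2)[symmetric] by (simp add: field_simps power2_eq_square)
    finally show "A * \<delta> * (?d * (t - s)) + (A / \<delta> + B) * (3 * ?d\<^sup>2 * (t - s)\<^sup>2) \<le> (t - s) * (A * \<delta> * (?d + 3 * ?d\<^sup>2) + B * (3 * ?d\<^sup>2) * h)"
      by (simp add: algebra_simps)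
  qed
  finally show ?thesis .
qed

text \<open>The deviation of the Hessian term from its conditional mean is a martingale difference.
  Its variance on a cell has the order of the squared length of the cell, so by orthogonality the
  variance of the sum has the order of the mesh.\<close>

lemma quadratic_variation:
  assumes \<epsilon>: "0 < \<epsilon>" and \<sigma>: "stepwise n \<sigma>" and K: "\<And>s \<omega>. 0 \<le> s \<Longrightarrow> \<omega> \<in> space M \<Longrightarrow> norm (\<sigma> s \<omega>) \<le> K"
    and Y: "\<And>s. 0 \<le> s \<Longrightarrow> Y s \<in> borel_measurable (F s)" and t: "0 \<le> t"
  defines "c \<equiv> \<lambda>i. min t (dyadic n i)"
  defines "D \<equiv> \<lambda>i \<omega>. (\<sigma> (dyadic n i) \<omega>)\<^sup>2 / 2 * (soft_hess \<epsilon> (Y (dyadic n i) \<omega>) (W (c (Suc i)) \<omega> - W (c i) \<omega>)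
      - (c (Suc i) - c i) * soft_laplace \<epsilon> (Y (dyadic n i) \<omega>))"
  shows "sqn (\<lambda>\<omega>. \<Sum>i<N. D i \<omega>) \<le> ennreal (2 * K ^ 4 * (real DIM('a))\<^sup>2 / \<epsilon>\<^sup>2 * t / 2 ^ n)"
    and "(\<lambda>\<omega>. \<Sum>i<N. D i \<omega>) \<in> borel_measurable M"
proof -
  let ?d = "real DIM('a)" and ?C = "2 * K ^ 4 * (real DIM('a))\<^sup>2 / \<epsilon>\<^sup>2"
  have c: "0 \<le> c i" "c i \<le> c (Suc i)" for i
    using t dyadic_less_Suc[of n i] by (auto simp: c_def)
  have [measurable]: "soft_laplace \<epsilon> \<in> borel_measurable (borel :: 'a measure)" "soft_norm \<epsilon> \<in> borel_measurable (borel :: 'a measure)"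
    using continuous_soft_laplace[OF \<epsilon>] continuous_soft_norm[OF \<epsilon>] by (auto intro: borel_measurable_continuous_onI)
  have *: "D i \<in> borel_measurable (F (c (Suc i))) \<and> integrable M (\<lambda>\<omega>. (D i \<omega>)\<^sup>2) \<and>
    (\<integral>\<omega>. (D i \<omega>)\<^sup>2 \<partial>M) \<le> ?C * (c (Suc i) - c i)\<^sup>2 \<and>
    (\<forall>U \<in> borel_measurable (F (c i)). integrable M (\<lambda>\<omega>. (U \<omega>)\<^sup>2) \<longrightarrow> (\<integral>\<omega>. U \<omega> * D i \<omega> \<partial>M) = 0)" for i
  proof (cases "dyadic n i < t")
    case False
    then have "c i = t" "c (Suc i) = t" using dyadic_less_Suc[of n i] by (auto simp: c_def)
    then have "D i = (\<lambda>_. 0)" by (simp add: D_def soft_hess_def fun_eq_iff)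
    then show ?thesis using \<open>c i = t\<close> \<open>c (Suc i) = t\<close> by simp
  next
    case True
    then have ci: "c i = dyadic n i" and lt: "c i < c (Suc i)" using dyadic_less_Suc[of n i] by (auto simp: c_def)
    let ?h = "c (Suc i) - c i"
    have h: "0 < ?h" using lt by simp
    have \<sigma>F[measurable]: "\<sigma> (c i) \<in> borel_measurable (F (c i))" by (rule stepwiseD(2)[OF \<sigma> c(1)])
    have YF[measurable]: "Y (c i) \<in> borel_measurable (F (c i))" by (rule Y[OF c(1)])
    let ?q = "\<lambda>(\<omega>, z). (\<sigma> (c i) \<omega>)\<^sup>2 / 2 * (soft_hess \<epsilon> (Y (c i) \<omega>) z - ?h * soft_laplace \<epsilon> (Y (c i) \<omega>))"
    have qm: "?q \<in> borel_measurable (F (c i) \<Otimes>\<^sub>M borel)"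
      unfolding soft_hess_def[abs_def] by measurable
    have Dq: "D i \<omega> = ?q (\<omega>, W (c (Suc i)) \<omega> - W (c i) \<omega>)" for \<omega> by (simp add: D_def ci)
    have DF: "D i \<in> borel_measurable (F (c (Suc i)))"
    proof -
      have "(\<lambda>\<omega>. W (c (Suc i)) \<omega> - W (c i) \<omega>) \<in> borel_measurable (F (c (Suc i)))"
        by (rule W_increment_adapted) (use c in auto)
      moreover have "(\<lambda>\<omega>. \<omega>) \<in> measurable (F (c (Suc i))) (F (c i))"
        by (rule measurable_F_mono[OF c]) simp
      ultimately have "(\<lambda>\<omega>. (\<omega>, W (c (Suc i)) \<omega> - W (c i) \<omega>)) \<in> measurable (F (c (Suc i))) (F (c i) \<Otimes>\<^sub>M borel)"
        by (intro measurable_Pair)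
      from measurable_compose[OF this qm] show ?thesis unfolding Dq[abs_def] .
    qed
    have DM: "D i \<in> borel_measurable M" by (rule measurable_F_M[OF c(1) DF])
    \<comment> \<open>The square of a sum is split at the cost of a factor \<open>2\<close>. The
      fourth moment \<open>3 * ?d\<^sup>2 * ?h\<^sup>2\<close> and the constant
      \<open>?d\<^sup>2 * ?h\<^sup>2\<close>, both weighted with
      \<open>K ^ 4 / (2 * \<epsilon>\<^sup>2)\<close>, add up to
      \<open>?C * ?h\<^sup>2\<close>.\<close>
    have q2: "ennreal ((?q (\<omega>, z))\<^sup>2) \<le> ennreal (K ^ 4 / (2 * \<epsilon>\<^sup>2)) * ennreal (norm z ^ 4) + ennreal (K ^ 4 * ?d\<^sup>2 * ?h\<^sup>2 / (2 * \<epsilon>\<^sup>2))"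
      if \<omega>: "\<omega> \<in> space M" for \<omega> and z :: 'a
    proof -
      have sK: "(\<sigma> (c i) \<omega>)\<^sup>2 \<le> K\<^sup>2" using K[OF c(1) \<omega>, of i] by (metis abs_ge_zero power2_abs power_mono real_norm_def)
      have "\<bar>soft_hess \<epsilon> (Y (c i) \<omega>) z - ?h * soft_laplace \<epsilon> (Y (c i) \<omega>)\<bar> \<le> (norm z)\<^sup>2 / \<epsilon> + ?h * (?d / \<epsilon>)"
      proof -
        have "\<bar>?h * soft_laplace \<epsilon> (Y (c i) \<omega>)\<bar> \<le> ?h * (?d / \<epsilon>)"
          using mult_left_mono[OF soft_laplace_bounds(4)[OF \<epsilon>, of "Y (c i) \<omega>"], of ?h]
            mult_nonneg_nonneg[OF less_imp_le[OF h] soft_laplace_bounds(2)[OF \<epsilon>, of "Y (c i) \<omega>"]] h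
          by (simp only: abs_of_nonneg less_imp_le)
        then show ?thesis using soft_hess_bound[OF \<epsilon>, of "Y (c i) \<omega>" z] by linarith
      qed
      then have "\<bar>?q (\<omega>, z)\<bar> \<le> K\<^sup>2 / 2 * ((norm z)\<^sup>2 / \<epsilon> + ?h * (?d / \<epsilon>))"
        using sK unfolding split_conv abs_mult by (intro mult_mono) auto
      then have "(?q (\<omega>, z))\<^sup>2 \<le> (K\<^sup>2 / 2 * ((norm z)\<^sup>2 / \<epsilon> + ?h * (?d / \<epsilon>)))\<^sup>2"
        by (rule abs_le_square_iff[THEN iffD1, OF order_trans]) (rule abs_ge_self)
      also have "\<dots> = K ^ 4 / 4 * ((norm z)\<^sup>2 / \<epsilon> + ?h * (?d / \<epsilon>))\<^sup>2"
        by (simp only: power_mult_distrib power_divide power_mult[symmetric]) simp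
      also have "\<dots> \<le> K ^ 4 / 4 * (2 * ((norm z)\<^sup>2 / \<epsilon>)\<^sup>2 + 2 * (?h * (?d / \<epsilon>))\<^sup>2)"
        by (intro mult_left_mono) (use sum_squares_bound[of "(norm z)\<^sup>2 / \<epsilon>" "?h * (?d / \<epsilon>)"] in \<open>simp_all only: power2_sum, auto\<close>)
      also have "\<dots> = K ^ 4 / (2 * \<epsilon>\<^sup>2) * norm z ^ 4 + K ^ 4 * ?d\<^sup>2 * ?h\<^sup>2 / (2 * \<epsilon>\<^sup>2)"
        by (simp only: power_mult_distrib power_divide power_mult[symmetric]) (simp add: field_simps)
      finally have "ennreal ((?q (\<omega>, z))\<^sup>2) \<le> ennreal (K ^ 4 / (2 * \<epsilon>\<^sup>2) * norm z ^ 4 + K ^ 4 * ?d\<^sup>2 * ?h\<^sup>2 / (2 * \<epsilon>\<^sup>2))"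
        by (rule ennreal_leI)
      also have "\<dots> = ennreal (K ^ 4 / (2 * \<epsilon>\<^sup>2)) * ennreal (norm z ^ 4) + ennreal (K ^ 4 * ?d\<^sup>2 * ?h\<^sup>2 / (2 * \<epsilon>\<^sup>2))"
        by (rule ennreal_mult_add) (auto intro!: mult_nonneg_nonneg divide_nonneg_nonneg)
      finally show ?thesis .
    qed
    have "(\<integral>\<^sup>+\<omega>. ennreal ((D i \<omega>)\<^sup>2) \<partial>M) \<le> (\<integral>\<^sup>+\<omega>. ennreal (K ^ 4 / (2 * \<epsilon>\<^sup>2)) * ennreal (norm (W (c (Suc i)) \<omega> - W (c i) \<omega>) ^ 4) + ennreal (K ^ 4 * ?d\<^sup>2 * ?h\<^sup>2 / (2 * \<epsilon>\<^sup>2)) \<partial>M)"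
      unfolding Dq by (intro nn_integral_mono q2)
    also have "\<dots> = ennreal (K ^ 4 / (2 * \<epsilon>\<^sup>2)) * (\<integral>\<^sup>+\<omega>. ennreal (norm (W (c (Suc i)) \<omega> - W (c i) \<omega>) ^ 4) \<partial>M) + ennreal (K ^ 4 * ?d\<^sup>2 * ?h\<^sup>2 / (2 * \<epsilon>\<^sup>2))"
    proof -
      have [measurable]: "W (c (Suc i)) \<in> borel_measurable M" "W (c i) \<in> borel_measurable M" by (auto intro: W_measurable c)
      show ?thesis by (simp add: nn_integral_add nn_integral_cmult emeasure_space_1)
    qed
    also have "\<dots> \<le> ennreal (K ^ 4 / (2 * \<epsilon>\<^sup>2)) * ennreal (3 * ?d\<^sup>2 * ?h\<^sup>2) + ennreal (K ^ 4 * ?d\<^sup>2 * ?h\<^sup>2 / (2 * \<epsilon>\<^sup>2))"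
      by (intro add_right_mono mult_left_mono increment_moments c) auto
    also have "\<dots> = ennreal (K ^ 4 / (2 * \<epsilon>\<^sup>2) * (3 * ?d\<^sup>2 * ?h\<^sup>2) + K ^ 4 * ?d\<^sup>2 * ?h\<^sup>2 / (2 * \<epsilon>\<^sup>2))"
      by (rule ennreal_mult_add[symmetric]) (auto intro!: mult_nonneg_nonneg divide_nonneg_nonneg)
    also have "K ^ 4 / (2 * \<epsilon>\<^sup>2) * (3 * ?d\<^sup>2 * ?h\<^sup>2) + K ^ 4 * ?d\<^sup>2 * ?h\<^sup>2 / (2 * \<epsilon>\<^sup>2) = ?C * ?h\<^sup>2"
      using \<epsilon> by (simp add: field_simps)
    finally have nn: "(\<integral>\<^sup>+\<omega>. ennreal ((D i \<omega>)\<^sup>2) \<partial>M) \<le> ennreal (?C * ?h\<^sup>2)" .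
    have int: "integrable M (\<lambda>\<omega>. (D i \<omega>)\<^sup>2)"
      by (rule integrableI_bounded) (use DM nn in \<open>auto simp: le_less_trans[OF _ ennreal_less_top]\<close>)
    have "ennreal (\<integral>\<omega>. (D i \<omega>)\<^sup>2 \<partial>M) \<le> ennreal (?C * ?h\<^sup>2)"
      using nn int by (subst nn_integral_eq_integral[symmetric]) auto
    then have le: "(\<integral>\<omega>. (D i \<omega>)\<^sup>2 \<partial>M) \<le> ?C * ?h\<^sup>2"
      by (subst (asm) ennreal_le_iff) (auto intro!: mult_nonneg_nonneg divide_nonneg_nonneg)
    have "(\<integral>\<omega>. U \<omega> * D i \<omega> \<partial>M) = 0" if U: "U \<in> borel_measurable (F (c i))" "integrable M (\<lambda>\<omega>. (U \<omega>)\<^sup>2)" for U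
      unfolding Dq
    proof (rule increment_orthogonal[OF c(1) lt qm _ _ U])
      show "integrable M (\<lambda>\<omega>. (?q (\<omega>, W (c (Suc i)) \<omega> - W (c i) \<omega>))\<^sup>2)" using int unfolding Dq .
      fix \<omega>
      interpret G: prob_space "gauss ?h :: 'a measure" by (rule prob_space_gauss[OF h])
      have "has_bochner_integral (gauss ?h) (\<lambda>z. (\<sigma> (c i) \<omega>)\<^sup>2 / 2 * (soft_hess \<epsilon> (Y (c i) \<omega>) z - ?h * soft_laplace \<epsilon> (Y (c i) \<omega>)))
          ((\<sigma> (c i) \<omega>)\<^sup>2 / 2 * (?h * soft_laplace \<epsilon> (Y (c i) \<omega>) - ?h * soft_laplace \<epsilon> (Y (c i) \<omega>)))"
        using has_bochner_integral_diff[OF soft_hess_mean[OF \<epsilon> h, of "Y (c i) \<omega>"], of "\<lambda>_. ?h * soft_laplace \<epsilon> (Y (c i) \<omega>)" "?h * soft_laplace \<epsilon> (Y (c i) \<omega>)"]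
          G.prob_space
        by (intro has_bochner_integral_mult_right) (simp add: has_bochner_integral_iff)
      then show "(\<integral>z. ?q (\<omega>, z) \<partial>gauss ?h) = 0" by (simp add: has_bochner_integral_iff)
    qed
    with DF int le show ?thesis by blast
  qed
  then have md: "mart_diff c D" using c unfolding mart_diff_def by blast
  note s = mart_diff_sum[OF md, of N]
  show "(\<lambda>\<omega>. \<Sum>i<N. D i \<omega>) \<in> borel_measurable M" using s measurable_F_M[OF c(1)] by blast
  have C: "0 \<le> ?C" by (auto intro!: mult_nonneg_nonneg divide_nonneg_nonneg)
  have "sqn (\<lambda>\<omega>. \<Sum>i<N. D i \<omega>) = ennreal (\<integral>\<omega>. (\<Sum>i<N. D i \<omega>)\<^sup>2 \<partial>M)"
    unfolding sqn_def by (rule nn_integral_eq_integral) (use s in auto)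
  also have "(\<integral>\<omega>. (\<Sum>i<N. D i \<omega>)\<^sup>2 \<partial>M) = (\<Sum>i<N. \<integral>\<omega>. (D i \<omega>)\<^sup>2 \<partial>M)" using s by blast
  also have "\<dots> \<le> (\<Sum>i<N. ?C / 2 ^ n * (c (Suc i) - c i))"
  proof (rule sum_mono)
    fix i
    have "(0::real) \<le> 1 / 2 ^ n" by simp
    then have "c (Suc i) - c i \<le> 1 / 2 ^ n" using dyadic_Suc[of n i] unfolding c_def by linarith
    then have "(c (Suc i) - c i)\<^sup>2 \<le> 1 / 2 ^ n * (c (Suc i) - c i)"
      using c(2)[of i] unfolding power2_eq_square by (intro mult_right_mono) auto
    then have "?C * (c (Suc i) - c i)\<^sup>2 \<le> ?C * (1 / 2 ^ n * (c (Suc i) - c i))" by (rule mult_left_mono[OF _ C])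
    with *[of i] show "(\<integral>\<omega>. (D i \<omega>)\<^sup>2 \<partial>M) \<le> ?C / 2 ^ n * (c (Suc i) - c i)" by simp
  qed
  also have "\<dots> = ?C / 2 ^ n * (c N - c 0)" by (simp only: sum_distrib_left[symmetric] sum_lessThan_telescope)
  also have "\<dots> \<le> ?C / 2 ^ n * t" using t C by (intro mult_left_mono) (auto simp: c_def)
  finally show "sqn (\<lambda>\<omega>. \<Sum>i<N. D i \<omega>) \<le> ennreal (?C * t / 2 ^ n)" by (simp add: ennreal_leI)
qed

end

context stochastic_basis
begin

lemma set_integrable_time:
  fixes f :: "real \<Rightarrow> 'b::{banach, second_countable_topology}"
  shows "set_integrable lborel {0..t} f \<longleftrightarrow> integrable (restrict_space lborel {0..t}) f"
  unfolding set_integrable_def by (rule integrable_restrict_space[symmetric]) simp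

lemma tint_eq_LINT: "tint t R \<omega> = (LINT s:{0..t}|lborel. R s \<omega>)"
  unfolding tint_def set_lebesgue_integral_def by (rule integral_restrict_space) simp

lemma tint_stepwise:
  assumes "0 \<le> t" and "\<And>s. 0 \<le> s \<Longrightarrow> R s \<omega> = R (dfloor n s) \<omega>"
  shows "tint t R \<omega> = (\<Sum>i<Suc (dindex n t). (min t (dyadic n (Suc i)) - min t (dyadic n i)) * R (dyadic n i) \<omega>)"
proof -
  have "has_bochner_integral lborel (\<lambda>s. indicator {0..t} s *\<^sub>R R s \<omega>)
    (\<Sum>i<Suc (dindex n t). (min t (dyadic n (Suc i)) - min t (dyadic n i)) *\<^sub>R R (dyadic n i) \<omega>)"
    by (rule has_integral_dyadic[OF assms(1)]) (rule assms(2))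
  then show ?thesis
    by (simp add: tint_eq_LINT set_lebesgue_integral_def has_bochner_integral_iff del: sum.lessThan_Suc)
qed

lemma tendsto_0_ennrealD:
  assumes "(f \<longlongrightarrow> (0::ennreal)) sequentially" "0 < \<eta>"
  shows "\<forall>\<^sub>F n in sequentially. f n \<le> ennreal \<eta>"
  using order_tendstoD(2)[OF assms(1), of "ennreal \<eta>"] assms(2)
  by (auto elim: eventually_mono)

end

lemma nn_integral_add4:
  assumes "f \<in> borel_measurable M" "g \<in> borel_measurable M" "h \<in> borel_measurable M" "k \<in> borel_measurable M"
  shows "(\<integral>\<^sup>+x. f x + g x + h x + k x \<partial>M) = (\<integral>\<^sup>+x. f x \<partial>M) + (\<integral>\<^sup>+x. g x \<partial>M) + (\<integral>\<^sup>+x. h x \<partial>M) + (\<integral>\<^sup>+x. k x \<partial>M)"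
  using assms by (simp add: nn_integral_add)

lemma LINT_Icc_diff:
  fixes b :: "real \<Rightarrow> 'b::{banach, second_countable_topology}"
  assumes "0 \<le> u" "u \<le> v" "v \<le> t" and b: "set_integrable lborel {0..t} b"
  shows "(LINT s:{0..v}|lborel. b s) - (LINT s:{0..u}|lborel. b s) = (LINT s:{u..<v}|lborel. b s)"
proof -
  have un: "{0..<v} = {0..<u} \<union> {u..<v}" using assms by auto
  have "set_integrable lborel {0..<u} b" "set_integrable lborel {u..<v} b"
    by (rule set_integrable_subset[OF b]; use assms in auto)+
  then show ?thesis unfolding LINT_half_open un by (subst set_integral_Un) auto
qed

section \<open>The formula along the grid\<close>

context brownian_basis
begin

text \<open>After telescoping four errors remain: the drift (\<open>\<psi>\<close>), the Taylor
  remainder (\<open>C\<close>), the fluctuation of the Hessian term (\<open>D\<close>) and the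
  Riemann sum for the Laplacian term. Each tends to \<open>0\<close> in mean of first order, while
  the integrands frozen at grid points converge in \<open>qnorm\<close>; these are the two
  conditions of \<open>l2int_closure\<close>.\<close>

lemma ito_step_integrand:
  assumes \<epsilon>: "0 < \<epsilon>" and t: "0 \<le> t" and \<sigma>: "stepwise n0 \<sigma>" and Y: "continuous_adapted M F Y"
    and b: "path_measurable b" and bfin: "(\<integral>\<^sup>+z. ennreal (norm (b (fst z) (snd z))) \<partial>Q t) < \<infinity>"
    and decomp: "AE \<omega> in M. \<forall>u\<in>{0..t}. Y u \<omega> = Y 0 \<omega> + vector_step_integral n0 \<sigma> u \<omega> + (LINT s:{0..u}|lborel. b s \<omega>)"
  shows "l2int t (\<lambda>s \<omega>. \<sigma> s \<omega> *\<^sub>R soft_grad \<epsilon> (Y s \<omega>))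
    (\<lambda>\<omega>. soft_norm \<epsilon> (Y t \<omega>) - soft_norm \<epsilon> (Y 0 \<omega>)
       - tint t (\<lambda>s \<omega>. (\<sigma> s \<omega>)\<^sup>2 / 2 * soft_laplace \<epsilon> (Y s \<omega>)) \<omega>
       - tint t (\<lambda>s \<omega>. soft_grad \<epsilon> (Y s \<omega>) \<bullet> b s \<omega>) \<omega>)"
    (is "l2int t ?\<Theta> ?J")
proof -
  let ?f = "soft_norm \<epsilon> :: 'a \<Rightarrow> real" and ?g = "soft_grad \<epsilon> :: 'a \<Rightarrow> 'a" and ?l = "soft_laplace \<epsilon> :: 'a \<Rightarrow> real"
  obtain K where K: "0 < K" "\<And>s \<omega>. 0 \<le> s \<Longrightarrow> \<omega> \<in> space M \<Longrightarrow> norm (\<sigma> s \<omega>) \<le> K"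
    using stepwise_bounded[OF \<sigma>] by blast
  have YF: "Y s \<in> borel_measurable (F s)" and YM: "Y s \<in> borel_measurable M" if "0 \<le> s" for s
    using Y that measurable_F_M unfolding continuous_adapted_def by blast+
  have Yc: "continuous_on {0..} (\<lambda>s. Y s \<omega>)" if "\<omega> \<in> space M" for \<omega>
    using Y that unfolding continuous_adapted_def by blast
  have fb: "?f \<in> borel_measurable borel" and gb: "?g \<in> borel_measurable borel" and lb: "?l \<in> borel_measurable borel"
    using continuous_soft_norm[OF \<epsilon>] continuous_soft_grad[OF \<epsilon>] continuous_soft_laplace[OF \<epsilon>]
    by (auto intro: borel_measurable_continuous_onI)
  have gcont: "(\<lambda>n. ?g (u n)) \<longlonglongrightarrow> ?g v" if "u \<longlonglongrightarrow> v" for u v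
    using continuous_on_tendsto_compose[OF continuous_soft_grad[OF \<epsilon>] that] by simp
  have lcont: "(\<lambda>n. ?l (u n)) \<longlonglongrightarrow> ?l v" if "u \<longlonglongrightarrow> v" for u v
    using continuous_on_tendsto_compose[OF continuous_soft_laplace[OF \<epsilon>] that] by simp
  have pY: "path_measurable Y" by (rule path_measurable_continuous[OF YM Yc])
  have pYn: "path_measurable (\<lambda>s. Y (dfloor n s))" for n by (rule path_measurable_dfloor[OF YM])
  have p\<sigma>: "path_measurable \<sigma>" by (rule path_measurable_stepwise[OF \<sigma>])
  have pg: "path_measurable (\<lambda>s \<omega>. ?g (Y s \<omega>))" by (rule path_measurable_compose[OF pY gb])
  have p\<Theta>: "path_measurable ?\<Theta>" by (rule path_measurable_scaleR[OF p\<sigma> pg])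
  let ?\<Theta>n = "\<lambda>n s \<omega>. \<sigma> s \<omega> *\<^sub>R ?g (Y (dfloor n s) \<omega>)"
  have st: "stepwise n (\<lambda>s \<omega>. ?g (Y (dfloor n s) \<omega>))" for n
    unfolding stepwise_def
  proof (intro conjI allI impI)
    fix s :: real assume s: "0 \<le> s"
    show "(\<lambda>\<omega>. ?g (Y (dfloor n s) \<omega>)) = (\<lambda>\<omega>. ?g (Y (dfloor n (dfloor n s)) \<omega>))"
      by (simp add: dfloor_def)
    show "(\<lambda>\<omega>. ?g (Y (dfloor n s) \<omega>)) \<in> borel_measurable (F s)"
      by (rule measurable_compose[OF measurable_F_mono[OF _ dfloor_le[OF s] YF] gb]) simp_all
  qed (use norm_soft_grad[OF \<epsilon>] in blast)
  have \<Theta>n: "stepwise n (?\<Theta>n n)" if "n0 \<le> n" for n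
    by (rule stepwise_scaleR[OF stepwise_refine[OF \<sigma> that] st])
  let ?R1 = "\<lambda>s \<omega>. (\<sigma> s \<omega>)\<^sup>2 / 2 * ?l (Y s \<omega>)" and ?R1n = "\<lambda>n s \<omega>. (\<sigma> s \<omega>)\<^sup>2 / 2 * ?l (Y (dfloor n s) \<omega>)"
  have psq: "path_measurable (\<lambda>s \<omega>. (\<sigma> s \<omega>)\<^sup>2 / 2)" by (rule path_measurable_compose[OF p\<sigma>]) simp
  have pR1: "path_measurable ?R1"
    using path_measurable_scaleR[OF psq path_measurable_compose[OF pY lb]] by simp
  have pR1n: "path_measurable (?R1n n)" for n
    using path_measurable_scaleR[OF psq path_measurable_compose[OF pYn lb]] by simp
  let ?R2 = "\<lambda>s \<omega>. ?g (Y s \<omega>) \<bullet> b s \<omega>"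
  have pR2: "path_measurable ?R2"
    using pg b unfolding path_measurable_def by simp
  define c where "c n i = min t (dyadic n i)" for n i
  define N where "N n = Suc (dindex n t)" for n
  \<comment> \<open>The position after the Brownian increment alone; the drift of the cell is added
    afterwards.\<close>
  define p where "p n i \<omega> = Y (dyadic n i) \<omega> + \<sigma> (dyadic n i) \<omega> *\<^sub>R (W (c n (Suc i)) \<omega> - W (c n i) \<omega>)" for n i \<omega>
  define \<psi> where "\<psi> n s \<omega> = norm (b s \<omega>) * (norm (?g (p n (dindex n s) \<omega>) - ?g (Y s \<omega>))
      + norm (?g (Y (c n (Suc (dindex n s))) \<omega>) - ?g (Y s \<omega>)))" for n s \<omega>
  define D where "D n i \<omega> = (\<sigma> (dyadic n i) \<omega>)\<^sup>2 / 2 * (soft_hess \<epsilon> (Y (dyadic n i) \<omega>) (W (c n (Suc i)) \<omega> - W (c n i) \<omega>)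
      - (c n (Suc i) - c n i) * ?l (Y (dyadic n i) \<omega>))" for n i \<omega>
  \<comment> \<open>\<open>A\<close> and \<open>B\<close> are the constants of
    \<open>soft_norm_taylor\<close> after the bound \<open>K\<close> for the step integrand has been
    pulled out.\<close>
  define A where "A = 2 / \<epsilon>\<^sup>2 * K ^ 3"
  define B where "B = 1 / \<epsilon> ^ 3 * K ^ 4"
  define C where "C n i \<omega> = A * norm (W (c n (Suc i)) \<omega> - W (c n i) \<omega>) ^ 3 + B * norm (W (c n (Suc i)) \<omega> - W (c n i) \<omega>) ^ 4" for n i \<omega>
  have AB: "0 \<le> A" "0 \<le> B" using K \<epsilon> by (auto simp: A_def B_def)
  have c: "0 \<le> c n i" "c n i \<le> c n (Suc i)" "c n i \<le> t" for n i
    using t dyadic_less_Suc[of n i] unfolding c_def by (auto simp: min_def)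
  have c_dy: "c n i = dyadic n i" if "i < N n" for n i
  proof -
    have "dyadic n i \<le> dyadic n (dindex n t)" using that by (intro dyadic_mono) (simp add: N_def)
    also have "\<dots> \<le> t" using dfloor_le[OF t, of n] by (simp add: dfloor_def)
    finally show ?thesis by (simp add: c_def)
  qed
  have cN: "c n (N n) = t" and c0: "c n 0 = 0" for n
    using less_dyadic_Suc_dindex[of t n] t by (auto simp: c_def N_def)
  have pm: "p n i \<in> borel_measurable M" for n i
    unfolding p_def using c stepwiseD(3)[OF \<sigma>]
    by (intro borel_measurable_add borel_measurable_scaleR borel_measurable_diff W_measurable YM) auto
  have Cm: "C n i \<in> borel_measurable M" for n i
  proof -
    have [measurable]: "W (c n (Suc i)) \<in> borel_measurable M" "W (c n i) \<in> borel_measurable M" using c by (auto intro: W_measurable)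
    show ?thesis unfolding C_def[abs_def] by measurable
  qed
  have pP: "path_measurable (\<lambda>s. p n (dindex n s))" for n by (rule path_measurable_grid[OF pm])
  have pYp: "path_measurable (\<lambda>s. Y (c n (Suc (dindex n s))))" for n
    by (rule path_measurable_grid[of "\<lambda>i. Y (c n (Suc i))"]) (rule YM[OF c(1)])
  have p\<psi>: "path_measurable (\<psi> n)" for n
    using path_measurable_compose[OF pP gb, of n] path_measurable_compose[OF pYp gb, of n] pg b
    unfolding path_measurable_def \<psi>_def[abs_def] by simp
  have g2: "norm (?g u - ?g v) \<le> 2" for u v
    using norm_triangle_ineq4[of "?g u" "?g v"] norm_soft_grad[OF \<epsilon>, of u] norm_soft_grad[OF \<epsilon>, of v] by linarith
  \<comment> \<open>Gradients have length at most \<open>1\<close>, so the two differences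
    contribute \<open>2 + 2\<close>; the resulting majorant is the same for all
    \<open>n\<close>.\<close>
  have \<psi>4: "\<bar>\<psi> n s \<omega>\<bar> \<le> 4 * norm (b s \<omega>)" and \<psi>0: "0 \<le> \<psi> n s \<omega>" for n s \<omega>
  proof -
    show "0 \<le> \<psi> n s \<omega>" unfolding \<psi>_def by simp
    moreover have "\<psi> n s \<omega> \<le> norm (b s \<omega>) * (2 + 2)" unfolding \<psi>_def by (intro mult_left_mono add_mono g2) simp
    ultimately show "\<bar>\<psi> n s \<omega>\<bar> \<le> 4 * norm (b s \<omega>)" by simp
  qed
  have bm: "(\<lambda>z. norm (b (fst z) (snd z))) \<in> borel_measurable (Q t)" using path_measurable_Q[OF b] by simp
  have b4m: "(\<lambda>z. 4 * norm (b (fst z) (snd z))) \<in> borel_measurable (Q t)" using bm by simp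
  have b4: "(\<integral>\<^sup>+z. ennreal (4 * norm (b (fst z) (snd z))) \<partial>Q t) < \<infinity>"
  proof -
    have "(\<integral>\<^sup>+z. ennreal (4 * norm (b (fst z) (snd z))) \<partial>Q t) = 4 * (\<integral>\<^sup>+z. ennreal (norm (b (fst z) (snd z))) \<partial>Q t)"
      using bm by (subst nn_integral_cmult[symmetric]) (auto simp: ennreal_mult')
    then show ?thesis using bfin by (simp add: ennreal_mult_less_top)
  qed
  have cs: "s \<in> {0..t} \<Longrightarrow> (\<lambda>n. c n (Suc (dindex n s))) \<longlonglongrightarrow> s" for s
  proof -
    assume s: "s \<in> {0..t}"
    have "(\<lambda>n. min t (dfloor n s + (1/2) ^ n)) \<longlonglongrightarrow> min t (s + 0)"
      using s by (intro tendsto_min tendsto_add tendsto_const dfloor_tendsto LIMSEQ_power_zero) auto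
    then show ?thesis using s by (simp add: c_def dyadic_Suc dfloor_def[symmetric] power_one_over)
  qed
  have Plim: "(\<lambda>n. p n (dindex n s) \<omega>) \<longlonglongrightarrow> Y s \<omega>" if s: "s \<in> {0..t}" and \<omega>: "\<omega> \<in> space M" for s \<omega>
  proof -
    have ds: "(\<lambda>n. c n (dindex n s)) \<longlonglongrightarrow> s"
    proof -
      have "c n (dindex n s) = dfloor n s" for n
        using s dfloor_le[of s n] by (simp add: c_def dfloor_def)
      then show ?thesis using dfloor_tendsto[of s] s by simp
    qed
    have W1: "(\<lambda>n. W (c n (Suc (dindex n s))) \<omega>) \<longlonglongrightarrow> W s \<omega>" and W2: "(\<lambda>n. W (c n (dindex n s)) \<omega>) \<longlonglongrightarrow> W s \<omega>"
      by (rule continuous_on_tendsto_compose[OF W_continuous[OF \<omega>] cs[OF s]], use s c in auto)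
         (rule continuous_on_tendsto_compose[OF W_continuous[OF \<omega>] ds], use s c in auto)
    have "(\<lambda>n. K * norm (W (c n (Suc (dindex n s))) \<omega> - W (c n (dindex n s)) \<omega>)) \<longlonglongrightarrow> K * norm (W s \<omega> - W s \<omega>)"
      by (intro tendsto_intros W1 W2)
    then have "(\<lambda>n. K * norm (W (c n (Suc (dindex n s))) \<omega> - W (c n (dindex n s)) \<omega>)) \<longlonglongrightarrow> 0" by simp
    then have "(\<lambda>n. \<sigma> (dyadic n (dindex n s)) \<omega> *\<^sub>R (W (c n (Suc (dindex n s))) \<omega> - W (c n (dindex n s)) \<omega>)) \<longlonglongrightarrow> 0"
    proof (rule Lim_null_comparison[rotated], intro always_eventually allI)
      fix n
      show "norm (\<sigma> (dyadic n (dindex n s)) \<omega> *\<^sub>R (W (c n (Suc (dindex n s))) \<omega> - W (c n (dindex n s)) \<omega>))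
        \<le> K * norm (W (c n (Suc (dindex n s))) \<omega> - W (c n (dindex n s)) \<omega>)"
        using K(2)[OF dyadic_nonneg \<omega>, of n "dindex n s"] unfolding norm_scaleR real_norm_def by (intro mult_right_mono) auto
    qed
    moreover have "(\<lambda>n. Y (dyadic n (dindex n s)) \<omega>) \<longlonglongrightarrow> Y s \<omega>"
      using dfloor_tendsto_path[OF Yc[OF \<omega>], of s] s by (simp add: dfloor_def)
    ultimately show ?thesis unfolding p_def using tendsto_add by fastforce
  qed
  have Yplim: "(\<lambda>n. Y (c n (Suc (dindex n s))) \<omega>) \<longlonglongrightarrow> Y s \<omega>" if s: "s \<in> {0..t}" and \<omega>: "\<omega> \<in> space M" for s \<omega>
    by (rule continuous_on_tendsto_compose[OF Yc[OF \<omega>] cs[OF s]]) (use s c in auto)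
  have AEQ: "AE z in Q t. fst z \<in> {0..t} \<and> snd z \<in> space M" by (rule AE_I2) (auto simp: space_Q)
  have \<psi>lim: "(\<lambda>n. \<integral>\<^sup>+z. ennreal \<bar>0 - \<psi> n (fst z) (snd z)\<bar> \<partial>Q t) \<longlonglongrightarrow> 0"
  proof (rule nn_integral_Q_tendsto_0[where R="\<psi>" and R'="\<lambda>_ _. 0", OF p\<psi> path_measurable_const _ _ b4m b4])
    show "AE z in Q t. (\<lambda>n. \<psi> n (fst z) (snd z)) \<longlonglongrightarrow> 0"
      using AEQ
    proof eventually_elim
      case (elim z)
      have "(\<lambda>n. \<psi> n (fst z) (snd z)) \<longlonglongrightarrow> norm (b (fst z) (snd z)) * (norm (?g (Y (fst z) (snd z)) - ?g (Y (fst z) (snd z)))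
          + norm (?g (Y (fst z) (snd z)) - ?g (Y (fst z) (snd z))))"
        unfolding \<psi>_def by (intro tendsto_intros gcont Plim Yplim) (use elim in auto)
      then show ?case by simp
    qed
  qed (use \<psi>4 in auto)
  have R1lim: "(\<lambda>n. \<integral>\<^sup>+z. ennreal \<bar>?R1 (fst z) (snd z) - ?R1n n (fst z) (snd z)\<bar> \<partial>Q t) \<longlonglongrightarrow> 0"
    and R1fin: "(\<integral>\<^sup>+z. ennreal \<bar>?R1 (fst z) (snd z)\<bar> \<partial>Q t) < \<infinity>"
    and R1nfin: "\<And>n. (\<integral>\<^sup>+z. ennreal \<bar>?R1n n (fst z) (snd z)\<bar> \<partial>Q t) < \<infinity>"
  proof -
    interpret Qf: finite_measure "Q t" by (rule finite_measure_Q)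
    define L where "L = K\<^sup>2 / 2 * (real DIM('a) / \<epsilon>)"
    have bd: "\<bar>(\<sigma> s \<omega>)\<^sup>2 / 2 * ?l v\<bar> \<le> L" if "0 \<le> s" "\<omega> \<in> space M" for s \<omega> v
    proof -
      have "(\<sigma> s \<omega>)\<^sup>2 \<le> K\<^sup>2" using K(2)[OF that] by (metis abs_ge_zero power2_abs power_mono real_norm_def)
      then show ?thesis unfolding L_def abs_mult
        using soft_laplace_bounds(2,4)[OF \<epsilon>, of v] by (intro mult_mono) auto
    qed
    have fin: "(\<integral>\<^sup>+z. ennreal L' \<partial>Q t) < \<infinity>" for L' by (simp add: ennreal_mult_eq_top_iff less_top[symmetric])
    show "(\<lambda>n. \<integral>\<^sup>+z. ennreal \<bar>?R1 (fst z) (snd z) - ?R1n n (fst z) (snd z)\<bar> \<partial>Q t) \<longlonglongrightarrow> 0"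
    proof (rule nn_integral_Q_tendsto_0[where R="?R1n" and R'="?R1" and w="\<lambda>_. L + L", OF pR1n pR1 _ _ _ fin])
      show "AE z in Q t. (\<lambda>n. ?R1n n (fst z) (snd z)) \<longlonglongrightarrow> ?R1 (fst z) (snd z)"
        using AEQ
      proof eventually_elim
        case (elim z)
        show ?case
          by (intro tendsto_mult tendsto_const lcont dfloor_tendsto_path Yc) (use elim in auto)
      qed
      show "AE z in Q t. \<bar>?R1 (fst z) (snd z) - ?R1n n (fst z) (snd z)\<bar> \<le> L + L" for n
        using AEQ
      proof eventually_elim
        case (elim z)
        then have z: "0 \<le> fst z" "snd z \<in> space M" by auto
        show ?case using bd[OF z, of "Y (fst z) (snd z)"] bd[OF z, of "Y (dfloor n (fst z)) (snd z)"] by linarith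
      qed
    qed simp
    have le: "(\<integral>\<^sup>+z. ennreal \<bar>(\<sigma> (fst z) (snd z))\<^sup>2 / 2 * ?l (v z)\<bar> \<partial>Q t) < \<infinity>" for v
    proof -
      have "AE z in Q t. ennreal \<bar>(\<sigma> (fst z) (snd z))\<^sup>2 / 2 * ?l (v z)\<bar> \<le> ennreal L"
        using AEQ
      proof eventually_elim
        case (elim z)
        then have z: "0 \<le> fst z" "snd z \<in> space M" by auto
        show ?case by (rule ennreal_leI[OF bd[OF z]])
      qed
      from le_less_trans[OF nn_integral_mono_AE[OF this] fin[of L]] show ?thesis .
    qed
    show "(\<integral>\<^sup>+z. ennreal \<bar>?R1 (fst z) (snd z)\<bar> \<partial>Q t) < \<infinity>" by (rule le)
    show "\<And>n. (\<integral>\<^sup>+z. ennreal \<bar>?R1n n (fst z) (snd z)\<bar> \<partial>Q t) < \<infinity>" by (rule le)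
  qed
  have R2le: "\<bar>?R2 s \<omega>\<bar> \<le> norm (b s \<omega>)" for s \<omega>
    using Cauchy_Schwarz_ineq2[of "?g (Y s \<omega>)" "b s \<omega>"] mult_right_mono[OF norm_soft_grad[OF \<epsilon>, of "Y s \<omega>"], of "norm (b s \<omega>)"]
    by simp
  have R2fin: "(\<integral>\<^sup>+z. ennreal (norm (?R2 (fst z) (snd z))) \<partial>Q t) < \<infinity>"
    by (rule le_less_trans[OF nn_integral_mono bfin]) (auto intro!: ennreal_leI R2le)
  have \<psi>fin: "(\<integral>\<^sup>+z. ennreal (norm (\<psi> n (fst z) (snd z))) \<partial>Q t) < \<infinity>" for n
    by (rule le_less_trans[OF nn_integral_mono b4]) (auto intro!: ennreal_leI \<psi>4)
  have JM: "?J \<in> borel_measurable M"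
    by (intro borel_measurable_diff tint_measurable pR1 pR2 measurable_compose[OF YM fb] t order_refl)
  have est: "(\<integral>\<^sup>+\<omega>. ennreal \<bar>?J \<omega> - step_integral n (?\<Theta>n n) W t \<omega>\<bar> \<partial>M)
      \<le> (\<integral>\<^sup>+z. ennreal \<bar>0 - \<psi> n (fst z) (snd z)\<bar> \<partial>Q t) + (\<integral>\<^sup>+\<omega>. (\<Sum>i<N n. ennreal (C n i \<omega>)) \<partial>M)
        + (\<integral>\<^sup>+\<omega>. ennreal \<bar>\<Sum>i<N n. D n i \<omega>\<bar> \<partial>M) + (\<integral>\<^sup>+z. ennreal \<bar>?R1 (fst z) (snd z) - ?R1n n (fst z) (snd z)\<bar> \<partial>Q t)"
    if n: "n0 \<le> n" for n
  proof -
    have ae: "AE \<omega> in M. ennreal \<bar>?J \<omega> - step_integral n (?\<Theta>n n) W t \<omega>\<bar>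
      \<le> (\<integral>\<^sup>+s\<in>{0..t}. ennreal \<bar>0 - \<psi> n s \<omega>\<bar> \<partial>lborel) + (\<Sum>i<N n. ennreal (C n i \<omega>))
         + ennreal \<bar>\<Sum>i<N n. D n i \<omega>\<bar> + ennreal \<bar>tint t ?R1 \<omega> - tint t (?R1n n) \<omega>\<bar>"
      using decomp AE_path_integrable[OF b bfin] AE_path_integrable[OF pR2 R2fin] AE_path_integrable[OF p\<psi> \<psi>fin, of n] AE_space
    proof eventually_elim
      case (elim \<omega>)
      note ib = elim(2)[folded set_integrable_time] and iR2 = elim(3)[folded set_integrable_time]
        and i\<psi> = elim(4)[folded set_integrable_time]
      let ?dW = "\<lambda>i. W (c n (Suc i)) \<omega> - W (c n i) \<omega>"
      have yp: "Y (c n (Suc i)) \<omega> = p n i \<omega> + (LINT s:{c n i..<c n (Suc i)}|lborel. b s \<omega>)" if i: "i < N n" for i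
      proof -
        have d: "Y u \<omega> = Y 0 \<omega> + vector_step_integral n \<sigma> u \<omega> + (LINT s:{0..u}|lborel. b s \<omega>)" if "u \<in> {0..t}" for u
          unfolding vector_step_integral_refine[OF \<sigma> n] by (rule bspec[OF elim(1) that])
        have m: "c n j \<in> {0..t}" for j using c[of n j] by simp
        have "Y (c n (Suc i)) \<omega> - Y (c n i) \<omega> = (vector_step_integral n \<sigma> (c n (Suc i)) \<omega> - vector_step_integral n \<sigma> (c n i) \<omega>)
            + ((LINT s:{0..c n (Suc i)}|lborel. b s \<omega>) - (LINT s:{0..c n i}|lborel. b s \<omega>))"
          unfolding d[OF m[of "Suc i"]] d[OF m[of i]] by simp
        also have "\<dots> = \<sigma> (dyadic n i) \<omega> *\<^sub>R ?dW i + (LINT s:{c n i..<c n (Suc i)}|lborel. b s \<omega>)"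
          unfolding LINT_Icc_diff[OF c(1)[of n i] c(2)[of n i] c(3)[of n "Suc i"] ib]
          unfolding c_def vector_step_integral_one_step[OF t] ..
        finally show ?thesis using c_dy[OF i] by (simp add: p_def algebra_simps)
      qed
      have drift: "\<bar>(\<Sum>i<N n. ?f (Y (c n (Suc i)) \<omega>) - ?f (p n i \<omega>)) - (LINT s:{0..t}|lborel. ?R2 s \<omega>)\<bar> \<le> (LINT s:{0..t}|lborel. \<psi> n s \<omega>)"
        unfolding \<psi>_def
        using drift_estimate[OF \<epsilon> t, of n "\<lambda>s. Y s \<omega>" "\<lambda>i. p n i \<omega>" "\<lambda>s. b s \<omega>", folded c_def N_def,
          OF yp ib iR2 i\<psi>[unfolded \<psi>_def]] .
      have \<psi>nn: "ennreal (LINT s:{0..t}|lborel. \<psi> n s \<omega>) = (\<integral>\<^sup>+s\<in>{0..t}. ennreal \<bar>0 - \<psi> n s \<omega>\<bar> \<partial>lborel)"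
        using i\<psi> unfolding set_lebesgue_integral_def set_integrable_def
        by (subst nn_integral_eq_integral[symmetric])
          (auto simp: \<psi>0 indicator_def intro!: nn_integral_cong)
      have taylor: "\<bar>?f (p n i \<omega>) - ?f (Y (c n i) \<omega>) - ?g (Y (c n i) \<omega>) \<bullet> (\<sigma> (dyadic n i) \<omega> *\<^sub>R ?dW i)
          - (\<sigma> (dyadic n i) \<omega>)\<^sup>2 / 2 * soft_hess \<epsilon> (Y (dyadic n i) \<omega>) (?dW i)\<bar> \<le> C n i \<omega>" if i: "i < N n" for i
      proof -
        let ?v = "\<sigma> (dyadic n i) \<omega> *\<^sub>R ?dW i"
        have nv: "norm ?v \<le> K * norm (?dW i)"
          using K(2)[OF dyadic_nonneg elim(5), of n i] unfolding norm_scaleR real_norm_def by (intro mult_right_mono) auto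
        have "(2 / \<epsilon>\<^sup>2) * norm ?v ^ 3 + (1 / \<epsilon> ^ 3) * norm ?v ^ 4 \<le> (2 / \<epsilon>\<^sup>2) * (K * norm (?dW i)) ^ 3 + (1 / \<epsilon> ^ 3) * (K * norm (?dW i)) ^ 4"
          using nv \<epsilon> by (intro add_mono mult_left_mono power_mono) auto
        also have "\<dots> = C n i \<omega>" unfolding C_def A_def B_def by (simp only: power_mult_distrib mult.assoc)
        finally show ?thesis
          using soft_norm_taylor[OF \<epsilon>, of "Y (dyadic n i) \<omega>" ?v]
          by (simp add: p_def c_dy[OF i] soft_hess_scaleR[OF \<epsilon>])
      qed
      have SI: "step_integral n (?\<Theta>n n) W t \<omega> = (\<Sum>i<N n. ?g (Y (c n i) \<omega>) \<bullet> (\<sigma> (dyadic n i) \<omega> *\<^sub>R ?dW i))"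
        unfolding step_integral_def N_def[symmetric] c_def[symmetric]
        by (intro sum.cong refl) (simp add: c_dy)
      have T1: "tint t (?R1n n) \<omega> = (\<Sum>i<N n. (c n (Suc i) - c n i) * ((\<sigma> (dyadic n i) \<omega>)\<^sup>2 / 2 * ?l (Y (dyadic n i) \<omega>)))"
      proof -
        have "?R1n n s \<omega> = ?R1n n (dfloor n s) \<omega>" if s: "0 \<le> s" for s
          using fun_cong[OF stepwiseD(1)[OF stepwise_refine[OF \<sigma> n] s], of \<omega>] by (simp add: dfloor_def)
        then have "tint t (?R1n n) \<omega> = (\<Sum>i<Suc (dindex n t). (min t (dyadic n (Suc i)) - min t (dyadic n i)) * ?R1n n (dyadic n i) \<omega>)"
          by (rule tint_stepwise[OF t, where R="?R1n n"])
        then show ?thesis by (simp add: N_def c_def del: sum.lessThan_Suc)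
      qed
      have tele: "?f (Y t \<omega>) - ?f (Y 0 \<omega>) = (\<Sum>i<N n. ?f (Y (c n (Suc i)) \<omega>) - ?f (p n i \<omega>)) + (\<Sum>i<N n. ?f (p n i \<omega>) - ?f (Y (c n i) \<omega>))"
      proof -
        have "(\<Sum>i<N n. ?f (Y (c n (Suc i)) \<omega>) - ?f (Y (c n i) \<omega>)) = ?f (Y (c n (N n)) \<omega>) - ?f (Y (c n 0) \<omega>)"
          by (rule sum_lessThan_telescope)
        then show ?thesis by (simp add: cN c0 sum.distrib[symmetric])
      qed
      let ?r = "\<lambda>i. ?f (p n i \<omega>) - ?f (Y (c n i) \<omega>) - ?g (Y (c n i) \<omega>) \<bullet> (\<sigma> (dyadic n i) \<omega> *\<^sub>R ?dW i)
          - (\<sigma> (dyadic n i) \<omega>)\<^sup>2 / 2 * soft_hess \<epsilon> (Y (dyadic n i) \<omega>) (?dW i)"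
      \<comment> \<open>On each cell the gradient term, the Hessian term and the conditional mean of
        the latter are added and subtracted.\<close>
      have sumid: "(\<Sum>i<N n. ?f (p n i \<omega>) - ?f (Y (c n i) \<omega>)) = (\<Sum>i<N n. ?r i) + step_integral n (?\<Theta>n n) W t \<omega>
          + (\<Sum>i<N n. D n i \<omega>) + tint t (?R1n n) \<omega>"
      proof -
        have alg: "u = (u - v - q * x) + v + q * (x - h * l) + h * (q * l)" for u v q x h l :: real
          by (simp add: algebra_simps)
        show ?thesis unfolding SI T1 sum.distrib[symmetric] D_def by (intro sum.cong refl alg)
      qed
      have rb: "\<bar>\<Sum>i<N n. ?r i\<bar> \<le> (\<Sum>i<N n. C n i \<omega>)"
        by (rule order_trans[OF sum_abs sum_mono]) (use taylor in simp)
      have J: "?J \<omega> - step_integral n (?\<Theta>n n) W t \<omega> = ((\<Sum>i<N n. ?f (Y (c n (Suc i)) \<omega>) - ?f (p n i \<omega>)) - tint t ?R2 \<omega>)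
          + (\<Sum>i<N n. ?r i) + (\<Sum>i<N n. D n i \<omega>) - (tint t ?R1 \<omega> - tint t (?R1n n) \<omega>)"
        unfolding tele sumid by simp
      have "\<bar>?J \<omega> - step_integral n (?\<Theta>n n) W t \<omega>\<bar> \<le> (LINT s:{0..t}|lborel. \<psi> n s \<omega>) + (\<Sum>i<N n. C n i \<omega>)
          + \<bar>\<Sum>i<N n. D n i \<omega>\<bar> + \<bar>tint t ?R1 \<omega> - tint t (?R1n n) \<omega>\<bar>"
        unfolding J using drift rb unfolding tint_eq_LINT[of t ?R2 \<omega>] by linarith
      then have "ennreal \<bar>?J \<omega> - step_integral n (?\<Theta>n n) W t \<omega>\<bar> \<le> ennreal ((LINT s:{0..t}|lborel. \<psi> n s \<omega>) + (\<Sum>i<N n. C n i \<omega>)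
          + \<bar>\<Sum>i<N n. D n i \<omega>\<bar> + \<bar>tint t ?R1 \<omega> - tint t (?R1n n) \<omega>\<bar>)" by (rule ennreal_leI)
      also have "\<dots> \<le> (\<integral>\<^sup>+s\<in>{0..t}. ennreal \<bar>0 - \<psi> n s \<omega>\<bar> \<partial>lborel) + (\<Sum>i<N n. ennreal (C n i \<omega>))
         + ennreal \<bar>\<Sum>i<N n. D n i \<omega>\<bar> + ennreal \<bar>tint t ?R1 \<omega> - tint t (?R1n n) \<omega>\<bar>"
      proof -
        have C0: "0 \<le> C n i \<omega>" for i using AB by (simp add: C_def)
        have "0 \<le> (LINT s:{0..t}|lborel. \<psi> n s \<omega>)"
          unfolding set_lebesgue_integral_def by (rule integral_nonneg_AE) (simp add: \<psi>0)
        then show ?thesis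
          unfolding \<psi>nn[symmetric] sum_ennreal[OF C0] using C0
          by (simp add: ennreal_plus[symmetric] sum_nonneg del: ennreal_plus)
      qed
      finally show ?case .
    qed
    have mpsi: "(\<lambda>\<omega>. \<integral>\<^sup>+s\<in>{0..t}. ennreal \<bar>0 - \<psi> n s \<omega>\<bar> \<partial>lborel) \<in> borel_measurable M"
    proof -
      interpret P: pair_sigma_finite M "restrict_space lborel {0..t}"
        using pair_Q[of t] by (simp add: pair_sigma_finite_def)
      have "(\<lambda>z. ennreal \<bar>0 - \<psi> n (snd z) (fst z)\<bar>) \<in> borel_measurable (M \<Otimes>\<^sub>M restrict_space lborel {0..t})"
        using measurable_compose[OF measurable_pair_swap' path_measurable_Q[OF p\<psi>, of n t, unfolded Q_def]]
        by (simp add: case_prod_unfold)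
      from P.M2.borel_measurable_nn_integral_fst[OF this] show ?thesis
        by (simp add: nn_integral_restrict_space)
    qed
    have Dm: "(\<lambda>\<omega>. \<Sum>i<N n. D n i \<omega>) \<in> borel_measurable M"
      unfolding D_def c_def by (rule quadratic_variation(2)[OF \<epsilon> stepwise_refine[OF \<sigma> n] K(2) YF t])
    have Tm: "tint t ?R1 \<in> borel_measurable M" "tint t (?R1n n) \<in> borel_measurable M"
      by (rule tint_measurable, rule pR1, rule tint_measurable, rule pR1n)
    note [measurable] = mpsi Dm Tm Cm
    have "(\<integral>\<^sup>+\<omega>. ennreal \<bar>?J \<omega> - step_integral n (?\<Theta>n n) W t \<omega>\<bar> \<partial>M) \<le>
      (\<integral>\<^sup>+\<omega>. (\<integral>\<^sup>+s\<in>{0..t}. ennreal \<bar>0 - \<psi> n s \<omega>\<bar> \<partial>lborel) + (\<Sum>i<N n. ennreal (C n i \<omega>))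
         + ennreal \<bar>\<Sum>i<N n. D n i \<omega>\<bar> + ennreal \<bar>tint t ?R1 \<omega> - tint t (?R1n n) \<omega>\<bar> \<partial>M)"
      by (rule nn_integral_mono_AE[OF ae])
    also have "\<dots> = (\<integral>\<^sup>+\<omega>. (\<integral>\<^sup>+s\<in>{0..t}. ennreal \<bar>0 - \<psi> n s \<omega>\<bar> \<partial>lborel) \<partial>M) + (\<integral>\<^sup>+\<omega>. (\<Sum>i<N n. ennreal (C n i \<omega>)) \<partial>M)
        + (\<integral>\<^sup>+\<omega>. ennreal \<bar>\<Sum>i<N n. D n i \<omega>\<bar> \<partial>M) + (\<integral>\<^sup>+\<omega>. ennreal \<bar>tint t ?R1 \<omega> - tint t (?R1n n) \<omega>\<bar> \<partial>M)"
      by (rule nn_integral_add4) measurable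
    also have "(\<integral>\<^sup>+\<omega>. (\<integral>\<^sup>+s\<in>{0..t}. ennreal \<bar>0 - \<psi> n s \<omega>\<bar> \<partial>lborel) \<partial>M) = (\<integral>\<^sup>+z. ennreal \<bar>0 - \<psi> n (fst z) (snd z)\<bar> \<partial>Q t)"
      using path_measurable_Q[OF p\<psi>, of n t] by (subst nn_integral_Q) auto
    finally show ?thesis
      by (rule order_trans) (intro add_left_mono tint_diff_L1 pR1 pR1n R1fin R1nfin)
  qed
  define d where "d = real DIM('a)"
  have Cest: "(\<integral>\<^sup>+\<omega>. (\<Sum>i<N n. ennreal (C n i \<omega>)) \<partial>M) \<le> ennreal (t * (A * sqrt ((1 / 2) ^ n) * (d + 3 * d\<^sup>2) + B * (3 * d\<^sup>2) * (1 / 2) ^ n))" for n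
  proof -
    let ?k = "A * sqrt ((1 / 2) ^ n) * (d + 3 * d\<^sup>2) + B * (3 * d\<^sup>2) * (1 / 2) ^ n"
    have k: "0 \<le> ?k" using AB by (simp add: d_def)
    have "(\<integral>\<^sup>+\<omega>. (\<Sum>i<N n. ennreal (C n i \<omega>)) \<partial>M) = (\<Sum>i<N n. \<integral>\<^sup>+\<omega>. ennreal (C n i \<omega>) \<partial>M)"
      by (rule nn_integral_sum) (use Cm in simp)
    also have "\<dots> \<le> (\<Sum>i<N n. ennreal ((c n (Suc i) - c n i) * ?k))"
    proof (rule sum_mono)
      fix i
      have "(0::real) \<le> 1 / 2 ^ n" by simp
      then have h: "c n (Suc i) - c n i \<le> (1 / 2) ^ n"
        using dyadic_Suc[of n i] unfolding c_def power_one_over by linarith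
      show "(\<integral>\<^sup>+\<omega>. ennreal (C n i \<omega>) \<partial>M) \<le> ennreal ((c n (Suc i) - c n i) * ?k)"
        unfolding C_def d_def by (rule cubic_remainder[OF c(1,2) h AB]) auto
    qed
    also have "\<dots> = ennreal (\<Sum>i<N n. (c n (Suc i) - c n i) * ?k)"
      by (rule sum_ennreal) (use c k in \<open>auto intro!: mult_nonneg_nonneg\<close>)
    also have "(\<Sum>i<N n. (c n (Suc i) - c n i) * ?k) = t * ?k"
      unfolding sum_distrib_right[symmetric] sum_lessThan_telescope by (simp add: cN c0)
    finally show ?thesis .
  qed
  \<comment> \<open>The summand \<open>1\<close> makes the bound strictly positive, as
    \<open>nn_integral_abs_le_sqn\<close> requires.\<close>
  define G where "G = 2 * K ^ 4 * (real DIM('a))\<^sup>2 / \<epsilon>\<^sup>2 * t + 1"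
  have G: "1 \<le> G" using t by (auto simp: G_def intro!: mult_nonneg_nonneg divide_nonneg_nonneg)
  have Dest: "(\<integral>\<^sup>+\<omega>. ennreal \<bar>\<Sum>i<N n. D n i \<omega>\<bar> \<partial>M) \<le> ennreal (sqrt (G * (1 / 2) ^ n))" if n: "n0 \<le> n" for n
  proof (rule nn_integral_abs_le_sqn)
    show "(\<lambda>\<omega>. \<Sum>i<N n. D n i \<omega>) \<in> borel_measurable M"
      unfolding D_def c_def by (rule quadratic_variation(2)[OF \<epsilon> stepwise_refine[OF \<sigma> n] K(2) YF t])
    have "sqn (\<lambda>\<omega>. \<Sum>i<N n. D n i \<omega>) \<le> ennreal (2 * K ^ 4 * (real DIM('a))\<^sup>2 / \<epsilon>\<^sup>2 * t / 2 ^ n)"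
      unfolding D_def c_def by (rule quadratic_variation(1)[OF \<epsilon> stepwise_refine[OF \<sigma> n] K(2) YF t])
    also have "\<dots> \<le> ennreal (G * (1 / 2) ^ n)"
    proof (rule ennreal_leI)
      have "2 * K ^ 4 * (real DIM('a))\<^sup>2 / \<epsilon>\<^sup>2 * t \<le> G" by (simp add: G_def)
      then have "2 * K ^ 4 * (real DIM('a))\<^sup>2 / \<epsilon>\<^sup>2 * t / 2 ^ n \<le> G / 2 ^ n"
        by (rule divide_right_mono) simp
      then show "2 * K ^ 4 * (real DIM('a))\<^sup>2 / \<epsilon>\<^sup>2 * t / 2 ^ n \<le> G * (1 / 2) ^ n"
        by (simp only: power_one_over) simp
    qed
    also have "G * (1 / 2) ^ n = (sqrt (G * (1 / 2) ^ n))\<^sup>2" using G by simp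
    finally show "sqn (\<lambda>\<omega>. \<Sum>i<N n. D n i \<omega>) \<le> ennreal ((sqrt (G * (1 / 2) ^ n))\<^sup>2)" .
  qed (use G in simp)
  show ?thesis
  proof (rule l2int_closure[OF p\<Theta> JM t])
    fix \<eta> :: real assume \<eta>: "0 < \<eta>"
    then have \<eta>4: "0 < \<eta> / 4" by simp
    have half: "(\<lambda>n. (1 / 2 :: real) ^ n) \<longlonglongrightarrow> 0" by (rule LIMSEQ_power_zero) simp
    have "(\<lambda>n. t * (A * sqrt ((1 / 2) ^ n) * (d + 3 * d\<^sup>2) + B * (3 * d\<^sup>2) * (1 / 2) ^ n)) \<longlonglongrightarrow> t * (A * sqrt 0 * (d + 3 * d\<^sup>2) + B * (3 * d\<^sup>2) * 0)"
      by (intro tendsto_intros half)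
    then have e1: "\<forall>\<^sub>F n in sequentially. t * (A * sqrt ((1 / 2) ^ n) * (d + 3 * d\<^sup>2) + B * (3 * d\<^sup>2) * (1 / 2) ^ n) < \<eta> / 4"
      using \<eta> by (intro order_tendstoD(2)) auto
    have "(\<lambda>n. sqrt (G * (1 / 2) ^ n)) \<longlonglongrightarrow> sqrt (G * 0)" by (intro tendsto_intros half)
    then have e2: "\<forall>\<^sub>F n in sequentially. sqrt (G * (1 / 2) ^ n) < \<eta> / 4"
      using \<eta> by (intro order_tendstoD(2)) auto
    interpret Qf: finite_measure "Q t" by (rule finite_measure_Q)
    have "(\<lambda>n. qnorm t (\<lambda>s \<omega>. ?\<Theta> s \<omega> - ?\<Theta>n n s \<omega>)) \<longlonglongrightarrow> 0"
    proof (rule qnorm_tendsto_0[where w="\<lambda>_. (K * 2)\<^sup>2"])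
      show "path_measurable (?\<Theta>n n)" for n
        by (rule path_measurable_scaleR[OF p\<sigma> path_measurable_compose[OF pYn gb]])
      show "path_measurable ?\<Theta>" by (rule p\<Theta>)
      show "AE z in Q t. (\<lambda>n. ?\<Theta>n n (fst z) (snd z)) \<longlonglongrightarrow> ?\<Theta> (fst z) (snd z)"
        using AEQ
      proof eventually_elim
        case (elim z)
        show ?case by (intro tendsto_scaleR tendsto_const gcont dfloor_tendsto_path Yc) (use elim in auto)
      qed
      show "AE z in Q t. (norm (?\<Theta> (fst z) (snd z) - ?\<Theta>n n (fst z) (snd z)))\<^sup>2 \<le> (K * 2)\<^sup>2" for n
        using AEQ
      proof eventually_elim
        case (elim z)
        then have z: "0 \<le> fst z" "snd z \<in> space M" by auto
        have "norm (?\<Theta> (fst z) (snd z) - ?\<Theta>n n (fst z) (snd z)) \<le> K * 2"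
          unfolding scaleR_diff_right[symmetric] norm_scaleR using K(2)[OF z] K(1)
          by (intro mult_mono g2) auto
        then show ?case by (rule power_mono) simp
      qed
      show "(\<integral>\<^sup>+z. ennreal ((K * 2)\<^sup>2) \<partial>Q t) < \<infinity>"
        by (simp add: ennreal_mult_eq_top_iff less_top[symmetric])
    qed simp
    note e3 = tendsto_0_ennrealD[OF this \<eta>]
    have "\<forall>\<^sub>F n in sequentially. n0 \<le> n \<and> qnorm t (\<lambda>s \<omega>. ?\<Theta> s \<omega> - ?\<Theta>n n s \<omega>) \<le> ennreal \<eta> \<and>
        (\<integral>\<^sup>+z. ennreal \<bar>0 - \<psi> n (fst z) (snd z)\<bar> \<partial>Q t) \<le> ennreal (\<eta> / 4) \<and>
        (\<integral>\<^sup>+z. ennreal \<bar>?R1 (fst z) (snd z) - ?R1n n (fst z) (snd z)\<bar> \<partial>Q t) \<le> ennreal (\<eta> / 4) \<and>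
        t * (A * sqrt ((1 / 2) ^ n) * (d + 3 * d\<^sup>2) + B * (3 * d\<^sup>2) * (1 / 2) ^ n) < \<eta> / 4 \<and> sqrt (G * (1 / 2) ^ n) < \<eta> / 4"
      by (intro eventually_conj e1 e2 e3 eventually_ge_at_top tendsto_0_ennrealD[OF \<psi>lim \<eta>4] tendsto_0_ennrealD[OF R1lim \<eta>4])
    then obtain n where n: "n0 \<le> n" "qnorm t (\<lambda>s \<omega>. ?\<Theta> s \<omega> - ?\<Theta>n n s \<omega>) \<le> ennreal \<eta>"
        "(\<integral>\<^sup>+z. ennreal \<bar>0 - \<psi> n (fst z) (snd z)\<bar> \<partial>Q t) \<le> ennreal (\<eta> / 4)"
        "(\<integral>\<^sup>+z. ennreal \<bar>?R1 (fst z) (snd z) - ?R1n n (fst z) (snd z)\<bar> \<partial>Q t) \<le> ennreal (\<eta> / 4)"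
        "t * (A * sqrt ((1 / 2) ^ n) * (d + 3 * d\<^sup>2) + B * (3 * d\<^sup>2) * (1 / 2) ^ n) < \<eta> / 4" "sqrt (G * (1 / 2) ^ n) < \<eta> / 4"
      unfolding eventually_sequentially by blast
    have "(\<integral>\<^sup>+\<omega>. ennreal \<bar>?J \<omega> - step_integral n (?\<Theta>n n) W t \<omega>\<bar> \<partial>M) \<le> ennreal (\<eta> / 4) + ennreal (\<eta> / 4) + ennreal (\<eta> / 4) + ennreal (\<eta> / 4)"
      by (rule order_trans[OF est[OF n(1)]], intro add_mono n(3,4)
          order_trans[OF Cest ennreal_leI[OF less_imp_le[OF n(5)]]]
          order_trans[OF Dest[OF n(1)] ennreal_leI[OF less_imp_le[OF n(6)]]])
    also have "\<dots> = ennreal \<eta>" using \<eta> by (simp add: ennreal_plus[symmetric] del: ennreal_plus)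
    finally show "\<exists>\<Theta>' J'. l2int t \<Theta>' J' \<and> qnorm t (\<lambda>s \<omega>. ?\<Theta> s \<omega> - \<Theta>' s \<omega>) \<le> ennreal \<eta> \<and>
        (\<integral>\<^sup>+\<omega>. ennreal \<bar>?J \<omega> - J' \<omega>\<bar> \<partial>M) \<le> ennreal \<eta>"
      using l2int_stepwise[OF \<Theta>n[OF n(1)] t] n(2) by blast
  qed
qed

end

section \<open>From simple integrands to dyadic steps\<close>

lemma tendsto_min_0:
  "f \<longlonglongrightarrow> (0::ennreal) \<Longrightarrow> 0 < \<eta> \<Longrightarrow> \<exists>k. \<forall>n\<ge>k. f n \<le> ennreal \<eta>"
  using order_tendstoD(2)[of f 0 sequentially "ennreal \<eta>"]
  by (auto simp: eventually_sequentially intro: less_imp_le)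

context brownian_basis
begin

text \<open>The variant of \<open>l2int_closure\<close> for almost sure limits: the values are
  Cauchy in mean square by \<open>l2int_dist\<close>, and Fatou's lemma gives their distance to the
  limit.\<close>

lemma l2int_AE_closure:
  assumes \<Theta>: "path_measurable \<Theta>" and J: "J \<in> borel_measurable M" and T: "0 \<le> T"
    and l: "\<And>k. l2int T (\<Theta>' k) (J' k)" and q: "(\<lambda>k. qnorm T (\<lambda>s \<omega>. \<Theta> s \<omega> - \<Theta>' k s \<omega>)) \<longlonglongrightarrow> 0"
    and lim: "AE \<omega> in M. (\<lambda>k. J' k \<omega>) \<longlonglongrightarrow> J \<omega>"
  shows "l2int T \<Theta> J"
proof (rule l2int_closure[OF \<Theta> J T])
  fix \<epsilon> :: real assume \<epsilon>: "0 < \<epsilon>"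
  \<comment> \<open>As before \<open>64 = 16 * (2 + 2)\<close>, so that \<open>64 * \<delta>\<close>
    is at most \<open>\<epsilon>\<^sup>2\<close>.\<close>
  define \<delta> where "\<delta> = min \<epsilon> (\<epsilon>\<^sup>2 / 64)"
  have \<delta>: "0 < \<delta>" using \<epsilon> by (simp add: \<delta>_def)
  obtain k where k: "\<And>n. k \<le> n \<Longrightarrow> qnorm T (\<lambda>s \<omega>. \<Theta> s \<omega> - \<Theta>' n s \<omega>) \<le> ennreal \<delta>"
    using tendsto_min_0[OF q \<delta>] by blast
  note m = l2int_measurable[OF l]
  have "sqn (\<lambda>\<omega>. J \<omega> - J' k \<omega>) \<le> ennreal (\<epsilon>\<^sup>2)"
  proof (rule sqn_Fatou[where k=k, OF m(2) m(2) lim])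
    fix j assume j: "k \<le> j"
    have "sqn (\<lambda>\<omega>. J' j \<omega> - J' k \<omega>) \<le> 16 * qnorm T (\<lambda>s \<omega>. \<Theta>' j s \<omega> - \<Theta>' k s \<omega>)"
      by (rule l2int_dist[OF l l T])
    also have "\<dots> \<le> 16 * (2 * qnorm T (\<lambda>s \<omega>. \<Theta>' j s \<omega> - \<Theta> s \<omega>) + 2 * qnorm T (\<lambda>s \<omega>. \<Theta> s \<omega> - \<Theta>' k s \<omega>))"
      by (intro mult_left_mono qnorm_triangle m \<Theta>) simp
    also have "\<dots> \<le> 16 * (2 * ennreal \<delta> + 2 * ennreal \<delta>)"
      by (subst qnorm_commute) (intro mult_left_mono add_mono k j order_refl, simp_all)
    also have "\<dots> = ennreal (64 * \<delta>)"
    proof -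
      have "16 * (2 * ennreal \<delta> + 2 * ennreal \<delta>) = ennreal 64 * ennreal \<delta>"
        by (simp add: distrib_left mult.assoc[symmetric]) (simp add: distrib_right[symmetric])
      then show ?thesis by (simp add: ennreal_mult')
    qed
    also have "\<dots> \<le> ennreal (\<epsilon>\<^sup>2)" by (rule ennreal_leI) (simp add: \<delta>_def min_def field_simps)
    finally show "sqn (\<lambda>\<omega>. J' j \<omega> - J' k \<omega>) \<le> ennreal (\<epsilon>\<^sup>2)" .
  qed
  then have "(\<integral>\<^sup>+\<omega>. ennreal \<bar>J \<omega> - J' k \<omega>\<bar> \<partial>M) \<le> ennreal \<epsilon>"
    by (intro nn_integral_abs_le_sqn \<epsilon> borel_measurable_diff J m)
  moreover have "qnorm T (\<lambda>s \<omega>. \<Theta> s \<omega> - \<Theta>' k s \<omega>) \<le> ennreal \<epsilon>"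
    by (rule order_trans[OF k[OF order_refl]]) (simp add: \<delta>_def ennreal_leI)
  ultimately show "\<exists>\<Theta>' J'. l2int T \<Theta>' J' \<and> qnorm T (\<lambda>s \<omega>. \<Theta> s \<omega> - \<Theta>' s \<omega>) \<le> ennreal \<epsilon> \<and>
        (\<integral>\<^sup>+\<omega>. ennreal \<bar>J \<omega> - J' \<omega>\<bar> \<partial>M) \<le> ennreal \<epsilon>" using l[of k] by blast
qed

section \<open>Simple integrands on arbitrary partitions\<close>

lemma sum_dyadic_below:
  fixes f :: "nat \<Rightarrow> 'b::ab_group_add"
  assumes "0 \<le> \<tau>" "Suc (dindex m \<tau>) \<le> N"
  shows "(\<Sum>j<N. if dyadic m j \<le> \<tau> then f (Suc j) - f j else 0) = f (Suc (dindex m \<tau>)) - f 0"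
proof -
  have iff: "dyadic m j \<le> \<tau> \<longleftrightarrow> j < Suc (dindex m \<tau>)" for j
  proof
    assume "dyadic m j \<le> \<tau>"
    then have "dindex m (dyadic m j) \<le> dindex m \<tau>" by (rule dindex_mono)
    then show "j < Suc (dindex m \<tau>)" by simp
  next
    assume "j < Suc (dindex m \<tau>)"
    then have "dyadic m j \<le> dyadic m (dindex m \<tau>)" by (intro dyadic_mono) simp
    then show "dyadic m j \<le> \<tau>" using dfloor_le[OF assms(1), of m] by (simp add: dfloor_def)
  qed
  have "(\<Sum>j<N. if dyadic m j \<le> \<tau> then f (Suc j) - f j else 0) = (\<Sum>j<Suc (dindex m \<tau>). f (Suc j) - f j)"
    by (rule sum.mono_neutral_cong_right) (use assms(2) in \<open>auto simp: iff\<close>)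
  then show ?thesis by (simp only: sum_lessThan_telescope)
qed

lemma simple_integrand_times:
  assumes "simple_integrand M F n \<tau> \<xi>" "i \<le> n"
  shows "0 \<le> \<tau> i" "\<tau> i \<le> \<tau> n"
proof -
  have s: "\<tau> i \<le> \<tau> (Suc i)" if "i < n" for i using assms(1) that by (auto simp: simple_integrand_def)
  have "i \<le> n \<longrightarrow> \<tau> 0 \<le> \<tau> i" for i
    by (induction i) (use s in \<open>auto intro: order_trans\<close>)
  moreover have "0 \<le> \<tau> 0" using assms(1) by (simp add: simple_integrand_def)
  ultimately show "0 \<le> \<tau> i" using assms(2) by (meson order_trans)
  show "\<tau> i \<le> \<tau> n" using assms(2)
    by (induction rule: inc_induct) (use s in \<open>auto intro: order_trans\<close>)
qed

text \<open>The times \<open>\<tau> i\<close> need not be dyadic; freezing the process at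
  \<open>dfloor m s\<close> still gives a step integrand, known at \<open>dfloor m s\<close> and
  hence at \<open>s\<close>.\<close>

lemma stepwise_simple_process:
  assumes S: "simple_integrand M F n \<tau> \<xi>"
  shows "stepwise m (\<lambda>s. simple_process n \<tau> \<xi> (dfloor m s))"
    and "\<exists>K. \<forall>s. \<forall>\<omega>\<in>space M. \<bar>simple_process n \<tau> \<xi> s \<omega>\<bar> \<le> K"
    and "0 \<le> s \<Longrightarrow> simple_process n \<tau> \<xi> s \<in> borel_measurable (F s)"
proof -
  note t = simple_integrand_times[OF S]
  show meas: "simple_process n \<tau> \<xi> s \<in> borel_measurable (F s)" if s: "0 \<le> s" for s
    unfolding simple_process_def[abs_def]
  proof (rule borel_measurable_sum)
    fix i assume i: "i \<in> {..<n}"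
    show "(\<lambda>\<omega>. \<xi> i \<omega> * indicator {\<tau> i<..\<tau> (Suc i)} s) \<in> borel_measurable (F s)"
    proof (cases "\<tau> i < s")
      case True
      have "\<xi> i \<in> borel_measurable (F s)"
        by (rule measurable_F_mono[of "\<tau> i"]) (use t i True S in \<open>auto simp: simple_integrand_def\<close>)
      then show ?thesis by simp
    qed simp
  qed
  have "\<forall>i<n. \<exists>K. \<forall>\<omega>\<in>space M. \<bar>\<xi> i \<omega>\<bar> \<le> K" using S by (auto simp: simple_integrand_def)
  then obtain K where K: "\<And>i \<omega>. i < n \<Longrightarrow> \<omega> \<in> space M \<Longrightarrow> \<bar>\<xi> i \<omega>\<bar> \<le> K i" by metis
  have bd: "\<bar>simple_process n \<tau> \<xi> s \<omega>\<bar> \<le> (\<Sum>i<n. K i)" if "\<omega> \<in> space M" for s \<omega>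
    unfolding simple_process_def
  proof (rule order_trans[OF sum_abs sum_mono])
    fix i assume "i \<in> {..<n}"
    then have "\<bar>\<xi> i \<omega>\<bar> \<le> K i" using K that by simp
    then show "\<bar>\<xi> i \<omega> * indicator {\<tau> i<..\<tau> (Suc i)} s\<bar> \<le> K i"
      by (auto simp: indicator_def)
  qed
  then show "\<exists>K. \<forall>s. \<forall>\<omega>\<in>space M. \<bar>simple_process n \<tau> \<xi> s \<omega>\<bar> \<le> K" by blast
  show "stepwise m (\<lambda>s. simple_process n \<tau> \<xi> (dfloor m s))"
    unfolding stepwise_def
  proof (intro conjI allI impI)
    fix s :: real assume s: "0 \<le> s"
    show "simple_process n \<tau> \<xi> (dfloor m s) = simple_process n \<tau> \<xi> (dfloor m (dfloor m s))"
      by (simp add: dfloor_def)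
    show "simple_process n \<tau> \<xi> (dfloor m s) \<in> borel_measurable (F s)"
      by (rule measurable_F_mono[OF _ dfloor_le[OF s] meas]) simp_all
  qed (use bd in \<open>auto intro!: exI[of _ "\<Sum>i<n. K i"]\<close>)
qed

text \<open>The intervals \<open>{\<tau> i<..\<tau> (Suc i)}\<close> are closed on the right, so the
  process is left continuous, and \<open>dfloor m s\<close> approaches \<open>s\<close> from the
  left.\<close>

lemma simple_process_dfloor:
  assumes "0 \<le> s"
  shows "(\<lambda>m. simple_process n \<tau> \<xi> (dfloor m s) \<omega>) \<longlonglongrightarrow> simple_process n \<tau> \<xi> s \<omega>"
  unfolding simple_process_def
proof (intro tendsto_sum tendsto_mult tendsto_const)
  fix i
  note lim = dfloor_tendsto[OF assms] and le = dfloor_le[OF assms]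
  show "(\<lambda>m. indicator {\<tau> i<..\<tau> (Suc i)} (dfloor m s) :: real) \<longlonglongrightarrow> indicator {\<tau> i<..\<tau> (Suc i)} s"
  proof (rule tendsto_eventually)
    consider "s \<le> \<tau> i" | "\<tau> i < s" "s \<le> \<tau> (Suc i)" | "\<tau> i < s" "\<tau> (Suc i) < s" by linarith
    then show "\<forall>\<^sub>F m in sequentially. indicator {\<tau> i<..\<tau> (Suc i)} (dfloor m s) = (indicator {\<tau> i<..\<tau> (Suc i)} s :: real)"
    proof cases
      case 1
      then have "\<not> \<tau> i < dfloor m s" for m using le[of m] by linarith
      with 1 show ?thesis by (simp add: indicator_def)
    next
      case 2
      show ?thesis using order_tendstoD(1)[OF lim 2(1)]
        by eventually_elim (use 2 le in \<open>auto simp: indicator_def intro: order_trans\<close>)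
    next
      case 3
      show ?thesis using order_tendstoD(1)[OF lim 3(2)]
        by eventually_elim (use 3 in \<open>auto simp: indicator_def\<close>)
    qed
  qed
qed

text \<open>At grid points the indicator of \<open>{\<tau> i<..\<tau> (Suc i)}\<close> is a
  difference of indicators of two initial segments. Over an initial segment the increments of
  \<open>W\<close> telescope to the first grid point after its end, and these points converge to the
  partition times.\<close>

lemma step_integral_simple_process:
  assumes S: "simple_integrand M F n \<tau> \<xi>" and t: "0 \<le> t" and \<omega>: "\<omega> \<in> space M"
  shows "(\<lambda>m. step_integral m (\<lambda>s \<omega>. simple_process n \<tau> \<xi> (dfloor m s) \<omega> *\<^sub>R b) W t \<omega>) \<longlonglongrightarrow> simple_integral n \<tau> \<xi> W t \<omega> \<bullet> b"
proof -
  note tt = simple_integrand_times[OF S]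
  let ?up = "\<lambda>m u. dyadic m (Suc (dindex m u))"
  let ?w = "\<lambda>u. b \<bullet> W (min t u) \<omega>"
  have eq: "step_integral m (\<lambda>s \<omega>. simple_process n \<tau> \<xi> (dfloor m s) \<omega> *\<^sub>R b) W t \<omega>
      = (\<Sum>i<n. \<xi> i \<omega> * (?w (?up m (\<tau> (Suc i))) - ?w (?up m (\<tau> i))))" for m
  proof -
    let ?N = "Suc (dindex m (max t (\<tau> n)))"
    let ?d = "\<lambda>j. ?w (dyadic m (Suc j)) - ?w (dyadic m j)"
    have N: "Suc (dindex m t) \<le> ?N" by (simp add: dindex_mono)
    have part: "(\<Sum>j<?N. if dyadic m j \<le> \<tau> i then ?d j else 0) = ?w (?up m (\<tau> i)) - ?w (dyadic m 0)" if "i \<le> n" for i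
      by (rule sum_dyadic_below[where f="\<lambda>j. ?w (dyadic m j)"]) (use tt[OF that] in \<open>auto intro!: dindex_mono\<close>)
    have "step_integral m (\<lambda>s \<omega>. simple_process n \<tau> \<xi> (dfloor m s) \<omega> *\<^sub>R b) W t \<omega>
        = (\<Sum>j<?N. simple_process n \<tau> \<xi> (dyadic m j) \<omega> * ?d j)"
      unfolding step_integral_extend[OF N] by (simp add: inner_diff_right right_diff_distrib del: sum.lessThan_Suc)
    also have "\<dots> = (\<Sum>j<?N. \<Sum>i<n. \<xi> i \<omega> * ((if dyadic m j \<le> \<tau> (Suc i) then ?d j else 0) - (if dyadic m j \<le> \<tau> i then ?d j else 0)))"
    proof (intro sum.cong refl)
      fix j
      have "\<xi> i \<omega> * indicator {\<tau> i<..\<tau> (Suc i)} (dyadic m j) * ?d j =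
        \<xi> i \<omega> * ((if dyadic m j \<le> \<tau> (Suc i) then ?d j else 0) - (if dyadic m j \<le> \<tau> i then ?d j else 0))" if "i < n" for i
      proof -
        have "\<tau> i \<le> \<tau> (Suc i)" using S that by (auto simp: simple_integrand_def)
        then show ?thesis by (auto simp: indicator_def)
      qed
      then show "simple_process n \<tau> \<xi> (dyadic m j) \<omega> * ?d j = (\<Sum>i<n. \<xi> i \<omega> * ((if dyadic m j \<le> \<tau> (Suc i) then ?d j else 0) - (if dyadic m j \<le> \<tau> i then ?d j else 0)))"
        unfolding simple_process_def sum_distrib_right by (intro sum.cong refl) auto
    qed
    also have "\<dots> = (\<Sum>i<n. \<xi> i \<omega> * ((\<Sum>j<?N. if dyadic m j \<le> \<tau> (Suc i) then ?d j else 0) - (\<Sum>j<?N. if dyadic m j \<le> \<tau> i then ?d j else 0)))"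
      by (subst sum.swap) (simp only: sum_subtractf[symmetric] sum_distrib_left)
    also have "\<dots> = (\<Sum>i<n. \<xi> i \<omega> * (?w (?up m (\<tau> (Suc i))) - ?w (?up m (\<tau> i))))"
    proof (intro sum.cong refl)
      fix i assume "i \<in> {..<n}"
      then have i: "Suc i \<le> n" "i \<le> n" by auto
      show "\<xi> i \<omega> * ((\<Sum>j<?N. if dyadic m j \<le> \<tau> (Suc i) then ?d j else 0) - (\<Sum>j<?N. if dyadic m j \<le> \<tau> i then ?d j else 0))
          = \<xi> i \<omega> * (?w (?up m (\<tau> (Suc i))) - ?w (?up m (\<tau> i)))"
        unfolding part[OF i(1)] part[OF i(2)] by simp
    qed
    finally show ?thesis .
  qed
  have up: "(\<lambda>m. ?w (?up m u)) \<longlonglongrightarrow> ?w u" if u: "0 \<le> u" for u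
  proof -
    have "(\<lambda>m. dfloor m u + (1/2) ^ m) \<longlonglongrightarrow> u + 0"
      using u by (intro tendsto_add dfloor_tendsto LIMSEQ_power_zero) auto
    then have "(\<lambda>m. ?up m u) \<longlonglongrightarrow> u" by (simp add: dyadic_Suc dfloor_def[symmetric] power_one_over)
    then have "(\<lambda>m. min t (?up m u)) \<longlonglongrightarrow> min t u" by (intro tendsto_min tendsto_const)
    then have "(\<lambda>m. W (min t (?up m u)) \<omega>) \<longlonglongrightarrow> W (min t u) \<omega>"
      by (rule continuous_on_tendsto_compose[OF W_continuous[OF \<omega>]]) (use u t in auto)
    then show ?thesis by (intro tendsto_inner tendsto_const)
  qed
  have "(\<lambda>m. \<Sum>i<n. \<xi> i \<omega> * (?w (?up m (\<tau> (Suc i))) - ?w (?up m (\<tau> i)))) \<longlonglongrightarrow> (\<Sum>i<n. \<xi> i \<omega> * (?w (\<tau> (Suc i)) - ?w (\<tau> i)))"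
    by (intro tendsto_sum tendsto_mult tendsto_diff tendsto_const up tt) auto
  moreover have "(\<Sum>i<n. \<xi> i \<omega> * (?w (\<tau> (Suc i)) - ?w (\<tau> i))) = simple_integral n \<tau> \<xi> W t \<omega> \<bullet> b"
    by (simp add: simple_integral_def inner_sum_left inner_diff_left inner_commute[of b])
  ultimately show ?thesis unfolding eq by simp
qed

lemma simple_process_approx:
  assumes S: "simple_integrand M F n \<tau> \<xi>" and T: "0 \<le> T"
  shows "path_measurable (simple_process n \<tau> \<xi>)"
    and "(\<lambda>m. qnorm T (\<lambda>s \<omega>. simple_process n \<tau> \<xi> s \<omega> *\<^sub>R (b::'c::euclidean_space) - simple_process n \<tau> \<xi> (dfloor m s) \<omega> *\<^sub>R b)) \<longlonglongrightarrow> 0"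
proof -
  note st = stepwise_simple_process(1)[OF S]
  show p: "path_measurable (simple_process n \<tau> \<xi>)"
    by (rule path_measurable_LIMSEQ[OF path_measurable_stepwise[OF st] simple_process_dfloor])
  obtain K where K: "\<And>s \<omega>. \<omega> \<in> space M \<Longrightarrow> \<bar>simple_process n \<tau> \<xi> s \<omega>\<bar> \<le> K"
    using stepwise_simple_process(2)[OF S] by blast
  interpret Qf: finite_measure "Q T" by (rule finite_measure_Q)
  have AEQ: "AE z in Q T. fst z \<in> {0..T} \<and> snd z \<in> space M" by (rule AE_I2) (auto simp: space_Q)
  show "(\<lambda>m. qnorm T (\<lambda>s \<omega>. simple_process n \<tau> \<xi> s \<omega> *\<^sub>R b - simple_process n \<tau> \<xi> (dfloor m s) \<omega> *\<^sub>R b)) \<longlonglongrightarrow> 0"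
  proof (rule qnorm_tendsto_0[where w="\<lambda>_. ((K + K) * norm b)\<^sup>2"])
    show "AE z in Q T. (\<lambda>m. simple_process n \<tau> \<xi> (dfloor m (fst z)) (snd z) *\<^sub>R b) \<longlonglongrightarrow> simple_process n \<tau> \<xi> (fst z) (snd z) *\<^sub>R b"
      using AEQ by eventually_elim (intro tendsto_scaleR tendsto_const simple_process_dfloor, simp)
    show "AE z in Q T. (norm (simple_process n \<tau> \<xi> (fst z) (snd z) *\<^sub>R b - simple_process n \<tau> \<xi> (dfloor m (fst z)) (snd z) *\<^sub>R b))\<^sup>2 \<le> ((K + K) * norm b)\<^sup>2" for m
      using AEQ
    proof eventually_elim
      case (elim z)
      then have z: "snd z \<in> space M" by simp
      have "\<bar>simple_process n \<tau> \<xi> (fst z) (snd z) - simple_process n \<tau> \<xi> (dfloor m (fst z)) (snd z)\<bar> \<le> K + K"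
        using K[OF z, of "fst z"] K[OF z, of "dfloor m (fst z)"] by linarith
      then have "norm (simple_process n \<tau> \<xi> (fst z) (snd z) *\<^sub>R b - simple_process n \<tau> \<xi> (dfloor m (fst z)) (snd z) *\<^sub>R b) \<le> (K + K) * norm b"
        unfolding scaleR_diff_left[symmetric] norm_scaleR by (rule mult_right_mono) simp
      then show ?case by (rule power_mono) simp
    qed
    show "(\<integral>\<^sup>+z. ennreal (((K + K) * norm b)\<^sup>2) \<partial>Q T) < \<infinity>" by (simp add: ennreal_mult_eq_top_iff less_top[symmetric])
  qed (auto intro: path_measurable_scaleR p path_measurable_const path_measurable_stepwise[OF st])
qed

lemma l2int_simple_integral:
  assumes S: "simple_integrand M F n \<tau> \<xi>" and t: "0 \<le> t"
  shows "l2int t (\<lambda>s \<omega>. simple_process n \<tau> \<xi> s \<omega> *\<^sub>R b) (\<lambda>\<omega>. simple_integral n \<tau> \<xi> W t \<omega> \<bullet> b)"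
proof (rule l2int_AE_closure)
  note st = stepwise_scaleR[OF stepwise_simple_process(1)[OF S] stepwise_const[of _ b]]
  show "path_measurable (\<lambda>s \<omega>. simple_process n \<tau> \<xi> s \<omega> *\<^sub>R b)"
    by (rule path_measurable_scaleR[OF simple_process_approx(1)[OF S t] path_measurable_const])
  show "l2int t (\<lambda>s \<omega>. simple_process n \<tau> \<xi> (dfloor m s) \<omega> *\<^sub>R b) (step_integral m (\<lambda>s \<omega>. simple_process n \<tau> \<xi> (dfloor m s) \<omega> *\<^sub>R b) W t)" for m
    by (rule l2int_stepwise[OF st t])
  show "(\<lambda>m. qnorm t (\<lambda>s \<omega>. simple_process n \<tau> \<xi> s \<omega> *\<^sub>R b - simple_process n \<tau> \<xi> (dfloor m s) \<omega> *\<^sub>R b)) \<longlonglongrightarrow> 0"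
    by (rule simple_process_approx(2)[OF S t])
  show "AE \<omega> in M. (\<lambda>m. step_integral m (\<lambda>s \<omega>. simple_process n \<tau> \<xi> (dfloor m s) \<omega> *\<^sub>R b) W t \<omega>) \<longlonglongrightarrow> simple_integral n \<tau> \<xi> W t \<omega> \<bullet> b"
    by (rule AE_I2) (rule step_integral_simple_process[OF S t])
  show "(\<lambda>\<omega>. simple_integral n \<tau> \<xi> W t \<omega> \<bullet> b) \<in> borel_measurable M"
    by (rule borel_measurable_LIMSEQ_metric[OF step_integral_L2(2)[OF st t] step_integral_simple_process[OF S t]])
qed (rule t)

text \<open>Progressive measurability gives joint measurability on each \<open>[0, k]\<close>;
  stopping the time at \<open>k\<close> and letting \<open>k\<close> grow covers the
  half-line.\<close>

lemma progressive_path_measurable: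
  assumes "progressive F H" shows "path_measurable H"
proof (rule path_measurable_LIMSEQ)
  fix s :: real and \<omega> assume "0 \<le> s"
  obtain k0 where k0: "s \<le> real k0" using real_arch_simple by blast
  show "(\<lambda>k. H (min s (real k)) \<omega>) \<longlonglongrightarrow> H s \<omega>"
    by (rule tendsto_eventually, rule eventually_sequentiallyI[of k0]) (use k0 in \<open>simp add: min_absorb1\<close>)
next
  fix k :: nat
  have p: "(\<lambda>(s, \<omega>). H s \<omega>) \<in> borel_measurable (restrict_space borel {0..real k} \<Otimes>\<^sub>M F (real k))"
    using assms by (simp add: progressive_def)
  have 1: "(\<lambda>s. min s (real k)) \<in> measurable (restrict_space borel {0..}) (restrict_space borel {0..real k})"
    by (rule measurable_restrict_space2) (auto simp: space_restrict_space intro: measurable_restrict_space1)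
  have 2: "(\<lambda>\<omega>. \<omega>) \<in> measurable M (F (real k))" by (rule measurable_F_M[of "real k"]) simp_all
  have "(\<lambda>z. (min (fst z) (real k), snd z)) \<in> measurable (restrict_space borel {0..} \<Otimes>\<^sub>M M) (restrict_space borel {0..real k} \<Otimes>\<^sub>M F (real k))"
    by (intro measurable_Pair measurable_compose[OF measurable_fst 1] measurable_compose[OF measurable_snd 2])
  from measurable_compose[OF this p] show "path_measurable (\<lambda>s. H (min s (real k)))"
    unfolding path_measurable_def by simp
qed

lemma qnorm_scaleR_const:
  assumes "path_measurable R"
  shows "qnorm T (\<lambda>s \<omega>. R s \<omega> *\<^sub>R (b::'c::euclidean_space)) = ennreal ((norm b)\<^sup>2) * qnorm T R"
proof -
  have [measurable]: "(\<lambda>z. R (fst z) (snd z)) \<in> borel_measurable (Q T)" by (rule path_measurable_Q[OF assms])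
  have "ennreal ((norm (R s \<omega> *\<^sub>R b))\<^sup>2) = ennreal ((norm b)\<^sup>2) * ennreal ((norm (R s \<omega>))\<^sup>2)" for s \<omega>
    by (simp add: power_mult_distrib ennreal_mult mult.commute)
  then show ?thesis
    using assms path_measurable_scaleR[OF assms path_measurable_const, of b]
    by (simp add: qnorm_Q nn_integral_cmult del: norm_scaleR)
qed

text \<open>Translates the limits of simple integrals in the definition of
  \<open>ito_integral\<close> into step integrands on dyadic grids, coordinate by
  coordinate.\<close>

lemma ito_integral_approx:
  assumes I: "ito_integral M F W \<sigma> I"
  shows "path_measurable \<sigma>"
    and "0 < \<eta> \<Longrightarrow> \<exists>n H. stepwise n H \<and> qnorm T (\<lambda>s \<omega>. \<sigma> s \<omega> - H s \<omega>) \<le> ennreal \<eta>"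
    and "0 \<le> t \<Longrightarrow> b \<in> Basis \<Longrightarrow> l2int t (\<lambda>s \<omega>. \<sigma> s \<omega> *\<^sub>R b) (\<lambda>\<omega>. I t \<omega> \<bullet> b)"
proof -
  show p\<sigma>: "path_measurable \<sigma>" using I progressive_path_measurable by (simp add: ito_integral_def)
  have IM: "I t \<in> borel_measurable M" if "0 \<le> t" for t
    using I that measurable_F_M unfolding ito_integral_def continuous_adapted_def by blast
  have ex: "\<exists>n \<tau> \<xi>. simple_integrand M F n \<tau> \<xi> \<and> qnorm T (\<lambda>s \<omega>. \<sigma> s \<omega> - simple_process n \<tau> \<xi> s \<omega>) \<le> ennreal \<eta> \<and>
      (\<integral>\<^sup>+\<omega>. ennreal ((norm (I t \<omega> - simple_integral n \<tau> \<xi> W t \<omega>))\<^sup>2) \<partial>M) \<le> ennreal \<eta>"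
    if T: "0 < T" and \<eta>: "0 < \<eta>" and t: "t \<in> {0..T}" for T \<eta> t
  proof -
    obtain n \<tau> \<xi> where S: "\<And>k. simple_integrand M F (n k) (\<tau> k) (\<xi> k)"
      and 1: "(\<lambda>k. \<integral>\<^sup>+\<omega>. (\<integral>\<^sup>+s\<in>{0..T}. ennreal ((\<sigma> s \<omega> - simple_process (n k) (\<tau> k) (\<xi> k) s \<omega>)\<^sup>2) \<partial>lborel) \<partial>M) \<longlonglongrightarrow> 0"
      and 2: "(\<lambda>k. \<integral>\<^sup>+\<omega>. ennreal ((norm (I t \<omega> - simple_integral (n k) (\<tau> k) (\<xi> k) W t \<omega>))\<^sup>2) \<partial>M) \<longlonglongrightarrow> 0"
      using I T t unfolding ito_integral_def by meson
    obtain k1 where k1: "\<And>k. k1 \<le> k \<Longrightarrow> (\<integral>\<^sup>+\<omega>. (\<integral>\<^sup>+s\<in>{0..T}. ennreal ((\<sigma> s \<omega> - simple_process (n k) (\<tau> k) (\<xi> k) s \<omega>)\<^sup>2) \<partial>lborel) \<partial>M) \<le> ennreal \<eta>"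
      using tendsto_min_0[OF 1 \<eta>] by blast
    obtain k2 where k2: "\<And>k. k2 \<le> k \<Longrightarrow> (\<integral>\<^sup>+\<omega>. ennreal ((norm (I t \<omega> - simple_integral (n k) (\<tau> k) (\<xi> k) W t \<omega>))\<^sup>2) \<partial>M) \<le> ennreal \<eta>"
      using tendsto_min_0[OF 2 \<eta>] by blast
    show ?thesis
      using S[of "max k1 k2"] k1[of "max k1 k2"] k2[of "max k1 k2"] unfolding qnorm_def by auto
  qed
  show "\<exists>n H. stepwise n H \<and> qnorm T (\<lambda>s \<omega>. \<sigma> s \<omega> - H s \<omega>) \<le> ennreal \<eta>" if \<eta>: "0 < \<eta>" for T \<eta>
  proof -
    \<comment> \<open>The definition of \<open>ito_integral\<close> speaks of positive
      \<open>T\<close>; enlarging \<open>T\<close> to at least \<open>1\<close> covers all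
      values.\<close>
    let ?T = "max T 1"
    have \<eta>4: "0 < \<eta> / 4" using \<eta> by simp
    obtain n \<tau> \<xi> where S: "simple_integrand M F n \<tau> \<xi>" and q: "qnorm ?T (\<lambda>s \<omega>. \<sigma> s \<omega> - simple_process n \<tau> \<xi> s \<omega>) \<le> ennreal (\<eta> / 4)"
      using ex[of ?T "\<eta> / 4" 0] \<eta>4 by fastforce
    have T0: "0 \<le> ?T" by simp
    obtain m where m: "qnorm ?T (\<lambda>s \<omega>. simple_process n \<tau> \<xi> s \<omega> - simple_process n \<tau> \<xi> (dfloor m s) \<omega>) \<le> ennreal (\<eta> / 4)"
      using tendsto_min_0[OF simple_process_approx(2)[OF S T0, of "1::real"] \<eta>4] by auto
    note st = stepwise_simple_process(1)[OF S, of m]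
    have "qnorm T (\<lambda>s \<omega>. \<sigma> s \<omega> - simple_process n \<tau> \<xi> (dfloor m s) \<omega>) \<le> qnorm ?T (\<lambda>s \<omega>. \<sigma> s \<omega> - simple_process n \<tau> \<xi> (dfloor m s) \<omega>)"
      by (rule qnorm_mono) simp
    also have "\<dots> \<le> 2 * qnorm ?T (\<lambda>s \<omega>. \<sigma> s \<omega> - simple_process n \<tau> \<xi> s \<omega>) + 2 * qnorm ?T (\<lambda>s \<omega>. simple_process n \<tau> \<xi> s \<omega> - simple_process n \<tau> \<xi> (dfloor m s) \<omega>)"
      by (rule qnorm_triangle[OF p\<sigma> simple_process_approx(1)[OF S, of 0] path_measurable_stepwise[OF st]]) simp
    also have "\<dots> \<le> 2 * ennreal (\<eta> / 4) + 2 * ennreal (\<eta> / 4)" by (intro add_mono mult_left_mono q m) auto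
    also have "\<dots> = ennreal 4 * ennreal (\<eta> / 4)" by (simp add: distrib_right[symmetric])
    also have "\<dots> = ennreal \<eta>" by (subst ennreal_mult'[symmetric]) auto
    finally show ?thesis using st by blast
  qed
  show "l2int t (\<lambda>s \<omega>. \<sigma> s \<omega> *\<^sub>R b) (\<lambda>\<omega>. I t \<omega> \<bullet> b)" if t: "0 \<le> t" and b: "b \<in> Basis" for t b
  proof (rule l2int_closure[OF path_measurable_scaleR[OF p\<sigma> path_measurable_const] _ t])
    show "(\<lambda>\<omega>. I t \<omega> \<bullet> b) \<in> borel_measurable M" using IM[OF t] by simp
    fix \<epsilon> :: real assume \<epsilon>: "0 < \<epsilon>"
    define \<delta> where "\<delta> = min \<epsilon> (\<epsilon>\<^sup>2)"
    have \<delta>: "0 < \<delta>" using \<epsilon> by (simp add: \<delta>_def)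
    obtain n \<tau> \<xi> where S: "simple_integrand M F n \<tau> \<xi>" and q: "qnorm (max t 1) (\<lambda>s \<omega>. \<sigma> s \<omega> - simple_process n \<tau> \<xi> s \<omega>) \<le> ennreal \<delta>"
      and e: "(\<integral>\<^sup>+\<omega>. ennreal ((norm (I t \<omega> - simple_integral n \<tau> \<xi> W t \<omega>))\<^sup>2) \<partial>M) \<le> ennreal \<delta>"
      using ex[of "max t 1" \<delta> t] \<delta> t by fastforce
    have l: "l2int t (\<lambda>s \<omega>. simple_process n \<tau> \<xi> s \<omega> *\<^sub>R b) (\<lambda>\<omega>. simple_integral n \<tau> \<xi> W t \<omega> \<bullet> b)"
      by (rule l2int_simple_integral[OF S t])
    have "sqn (\<lambda>\<omega>. I t \<omega> \<bullet> b - simple_integral n \<tau> \<xi> W t \<omega> \<bullet> b) \<le> (\<integral>\<^sup>+\<omega>. ennreal ((norm (I t \<omega> - simple_integral n \<tau> \<xi> W t \<omega>))\<^sup>2) \<partial>M)"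
      unfolding sqn_def
    proof (intro nn_integral_mono ennreal_leI)
      fix \<omega>
      have "\<bar>(I t \<omega> - simple_integral n \<tau> \<xi> W t \<omega>) \<bullet> b\<bar> \<le> norm (I t \<omega> - simple_integral n \<tau> \<xi> W t \<omega>)"
        by (rule Basis_le_norm[OF b])
      then show "(I t \<omega> \<bullet> b - simple_integral n \<tau> \<xi> W t \<omega> \<bullet> b)\<^sup>2 \<le> (norm (I t \<omega> - simple_integral n \<tau> \<xi> W t \<omega>))\<^sup>2"
        unfolding inner_diff_left[symmetric] by (metis abs_ge_zero power2_abs power_mono)
    qed
    also have "\<dots> \<le> ennreal (\<epsilon>\<^sup>2)" by (rule order_trans[OF e]) (simp add: \<delta>_def ennreal_leI)
    finally have "(\<integral>\<^sup>+\<omega>. ennreal \<bar>I t \<omega> \<bullet> b - simple_integral n \<tau> \<xi> W t \<omega> \<bullet> b\<bar> \<partial>M) \<le> ennreal \<epsilon>"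
      using IM[OF t] l2int_measurable(2)[OF l] by (intro nn_integral_abs_le_sqn \<epsilon>) simp_all
    moreover have "qnorm t (\<lambda>s \<omega>. \<sigma> s \<omega> *\<^sub>R b - simple_process n \<tau> \<xi> s \<omega> *\<^sub>R b) \<le> ennreal \<epsilon>"
    proof -
      have "qnorm t (\<lambda>s \<omega>. \<sigma> s \<omega> *\<^sub>R b - simple_process n \<tau> \<xi> s \<omega> *\<^sub>R b) = qnorm t (\<lambda>s \<omega>. \<sigma> s \<omega> - simple_process n \<tau> \<xi> s \<omega>)"
        using qnorm_scaleR_const[OF path_measurable_diff[OF p\<sigma> simple_process_approx(1)[OF S t]], of t b] b
        by (simp add: scaleR_diff_left)
      also have "\<dots> \<le> qnorm (max t 1) (\<lambda>s \<omega>. \<sigma> s \<omega> - simple_process n \<tau> \<xi> s \<omega>)" by (rule qnorm_mono) simp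
      also have "\<dots> \<le> ennreal \<epsilon>" by (rule order_trans[OF q]) (simp add: \<delta>_def ennreal_leI)
      finally show ?thesis .
    qed
    ultimately show "\<exists>\<Theta>' J'. l2int t \<Theta>' J' \<and> qnorm t (\<lambda>s \<omega>. \<sigma> s \<omega> *\<^sub>R b - \<Theta>' s \<omega>) \<le> ennreal \<epsilon> \<and>
        (\<integral>\<^sup>+\<omega>. ennreal \<bar>I t \<omega> \<bullet> b - J' \<omega>\<bar> \<partial>M) \<le> ennreal \<epsilon>" using l by blast
  qed
qed

end

section \<open>Ito's formula for the norm\<close>

context stochastic_basis
begin

lemma tint_zero: "tint t (\<lambda>s \<omega>. 0) \<omega> = 0"
  by (simp add: tint_def)

lemma functional_diff_L1:
  fixes u u0 v v0 :: "'w \<Rightarrow> real"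
  assumes [measurable]: "u \<in> borel_measurable M" "u0 \<in> borel_measurable M" "v \<in> borel_measurable M" "v0 \<in> borel_measurable M"
    and p: "path_measurable R1" "path_measurable R2" "path_measurable S1" "path_measurable S2"
    and fin: "(\<integral>\<^sup>+z. ennreal \<bar>R1 (fst z) (snd z)\<bar> \<partial>Q t) < \<infinity>" "(\<integral>\<^sup>+z. ennreal \<bar>R2 (fst z) (snd z)\<bar> \<partial>Q t) < \<infinity>"
      "(\<integral>\<^sup>+z. ennreal \<bar>S1 (fst z) (snd z)\<bar> \<partial>Q t) < \<infinity>" "(\<integral>\<^sup>+z. ennreal \<bar>S2 (fst z) (snd z)\<bar> \<partial>Q t) < \<infinity>"
  shows "(\<integral>\<^sup>+\<omega>. ennreal \<bar>(u \<omega> - u0 \<omega> - tint t R1 \<omega> - tint t R2 \<omega>) - (v \<omega> - v0 \<omega> - tint t S1 \<omega> - tint t S2 \<omega>)\<bar> \<partial>M)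
    \<le> (\<integral>\<^sup>+\<omega>. ennreal \<bar>u \<omega> - v \<omega>\<bar> \<partial>M) + (\<integral>\<^sup>+\<omega>. ennreal \<bar>u0 \<omega> - v0 \<omega>\<bar> \<partial>M)
      + (\<integral>\<^sup>+z. ennreal \<bar>R1 (fst z) (snd z) - S1 (fst z) (snd z)\<bar> \<partial>Q t)
      + (\<integral>\<^sup>+z. ennreal \<bar>R2 (fst z) (snd z) - S2 (fst z) (snd z)\<bar> \<partial>Q t)"
proof -
  note [measurable] = p[THEN tint_measurable]
  have "(\<integral>\<^sup>+\<omega>. ennreal \<bar>(u \<omega> - u0 \<omega> - tint t R1 \<omega> - tint t R2 \<omega>) - (v \<omega> - v0 \<omega> - tint t S1 \<omega> - tint t S2 \<omega>)\<bar> \<partial>M)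
    \<le> (\<integral>\<^sup>+\<omega>. ennreal \<bar>u \<omega> - v \<omega>\<bar> + ennreal \<bar>u0 \<omega> - v0 \<omega>\<bar> + ennreal \<bar>tint t R1 \<omega> - tint t S1 \<omega>\<bar> + ennreal \<bar>tint t R2 \<omega> - tint t S2 \<omega>\<bar> \<partial>M)"
    by (intro nn_integral_mono) (simp add: ennreal_plus[symmetric] ennreal_leI del: ennreal_plus)
  also have "\<dots> = (\<integral>\<^sup>+\<omega>. ennreal \<bar>u \<omega> - v \<omega>\<bar> \<partial>M) + (\<integral>\<^sup>+\<omega>. ennreal \<bar>u0 \<omega> - v0 \<omega>\<bar> \<partial>M)
      + (\<integral>\<^sup>+\<omega>. ennreal \<bar>tint t R1 \<omega> - tint t S1 \<omega>\<bar> \<partial>M) + (\<integral>\<^sup>+\<omega>. ennreal \<bar>tint t R2 \<omega> - tint t S2 \<omega>\<bar> \<partial>M)"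
    by (rule nn_integral_add4) measurable
  finally show ?thesis
    by (rule order_trans) (intro add_mono order_refl tint_diff_L1 p fin)
qed

lemma path_measurable_inner:
  "path_measurable \<Theta> \<Longrightarrow> path_measurable \<beta> \<Longrightarrow> path_measurable (\<lambda>s \<omega>. \<Theta> s \<omega> \<bullet> \<beta> s \<omega>)"
  unfolding path_measurable_def by simp

lemma path_measurable_mult:
  "path_measurable R \<Longrightarrow> path_measurable S \<Longrightarrow> path_measurable (\<lambda>s \<omega>. R s \<omega> * S s \<omega> :: real)"
  unfolding path_measurable_def by simp

end

context brownian_basis
begin

lemma vector_step_integral_inner:
  "b \<in> Basis \<Longrightarrow> vector_step_integral n \<sigma> t \<omega> \<bullet> b = step_integral n (\<lambda>s \<omega>. \<sigma> s \<omega> *\<^sub>R b) W t \<omega>"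
  by (simp add: vector_step_integral_def inner_sum_left_Basis)

lemma continuous_adapted_vector_step_integral:
  assumes "stepwise n \<sigma>" shows "continuous_adapted M F (vector_step_integral n \<sigma>)"
  unfolding continuous_adapted_def vector_step_integral_def[abs_def]
proof (intro conjI allI impI ballI)
  note st = stepwise_scaleR[OF assms stepwise_const]
  show "(\<lambda>\<omega>. \<Sum>b\<in>Basis. step_integral n (\<lambda>s \<omega>. \<sigma> s \<omega> *\<^sub>R b) W t \<omega> *\<^sub>R b) \<in> borel_measurable (F t)" if "0 \<le> t" for t
    by (intro borel_measurable_sum borel_measurable_scaleR step_integral_L2(1)[OF st that] borel_measurable_const)
  show "continuous_on {0..} (\<lambda>t. \<Sum>b\<in>Basis. step_integral n (\<lambda>s \<omega>. \<sigma> s \<omega> *\<^sub>R b) W t \<omega> *\<^sub>R b)" if "\<omega> \<in> space M" for \<omega>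
    by (intro continuous_on_sum continuous_on_scaleR step_integral_continuous W_continuous that continuous_on_const)
qed

text \<open>The squared length is a sum over the coordinates, each of which is bounded by
  \<open>l2int_dist\<close>; hence the factor \<open>16 * real DIM('a)\<close>.\<close>

lemma vector_step_integral_dist:
  assumes st: "stepwise n S" and p\<sigma>: "path_measurable \<sigma>" and u: "0 \<le> u" "u \<le> t" and q: "qnorm t (\<lambda>s \<omega>. \<sigma> s \<omega> - S s \<omega>) \<le> ennreal \<delta>"
    and lI: "\<And>b. b \<in> Basis \<Longrightarrow> l2int u (\<lambda>s \<omega>. \<sigma> s \<omega> *\<^sub>R b) (\<lambda>\<omega>. I u \<omega> \<bullet> b)" and \<delta>: "0 \<le> \<delta>"
  shows "(\<integral>\<^sup>+\<omega>. ennreal ((norm (vector_step_integral n S u \<omega> - I u \<omega>))\<^sup>2) \<partial>M) \<le> ennreal (16 * real DIM('a) * \<delta>)"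
proof -
  let ?s = "\<lambda>b. step_integral n (\<lambda>s \<omega>. S s \<omega> *\<^sub>R b) W u"
  note sb = stepwise_scaleR[OF st stepwise_const]
  have "ennreal ((norm (vector_step_integral n S u \<omega> - I u \<omega>))\<^sup>2) = (\<Sum>b\<in>Basis. ennreal ((?s b \<omega> - I u \<omega> \<bullet> b)\<^sup>2))" for \<omega>
    by (simp add: norm2_Basis inner_diff_right inner_commute[of _ "vector_step_integral n S u \<omega>"] vector_step_integral_inner
        inner_commute[of _ "I u \<omega>"] sum_ennreal)
  then have "(\<integral>\<^sup>+\<omega>. ennreal ((norm (vector_step_integral n S u \<omega> - I u \<omega>))\<^sup>2) \<partial>M) = (\<Sum>b\<in>Basis. sqn (\<lambda>\<omega>. ?s b \<omega> - I u \<omega> \<bullet> b))"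
    unfolding sqn_def
  proof (simp only:, intro nn_integral_sum)
    fix b :: 'a assume b: "b \<in> Basis"
    note [measurable] = step_integral_L2(2)[OF sb u(1)] l2int_measurable(2)[OF lI[OF b]]
    show "(\<lambda>\<omega>. ennreal ((?s b \<omega> - I u \<omega> \<bullet> b)\<^sup>2)) \<in> borel_measurable M" by measurable
  qed
  also have "\<dots> \<le> (\<Sum>b\<in>(Basis::'a set). ennreal (16 * \<delta>))"
  proof (rule sum_mono)
    fix b :: 'a assume b: "b \<in> Basis"
    have "sqn (\<lambda>\<omega>. ?s b \<omega> - I u \<omega> \<bullet> b) \<le> 16 * qnorm u (\<lambda>s \<omega>. S s \<omega> *\<^sub>R b - \<sigma> s \<omega> *\<^sub>R b)"
      by (rule l2int_dist[OF l2int_stepwise[OF sb u(1)] lI[OF b] u(1)])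
    also have "qnorm u (\<lambda>s \<omega>. S s \<omega> *\<^sub>R b - \<sigma> s \<omega> *\<^sub>R b) = qnorm u (\<lambda>s \<omega>. \<sigma> s \<omega> - S s \<omega>)"
      using qnorm_scaleR_const[OF path_measurable_diff[OF path_measurable_stepwise[OF st] p\<sigma>], of u b] b
      by (simp add: scaleR_diff_left qnorm_commute[of u S])
    also have "\<dots> \<le> qnorm t (\<lambda>s \<omega>. \<sigma> s \<omega> - S s \<omega>)" by (rule qnorm_mono[OF u(2)])
    also have "\<dots> \<le> ennreal \<delta>" by (rule q)
    finally show "sqn (\<lambda>\<omega>. ?s b \<omega> - I u \<omega> \<bullet> b) \<le> ennreal (16 * \<delta>)"
      by (simp add: ennreal_mult' mult_left_mono)
  qed
  also have "\<dots> = ennreal (16 * real DIM('a) * \<delta>)" using \<delta> by (subst sum_ennreal) (auto simp: mult_ac)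
  finally show ?thesis .
qed

text \<open>The martingale part of \<open>Y\<close> is exchanged for the integral of a step
  integrand \<open>S k\<close> while the drift is kept: \<open>Z k = Y - I + V k\<close> has the
  form required by \<open>ito_step_integrand\<close>. The squared errors decrease geometrically in
  mean, so their sum is integrable over \<open>Q t\<close>. This one function provides both
  convergence almost everywhere and a majorant for all \<open>k\<close>.\<close>

lemma ito_soft_norm:
  assumes \<epsilon>: "0 < \<epsilon>" and t: "0 \<le> t" and p\<sigma>: "path_measurable \<sigma>"
    and approx: "\<And>\<eta>. 0 < \<eta> \<Longrightarrow> \<exists>n H. stepwise n H \<and> qnorm t (\<lambda>s \<omega>. \<sigma> s \<omega> - H s \<omega>) \<le> ennreal \<eta>"
    and I: "continuous_adapted M F I" and lI: "\<And>u b. 0 \<le> u \<Longrightarrow> b \<in> Basis \<Longrightarrow> l2int u (\<lambda>s \<omega>. \<sigma> s \<omega> *\<^sub>R b) (\<lambda>\<omega>. I u \<omega> \<bullet> b)"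
    and Y: "continuous_adapted M F Y"
    and \<beta>: "path_measurable \<beta>" and \<beta>fin: "(\<integral>\<^sup>+z. ennreal (norm (\<beta> (fst z) (snd z))) \<partial>Q t) < \<infinity>"
    and decomp: "AE \<omega> in M. \<forall>u\<in>{0..t}. Y u \<omega> = Y 0 \<omega> + I u \<omega> + (LINT s:{0..u}|lborel. \<beta> s \<omega>)"
  shows "l2int t (\<lambda>s \<omega>. \<sigma> s \<omega> *\<^sub>R soft_grad \<epsilon> (Y s \<omega>))
    (\<lambda>\<omega>. soft_norm \<epsilon> (Y t \<omega>) - soft_norm \<epsilon> (Y 0 \<omega>)
       - tint t (\<lambda>s \<omega>. (\<sigma> s \<omega>)\<^sup>2 / 2 * soft_laplace \<epsilon> (Y s \<omega>)) \<omega>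
       - tint t (\<lambda>s \<omega>. soft_grad \<epsilon> (Y s \<omega>) \<bullet> \<beta> s \<omega>) \<omega>)"
    (is "l2int t ?\<Theta> ?J")
    and "qnorm t \<sigma> < \<infinity>"
proof -
  let ?f = "soft_norm \<epsilon> :: 'a \<Rightarrow> real" and ?g = "soft_grad \<epsilon> :: 'a \<Rightarrow> 'a" and ?l = "soft_laplace \<epsilon> :: 'a \<Rightarrow> real"
  have fb: "?f \<in> borel_measurable borel" and gb: "?g \<in> borel_measurable borel" and lb: "?l \<in> borel_measurable borel"
    using continuous_soft_norm[OF \<epsilon>] continuous_soft_grad[OF \<epsilon>] continuous_soft_laplace[OF \<epsilon>]
    by (auto intro: borel_measurable_continuous_onI)
  have gcont: "(\<lambda>n. ?g (u n)) \<longlonglongrightarrow> ?g v" if "u \<longlonglongrightarrow> v" for u v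
    using continuous_on_tendsto_compose[OF continuous_soft_grad[OF \<epsilon>] that] by simp
  have lcont: "(\<lambda>n. ?l (u n)) \<longlonglongrightarrow> ?l v" if "u \<longlonglongrightarrow> v" for u v
    using continuous_on_tendsto_compose[OF continuous_soft_laplace[OF \<epsilon>] that] by simp
  have "\<forall>k. \<exists>n H. stepwise n H \<and> qnorm t (\<lambda>s \<omega>. \<sigma> s \<omega> - H s \<omega>) \<le> ennreal ((1 / 2) ^ k)"
    by (intro allI approx) simp
  from choice[OF this] obtain n where "\<forall>k. \<exists>H. stepwise (n k) H \<and> qnorm t (\<lambda>s \<omega>. \<sigma> s \<omega> - H s \<omega>) \<le> ennreal ((1 / 2) ^ k)" ..
  from choice[OF this] obtain S where S: "\<And>k. stepwise (n k) (S k)"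
    and qS: "\<And>k. qnorm t (\<lambda>s \<omega>. \<sigma> s \<omega> - S k s \<omega>) \<le> ennreal ((1 / 2) ^ k)" by blast
  define V where "V k = vector_step_integral (n k) (S k)" for k
  define Z where "Z k u \<omega> = Y u \<omega> - I u \<omega> + V k u \<omega>" for k u \<omega>
  have V: "continuous_adapted M F (V k)" for k unfolding V_def by (rule continuous_adapted_vector_step_integral[OF S])
  have Z: "continuous_adapted M F (Z k)" for k
    using Y I V[of k] unfolding continuous_adapted_def Z_def
    by (auto intro!: borel_measurable_add borel_measurable_diff continuous_on_add continuous_on_diff)
  have measM: "X u \<in> borel_measurable M" if "continuous_adapted M F X" "0 \<le> u" for X :: "real \<Rightarrow> 'w \<Rightarrow> 'a" and u
    using that measurable_F_M unfolding continuous_adapted_def by blast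
  have pathM: "path_measurable X" if "continuous_adapted M F X" for X :: "real \<Rightarrow> 'w \<Rightarrow> 'a"
    by (rule path_measurable_continuous[OF measM[OF that]]) (use that in \<open>auto simp: continuous_adapted_def\<close>)
  have V0: "V k 0 \<omega> = 0" for k \<omega> by (simp add: V_def vector_step_integral_def step_integral_0)
  have Zdec: "AE \<omega> in M. \<forall>u\<in>{0..t}. Z k u \<omega> = Z k 0 \<omega> + vector_step_integral (n k) (S k) u \<omega> + (LINT s:{0..u}|lborel. \<beta> s \<omega>)" for k
    using decomp
  proof eventually_elim
    case (elim \<omega>)
    \<comment> \<open>The decomposition at time \<open>0\<close> forces
      \<open>I 0 \<omega> = 0\<close>, so \<open>Y\<close> and \<open>Z k\<close> start at the same
      point.\<close>
    have "Y 0 \<omega> = Y 0 \<omega> + I 0 \<omega> + (LINT s:{0..0}|lborel. \<beta> s \<omega>)" by (rule bspec[OF elim]) (use t in simp)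
    then have I0: "I 0 \<omega> = 0" unfolding LINT_half_open by (simp add: set_lebesgue_integral_def)
    show ?case
    proof
      fix u assume "u \<in> {0..t}"
      from bspec[OF elim this] have "Y u \<omega> - I u \<omega> = Y 0 \<omega> + (LINT s:{0..u}|lborel. \<beta> s \<omega>)" by (simp add: algebra_simps)
      then show "Z k u \<omega> = Z k 0 \<omega> + vector_step_integral (n k) (S k) u \<omega> + (LINT s:{0..u}|lborel. \<beta> s \<omega>)"
        unfolding Z_def V0 I0 by (simp add: V_def)
    qed
  qed
  let ?Jk = "\<lambda>k \<omega>. ?f (Z k t \<omega>) - ?f (Z k 0 \<omega>) - tint t (\<lambda>s \<omega>. (S k s \<omega>)\<^sup>2 / 2 * ?l (Z k s \<omega>)) \<omega>
       - tint t (\<lambda>s \<omega>. ?g (Z k s \<omega>) \<bullet> \<beta> s \<omega>) \<omega>"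
  let ?\<Theta>k = "\<lambda>k s \<omega>. S k s \<omega> *\<^sub>R ?g (Z k s \<omega>)"
  have lk: "l2int t (?\<Theta>k k) (?Jk k)" for k by (rule ito_step_integrand[OF \<epsilon> t S Z \<beta> \<beta>fin Zdec])
  define d where "d = real DIM('a)"
  have d: "0 < d" by (simp add: d_def)
  have dist: "(\<integral>\<^sup>+\<omega>. ennreal ((norm (Z k u \<omega> - Y u \<omega>))\<^sup>2) \<partial>M) \<le> ennreal (16 * d * (1 / 2) ^ k)" if "u \<in> {0..t}" for k u
  proof -
    have "(\<integral>\<^sup>+\<omega>. ennreal ((norm (vector_step_integral (n k) (S k) u \<omega> - I u \<omega>))\<^sup>2) \<partial>M) \<le> ennreal (16 * real DIM('a) * (1 / 2) ^ k)"
      by (rule vector_step_integral_dist[OF S p\<sigma> _ _ qS lI]) (use that in auto)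
    then show ?thesis by (simp add: Z_def V_def d_def)
  qed
  have pS: "path_measurable (S k)" for k by (rule path_measurable_stepwise[OF S])
  note pZ = pathM[OF Z] and pY = pathM[OF Y]
  note mQ = path_measurable_Q[where T=t]
  have Zq: "(\<integral>\<^sup>+z. ennreal ((norm (Z k (fst z) (snd z) - Y (fst z) (snd z)))\<^sup>2) \<partial>Q t) \<le> ennreal (16 * d * t * (1 / 2) ^ k)" for k
  proof -
    note [measurable] = mQ[OF pZ, of k] mQ[OF pY]
    have "(\<integral>\<^sup>+z. ennreal ((norm (Z k (fst z) (snd z) - Y (fst z) (snd z)))\<^sup>2) \<partial>Q t)
        = (\<integral>\<^sup>+s. \<integral>\<^sup>+\<omega>. ennreal ((norm (Z k s \<omega> - Y s \<omega>))\<^sup>2) \<partial>M \<partial>restrict_space lborel {0..t})"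
      using nn_integral_fst[of "\<lambda>z. ennreal ((norm (Z k (fst z) (snd z) - Y (fst z) (snd z)))\<^sup>2)" "restrict_space lborel {0..t}"]
      unfolding Q_def[symmetric] by simp
    also have "\<dots> \<le> (\<integral>\<^sup>+s. ennreal (16 * d * (1 / 2) ^ k) \<partial>restrict_space lborel {0..t})"
      by (intro nn_integral_mono dist) (simp add: space_restrict_space)
    also have "\<dots> = ennreal (16 * d * (1 / 2) ^ k) * ennreal t"
      using t by (simp add: emeasure_restrict_space space_restrict_space)
    also have "\<dots> = ennreal (16 * d * t * (1 / 2) ^ k)" using t d by (subst ennreal_mult[symmetric]) (auto simp: mult_ac)
    finally show ?thesis .
  qed
  define e where "e k z = (\<sigma> (fst z) (snd z) - S k (fst z) (snd z))\<^sup>2 + (norm (Z k (fst z) (snd z) - Y (fst z) (snd z)))\<^sup>2" for k z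
  have em[measurable]: "e k \<in> borel_measurable (Q t)" for k
    unfolding e_def[abs_def] using mQ[OF pZ, of k] mQ[OF pY] mQ[OF p\<sigma>] mQ[OF pS, of k] by measurable
  have e0: "0 \<le> e k z" for k z by (simp add: e_def)
  \<comment> \<open>The sum of all errors: it dominates each of them, and where it is finite they
    tend to \<open>0\<close>. By \<open>enn2real\<close> it is set to \<open>0\<close> where the sum
    is infinite, which happens on a null set only.\<close>
  define w where "w z = enn2real (\<Sum>k. ennreal (e k z))" for z
  have wm[measurable]: "w \<in> borel_measurable (Q t)" unfolding w_def[abs_def] by measurable
  have eint: "(\<integral>\<^sup>+z. ennreal (e k z) \<partial>Q t) \<le> ennreal ((1 + 16 * d * t) * (1 / 2) ^ k)" for k
  proof -
    note [measurable] = mQ[OF pZ, of k] mQ[OF pY] mQ[OF p\<sigma>] mQ[OF pS, of k]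
    have "(\<integral>\<^sup>+z. ennreal (e k z) \<partial>Q t) = qnorm t (\<lambda>s \<omega>. \<sigma> s \<omega> - S k s \<omega>) + (\<integral>\<^sup>+z. ennreal ((norm (Z k (fst z) (snd z) - Y (fst z) (snd z)))\<^sup>2) \<partial>Q t)"
      unfolding qnorm_Q[OF path_measurable_diff[OF p\<sigma> pS]] by (simp add: e_def nn_integral_add)
    also have "\<dots> \<le> ennreal ((1 / 2) ^ k) + ennreal (16 * d * t * (1 / 2) ^ k)" by (intro add_mono qS Zq)
    also have "\<dots> = ennreal ((1 + 16 * d * t) * (1 / 2) ^ k)"
      using d t by (simp add: ennreal_plus[symmetric] distrib_right del: ennreal_plus)
    finally show ?thesis .
  qed
  have sumfin: "(\<integral>\<^sup>+z. (\<Sum>k. ennreal (e k z)) \<partial>Q t) < \<infinity>"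
  proof -
    have "(\<integral>\<^sup>+z. (\<Sum>k. ennreal (e k z)) \<partial>Q t) = (\<Sum>k. \<integral>\<^sup>+z. ennreal (e k z) \<partial>Q t)"
      by (rule nn_integral_suminf) measurable
    also have "\<dots> \<le> (\<Sum>k. ennreal ((1 + 16 * d * t) * (1 / 2) ^ k))" by (intro suminf_le eint) auto
    also have "\<dots> = ennreal (\<Sum>k. (1 + 16 * d * t) * (1 / 2) ^ k)"
      using d t by (intro suminf_ennreal2 summable_mult summable_geometric) auto
    finally show ?thesis by (simp add: le_less_trans)
  qed
  have wfin: "(\<integral>\<^sup>+z. ennreal (w z) \<partial>Q t) < \<infinity>"
    by (rule le_less_trans[OF nn_integral_mono sumfin]) (simp add: w_def ennreal_enn2real_if)
  have AEw: "AE z in Q t. (\<forall>k. e k z \<le> w z) \<and> (\<lambda>k. e k z) \<longlonglongrightarrow> 0"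
  proof -
    have "AE z in Q t. (\<Sum>k. ennreal (e k z)) \<noteq> \<infinity>"
      using sumfin by (intro nn_integral_PInf_AE) auto
    then show ?thesis
    proof eventually_elim
      case (elim z)
      have sm: "summable (\<lambda>k. e k z)" using elim by (intro summable_suminf_not_top e0) simp
      have "w z = (\<Sum>k. e k z)"
        unfolding w_def suminf_ennreal2[OF e0 sm] by (rule enn2real_ennreal[OF suminf_nonneg[OF sm e0]])
      then have "e k z \<le> w z" for k using sum_le_suminf[OF sm, of "{k}"] e0 by simp
      then show ?case using summable_LIMSEQ_zero[OF sm] by blast
    qed
  qed
  have w0: "0 \<le> w z" for z by (simp add: w_def)
  have limS: "(\<lambda>k. S k (fst z) (snd z)) \<longlonglongrightarrow> \<sigma> (fst z) (snd z)" and limZ: "(\<lambda>k. Z k (fst z) (snd z)) \<longlonglongrightarrow> Y (fst z) (snd z)"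
    if "(\<lambda>k. e k z) \<longlonglongrightarrow> 0" for z
  proof -
    have sq: "(\<lambda>k. sqrt (e k z)) \<longlonglongrightarrow> 0" using tendsto_real_sqrt[OF that] by simp
    have "(\<lambda>k. \<sigma> (fst z) (snd z) - S k (fst z) (snd z)) \<longlonglongrightarrow> 0"
      by (rule Lim_null_comparison[OF always_eventually sq]) (auto simp: e_def intro!: real_le_rsqrt)
    from tendsto_diff[OF tendsto_const[of "\<sigma> (fst z) (snd z)"] this]
    show "(\<lambda>k. S k (fst z) (snd z)) \<longlonglongrightarrow> \<sigma> (fst z) (snd z)" by simp
    have "(\<lambda>k. Z k (fst z) (snd z) - Y (fst z) (snd z)) \<longlonglongrightarrow> 0"
      by (rule Lim_null_comparison[OF always_eventually sq]) (auto simp: e_def intro!: real_le_rsqrt)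
    from tendsto_add[OF this tendsto_const[of "Y (fst z) (snd z)"]]
    show "(\<lambda>k. Z k (fst z) (snd z)) \<longlonglongrightarrow> Y (fst z) (snd z)" by simp
  qed
  have Ssq: "(S k (fst z) (snd z))\<^sup>2 \<le> 2 * (\<sigma> (fst z) (snd z))\<^sup>2 + 2 * w z" if "e k z \<le> w z" for k z
  proof -
    have "(\<sigma> (fst z) (snd z) - S k (fst z) (snd z))\<^sup>2 \<le> w z" using that by (simp add: e_def) (metis add_increasing2 dual_order.trans order_refl zero_le_power2)
    moreover have "(S k (fst z) (snd z))\<^sup>2 \<le> 2 * (\<sigma> (fst z) (snd z))\<^sup>2 + 2 * (\<sigma> (fst z) (snd z) - S k (fst z) (snd z))\<^sup>2"
    proof -
      have "y\<^sup>2 \<le> 2 * x\<^sup>2 + 2 * (x - y)\<^sup>2" for x y :: real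
        using zero_le_power2[of "2 * x - y"] by (simp add: power2_diff power_mult_distrib algebra_simps)
      then show ?thesis .
    qed
    ultimately show ?thesis by linarith
  qed
  show \<sigma>fin: "qnorm t \<sigma> < \<infinity>"
  proof -
    obtain c where c: "qnorm t (S 0) = ennreal c" using qnorm_stepwise[OF S t] by blast
    have "qnorm t (\<lambda>s \<omega>. \<sigma> s \<omega> - 0) \<le> 2 * qnorm t (\<lambda>s \<omega>. \<sigma> s \<omega> - S 0 s \<omega>) + 2 * qnorm t (\<lambda>s \<omega>. S 0 s \<omega> - 0)"
      by (rule qnorm_triangle[OF p\<sigma> pS path_measurable_const])
    also have "\<dots> \<le> ennreal 2 * ennreal 1 + ennreal 2 * ennreal c"
      using qS[of 0] c by (intro add_mono mult_mono) auto
    also have "\<dots> < \<infinity>" by (simp only: ennreal_mult'[symmetric, of 2]) simp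
    finally show ?thesis by simp
  qed
  have \<sigma>m[measurable]: "(\<lambda>z. \<sigma> (fst z) (snd z)) \<in> borel_measurable (Q t)" by (rule mQ[OF p\<sigma>])
  have comb: "(\<integral>\<^sup>+z. ennreal (a * (\<sigma> (fst z) (snd z))\<^sup>2 + b * w z) \<partial>Q t) < \<infinity>" if "0 \<le> a" "0 \<le> b" for a b
  proof -
    have "(\<integral>\<^sup>+z. ennreal (a * (\<sigma> (fst z) (snd z))\<^sup>2 + b * w z) \<partial>Q t) = ennreal a * qnorm t \<sigma> + ennreal b * (\<integral>\<^sup>+z. ennreal (w z) \<partial>Q t)"
      using that w0 by (simp add: qnorm_Q[OF p\<sigma>] ennreal_mult ennreal_plus nn_integral_add nn_integral_cmult)
    then show ?thesis using \<sigma>fin wfin by (simp add: ennreal_mult_less_top)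
  qed
  have g1: "norm (?g u) \<le> 1" for u by (rule norm_soft_grad[OF \<epsilon>])
  have pgY: "path_measurable (\<lambda>s \<omega>. ?g (Y s \<omega>))" by (rule path_measurable_compose[OF pY gb])
  have pgZ: "path_measurable (\<lambda>s \<omega>. ?g (Z k s \<omega>))" for k by (rule path_measurable_compose[OF pZ gb])
  have p\<Theta>: "path_measurable ?\<Theta>" by (rule path_measurable_scaleR[OF p\<sigma> pgY])
  have p\<Theta>k: "path_measurable (?\<Theta>k k)" for k by (rule path_measurable_scaleR[OF pS pgZ])
  let ?R1 = "\<lambda>s \<omega>. (\<sigma> s \<omega>)\<^sup>2 / 2 * ?l (Y s \<omega>)" and ?R1k = "\<lambda>k s \<omega>. (S k s \<omega>)\<^sup>2 / 2 * ?l (Z k s \<omega>)"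
  let ?R2 = "\<lambda>s \<omega>. ?g (Y s \<omega>) \<bullet> \<beta> s \<omega>" and ?R2k = "\<lambda>k s \<omega>. ?g (Z k s \<omega>) \<bullet> \<beta> s \<omega>"
  have pR1: "path_measurable ?R1"
    by (intro path_measurable_mult path_measurable_compose[OF pY lb] path_measurable_compose[OF p\<sigma>, of "\<lambda>x. x\<^sup>2 / 2"]) simp
  have pR1k: "path_measurable (?R1k k)" for k
    by (intro path_measurable_mult path_measurable_compose[OF pZ lb] path_measurable_compose[OF pS, of "\<lambda>x. x\<^sup>2 / 2"]) simp
  have pR2: "path_measurable ?R2" by (rule path_measurable_inner[OF pgY \<beta>])
  have pR2k: "path_measurable (?R2k k)" for k by (rule path_measurable_inner[OF pgZ \<beta>])
  have R2b: "\<bar>?g u \<bullet> v\<bar> \<le> norm v" for u v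
    using Cauchy_Schwarz_ineq2[of "?g u" v] mult_right_mono[OF g1, of "norm v" u] by simp
  have \<beta>m: "(\<lambda>z. norm (\<beta> (fst z) (snd z))) \<in> borel_measurable (Q t)" using mQ[OF \<beta>] by simp
  have R2fin: "(\<integral>\<^sup>+z. ennreal \<bar>?g (X z) \<bullet> \<beta> (fst z) (snd z)\<bar> \<partial>Q t) < \<infinity>" for X
    by (rule le_less_trans[OF nn_integral_mono \<beta>fin]) (rule ennreal_leI[OF R2b])
  have R1b: "\<bar>x\<^sup>2 / 2 * ?l u\<bar> \<le> d / \<epsilon> * x\<^sup>2" for x u
  proof -
    have "\<bar>x\<^sup>2 / 2 * ?l u\<bar> \<le> x\<^sup>2 * (d / \<epsilon>)"
      unfolding abs_mult d_def using soft_laplace_bounds(2,4)[OF \<epsilon>, of u] by (intro mult_mono) auto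
    then show ?thesis by (simp add: mult.commute)
  qed
  have R1fin: "(\<integral>\<^sup>+z. ennreal \<bar>?R1 (fst z) (snd z)\<bar> \<partial>Q t) < \<infinity>"
    by (rule le_less_trans[OF nn_integral_mono comb[of "d / \<epsilon>" 0]])
      (use d \<epsilon> R1b in \<open>auto intro!: ennreal_leI simp del: times_divide_eq_left\<close>)
  have R1kb: "AE z in Q t. \<bar>?R1k k (fst z) (snd z)\<bar> \<le> 2 * d / \<epsilon> * (\<sigma> (fst z) (snd z))\<^sup>2 + 2 * d / \<epsilon> * w z" for k
    using AEw
  proof eventually_elim
    case (elim z)
    have "\<bar>?R1k k (fst z) (snd z)\<bar> \<le> d / \<epsilon> * (S k (fst z) (snd z))\<^sup>2" by (rule R1b)
    also have "\<dots> \<le> d / \<epsilon> * (2 * (\<sigma> (fst z) (snd z))\<^sup>2 + 2 * w z)"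
      using d \<epsilon> elim by (intro mult_left_mono Ssq) auto
    finally show ?case by (simp add: algebra_simps)
  qed
  have R1kfin: "(\<integral>\<^sup>+z. ennreal \<bar>?R1k k (fst z) (snd z)\<bar> \<partial>Q t) < \<infinity>" for k
  proof (rule le_less_trans[OF nn_integral_mono_AE comb[of "2 * d / \<epsilon>" "2 * d / \<epsilon>"]])
    show "AE z in Q t. ennreal \<bar>?R1k k (fst z) (snd z)\<bar> \<le> ennreal (2 * d / \<epsilon> * (\<sigma> (fst z) (snd z))\<^sup>2 + 2 * d / \<epsilon> * w z)"
      using R1kb[of k] by eventually_elim (rule ennreal_leI)
  qed (use d \<epsilon> in auto)
  have q\<Theta>: "(\<lambda>k. qnorm t (\<lambda>s \<omega>. ?\<Theta> s \<omega> - ?\<Theta>k k s \<omega>)) \<longlonglongrightarrow> 0"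
  \<comment> \<open>The majorant is
    \<open>2 * \<sigma>\<^sup>2 + 2 * (2 * \<sigma>\<^sup>2 + 2 * w)\<close>, the inner bracket
    being the bound for the square of \<open>S k\<close>.\<close>
  proof (rule qnorm_tendsto_0[OF p\<Theta>k p\<Theta>, where w="\<lambda>z. 6 * (\<sigma> (fst z) (snd z))\<^sup>2 + 4 * w z"])
    show "AE z in Q t. (\<lambda>k. ?\<Theta>k k (fst z) (snd z)) \<longlonglongrightarrow> ?\<Theta> (fst z) (snd z)"
      using AEw by eventually_elim (intro tendsto_scaleR gcont limS limZ, auto)
    show "AE z in Q t. (norm (?\<Theta> (fst z) (snd z) - ?\<Theta>k k (fst z) (snd z)))\<^sup>2 \<le> 6 * (\<sigma> (fst z) (snd z))\<^sup>2 + 4 * w z" for k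
      using AEw
    proof eventually_elim
      case (elim z)
      let ?s = "\<sigma> (fst z) (snd z)" and ?sk = "S k (fst z) (snd z)"
      have "norm (?\<Theta> (fst z) (snd z) - ?\<Theta>k k (fst z) (snd z)) \<le> \<bar>?s\<bar> + \<bar>?sk\<bar>"
        using norm_triangle_ineq4[of "?\<Theta> (fst z) (snd z)" "?\<Theta>k k (fst z) (snd z)"]
          mult_left_mono[OF g1, of "\<bar>?s\<bar>" "Y (fst z) (snd z)"] mult_left_mono[OF g1, of "\<bar>?sk\<bar>" "Z k (fst z) (snd z)"] by simp
      then have "(norm (?\<Theta> (fst z) (snd z) - ?\<Theta>k k (fst z) (snd z)))\<^sup>2 \<le> (\<bar>?s\<bar> + \<bar>?sk\<bar>)\<^sup>2" by (rule power_mono) simp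
      also have "\<dots> \<le> 2 * ?s\<^sup>2 + 2 * ?sk\<^sup>2" using sum_squares_bound[of "\<bar>?s\<bar>" "\<bar>?sk\<bar>"] by (simp add: power2_sum)
      also have "\<dots> \<le> 6 * ?s\<^sup>2 + 4 * w z" using Ssq[of k z] elim by auto
      finally show ?case .
    qed
  qed (use comb[of 6 4] in auto)
  have R1lim: "(\<lambda>k. \<integral>\<^sup>+z. ennreal \<bar>?R1 (fst z) (snd z) - ?R1k k (fst z) (snd z)\<bar> \<partial>Q t) \<longlonglongrightarrow> 0"
  proof (rule nn_integral_Q_tendsto_0[where R="?R1k" and R'="?R1" and w="\<lambda>z. 3 * d / \<epsilon> * (\<sigma> (fst z) (snd z))\<^sup>2 + 2 * d / \<epsilon> * w z", OF pR1k pR1])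
    show "AE z in Q t. (\<lambda>k. ?R1k k (fst z) (snd z)) \<longlonglongrightarrow> ?R1 (fst z) (snd z)"
      using AEw by eventually_elim (intro tendsto_mult tendsto_divide tendsto_power tendsto_const lcont limS limZ, auto)
    show "AE z in Q t. \<bar>?R1 (fst z) (snd z) - ?R1k k (fst z) (snd z)\<bar> \<le> 3 * d / \<epsilon> * (\<sigma> (fst z) (snd z))\<^sup>2 + 2 * d / \<epsilon> * w z" for k
      using R1kb[of k]
    proof eventually_elim
      case (elim z)
      have eq: "3 * d / \<epsilon> * (\<sigma> (fst z) (snd z))\<^sup>2 = d / \<epsilon> * (\<sigma> (fst z) (snd z))\<^sup>2 + 2 * d / \<epsilon> * (\<sigma> (fst z) (snd z))\<^sup>2"
        by (simp add: field_simps)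
      show ?case unfolding eq using elim R1b[of "\<sigma> (fst z) (snd z)" "Y (fst z) (snd z)"] by linarith
    qed
  qed (use comb[of "3 * d / \<epsilon>" "2 * d / \<epsilon>"] d \<epsilon> in auto)
  have R2lim: "(\<lambda>k. \<integral>\<^sup>+z. ennreal \<bar>?R2 (fst z) (snd z) - ?R2k k (fst z) (snd z)\<bar> \<partial>Q t) \<longlonglongrightarrow> 0"
  proof (rule nn_integral_Q_tendsto_0[where R="?R2k" and R'="?R2" and w="\<lambda>z. 2 * norm (\<beta> (fst z) (snd z))", OF pR2k pR2])
    show "AE z in Q t. (\<lambda>k. ?R2k k (fst z) (snd z)) \<longlonglongrightarrow> ?R2 (fst z) (snd z)"
      using AEw by eventually_elim (intro tendsto_inner tendsto_const gcont limZ, auto)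
    show "AE z in Q t. \<bar>?R2 (fst z) (snd z) - ?R2k k (fst z) (snd z)\<bar> \<le> 2 * norm (\<beta> (fst z) (snd z))" for k
    proof (rule AE_I2)
      fix z
      show "\<bar>?R2 (fst z) (snd z) - ?R2k k (fst z) (snd z)\<bar> \<le> 2 * norm (\<beta> (fst z) (snd z))"
        using R2b[of "Y (fst z) (snd z)" "\<beta> (fst z) (snd z)"] R2b[of "Z k (fst z) (snd z)" "\<beta> (fst z) (snd z)"] by linarith
    qed
    show "(\<integral>\<^sup>+z. ennreal (2 * norm (\<beta> (fst z) (snd z))) \<partial>Q t) < \<infinity>"
      using \<beta>fin \<beta>m by (simp add: ennreal_mult' nn_integral_cmult ennreal_mult_less_top)
  qed (use \<beta>m in simp)
  have fL1: "(\<integral>\<^sup>+\<omega>. ennreal \<bar>?f (Y u \<omega>) - ?f (Z k u \<omega>)\<bar> \<partial>M) \<le> ennreal (sqrt (16 * d * (1 / 2) ^ k))" if u: "u \<in> {0..t}" for u k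
  proof (rule nn_integral_abs_le_sqn)
    show "(\<lambda>\<omega>. ?f (Y u \<omega>) - ?f (Z k u \<omega>)) \<in> borel_measurable M"
      using u by (intro borel_measurable_diff measurable_compose[OF measM fb] Y Z) auto
    have "sqn (\<lambda>\<omega>. ?f (Y u \<omega>) - ?f (Z k u \<omega>)) \<le> (\<integral>\<^sup>+\<omega>. ennreal ((norm (Z k u \<omega> - Y u \<omega>))\<^sup>2) \<partial>M)"
      unfolding sqn_def
    proof (intro nn_integral_mono ennreal_leI)
      fix \<omega>
      have "\<bar>?f (Y u \<omega>) - ?f (Z k u \<omega>)\<bar> \<le> norm (Z k u \<omega> - Y u \<omega>)"
        using soft_norm_lipschitz[OF \<epsilon>, of "Y u \<omega>" "Z k u \<omega>"] by (simp add: norm_minus_commute)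
      then show "(?f (Y u \<omega>) - ?f (Z k u \<omega>))\<^sup>2 \<le> (norm (Z k u \<omega> - Y u \<omega>))\<^sup>2"
        by (metis abs_ge_zero power2_abs power_mono)
    qed
    also have "\<dots> \<le> ennreal (16 * d * (1 / 2) ^ k)" by (rule dist[OF u])
    also have "16 * d * (1 / 2) ^ k = (sqrt (16 * d * (1 / 2) ^ k))\<^sup>2" using d by simp
    finally show "sqn (\<lambda>\<omega>. ?f (Y u \<omega>) - ?f (Z k u \<omega>)) \<le> ennreal ((sqrt (16 * d * (1 / 2) ^ k))\<^sup>2)" .
  qed (use d in simp)
  have JM: "?J \<in> borel_measurable M"
    by (intro borel_measurable_diff tint_measurable pR1 pR2 measurable_compose[OF measM fb] Y t order_refl)
  show "l2int t ?\<Theta> ?J"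
  proof (rule l2int_closure[OF p\<Theta> JM t])
    fix \<eta> :: real assume \<eta>: "0 < \<eta>"
    then have \<eta>4: "0 < \<eta> / 4" by simp
    have "(\<lambda>k. sqrt (16 * d * (1 / 2) ^ k)) \<longlonglongrightarrow> sqrt (16 * d * 0)"
      by (intro tendsto_intros LIMSEQ_power_zero) simp
    then have e1: "\<forall>\<^sub>F k in sequentially. sqrt (16 * d * (1 / 2) ^ k) < \<eta> / 4"
      using \<eta> by (intro order_tendstoD(2)) auto
    have "\<forall>\<^sub>F k in sequentially. qnorm t (\<lambda>s \<omega>. ?\<Theta> s \<omega> - ?\<Theta>k k s \<omega>) \<le> ennreal \<eta> \<and>
        (\<integral>\<^sup>+z. ennreal \<bar>?R1 (fst z) (snd z) - ?R1k k (fst z) (snd z)\<bar> \<partial>Q t) \<le> ennreal (\<eta> / 4) \<and>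
        (\<integral>\<^sup>+z. ennreal \<bar>?R2 (fst z) (snd z) - ?R2k k (fst z) (snd z)\<bar> \<partial>Q t) \<le> ennreal (\<eta> / 4) \<and>
        sqrt (16 * d * (1 / 2) ^ k) < \<eta> / 4"
      by (intro eventually_conj e1 tendsto_0_ennrealD[OF q\<Theta> \<eta>] tendsto_0_ennrealD[OF R1lim \<eta>4] tendsto_0_ennrealD[OF R2lim \<eta>4])
    then obtain k where k: "qnorm t (\<lambda>s \<omega>. ?\<Theta> s \<omega> - ?\<Theta>k k s \<omega>) \<le> ennreal \<eta>"
        "(\<integral>\<^sup>+z. ennreal \<bar>?R1 (fst z) (snd z) - ?R1k k (fst z) (snd z)\<bar> \<partial>Q t) \<le> ennreal (\<eta> / 4)"
        "(\<integral>\<^sup>+z. ennreal \<bar>?R2 (fst z) (snd z) - ?R2k k (fst z) (snd z)\<bar> \<partial>Q t) \<le> ennreal (\<eta> / 4)"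
        "sqrt (16 * d * (1 / 2) ^ k) < \<eta> / 4"
      unfolding eventually_sequentially by blast
    have tt: "t \<in> {0..t}" "0 \<in> {0..t}" using t by auto
    note fm = measurable_compose[OF measM fb]
    have "(\<integral>\<^sup>+\<omega>. ennreal \<bar>?J \<omega> - ?Jk k \<omega>\<bar> \<partial>M) \<le> ennreal (\<eta> / 4) + ennreal (\<eta> / 4) + ennreal (\<eta> / 4) + ennreal (\<eta> / 4)"
      by (rule order_trans[OF functional_diff_L1[OF fm[OF Y t] fm[OF Y order_refl] fm[OF Z t] fm[OF Z order_refl]
              pR1 pR2 pR1k pR2k R1fin R2fin R1kfin R2fin]],
          intro add_mono k(2,3) order_trans[OF fL1[OF tt(1)] ennreal_leI[OF less_imp_le[OF k(4)]]]
            order_trans[OF fL1[OF tt(2)] ennreal_leI[OF less_imp_le[OF k(4)]]])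
    also have "\<dots> = ennreal \<eta>" using \<eta> by (simp add: ennreal_plus[symmetric] del: ennreal_plus)
    finally show "\<exists>\<Theta>' J'. l2int t \<Theta>' J' \<and> qnorm t (\<lambda>s \<omega>. ?\<Theta> s \<omega> - \<Theta>' s \<omega>) \<le> ennreal \<eta> \<and>
        (\<integral>\<^sup>+\<omega>. ennreal \<bar>?J \<omega> - J' \<omega>\<bar> \<partial>M) \<le> ennreal \<eta>"
      using lk[of k] k(1) by blast
  qed
qed

end

section \<open>Limits of the regularised norm and its derivatives\<close>

lemma inverse_Suc_tendsto_0: "(\<lambda>k. inverse (real (Suc k))) \<longlonglongrightarrow> 0"
  by (rule LIMSEQ_inverse_real_of_nat)

lemma soft_norm_limit: "(\<lambda>k. soft_norm (inverse (real (Suc k))) z) \<longlonglongrightarrow> norm z"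
proof -
  have "(\<lambda>k. sqrt ((norm z)\<^sup>2 + (inverse (real (Suc k)))\<^sup>2)) \<longlonglongrightarrow> sqrt ((norm z)\<^sup>2 + 0\<^sup>2)"
    by (intro tendsto_intros inverse_Suc_tendsto_0)
  then show ?thesis by (simp add: soft_norm_def)
qed

text \<open>At \<open>z = 0\<close> both sides vanish, so this limit, unlike that of the Laplacian,
  is available everywhere.\<close>

lemma soft_grad_limit: "(\<lambda>k. soft_grad (inverse (real (Suc k))) z) \<longlonglongrightarrow> sgn z"
proof (cases "z = 0")
  case False
  have "(\<lambda>k. z /\<^sub>R soft_norm (inverse (real (Suc k))) z) \<longlonglongrightarrow> z /\<^sub>R norm z"
    by (intro tendsto_intros soft_norm_limit) (use False in simp)
  then show ?thesis by (simp add: soft_grad_def sgn_div_norm)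
qed (simp add: soft_grad_def)

lemma soft_laplace_limit:
  fixes z :: "'a::euclidean_space"
  assumes "z \<noteq> 0"
  shows "(\<lambda>k. soft_laplace (inverse (real (Suc k))) z) \<longlonglongrightarrow> (real DIM('a) - 1) / norm z"
proof -
  have "(\<lambda>k. real DIM('a) / soft_norm (inverse (real (Suc k))) z - (norm z)\<^sup>2 / (soft_norm (inverse (real (Suc k))) z) ^ 3)
      \<longlonglongrightarrow> real DIM('a) / norm z - (norm z)\<^sup>2 / (norm z) ^ 3"
    by (intro tendsto_intros soft_norm_limit) (use assms in auto)
  moreover have "real DIM('a) / norm z - (norm z)\<^sup>2 / (norm z) ^ 3 = (real DIM('a) - 1) / norm z"
    using assms by (simp add: diff_divide_distrib power2_eq_square power3_eq_cube)
  ultimately show ?thesis by (simp add: soft_laplace_def)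
qed

context brownian_basis
begin

text \<open>The regularised stochastic integral has mean zero. Since \<open>Y t\<close> is bounded
  by \<open>R\<close> and the drift term by the integral \<open>B\<close> of
  \<open>norm \<beta>\<close>, the nonnegative Laplacian term has expectation at most
  \<open>\<bar>R\<bar> + 1 + B\<close> for every \<open>k\<close>. Fatou's lemma carries this bound
  to the limit, and \<open>1 \<le> real DIM('a) - 1\<close> turns it into integrability of
  \<open>\<sigma>\<^sup>2 / norm Y\<close>, which then dominates the Laplacian terms.\<close>

lemma ito_norm:
  assumes t: "0 \<le> t" and p\<sigma>: "path_measurable \<sigma>"
    and approx: "\<And>\<eta>. 0 < \<eta> \<Longrightarrow> \<exists>n H. stepwise n H \<and> qnorm t (\<lambda>s \<omega>. \<sigma> s \<omega> - H s \<omega>) \<le> ennreal \<eta>"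
    and I: "continuous_adapted M F I" and lI: "\<And>u b. 0 \<le> u \<Longrightarrow> b \<in> Basis \<Longrightarrow> l2int u (\<lambda>s \<omega>. \<sigma> s \<omega> *\<^sub>R b) (\<lambda>\<omega>. I u \<omega> \<bullet> b)"
    and Y: "continuous_adapted M F Y"
    and \<beta>: "path_measurable \<beta>" and \<beta>fin: "(\<integral>\<^sup>+z. ennreal (norm (\<beta> (fst z) (snd z))) \<partial>Q t) < \<infinity>"
    and decomp: "AE \<omega> in M. \<forall>u\<in>{0..t}. Y u \<omega> = Y 0 \<omega> + I u \<omega> + (LINT s:{0..u}|lborel. \<beta> s \<omega>)"
    and nz: "AE z in Q t. Y (fst z) (snd z) \<noteq> 0"
    and bound: "AE \<omega> in M. norm (Y t \<omega>) \<le> R"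
    and dim: "2 \<le> DIM('a)"
  shows "(\<integral>\<^sup>+z. ennreal ((\<sigma> (fst z) (snd z))\<^sup>2 / norm (Y (fst z) (snd z))) \<partial>Q t) < \<infinity>"
    and "l2int t (\<lambda>s \<omega>. \<sigma> s \<omega> *\<^sub>R sgn (Y s \<omega>))
    (\<lambda>\<omega>. norm (Y t \<omega>) - norm (Y 0 \<omega>)
       - tint t (\<lambda>s \<omega>. (\<sigma> s \<omega>)\<^sup>2 / 2 * ((real DIM('a) - 1) / norm (Y s \<omega>))) \<omega>
       - tint t (\<lambda>s \<omega>. sgn (Y s \<omega>) \<bullet> \<beta> s \<omega>) \<omega>)" (is "l2int t ?\<Theta> ?J")
    and "qnorm t \<sigma> < \<infinity>"
proof -
  define d where "d = real DIM('a)"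
  have d: "2 \<le> d" using dim by (simp add: d_def)
  define \<epsilon> where "\<epsilon> k = inverse (real (Suc k))" for k
  have \<epsilon>: "0 < \<epsilon> k" "\<epsilon> k \<le> 1" for k by (auto simp: \<epsilon>_def field_simps)
  let ?f = "\<lambda>k. soft_norm (\<epsilon> k) :: 'a \<Rightarrow> real" and ?g = "\<lambda>k. soft_grad (\<epsilon> k) :: 'a \<Rightarrow> 'a" and ?l = "\<lambda>k. soft_laplace (\<epsilon> k) :: 'a \<Rightarrow> real"
  have fb: "?f k \<in> borel_measurable borel" and gb: "?g k \<in> borel_measurable borel" and lb: "?l k \<in> borel_measurable borel" for k
    using continuous_soft_norm[OF \<epsilon>(1)] continuous_soft_grad[OF \<epsilon>(1)] continuous_soft_laplace[OF \<epsilon>(1)]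
    by (auto intro: borel_measurable_continuous_onI)
  have YM: "Y u \<in> borel_measurable M" if "0 \<le> u" for u
    using Y that measurable_F_M unfolding continuous_adapted_def by blast
  have pY: "path_measurable Y"
    by (rule path_measurable_continuous[OF YM]) (use Y in \<open>auto simp: continuous_adapted_def\<close>)
  let ?R1 = "\<lambda>s \<omega>. (\<sigma> s \<omega>)\<^sup>2 / 2 * ((real DIM('a) - 1) / norm (Y s \<omega>))" and ?R1k = "\<lambda>k s \<omega>. (\<sigma> s \<omega>)\<^sup>2 / 2 * ?l k (Y s \<omega>)"
  let ?R2 = "\<lambda>s \<omega>. sgn (Y s \<omega>) \<bullet> \<beta> s \<omega>" and ?R2k = "\<lambda>k s \<omega>. ?g k (Y s \<omega>) \<bullet> \<beta> s \<omega>"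
  let ?\<Theta>k = "\<lambda>k s \<omega>. \<sigma> s \<omega> *\<^sub>R ?g k (Y s \<omega>)"
  let ?Jk = "\<lambda>k \<omega>. ?f k (Y t \<omega>) - ?f k (Y 0 \<omega>) - tint t (?R1k k) \<omega> - tint t (?R2k k) \<omega>"
  note ito = ito_soft_norm[OF \<epsilon>(1) t p\<sigma> approx I lI Y \<beta> \<beta>fin decomp]
  have lk: "l2int t (?\<Theta>k k) (?Jk k)" for k by (rule ito(1))
  show \<sigma>fin: "qnorm t \<sigma> < \<infinity>" by (rule ito(2))
  have psq: "path_measurable (\<lambda>s \<omega>. (\<sigma> s \<omega>)\<^sup>2 / 2)" by (rule path_measurable_compose[OF p\<sigma>]) simp
  have pR1: "path_measurable ?R1"
    by (intro path_measurable_mult psq path_measurable_compose[OF pY, of "\<lambda>y. (real DIM('a) - 1) / norm y"]) simp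
  have pR1k: "path_measurable (?R1k k)" for k by (intro path_measurable_mult psq path_measurable_compose[OF pY lb])
  have psg: "path_measurable (\<lambda>s \<omega>. sgn (Y s \<omega>))" by (rule path_measurable_compose[OF pY]) (simp add: sgn_div_norm[abs_def])
  have pg: "path_measurable (\<lambda>s \<omega>. ?g k (Y s \<omega>))" for k by (rule path_measurable_compose[OF pY gb])
  have pR2: "path_measurable ?R2" by (rule path_measurable_inner[OF psg \<beta>])
  have pR2k: "path_measurable (?R2k k)" for k by (rule path_measurable_inner[OF pg \<beta>])
  have p\<Theta>: "path_measurable ?\<Theta>" by (rule path_measurable_scaleR[OF p\<sigma> psg])
  have p\<Theta>k: "path_measurable (?\<Theta>k k)" for k by (rule path_measurable_scaleR[OF p\<sigma> pg])
  note mQ = path_measurable_Q[where T=t]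
  note [measurable] = mQ[OF pY] mQ[OF p\<sigma>] mQ[OF \<beta>]
  have g1: "norm (?g k u) \<le> 1" for u k by (rule norm_soft_grad[OF \<epsilon>(1)])
  have s1: "norm (sgn u) \<le> 1" for u :: 'a by (simp add: norm_sgn)
  have in_b: "\<bar>g \<bullet> v\<bar> \<le> norm v" if "norm g \<le> 1" for g v :: 'a
    using Cauchy_Schwarz_ineq2[of g v] mult_right_mono[OF that, of "norm v"] by simp
  have R2fin: "(\<integral>\<^sup>+z. ennreal \<bar>X z \<bullet> \<beta> (fst z) (snd z)\<bar> \<partial>Q t) < \<infinity>" if "\<And>z. norm (X z) \<le> 1" for X
    by (rule le_less_trans[OF nn_integral_mono \<beta>fin]) (intro ennreal_leI in_b that)
  have l0: "0 \<le> ?l k u" for k u by (rule soft_laplace_bounds(2)[OF \<epsilon>(1)])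
  have R1kfin: "(\<integral>\<^sup>+z. ennreal \<bar>?R1k k (fst z) (snd z)\<bar> \<partial>Q t) < \<infinity>" for k
  proof -
    have "(\<integral>\<^sup>+z. ennreal \<bar>?R1k k (fst z) (snd z)\<bar> \<partial>Q t) \<le> (\<integral>\<^sup>+z. ennreal (d / \<epsilon> k) * ennreal ((norm (\<sigma> (fst z) (snd z)))\<^sup>2) \<partial>Q t)"
    proof (intro nn_integral_mono)
      fix z
      have "\<bar>?R1k k (fst z) (snd z)\<bar> \<le> (\<sigma> (fst z) (snd z))\<^sup>2 * (d / \<epsilon> k)"
        unfolding abs_mult d_def using soft_laplace_bounds(2,4)[OF \<epsilon>(1), of k "Y (fst z) (snd z)"] by (intro mult_mono) auto
      then show "ennreal \<bar>?R1k k (fst z) (snd z)\<bar> \<le> ennreal (d / \<epsilon> k) * ennreal ((norm (\<sigma> (fst z) (snd z)))\<^sup>2)"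
        using d \<epsilon>(1)[of k] by (simp add: ennreal_mult'[symmetric] ennreal_leI mult.commute)
    qed
    also have "\<dots> = ennreal (d / \<epsilon> k) * qnorm t \<sigma>" by (simp add: qnorm_Q[OF p\<sigma>] nn_integral_cmult)
    finally show ?thesis using \<sigma>fin by (simp add: ennreal_mult_less_top le_less_trans)
  qed
  define B where "B = enn2real (\<integral>\<^sup>+z. ennreal (norm (\<beta> (fst z) (snd z))) \<partial>Q t)"
  have B: "(\<integral>\<^sup>+z. ennreal (norm (\<beta> (fst z) (snd z))) \<partial>Q t) = ennreal B"
    using \<beta>fin by (simp add: B_def ennreal_enn2real_if)
  have lap: "(\<integral>\<^sup>+z. ennreal (?R1k k (fst z) (snd z)) \<partial>Q t) \<le> ennreal (\<bar>R\<bar> + 1 + B)" for k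
  proof -
    have mR2: "tint t (?R2k k) \<in> borel_measurable M" by (rule tint_measurable[OF pR2k])
    have R2L1: "(\<integral>\<^sup>+\<omega>. ennreal \<bar>tint t (?R2k k) \<omega>\<bar> \<partial>M) \<le> ennreal B"
    proof -
      have "(\<integral>\<^sup>+\<omega>. ennreal \<bar>tint t (?R2k k) \<omega> - tint t (\<lambda>_ _. 0) \<omega>\<bar> \<partial>M) \<le> (\<integral>\<^sup>+z. ennreal \<bar>?R2k k (fst z) (snd z) - 0\<bar> \<partial>Q t)"
        by (rule tint_diff_L1[OF pR2k path_measurable_const R2fin[OF g1]]) simp
      also have "\<dots> \<le> (\<integral>\<^sup>+z. ennreal (norm (\<beta> (fst z) (snd z))) \<partial>Q t)"
        by (intro nn_integral_mono ennreal_leI) (simp add: in_b g1)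
      finally show ?thesis by (simp add: tint_zero B)
    qed
    have iR2: "integrable M (tint t (?R2k k))"
      by (rule integrableI_bounded) (use mR2 R2L1 in \<open>auto simp: le_less_trans[OF _ ennreal_less_top]\<close>)
    have eR2: "\<bar>\<integral>\<omega>. tint t (?R2k k) \<omega> \<partial>M\<bar> \<le> B"
    proof -
      have "ennreal (norm (\<integral>\<omega>. tint t (?R2k k) \<omega> \<partial>M)) \<le> (\<integral>\<^sup>+\<omega>. ennreal (norm (tint t (?R2k k) \<omega>)) \<partial>M)"
        by (rule integral_norm_bound_ennreal[OF iR2])
      also have "\<dots> \<le> ennreal B" using R2L1 by simp
      finally show ?thesis by (simp add: B_def)
    qed
    have f_le: "\<bar>?f k (Y t \<omega>)\<bar> \<le> \<bar>R\<bar> + 1" if "norm (Y t \<omega>) \<le> R" for \<omega>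
      using soft_norm_le[OF \<epsilon>(1), of k "Y t \<omega>"] soft_norm_pos[OF \<epsilon>(1), of k "Y t \<omega>"] \<epsilon>(2)[of k] that by auto
    have ift: "integrable M (\<lambda>\<omega>. ?f k (Y t \<omega>))"
      by (rule integrable_const_bound[of _ "\<bar>R\<bar> + 1"]) (use bound f_le measurable_compose[OF YM[OF t] fb] in auto)
    have ift_le: "(\<integral>\<omega>. ?f k (Y t \<omega>) \<partial>M) \<le> \<bar>R\<bar> + 1"
    proof -
      have "(\<integral>\<omega>. ?f k (Y t \<omega>) \<partial>M) \<le> (\<integral>\<omega>. \<bar>R\<bar> + 1 \<partial>M)"
        by (rule integral_mono_AE[OF ift]) (use bound in \<open>auto elim!: eventually_mono dest!: f_le\<close>)
      then show ?thesis by (simp add: prob_space)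
    qed
    note Jm = l2int_mean[OF lk t, of k]
    \<comment> \<open>The formula for \<open>?Jk k\<close> is solved for the Laplacian term,
      omitting the nonnegative \<open>?f k (Y 0 \<omega>)\<close>; so \<open>?G\<close> lies above
      that term, and its mean can be bounded.\<close>
    let ?G = "\<lambda>\<omega>. ?f k (Y t \<omega>) - tint t (?R2k k) \<omega> - ?Jk k \<omega>"
    have iG: "integrable M ?G" by (rule Bochner_Integration.integrable_diff[OF Bochner_Integration.integrable_diff[OF ift iR2] Jm(1)])
    have eG: "(\<integral>\<omega>. ?G \<omega> \<partial>M) \<le> \<bar>R\<bar> + 1 + B"
    proof -
      have "(\<integral>\<omega>. ?G \<omega> \<partial>M) = (\<integral>\<omega>. ?f k (Y t \<omega>) - tint t (?R2k k) \<omega> \<partial>M) - (\<integral>\<omega>. ?Jk k \<omega> \<partial>M)"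
        by (rule Bochner_Integration.integral_diff[OF Bochner_Integration.integrable_diff[OF ift iR2] Jm(1)])
      also have "(\<integral>\<omega>. ?f k (Y t \<omega>) - tint t (?R2k k) \<omega> \<partial>M) = (\<integral>\<omega>. ?f k (Y t \<omega>) \<partial>M) - (\<integral>\<omega>. tint t (?R2k k) \<omega> \<partial>M)"
        by (rule Bochner_Integration.integral_diff[OF ift iR2])
      finally show ?thesis using Jm(2) ift_le eR2 by linarith
    qed
    have T0: "0 \<le> tint t (?R1k k) \<omega>" for \<omega>
      unfolding tint_def by (rule integral_nonneg_AE) (simp add: l0)
    have TG: "tint t (?R1k k) \<omega> \<le> ?G \<omega>" for \<omega>
      using soft_norm_pos[OF \<epsilon>(1), of k "Y 0 \<omega>"] by linarith
    have "(\<integral>\<^sup>+z. ennreal (?R1k k (fst z) (snd z)) \<partial>Q t) = (\<integral>\<^sup>+\<omega>. ennreal (tint t (?R1k k) \<omega>) \<partial>M)"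
    proof -
      have "(\<integral>\<^sup>+z. ennreal (?R1k k (fst z) (snd z)) \<partial>Q t) = (\<integral>\<^sup>+\<omega>. (\<integral>\<^sup>+s\<in>{0..t}. ennreal (?R1k k s \<omega>) \<partial>lborel) \<partial>M)"
        using mQ[OF pR1k, of k] by (subst nn_integral_Q) auto
      also have "\<dots> = (\<integral>\<^sup>+\<omega>. ennreal (tint t (?R1k k) \<omega>) \<partial>M)"
      proof (rule nn_integral_cong_AE, use AE_path_integrable[OF pR1k R1kfin[folded real_norm_def], of k] in eventually_elim)
        case (elim \<omega>)
        have "ennreal (tint t (?R1k k) \<omega>) = (\<integral>\<^sup>+s. ennreal (?R1k k s \<omega>) \<partial>restrict_space lborel {0..t})"
          unfolding tint_def using elim by (subst nn_integral_eq_integral) (auto simp: l0)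
        then show ?case by (simp add: nn_integral_restrict_space)
      qed
      finally show ?thesis .
    qed
    also have "\<dots> \<le> (\<integral>\<^sup>+\<omega>. ennreal (?G \<omega>) \<partial>M)" by (intro nn_integral_mono ennreal_leI TG)
    also have "\<dots> = ennreal (\<integral>\<omega>. ?G \<omega> \<partial>M)"
    proof (rule nn_integral_eq_integral[OF iG AE_I2])
      fix \<omega> show "0 \<le> ?G \<omega>" by (rule order_trans[OF T0 TG])
    qed
    also have "\<dots> \<le> ennreal (\<bar>R\<bar> + 1 + B)" by (rule ennreal_leI[OF eG])
    finally show ?thesis .
  qed
  have glim: "(\<lambda>k. ?g k u) \<longlonglongrightarrow> sgn u" for u
    unfolding \<epsilon>_def by (rule soft_grad_limit)
  have llim: "(\<lambda>k. ?l k u) \<longlonglongrightarrow> (real DIM('a) - 1) / norm u" if "u \<noteq> 0" for u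
    unfolding \<epsilon>_def by (rule soft_laplace_limit[OF that])
  have half: "(\<integral>\<^sup>+z. ennreal (?R1 (fst z) (snd z)) \<partial>Q t) \<le> ennreal (\<bar>R\<bar> + 1 + B)"
  proof -
    \<comment> \<open>The limit of the Laplacian is available away from the zeros of
      \<open>Y\<close>, which form a null set of \<open>Q t\<close> by \<open>nz\<close>.\<close>
    have "(\<integral>\<^sup>+z. ennreal (?R1 (fst z) (snd z)) \<partial>Q t) = (\<integral>\<^sup>+z. liminf (\<lambda>k. ennreal (?R1k k (fst z) (snd z))) \<partial>Q t)"
    proof (rule nn_integral_cong_AE, use nz in eventually_elim)
      case (elim z)
      have "(\<lambda>k. ennreal (?R1k k (fst z) (snd z))) \<longlonglongrightarrow> ennreal (?R1 (fst z) (snd z))"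
        by (intro tendsto_intros llim elim)
      from lim_imp_Liminf[OF _ this] show ?case by simp
    qed
    also have "\<dots> \<le> liminf (\<lambda>k. \<integral>\<^sup>+z. ennreal (?R1k k (fst z) (snd z)) \<partial>Q t)"
      by (rule nn_integral_liminf) (use mQ[OF pR1k] in simp)
    also have "\<dots> \<le> liminf (\<lambda>k. ennreal (\<bar>R\<bar> + 1 + B))" by (intro Liminf_mono always_eventually allI lap)
    finally show ?thesis by (simp add: Liminf_const)
  qed
  show inv: "(\<integral>\<^sup>+z. ennreal ((\<sigma> (fst z) (snd z))\<^sup>2 / norm (Y (fst z) (snd z))) \<partial>Q t) < \<infinity>"
  proof -
    have "(\<integral>\<^sup>+z. ennreal ((\<sigma> (fst z) (snd z))\<^sup>2 / norm (Y (fst z) (snd z))) \<partial>Q t) \<le> (\<integral>\<^sup>+z. 2 * ennreal (?R1 (fst z) (snd z)) \<partial>Q t)"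
    proof (intro nn_integral_mono)
      fix z
      let ?x = "(\<sigma> (fst z) (snd z))\<^sup>2 / norm (Y (fst z) (snd z))"
      have "1 * ?x \<le> (d - 1) * ?x" using d by (intro mult_right_mono) auto
      then have "?x \<le> 2 * ?R1 (fst z) (snd z)" by (simp add: d_def mult.commute)
      then have "ennreal ?x \<le> ennreal (2 * ?R1 (fst z) (snd z))" by (rule ennreal_leI)
      then show "ennreal ?x \<le> 2 * ennreal (?R1 (fst z) (snd z))" by (subst (asm) ennreal_mult') simp_all
    qed
    also have "\<dots> = 2 * (\<integral>\<^sup>+z. ennreal (?R1 (fst z) (snd z)) \<partial>Q t)" using mQ[OF pR1] by (intro nn_integral_cmult) simp
    finally show ?thesis using half by (simp add: ennreal_mult_less_top le_less_trans)
  qed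
  have R1fin: "(\<integral>\<^sup>+z. ennreal \<bar>?R1 (fst z) (snd z)\<bar> \<partial>Q t) < \<infinity>"
  proof -
    have "\<bar>?R1 s \<omega>\<bar> = ?R1 s \<omega>" for s \<omega> using d by (intro abs_of_nonneg mult_nonneg_nonneg divide_nonneg_nonneg) (auto simp: d_def)
    then show ?thesis using half by (simp add: le_less_trans)
  qed
  have q\<Theta>: "(\<lambda>k. qnorm t (\<lambda>s \<omega>. ?\<Theta> s \<omega> - ?\<Theta>k k s \<omega>)) \<longlonglongrightarrow> 0"
  proof (rule qnorm_tendsto_0[OF p\<Theta>k p\<Theta>, where w="\<lambda>z. 4 * (norm (\<sigma> (fst z) (snd z)))\<^sup>2"])
    show "AE z in Q t. (\<lambda>k. ?\<Theta>k k (fst z) (snd z)) \<longlonglongrightarrow> ?\<Theta> (fst z) (snd z)"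
      by (intro AE_I2 tendsto_scaleR tendsto_const glim)
    show "AE z in Q t. (norm (?\<Theta> (fst z) (snd z) - ?\<Theta>k k (fst z) (snd z)))\<^sup>2 \<le> 4 * (norm (\<sigma> (fst z) (snd z)))\<^sup>2" for k
    proof (rule AE_I2)
      fix z
      have "norm (sgn u - ?g k u) \<le> 2" for u using norm_triangle_ineq4[of "sgn u" "?g k u"] g1[of k u] s1[of u] by linarith
      then have "norm (?\<Theta> (fst z) (snd z) - ?\<Theta>k k (fst z) (snd z)) \<le> norm (\<sigma> (fst z) (snd z)) * 2"
        unfolding scaleR_diff_right[symmetric] norm_scaleR real_norm_def by (intro mult_left_mono) auto
      then have "(norm (?\<Theta> (fst z) (snd z) - ?\<Theta>k k (fst z) (snd z)))\<^sup>2 \<le> (norm (\<sigma> (fst z) (snd z)) * 2)\<^sup>2" by (rule power_mono) simp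
      then show "(norm (?\<Theta> (fst z) (snd z) - ?\<Theta>k k (fst z) (snd z)))\<^sup>2 \<le> 4 * (norm (\<sigma> (fst z) (snd z)))\<^sup>2"
        by (simp add: power_mult_distrib)
    qed
    show "(\<integral>\<^sup>+z. ennreal (4 * (norm (\<sigma> (fst z) (snd z)))\<^sup>2) \<partial>Q t) < \<infinity>"
      using \<sigma>fin by (simp add: ennreal_mult' nn_integral_cmult qnorm_Q[OF p\<sigma>] ennreal_mult_less_top)
  qed measurable
  have R1lim: "(\<lambda>k. \<integral>\<^sup>+z. ennreal \<bar>?R1 (fst z) (snd z) - ?R1k k (fst z) (snd z)\<bar> \<partial>Q t) \<longlonglongrightarrow> 0"
  \<comment> \<open>Both Laplacians are at most \<open>d / norm y\<close>; with the factor
    \<open>1 / 2\<close> in front, the two bounds add up to the majorant.\<close>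
  proof (rule nn_integral_Q_tendsto_0[where R="?R1k" and R'="?R1" and w="\<lambda>z. d * ((\<sigma> (fst z) (snd z))\<^sup>2 / norm (Y (fst z) (snd z)))", OF pR1k pR1])
    show "AE z in Q t. (\<lambda>k. ?R1k k (fst z) (snd z)) \<longlonglongrightarrow> ?R1 (fst z) (snd z)"
      using nz by eventually_elim (intro tendsto_mult tendsto_const llim)
    show "AE z in Q t. \<bar>?R1 (fst z) (snd z) - ?R1k k (fst z) (snd z)\<bar> \<le> d * ((\<sigma> (fst z) (snd z))\<^sup>2 / norm (Y (fst z) (snd z)))" for k
      using nz
    proof eventually_elim
      case (elim z)
      let ?y = "Y (fst z) (snd z)"
      have n: "0 < norm ?y" using elim by simp
      have "?l k ?y \<le> d / norm ?y"
      proof -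
        have "?l k ?y \<le> d / ?f k ?y" unfolding d_def by (rule soft_laplace_bounds(3)[OF \<epsilon>(1)])
        also have "\<dots> \<le> d / norm ?y" using n soft_norm_pos[OF \<epsilon>(1), of k ?y] soft_norm_ge(2)[OF \<epsilon>(1), of ?y k] d by (intro divide_left_mono) auto
        finally show ?thesis .
      qed
      moreover have "(d - 1) / norm ?y \<le> d / norm ?y" "0 \<le> (d - 1) / norm ?y" using n d by (auto intro!: divide_right_mono)
      ultimately have "\<bar>(d - 1) / norm ?y - ?l k ?y\<bar> \<le> d / norm ?y + d / norm ?y" using l0[of k ?y] d n by (smt (verit) divide_nonneg_pos)
      then have "\<bar>(\<sigma> (fst z) (snd z))\<^sup>2 / 2\<bar> * \<bar>(d - 1) / norm ?y - ?l k ?y\<bar> \<le> \<bar>(\<sigma> (fst z) (snd z))\<^sup>2 / 2\<bar> * (d / norm ?y + d / norm ?y)"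
        by (rule mult_left_mono) simp
      also have "\<dots> = d * ((\<sigma> (fst z) (snd z))\<^sup>2 / norm ?y)" by (simp add: field_simps)
      finally show ?case unfolding abs_mult[symmetric] d_def by (simp add: right_diff_distrib)
    qed
    show "(\<integral>\<^sup>+z. ennreal (d * ((\<sigma> (fst z) (snd z))\<^sup>2 / norm (Y (fst z) (snd z)))) \<partial>Q t) < \<infinity>"
    proof -
      have "(\<integral>\<^sup>+z. ennreal (d * ((\<sigma> (fst z) (snd z))\<^sup>2 / norm (Y (fst z) (snd z)))) \<partial>Q t)
          = ennreal d * (\<integral>\<^sup>+z. ennreal ((\<sigma> (fst z) (snd z))\<^sup>2 / norm (Y (fst z) (snd z))) \<partial>Q t)"
        using d by (subst nn_integral_cmult[symmetric]) (auto simp: ennreal_mult' simp del: times_divide_eq_right)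
      then show ?thesis using inv by (simp add: ennreal_mult_less_top)
    qed
  qed measurable
  have R2lim: "(\<lambda>k. \<integral>\<^sup>+z. ennreal \<bar>?R2 (fst z) (snd z) - ?R2k k (fst z) (snd z)\<bar> \<partial>Q t) \<longlonglongrightarrow> 0"
  proof (rule nn_integral_Q_tendsto_0[where R="?R2k" and R'="?R2" and w="\<lambda>z. 2 * norm (\<beta> (fst z) (snd z))", OF pR2k pR2])
    show "AE z in Q t. (\<lambda>k. ?R2k k (fst z) (snd z)) \<longlonglongrightarrow> ?R2 (fst z) (snd z)"
      by (intro AE_I2 tendsto_inner tendsto_const glim)
    show "AE z in Q t. \<bar>?R2 (fst z) (snd z) - ?R2k k (fst z) (snd z)\<bar> \<le> 2 * norm (\<beta> (fst z) (snd z))" for k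
    proof (rule AE_I2)
      fix z
      show "\<bar>?R2 (fst z) (snd z) - ?R2k k (fst z) (snd z)\<bar> \<le> 2 * norm (\<beta> (fst z) (snd z))"
        using in_b[OF s1, of "Y (fst z) (snd z)" "\<beta> (fst z) (snd z)"] in_b[OF g1, of k "Y (fst z) (snd z)" "\<beta> (fst z) (snd z)"] by linarith
    qed
    show "(\<integral>\<^sup>+z. ennreal (2 * norm (\<beta> (fst z) (snd z))) \<partial>Q t) < \<infinity>"
      using \<beta>fin by (simp add: ennreal_mult' nn_integral_cmult ennreal_mult_less_top)
  qed measurable
  have nm: "(\<lambda>\<omega>. norm (Y u \<omega>)) \<in> borel_measurable M" if "0 \<le> u" for u using YM[OF that] by simp
  have JM: "?J \<in> borel_measurable M"
    by (intro borel_measurable_diff tint_measurable pR1 pR2 nm t order_refl)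
  show "l2int t ?\<Theta> ?J"
  proof (rule l2int_closure[OF p\<Theta> JM t])
    fix \<eta> :: real assume \<eta>: "0 < \<eta>"
    then have \<eta>4: "0 < \<eta> / 4" by simp
    have e1: "\<forall>\<^sub>F k in sequentially. \<epsilon> k < \<eta> / 4"
      using order_tendstoD(2)[OF inverse_Suc_tendsto_0 \<eta>4] by (simp only: \<epsilon>_def)
    have "\<forall>\<^sub>F k in sequentially. qnorm t (\<lambda>s \<omega>. ?\<Theta> s \<omega> - ?\<Theta>k k s \<omega>) \<le> ennreal \<eta> \<and>
        (\<integral>\<^sup>+z. ennreal \<bar>?R1 (fst z) (snd z) - ?R1k k (fst z) (snd z)\<bar> \<partial>Q t) \<le> ennreal (\<eta> / 4) \<and>
        (\<integral>\<^sup>+z. ennreal \<bar>?R2 (fst z) (snd z) - ?R2k k (fst z) (snd z)\<bar> \<partial>Q t) \<le> ennreal (\<eta> / 4) \<and> \<epsilon> k < \<eta> / 4"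
      by (intro eventually_conj e1 tendsto_0_ennrealD[OF q\<Theta> \<eta>] tendsto_0_ennrealD[OF R1lim \<eta>4] tendsto_0_ennrealD[OF R2lim \<eta>4])
    then obtain k where k: "qnorm t (\<lambda>s \<omega>. ?\<Theta> s \<omega> - ?\<Theta>k k s \<omega>) \<le> ennreal \<eta>"
        "(\<integral>\<^sup>+z. ennreal \<bar>?R1 (fst z) (snd z) - ?R1k k (fst z) (snd z)\<bar> \<partial>Q t) \<le> ennreal (\<eta> / 4)"
        "(\<integral>\<^sup>+z. ennreal \<bar>?R2 (fst z) (snd z) - ?R2k k (fst z) (snd z)\<bar> \<partial>Q t) \<le> ennreal (\<eta> / 4)" "\<epsilon> k < \<eta> / 4"
      unfolding eventually_sequentially by blast
    have fL1: "(\<integral>\<^sup>+\<omega>. ennreal \<bar>norm (Y u \<omega>) - ?f k (Y u \<omega>)\<bar> \<partial>M) \<le> ennreal (\<eta> / 4)" for u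
    proof -
      have "(\<integral>\<^sup>+\<omega>. ennreal \<bar>norm (Y u \<omega>) - ?f k (Y u \<omega>)\<bar> \<partial>M) \<le> (\<integral>\<^sup>+\<omega>. ennreal (\<eta> / 4) \<partial>M)"
      proof (intro nn_integral_mono ennreal_leI)
        fix \<omega>
        show "\<bar>norm (Y u \<omega>) - ?f k (Y u \<omega>)\<bar> \<le> \<eta> / 4"
          using soft_norm_le[OF \<epsilon>(1), of k "Y u \<omega>"] soft_norm_ge(2)[OF \<epsilon>(1), of "Y u \<omega>" k] k(4) by linarith
      qed
      then show ?thesis by (simp add: emeasure_space_1)
    qed
    note fm = measurable_compose[OF YM fb]
    have "(\<integral>\<^sup>+\<omega>. ennreal \<bar>?J \<omega> - ?Jk k \<omega>\<bar> \<partial>M) \<le> ennreal (\<eta> / 4) + ennreal (\<eta> / 4) + ennreal (\<eta> / 4) + ennreal (\<eta> / 4)"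
      by (rule order_trans[OF functional_diff_L1[OF nm[OF t] nm[OF order_refl] fm[OF t] fm[OF order_refl]
              pR1 pR2 pR1k pR2k R1fin R2fin[OF s1] R1kfin R2fin[OF g1]]], intro add_mono k(2,3) fL1)
    also have "\<dots> = ennreal \<eta>" using \<eta> by (simp add: ennreal_plus[symmetric] del: ennreal_plus)
    finally show "\<exists>\<Theta>' J'. l2int t \<Theta>' J' \<and> qnorm t (\<lambda>s \<omega>. ?\<Theta> s \<omega> - \<Theta>' s \<omega>) \<le> ennreal \<eta> \<and>
        (\<integral>\<^sup>+\<omega>. ennreal \<bar>?J \<omega> - J' \<omega>\<bar> \<partial>M) \<le> ennreal \<eta>"
      using lk[of k] k(1) by blast
  qed
qed

end

section \<open>The driving Brownian motion of the norm\<close>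

lemma borel_measurable_lebesgue_AE:
  fixes f g :: "real \<Rightarrow> 'b::euclidean_space"
  assumes f: "f \<in> borel_measurable lebesgue" and ae: "AE s in lebesgue. f s = g s"
  shows "g \<in> borel_measurable lebesgue"
proof (rule measurableI)
  fix A :: "'b set" assume A: "A \<in> sets borel"
  have 1: "f -` A \<inter> space lebesgue \<in> sets lebesgue" using f A by (rule measurable_sets)
  have 2: "AE s in lebesgue. s \<in> f -` A \<inter> space lebesgue \<longleftrightarrow> s \<in> g -` A \<inter> space lebesgue"
    using ae by eventually_elim simp
  show "g -` A \<inter> space lebesgue \<in> sets lebesgue"
    by (rule completion.in_sets_AE[OF 2 1]) simp
qed simp

lemma set_integral_lebesgue_cong_AE:
  fixes f g :: "real \<Rightarrow> 'b::euclidean_space"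
  assumes f: "set_integrable lebesgue S f" and ae: "AE s in lebesgue. s \<in> S \<longrightarrow> f s = g s"
  shows "set_integrable lebesgue S g" and "(LINT s:S|lebesgue. f s) = (LINT s:S|lebesgue. g s)"
proof -
  have fm: "(\<lambda>s. indicator S s *\<^sub>R f s) \<in> borel_measurable lebesgue"
    using f unfolding set_integrable_def by (rule borel_measurable_integrable)
  have ae': "AE s in lebesgue. indicator S s *\<^sub>R f s = indicator S s *\<^sub>R g s"
    using ae by eventually_elim (auto simp: indicator_def)
  note gm = borel_measurable_lebesgue_AE[OF fm ae']
  show "set_integrable lebesgue S g"
    using f integrable_cong_AE[OF fm gm ae'] unfolding set_integrable_def by simp
  show "(LINT s:S|lebesgue. f s) = (LINT s:S|lebesgue. g s)"
    unfolding set_lebesgue_integral_def by (rule integral_cong_AE[OF fm gm ae'])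
qed

lemma set_integral_lebesgue_lborel:
  fixes f :: "real \<Rightarrow> 'b::euclidean_space"
  assumes "set_integrable lborel S f"
  shows "set_integrable lebesgue S f" and "(LINT s:S|lebesgue. f s) = (LINT s:S|lborel. f s)"
proof -
  have m: "(\<lambda>s. indicator S s *\<^sub>R f s) \<in> borel_measurable lborel"
    using assms unfolding set_integrable_def by (rule borel_measurable_integrable)
  show "set_integrable lebesgue S f" using assms integrable_completion[OF m] unfolding set_integrable_def by simp
  show "(LINT s:S|lebesgue. f s) = (LINT s:S|lborel. f s)"
    using integral_completion[OF m] unfolding set_lebesgue_integral_def by simp
qed

text \<open>The value of \<open>generator\<close> is unspecified at exceptional points, so nothing
  is known about measurability of the resulting drift at the exceptional times. The integral in
  \<open>has_ito_differential\<close> is taken over the completed measure, where changing a function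
  on a null set preserves both measurability and integral.\<close>

lemma has_ito_differential_cong_drift:
  fixes b b' :: "real \<Rightarrow> 'w \<Rightarrow> 'b::euclidean_space"
  assumes "has_ito_differential M F Y W \<sigma> b"
    and ae: "AE \<omega> in M. AE s in lebesgue. 0 < s \<longrightarrow> b s \<omega> = b' s \<omega>"
  shows "has_ito_differential M F Y W \<sigma> b'"
proof -
  obtain I where I: "ito_integral M F W \<sigma> I" and "AE \<omega> in M. \<forall>t\<ge>0. set_integrable lebesgue {0..t} (\<lambda>s. b s \<omega>) \<and>
       Y t \<omega> = Y 0 \<omega> + I t \<omega> + (LINT s:{0..t}|lebesgue. b s \<omega>)"
    using assms(1) unfolding has_ito_differential_def by blast
  from this(2) ae have "AE \<omega> in M. \<forall>t\<ge>0. set_integrable lebesgue {0..t} (\<lambda>s. b' s \<omega>) \<and>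
       Y t \<omega> = Y 0 \<omega> + I t \<omega> + (LINT s:{0..t}|lebesgue. b' s \<omega>)"
  proof eventually_elim
    case (elim \<omega>)
    show ?case
    proof (intro allI impI)
      fix t :: real assume t: "0 \<le> t"
      have i: "set_integrable lebesgue {0..t} (\<lambda>s. b s \<omega>)"
        and y: "Y t \<omega> = Y 0 \<omega> + I t \<omega> + (LINT s:{0..t}|lebesgue. b s \<omega>)" using elim(1) t by blast+
      have "AE s in lebesgue. s \<noteq> (0::real)" by (rule AE_completion) (rule AE_lborel_singleton)
      with elim(2) have "AE s in lebesgue. s \<in> {0..t} \<longrightarrow> b s \<omega> = b' s \<omega>" by eventually_elim auto
      note * = set_integral_lebesgue_cong_AE[OF i this]
      show "set_integrable lebesgue {0..t} (\<lambda>s. b' s \<omega>) \<and> Y t \<omega> = Y 0 \<omega> + I t \<omega> + (LINT s:{0..t}|lebesgue. b' s \<omega>)"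
        using *(1) y unfolding *(2) by blast
    qed
  qed
  with I show ?thesis unfolding has_ito_differential_def by blast
qed

section \<open>Integration against the rotated Brownian motion\<close>

context brownian_basis
begin

lemma AE_grid: "AE s in lborel. \<forall>i. s \<noteq> dyadic n i"
proof -
  have "AE s in lborel. s \<noteq> dyadic n i" for i by (rule AE_lborel_singleton)
  then show ?thesis by (simp add: AE_all_countable)
qed

text \<open>Simple integrands live on cells closed on the right, step integrands on cells closed on
  the left; the two agree off the grid, which is a null set of times.\<close>

lemma simple_process_step:
  assumes "stepwise n H" and "0 \<le> s" "s \<le> T" and ng: "\<forall>i. s \<noteq> dyadic n i"
  shows "simple_process (Suc (dindex n T)) (dyadic n) (\<lambda>i. H (dyadic n i)) s \<omega> = H s \<omega>"
proof -
  let ?i = "dindex n s"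
  have i: "dyadic n ?i \<le> s" "s < dyadic n (Suc ?i)"
    using dfloor_le[OF assms(2), of n] less_dyadic_Suc_dindex[of s n] by (auto simp: dfloor_def)
  have "simple_process (Suc (dindex n T)) (dyadic n) (\<lambda>i. H (dyadic n i)) s \<omega>
      = (\<Sum>i\<in>{?i}. H (dyadic n i) \<omega> * indicator {dyadic n i<..dyadic n (Suc i)} s)"
    unfolding simple_process_def
  proof (rule sum.mono_neutral_cong_right)
    show "{?i} \<subseteq> {..<Suc (dindex n T)}" using dindex_mono[OF assms(3), of n] by auto
    show "\<forall>i\<in>{..<Suc (dindex n T)} - {?i}. H (dyadic n i) \<omega> * indicator {dyadic n i<..dyadic n (Suc i)} s = 0"
    proof
      fix i assume "i \<in> {..<Suc (dindex n T)} - {?i}"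
      then have "\<not> (dyadic n i \<le> s \<and> s < dyadic n (Suc i))" using dindex_eqI by fastforce
      then have "\<not> (dyadic n i < s \<and> s \<le> dyadic n (Suc i))" using ng by (metis less_eq_real_def)
      then show "H (dyadic n i) \<omega> * indicator {dyadic n i<..dyadic n (Suc i)} s = 0" by (simp add: indicator_def)
    qed
  qed auto
  also have "\<dots> = H (dyadic n ?i) \<omega>"
  proof -
    have "dyadic n ?i < s" using i(1) ng by (metis less_eq_real_def)
    then have "indicator {dyadic n ?i<..dyadic n (Suc ?i)} s = (1::real)" using i(2) by (simp add: indicator_def)
    then show ?thesis by simp
  qed
  also have "\<dots> = H s \<omega>" using fun_cong[OF stepwiseD(1)[OF assms(1,2)], of \<omega>] by (simp add: dfloor_def)
  finally show ?thesis .
qed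

text \<open>With \<open>B\<close> replaced by a step integral \<open>?Z\<close> of
  \<open>E k\<close>, the claim is an identity of finite sums, by associativity on each cell. The
  integral of \<open>H\<close> against \<open>B\<close> involves only finitely many values of
  \<open>B\<close>, each of which is close to that of \<open>?Z\<close> by the isometry.\<close>

lemma l2int_rotated_step:
  assumes e: "path_measurable e" and E: "\<And>n. stepwise n (E n)" and lim: "(\<lambda>n. qnorm t (\<lambda>s \<omega>. e s \<omega> - E n s \<omega>)) \<longlonglongrightarrow> 0"
    and B: "\<And>u. 0 \<le> u \<Longrightarrow> l2int u e (B u)" and H: "stepwise n (H :: real \<Rightarrow> 'w \<Rightarrow> real)" and t: "0 \<le> t"
  shows "l2int t (\<lambda>s \<omega>. H s \<omega> *\<^sub>R e s \<omega>) (step_integral n H B t)"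
proof (rule l2int_closure[OF _ _ t])
  let ?N = "Suc (dindex n t)" and ?c = "\<lambda>i. min t (dyadic n i)"
  have c: "0 \<le> ?c i" "?c i \<le> t" for i using t by auto
  obtain K where K: "0 < K" "\<And>s \<omega>. 0 \<le> s \<Longrightarrow> \<omega> \<in> space M \<Longrightarrow> norm (H s \<omega>) \<le> K"
    using stepwise_bounded[OF H] by blast
  have pH: "path_measurable H" by (rule path_measurable_stepwise[OF H])
  have pE: "path_measurable (E k)" for k by (rule path_measurable_stepwise[OF E])
  have BM: "B u \<in> borel_measurable M" if "0 \<le> u" for u by (rule l2int_measurable(2)[OF B[OF that]])
  show "path_measurable (\<lambda>s \<omega>. H s \<omega> *\<^sub>R e s \<omega>)" by (rule path_measurable_scaleR[OF pH e])
  show SM: "step_integral n H B t \<in> borel_measurable M"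
    unfolding step_integral_def[abs_def]
    by (intro borel_measurable_sum borel_measurable_inner borel_measurable_diff BM c stepwiseD(3)[OF H] dyadic_nonneg)
  fix \<eta> :: real assume \<eta>: "0 < \<eta>"
  \<comment> \<open>Each of the \<open>?N\<close> cells involves two values of
    \<open>B - ?Z\<close>, each with weight at most \<open>K\<close>.\<close>
  define \<delta> where "\<delta> = \<eta> / (2 * K * real ?N)"
  have \<delta>: "0 < \<delta>" using \<eta> K by (simp add: \<delta>_def)
  \<comment> \<open>\<open>16 * \<gamma> \<le> \<delta>\<^sup>2\<close> serves the isometry for the
    values, \<open>K\<^sup>2 * \<gamma> \<le> \<eta>\<close> the distance of the integrands.\<close>
  define \<gamma> where "\<gamma> = min (\<delta>\<^sup>2 / 16) (\<eta> / K\<^sup>2)"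
  have \<gamma>: "0 < \<gamma>" using \<delta> \<eta> K by (simp add: \<gamma>_def)
  obtain k0 where k0: "\<And>k. k0 \<le> k \<Longrightarrow> qnorm t (\<lambda>s \<omega>. e s \<omega> - E k s \<omega>) \<le> ennreal \<gamma>"
    using tendsto_min_0[OF lim \<gamma>] by blast
  define k where "k = max n k0"
  have k: "n \<le> k" "qnorm t (\<lambda>s \<omega>. e s \<omega> - E k s \<omega>) \<le> ennreal \<gamma>" using k0[of k] by (auto simp: k_def)
  let ?Z = "step_integral k (E k) W"
  have Hk: "stepwise k H" by (rule stepwise_refine[OF H k(1)])
  have HE: "stepwise k (\<lambda>s \<omega>. H s \<omega> *\<^sub>R E k s \<omega>)" by (rule stepwise_scaleR[OF Hk E])
  have eq: "step_integral k (\<lambda>s \<omega>. H s \<omega> *\<^sub>R E k s \<omega>) W t \<omega> = step_integral n H ?Z t \<omega>" for \<omega>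
  proof -
    have "step_integral n H ?Z t \<omega> = step_integral k H ?Z t \<omega>"
      by (rule step_integral_refine[symmetric, OF _ k(1)]) (erule stepwiseD(1)[OF H])
    also have "\<dots> = step_integral k (\<lambda>s \<omega>. H s \<omega> *\<^sub>R E k s \<omega>) W t \<omega>"
      unfolding step_integral_def[of k H] step_integral_one_step[OF t]
      by (simp add: step_integral_def del: sum.lessThan_Suc)
    finally show ?thesis ..
  qed
  have l: "l2int t (\<lambda>s \<omega>. H s \<omega> *\<^sub>R E k s \<omega>) (step_integral n H ?Z t)"
    using l2int_stepwise[OF HE t] by (simp add: eq[abs_def])
  have ZM: "?Z u \<in> borel_measurable M" if "0 \<le> u" for u by (rule step_integral_L2(2)[OF E that])
  have one: "(\<integral>\<^sup>+\<omega>. ennreal \<bar>B u \<omega> - ?Z u \<omega>\<bar> \<partial>M) \<le> ennreal \<delta>" if u: "0 \<le> u" "u \<le> t" for u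
  proof (rule nn_integral_abs_le_sqn[OF _ _ \<delta>])
    show "(\<lambda>\<omega>. B u \<omega> - ?Z u \<omega>) \<in> borel_measurable M" by (intro borel_measurable_diff BM ZM u)
    have "sqn (\<lambda>\<omega>. B u \<omega> - ?Z u \<omega>) \<le> 16 * qnorm u (\<lambda>s \<omega>. e s \<omega> - E k s \<omega>)"
      by (rule l2int_dist[OF B[OF u(1)] l2int_stepwise[OF E u(1)] u(1)])
    also have "\<dots> \<le> 16 * ennreal \<gamma>" by (intro mult_left_mono order_trans[OF qnorm_mono[OF u(2)] k(2)]) simp
    also have "\<dots> = ennreal (16 * \<gamma>)" by (simp add: ennreal_mult')
    also have "\<dots> \<le> ennreal (\<delta>\<^sup>2)" by (rule ennreal_leI) (simp add: \<gamma>_def min_def field_simps)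
    finally show "sqn (\<lambda>\<omega>. B u \<omega> - ?Z u \<omega>) \<le> ennreal (\<delta>\<^sup>2)" .
  qed
  have "(\<integral>\<^sup>+\<omega>. ennreal \<bar>step_integral n H B t \<omega> - step_integral n H ?Z t \<omega>\<bar> \<partial>M)
    \<le> (\<integral>\<^sup>+\<omega>. (\<Sum>i<?N. ennreal K * ennreal \<bar>B (?c (Suc i)) \<omega> - ?Z (?c (Suc i)) \<omega>\<bar> + ennreal K * ennreal \<bar>B (?c i) \<omega> - ?Z (?c i) \<omega>\<bar>) \<partial>M)"
  proof (intro nn_integral_mono)
    fix \<omega> assume \<omega>: "\<omega> \<in> space M"
    have "\<bar>step_integral n H B t \<omega> - step_integral n H ?Z t \<omega>\<bar>
      = \<bar>\<Sum>i<?N. H (dyadic n i) \<omega> * ((B (?c (Suc i)) \<omega> - ?Z (?c (Suc i)) \<omega>) - (B (?c i) \<omega> - ?Z (?c i) \<omega>))\<bar>"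
      unfolding step_integral_def[of n H] sum_subtractf[symmetric] by (simp add: algebra_simps del: sum.lessThan_Suc)
    also have "\<dots> \<le> (\<Sum>i<?N. K * \<bar>B (?c (Suc i)) \<omega> - ?Z (?c (Suc i)) \<omega>\<bar> + K * \<bar>B (?c i) \<omega> - ?Z (?c i) \<omega>\<bar>)"
    proof (rule order_trans[OF sum_abs sum_mono])
      fix i
      let ?x = "B (?c (Suc i)) \<omega> - ?Z (?c (Suc i)) \<omega>" and ?y = "B (?c i) \<omega> - ?Z (?c i) \<omega>"
      have "\<bar>H (dyadic n i) \<omega> * (?x - ?y)\<bar> \<le> K * (\<bar>?x\<bar> + \<bar>?y\<bar>)"
        unfolding abs_mult using K(2)[OF dyadic_nonneg \<omega>, of n i] by (intro mult_mono abs_triangle_ineq4) auto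
      then show "\<bar>H (dyadic n i) \<omega> * (?x - ?y)\<bar> \<le> K * \<bar>?x\<bar> + K * \<bar>?y\<bar>" by (simp add: distrib_left)
    qed
    finally have "ennreal \<bar>step_integral n H B t \<omega> - step_integral n H ?Z t \<omega>\<bar>
      \<le> ennreal (\<Sum>i<?N. K * \<bar>B (?c (Suc i)) \<omega> - ?Z (?c (Suc i)) \<omega>\<bar> + K * \<bar>B (?c i) \<omega> - ?Z (?c i) \<omega>\<bar>)" by (rule ennreal_leI)
    also have "\<dots> = (\<Sum>i<?N. ennreal K * ennreal \<bar>B (?c (Suc i)) \<omega> - ?Z (?c (Suc i)) \<omega>\<bar> + ennreal K * ennreal \<bar>B (?c i) \<omega> - ?Z (?c i) \<omega>\<bar>)"
      using K(1) by (subst sum_ennreal[symmetric]) (auto simp: ennreal_mult' simp del: sum.lessThan_Suc)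
    finally show "ennreal \<bar>step_integral n H B t \<omega> - step_integral n H ?Z t \<omega>\<bar> \<le> \<dots>" .
  qed
  also have "\<dots> = (\<Sum>i<?N. ennreal K * (\<integral>\<^sup>+\<omega>. ennreal \<bar>B (?c (Suc i)) \<omega> - ?Z (?c (Suc i)) \<omega>\<bar> \<partial>M) + ennreal K * (\<integral>\<^sup>+\<omega>. ennreal \<bar>B (?c i) \<omega> - ?Z (?c i) \<omega>\<bar> \<partial>M))"
  proof -
    have [measurable]: "B (?c i) \<in> borel_measurable M" "?Z (?c i) \<in> borel_measurable M" for i by (intro BM ZM c)+
    show ?thesis by (subst nn_integral_sum) (auto simp: nn_integral_add nn_integral_cmult simp del: sum.lessThan_Suc)
  qed
  also have "\<dots> \<le> (\<Sum>i<?N. ennreal K * ennreal \<delta> + ennreal K * ennreal \<delta>)"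
    by (intro sum_mono add_mono mult_left_mono one c) auto
  also have "\<dots> = (\<Sum>i<?N. ennreal (2 * K * \<delta>))"
  proof -
    have "ennreal K * ennreal \<delta> + ennreal K * ennreal \<delta> = ennreal (K * \<delta> + K * \<delta>)"
    proof -
      have "ennreal K * ennreal \<delta> = ennreal (K * \<delta>)" using K(1) \<delta> by (subst ennreal_mult) auto
      then show ?thesis using K(1) \<delta> by (subst ennreal_plus) auto
    qed
    also have "K * \<delta> + K * \<delta> = 2 * K * \<delta>" by simp
    finally show ?thesis by (simp only:)
  qed
  also have "\<dots> = ennreal (real ?N * (2 * K * \<delta>))"
    using K(1) \<delta> by (subst sum_ennreal) (auto simp del: sum.lessThan_Suc)
  also have "real ?N * (2 * K * \<delta>) = \<eta>"
  proof -
    have "2 * K * real ?N \<noteq> 0" using K(1) by simp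
    then have "(2 * K * real ?N) * \<delta> = \<eta>" unfolding \<delta>_def times_divide_eq_right by (rule nonzero_mult_div_cancel_left)
    then show ?thesis by (simp only: mult_ac)
  qed
  finally have L1: "(\<integral>\<^sup>+\<omega>. ennreal \<bar>step_integral n H B t \<omega> - step_integral n H ?Z t \<omega>\<bar> \<partial>M) \<le> ennreal \<eta>" .
  have "qnorm t (\<lambda>s \<omega>. H s \<omega> *\<^sub>R e s \<omega> - H s \<omega> *\<^sub>R E k s \<omega>) \<le> ennreal (K\<^sup>2) * qnorm t (\<lambda>s \<omega>. e s \<omega> - E k s \<omega>)"
  proof -
    note [measurable] = path_measurable_Q[OF e, of t] path_measurable_Q[OF pE, of k t]
    have "qnorm t (\<lambda>s \<omega>. H s \<omega> *\<^sub>R e s \<omega> - H s \<omega> *\<^sub>R E k s \<omega>) \<le> (\<integral>\<^sup>+z. ennreal (K\<^sup>2) * ennreal ((norm (e (fst z) (snd z) - E k (fst z) (snd z)))\<^sup>2) \<partial>Q t)"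
      unfolding qnorm_Q[OF path_measurable_diff[OF path_measurable_scaleR[OF pH e] path_measurable_scaleR[OF pH pE]]]
    proof (rule nn_integral_mono)
      fix z assume "z \<in> space (Q t)"
      then have z: "0 \<le> fst z" "snd z \<in> space M" by (auto simp: space_Q)
      have "norm (H (fst z) (snd z) *\<^sub>R e (fst z) (snd z) - H (fst z) (snd z) *\<^sub>R E k (fst z) (snd z)) \<le> K * norm (e (fst z) (snd z) - E k (fst z) (snd z))"
        unfolding scaleR_diff_right[symmetric] norm_scaleR using K(2)[OF z] by (intro mult_right_mono) auto
      then have "(norm (H (fst z) (snd z) *\<^sub>R e (fst z) (snd z) - H (fst z) (snd z) *\<^sub>R E k (fst z) (snd z)))\<^sup>2 \<le> (K * norm (e (fst z) (snd z) - E k (fst z) (snd z)))\<^sup>2"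
        by (rule power_mono) simp
      then show "ennreal ((norm (H (fst z) (snd z) *\<^sub>R e (fst z) (snd z) - H (fst z) (snd z) *\<^sub>R E k (fst z) (snd z)))\<^sup>2)
          \<le> ennreal (K\<^sup>2) * ennreal ((norm (e (fst z) (snd z) - E k (fst z) (snd z)))\<^sup>2)"
        by (simp add: ennreal_mult'[symmetric] power_mult_distrib ennreal_leI)
    qed
    also have "\<dots> = ennreal (K\<^sup>2) * qnorm t (\<lambda>s \<omega>. e s \<omega> - E k s \<omega>)"
      unfolding qnorm_Q[OF path_measurable_diff[OF e pE]] by (rule nn_integral_cmult) measurable
    finally show ?thesis .
  qed
  also have "\<dots> \<le> ennreal (K\<^sup>2) * ennreal \<gamma>" by (intro mult_left_mono k(2)) simp
  also have "\<dots> \<le> ennreal \<eta>"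
    using K(1) by (simp add: ennreal_mult'[symmetric] \<gamma>_def min_def field_simps ennreal_leI)
  finally show "\<exists>\<Theta>' J'. l2int t \<Theta>' J' \<and> qnorm t (\<lambda>s \<omega>. H s \<omega> *\<^sub>R e s \<omega> - \<Theta>' s \<omega>) \<le> ennreal \<eta> \<and>
        (\<integral>\<^sup>+\<omega>. ennreal \<bar>step_integral n H B t \<omega> - J' \<omega>\<bar> \<partial>M) \<le> ennreal \<eta>" using l L1 by blast
qed

text \<open>Step approximations of \<open>\<sigma>\<close> serve as simple integrands for
  \<open>B\<close>. Since \<open>e\<close> has length one, multiplying by it preserves
  \<open>qnorm\<close> distances, so the isometry for \<open>W\<close> gives mean square convergence
  of the integrals against \<open>B\<close>.\<close>

lemma ito_integral_rotated:
  assumes \<sigma>: "progressive F \<sigma>" and approx: "\<And>T \<eta>. 0 < \<eta> \<Longrightarrow> \<exists>n H. stepwise n H \<and> qnorm T (\<lambda>s \<omega>. \<sigma> s \<omega> - H s \<omega>) \<le> ennreal \<eta>"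
    and unit: "\<And>s \<omega>. norm (e s \<omega>) = 1"
    and J: "continuous_adapted M F J" "\<And>t. 0 \<le> t \<Longrightarrow> l2int t (\<lambda>s \<omega>. \<sigma> s \<omega> *\<^sub>R e s \<omega>) (J t)"
    and step: "\<And>n H t. stepwise n (H :: real \<Rightarrow> 'w \<Rightarrow> real) \<Longrightarrow> 0 \<le> t \<Longrightarrow> l2int t (\<lambda>s \<omega>. H s \<omega> *\<^sub>R e s \<omega>) (step_integral n H B t)"
  shows "ito_integral M F B \<sigma> J"
  unfolding ito_integral_def
proof (intro conjI \<sigma> J(1) allI impI)
  fix T :: real assume T: "0 < T"
  have "\<forall>k. \<exists>n H. stepwise n H \<and> qnorm T (\<lambda>s \<omega>. \<sigma> s \<omega> - H s \<omega>) \<le> ennreal ((1 / 2) ^ k)"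
    by (intro allI approx) simp
  from choice[OF this] obtain n where "\<forall>k. \<exists>H. stepwise (n k) H \<and> qnorm T (\<lambda>s \<omega>. \<sigma> s \<omega> - H s \<omega>) \<le> ennreal ((1 / 2) ^ k)" ..
  from choice[OF this] obtain S where S: "\<And>k. stepwise (n k) (S k)"
    and qS: "\<And>k. qnorm T (\<lambda>s \<omega>. \<sigma> s \<omega> - S k s \<omega>) \<le> ennreal ((1 / 2) ^ k)" by blast
  let ?N = "\<lambda>k. Suc (dindex (n k) T)" and ?\<tau> = "\<lambda>k. dyadic (n k)" and ?\<xi> = "\<lambda>k i. S k (dyadic (n k) i)"
  have simple: "simple_integrand M F (?N k) (?\<tau> k) (?\<xi> k)" for k
    unfolding simple_integrand_def
  proof (intro conjI allI impI)
    fix i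
    show "dyadic (n k) i \<le> dyadic (n k) (Suc i)" by (rule less_imp_le[OF dyadic_less_Suc])
    show "S k (dyadic (n k) i) \<in> borel_measurable (F (dyadic (n k) i))" by (rule stepwiseD(2)[OF S]) simp
    obtain K where "\<And>s \<omega>. 0 \<le> s \<Longrightarrow> \<omega> \<in> space M \<Longrightarrow> norm (S k s \<omega>) \<le> K" using stepwise_bounded[OF S] by blast
    then have "\<forall>\<omega>\<in>space M. \<bar>S k (dyadic (n k) i) \<omega>\<bar> \<le> K" by simp
    then show "\<exists>K. \<forall>\<omega>\<in>space M. \<bar>S k (dyadic (n k) i) \<omega>\<bar> \<le> K" ..
  qed simp
  have q0: "(\<lambda>k. ennreal ((1 / 2) ^ k)) \<longlonglongrightarrow> 0"
    unfolding ennreal_0[symmetric] by (intro tendsto_ennrealI LIMSEQ_power_zero) simp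
  have p\<sigma>: "path_measurable \<sigma>" by (rule progressive_path_measurable[OF \<sigma>])
  have qeq: "(\<integral>\<^sup>+\<omega>. (\<integral>\<^sup>+s\<in>{0..T}. ennreal ((\<sigma> s \<omega> - simple_process (?N k) (?\<tau> k) (?\<xi> k) s \<omega>)\<^sup>2) \<partial>lborel) \<partial>M)
      = qnorm T (\<lambda>s \<omega>. \<sigma> s \<omega> - S k s \<omega>)" for k
    unfolding qnorm_def
  proof (rule nn_integral_cong, rule nn_integral_cong_AE)
    fix \<omega>
    show "AE s in lborel. ennreal ((\<sigma> s \<omega> - simple_process (?N k) (?\<tau> k) (?\<xi> k) s \<omega>)\<^sup>2) * indicator {0..T} s
        = ennreal ((norm (\<sigma> s \<omega> - S k s \<omega>))\<^sup>2) * indicator {0..T} s"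
      using AE_grid[of "n k"]
    proof eventually_elim
      case (elim s)
      show ?case
      proof (cases "s \<in> {0..T}")
        case True
        then have s: "0 \<le> s" "s \<le> T" by auto
        show ?thesis unfolding simple_process_step[OF S s elim] by simp
      qed simp
    qed
  qed
  have Jt: "(\<lambda>k. \<integral>\<^sup>+\<omega>. ennreal ((norm (J t \<omega> - simple_integral (?N k) (?\<tau> k) (?\<xi> k) B t \<omega>))\<^sup>2) \<partial>M) \<longlonglongrightarrow> 0" if t: "t \<in> {0..T}" for t
  proof -
    have t0: "0 \<le> t" using t by simp
    have le: "(\<integral>\<^sup>+\<omega>. ennreal ((norm (J t \<omega> - simple_integral (?N k) (?\<tau> k) (?\<xi> k) B t \<omega>))\<^sup>2) \<partial>M) \<le> 16 * ennreal ((1 / 2) ^ k)" for k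
    proof -
      have N: "Suc (dindex (n k) t) \<le> ?N k" using t by (simp add: dindex_mono)
      have "simple_integral (?N k) (?\<tau> k) (?\<xi> k) B t \<omega> = step_integral (n k) (S k) B t \<omega>" for \<omega>
        unfolding step_integral_extend[OF N] simple_integral_def by (simp del: sum.lessThan_Suc)
      then have "(\<integral>\<^sup>+\<omega>. ennreal ((norm (J t \<omega> - simple_integral (?N k) (?\<tau> k) (?\<xi> k) B t \<omega>))\<^sup>2) \<partial>M)
          = sqn (\<lambda>\<omega>. J t \<omega> - step_integral (n k) (S k) B t \<omega>)" by (simp add: sqn_def)
      also have "\<dots> \<le> 16 * qnorm t (\<lambda>s \<omega>. \<sigma> s \<omega> *\<^sub>R e s \<omega> - S k s \<omega> *\<^sub>R e s \<omega>)"
        by (rule l2int_dist[OF J(2)[OF t0] step[OF S t0] t0])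
      also have "qnorm t (\<lambda>s \<omega>. \<sigma> s \<omega> *\<^sub>R e s \<omega> - S k s \<omega> *\<^sub>R e s \<omega>) = qnorm t (\<lambda>s \<omega>. \<sigma> s \<omega> - S k s \<omega>)"
        unfolding qnorm_def scaleR_diff_left[symmetric] norm_scaleR unit by simp
      also have "16 * \<dots> \<le> 16 * ennreal ((1 / 2) ^ k)"
        using t by (intro mult_left_mono order_trans[OF qnorm_mono qS]) auto
      finally show ?thesis .
    qed
    have "(\<lambda>k. 16 * ennreal ((1 / 2) ^ k)) \<longlonglongrightarrow> 16 * 0" by (intro ennreal_tendsto_cmult q0) simp
    then have L: "(\<lambda>k. 16 * ennreal ((1 / 2) ^ k)) \<longlonglongrightarrow> 0" by (simp only: mult_zero_right)
    show ?thesis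
      by (rule tendsto_sandwich[OF always_eventually always_eventually tendsto_const L]) (rule allI, rule zero_le, rule allI, rule le)
  qed
  show "\<exists>n \<tau> \<xi>. (\<forall>k. simple_integrand M F (n k) (\<tau> k) (\<xi> k)) \<and>
        (\<lambda>k. \<integral>\<^sup>+\<omega>. (\<integral>\<^sup>+s\<in>{0..T}. ennreal ((\<sigma> s \<omega> - simple_process (n k) (\<tau> k) (\<xi> k) s \<omega>)\<^sup>2) \<partial>lborel) \<partial>M) \<longlonglongrightarrow> 0 \<and>
        (\<forall>t\<in>{0..T}. (\<lambda>k. \<integral>\<^sup>+\<omega>. ennreal ((norm (J t \<omega> - simple_integral (n k) (\<tau> k) (\<xi> k) B t \<omega>))\<^sup>2) \<partial>M) \<longlonglongrightarrow> 0)"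
  proof (intro exI[of _ ?N] exI[of _ ?\<tau>] exI[of _ ?\<xi>] conjI allI simple ballI Jt)
    show "(\<lambda>k. \<integral>\<^sup>+\<omega>. (\<integral>\<^sup>+s\<in>{0..T}. ennreal ((\<sigma> s \<omega> - simple_process (?N k) (?\<tau> k) (?\<xi> k) s \<omega>)\<^sup>2) \<partial>lborel) \<partial>M) \<longlonglongrightarrow> 0"
      unfolding qeq
      by (rule tendsto_sandwich[OF always_eventually always_eventually tendsto_const q0]) (rule allI, rule zero_le, rule allI, rule qS)
  qed
qed

lemma continuous_indefinite_LINT:
  fixes f :: "real \<Rightarrow> real"
  assumes "\<And>k::nat. set_integrable lborel {0..real k} f"
  shows "continuous_on {0..} (\<lambda>t. LINT s:{0..t}|lborel. f s)"
proof (rule continuous_on_halfline)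
  fix T :: real
  obtain k where k: "T \<le> real k" using real_arch_simple by blast
  have "continuous_on {0..real k} (\<lambda>t. integral {0..t} f)"
    by (rule indefinite_integral_continuous_1[OF set_borel_integral_eq_integral(1)[OF assms]])
  then have "continuous_on {0..<T} (\<lambda>t. integral {0..t} f)" by (rule continuous_on_subset) (use k in auto)
  then show "continuous_on {0..<T} (\<lambda>t. LINT s:{0..t}|lborel. f s)"
  proof (rule continuous_on_eq)
    fix t assume "t \<in> {0..<T}"
    then have "set_integrable lborel {0..t} f" by (intro set_integrable_subset[OF assms[of k]]) (use k in auto)
    then show "integral {0..t} f = (LINT s:{0..t}|lborel. f s)"
      by (rule set_borel_integral_eq_integral(2)[symmetric])
  qed
qed

theorem norm_ito_differential:
  assumes I: "ito_integral M F W \<sigma> I" and Y: "continuous_adapted M F Y" and \<beta>: "path_measurable \<beta>"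
    and \<beta>fin: "\<And>t. 0 \<le> t \<Longrightarrow> (\<integral>\<^sup>+z. ennreal (norm (\<beta> (fst z) (snd z))) \<partial>Q t) < \<infinity>"
    and decomp: "AE \<omega> in M. \<forall>t\<ge>0. Y t \<omega> = Y 0 \<omega> + I t \<omega> + (LINT s:{0..t}|lborel. \<beta> s \<omega>)"
    and nz: "\<And>t. 0 \<le> t \<Longrightarrow> AE z in Q t. Y (fst z) (snd z) \<noteq> 0"
    and bound: "\<And>t. 0 \<le> t \<Longrightarrow> \<exists>R. AE \<omega> in M. norm (Y t \<omega>) \<le> R"
    and dim: "2 \<le> DIM('a)"
  shows "\<exists>B. brownian_motion M F B \<and> has_ito_differential M F (\<lambda>t \<omega>. norm (Y t \<omega>)) B \<sigma>
    (\<lambda>s \<omega>. (\<sigma> s \<omega>)\<^sup>2 / 2 * ((real DIM('a) - 1) / norm (Y s \<omega>)) + sgn (Y s \<omega>) \<bullet> \<beta> s \<omega>)"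
proof -
  have YF: "Y s \<in> borel_measurable (F s)" and YM: "Y s \<in> borel_measurable M" if "0 \<le> s" for s
    using Y that measurable_F_M unfolding continuous_adapted_def by blast+
  have Yc: "continuous_on {0..} (\<lambda>s. Y s \<omega>)" if "\<omega> \<in> space M" for \<omega>
    using Y that unfolding continuous_adapted_def by blast
  have pY: "path_measurable Y" by (rule path_measurable_continuous[OF YM Yc])
  define b0 :: 'a where "b0 = (SOME b. b \<in> Basis)"
  have b0: "norm b0 = 1" unfolding b0_def by (rule norm_Basis) (metis nonempty_Basis some_in_eq)
  \<comment> \<open>At the origin \<open>sgn\<close> gives the zero vector. A fixed unit vector is
    inserted there, because the Gaussian computation asks for length one at every point;
    \<open>u (Y s \<omega>)\<close> and \<open>sgn (Y s \<omega>)\<close> differ only where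
    \<open>Y\<close> vanishes.\<close>
  define u where "u z = (if z = 0 then b0 else sgn z)" for z :: 'a
  have u1: "norm (u z) = 1" for z using b0 by (simp add: u_def norm_sgn)
  have um: "u \<in> borel_measurable borel" unfolding u_def[abs_def] sgn_div_norm by measurable
  define e where "e s \<omega> = u (Y s \<omega>)" for s \<omega>
  define E where "E n s \<omega> = e (dfloor n s) \<omega>" for n s \<omega>
  have pe: "path_measurable e" unfolding e_def by (rule path_measurable_compose[OF pY um])
  have E: "stepwise n (E n)" for n
    unfolding stepwise_def
  proof (intro conjI allI impI)
    fix s :: real assume s: "0 \<le> s"
    show "E n s = E n (dfloor n s)" by (simp add: E_def dfloor_def fun_eq_iff)
    show "E n s \<in> borel_measurable (F s)" unfolding E_def[abs_def] e_def
      by (rule measurable_compose[OF measurable_F_mono[OF _ dfloor_le[OF s] YF] um]) simp_all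
  qed (use u1 in \<open>auto simp: E_def e_def intro!: exI[of _ 1]\<close>)
  have elim_q: "(\<lambda>n. qnorm t (\<lambda>s \<omega>. e s \<omega> - E n s \<omega>)) \<longlonglongrightarrow> 0" if t: "0 \<le> t" for t
  proof (rule qnorm_tendsto_0[OF path_measurable_stepwise[OF E] pe, where w="\<lambda>_. 2\<^sup>2"])
    interpret Qf: finite_measure "Q t" by (rule finite_measure_Q)
    have AEQ: "AE z in Q t. fst z \<in> {0..t} \<and> snd z \<in> space M" by (rule AE_I2) (auto simp: space_Q)
    show "AE z in Q t. (\<lambda>n. E n (fst z) (snd z)) \<longlonglongrightarrow> e (fst z) (snd z)"
      using nz[OF t] AEQ
    proof eventually_elim
      case (elim z)
      have Yl: "(\<lambda>n. Y (dfloor n (fst z)) (snd z)) \<longlonglongrightarrow> Y (fst z) (snd z)"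
        by (rule dfloor_tendsto_path[OF Yc]) (use elim in auto)
      have "\<forall>\<^sub>F n in sequentially. sgn (Y (dfloor n (fst z)) (snd z)) = E n (fst z) (snd z)"
        using tendsto_imp_eventually_ne[OF Yl elim(1)] by eventually_elim (simp add: E_def e_def u_def)
      then have "(\<lambda>n. E n (fst z) (snd z)) \<longlonglongrightarrow> sgn (Y (fst z) (snd z))"
        by (rule Lim_transform_eventually[OF tendsto_sgn[OF Yl elim(1)]])
      then show ?case using elim(1) by (simp add: e_def u_def)
    qed
    show "AE z in Q t. (norm (e (fst z) (snd z) - E n (fst z) (snd z)))\<^sup>2 \<le> 2\<^sup>2" for n
    proof (rule AE_I2)
      fix z
      have "norm (e (fst z) (snd z) - E n (fst z) (snd z)) \<le> 2"
        using norm_triangle_ineq4[of "e (fst z) (snd z)" "E n (fst z) (snd z)"] by (simp add: E_def e_def u1)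
      then show "(norm (e (fst z) (snd z) - E n (fst z) (snd z)))\<^sup>2 \<le> 2\<^sup>2" by (rule power_mono) simp
    qed
    show "(\<integral>\<^sup>+z. ennreal (2\<^sup>2) \<partial>Q t) < \<infinity>" by (simp add: ennreal_mult_eq_top_iff less_top[symmetric])
  qed simp
  obtain B r where B: "continuous_adapted M F B" "\<And>\<omega>. B 0 \<omega> = 0" "\<And>t. 0 \<le> t \<Longrightarrow> l2int t e (B t)"
    "\<And>t. 0 \<le> t \<Longrightarrow> AE \<omega> in M. (\<lambda>j. step_integral (r j) (E (r j)) W t \<omega>) \<longlonglongrightarrow> B t \<omega>"
    using continuous_l2int[OF E pe elim_q] by auto
  have BM: "brownian_motion M F B"
    by (rule rotated_brownian_motion[OF E _ B(1,2,4)]) (simp add: E_def e_def u1)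
  let ?R1 = "\<lambda>s \<omega>. (\<sigma> s \<omega>)\<^sup>2 / 2 * ((real DIM('a) - 1) / norm (Y s \<omega>))" and ?R2 = "\<lambda>s \<omega>. sgn (Y s \<omega>) \<bullet> \<beta> s \<omega>"
  define D where "D s \<omega> = ?R1 s \<omega> + ?R2 s \<omega>" for s \<omega>
  note a = ito_integral_approx[OF I]
  have Ic: "continuous_adapted M F I" using I unfolding ito_integral_def by blast
  have dec_t: "AE \<omega> in M. \<forall>v\<in>{0..t}. Y v \<omega> = Y 0 \<omega> + I v \<omega> + (LINT s:{0..v}|lborel. \<beta> s \<omega>)" for t
    using decomp
  proof eventually_elim
    case (elim \<omega>)
    show ?case
    proof
      fix v assume "v \<in> {0..t}"
      then have "0 \<le> v" by simp
      with elim show "Y v \<omega> = Y 0 \<omega> + I v \<omega> + (LINT s:{0..v}|lborel. \<beta> s \<omega>)" by blast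
    qed
  qed
  have psq: "path_measurable (\<lambda>s \<omega>. (\<sigma> s \<omega>)\<^sup>2 / 2)" by (rule path_measurable_compose[OF a(1)]) simp
  have pR1: "path_measurable ?R1"
    by (intro path_measurable_mult psq path_measurable_compose[OF pY, of "\<lambda>y. (real DIM('a) - 1) / norm y"]) simp
  have psg: "path_measurable (\<lambda>s \<omega>. sgn (Y s \<omega>))" by (rule path_measurable_compose[OF pY]) (simp add: sgn_div_norm[abs_def])
  have pR2: "path_measurable ?R2" by (rule path_measurable_inner[OF psg \<beta>])
  have dpos: "0 \<le> real DIM('a) - 1" using dim by simp
  have R1fin: "(\<integral>\<^sup>+z. ennreal (norm (?R1 (fst z) (snd z))) \<partial>Q t) < \<infinity>" if t: "0 \<le> t" for t
  proof -
    obtain R where R: "AE \<omega> in M. norm (Y t \<omega>) \<le> R" using bound[OF t] by blast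
    note fin = ito_norm(1)[OF t a(1) a(2) Ic a(3) Y \<beta> \<beta>fin[OF t] dec_t nz[OF t] R dim]
    note [measurable] = path_measurable_Q[OF pY, of t] path_measurable_Q[OF a(1), of t]
    have "norm (?R1 s \<omega>) = (real DIM('a) - 1) / 2 * ((\<sigma> s \<omega>)\<^sup>2 / norm (Y s \<omega>))" for s \<omega>
      using dpos by (simp add: abs_mult)
    then have "(\<integral>\<^sup>+z. ennreal (norm (?R1 (fst z) (snd z))) \<partial>Q t)
        = (\<integral>\<^sup>+z. ennreal ((real DIM('a) - 1) / 2) * ennreal ((\<sigma> (fst z) (snd z))\<^sup>2 / norm (Y (fst z) (snd z))) \<partial>Q t)"
      using dpos by (simp only: ennreal_mult'[symmetric] divide_nonneg_nonneg zero_le_numeral)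
    also have "\<dots> = ennreal ((real DIM('a) - 1) / 2) * (\<integral>\<^sup>+z. ennreal ((\<sigma> (fst z) (snd z))\<^sup>2 / norm (Y (fst z) (snd z))) \<partial>Q t)"
      by (rule nn_integral_cmult) measurable
    finally show ?thesis using fin by (simp only: ennreal_mult_less_top infinity_ennreal_def) simp
  qed
  have R2fin: "(\<integral>\<^sup>+z. ennreal (norm (?R2 (fst z) (snd z))) \<partial>Q t) < \<infinity>" if t: "0 \<le> t" for t
  proof (rule le_less_trans[OF nn_integral_mono \<beta>fin[OF t]])
    fix z
    have "\<bar>sgn (Y (fst z) (snd z)) \<bullet> \<beta> (fst z) (snd z)\<bar> \<le> norm (sgn (Y (fst z) (snd z))) * norm (\<beta> (fst z) (snd z))"
      by (rule Cauchy_Schwarz_ineq2)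
    also have "\<dots> \<le> 1 * norm (\<beta> (fst z) (snd z))" by (intro mult_right_mono) (simp_all add: norm_sgn)
    finally show "ennreal (norm (?R2 (fst z) (snd z))) \<le> ennreal (norm (\<beta> (fst z) (snd z)))"
      by (intro ennreal_leI) simp
  qed
  \<comment> \<open>The event that the drift is integrable over every bounded interval; integer
    endpoints suffice and keep the condition countable.\<close>
  define G where "G = {\<omega>\<in>space M. \<forall>k::nat. set_integrable lborel {0..real k} (\<lambda>s. D s \<omega>)}"
  have int_ae: "AE \<omega> in M. integrable (restrict_space lborel {0..t}) (\<lambda>s. ?R1 s \<omega>) \<and> integrable (restrict_space lborel {0..t}) (\<lambda>s. ?R2 s \<omega>)"
    if t: "0 \<le> t" for t
    using AE_path_integrable[OF pR1 R1fin[OF t]] AE_path_integrable[OF pR2 R2fin[OF t]] by eventually_elim blast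
  have AEG: "AE \<omega> in M. \<omega> \<in> G"
  proof -
    have "AE \<omega> in M. set_integrable lborel {0..real k} (\<lambda>s. D s \<omega>)" for k :: nat
      using int_ae[OF of_nat_0_le_iff[of k]] unfolding set_integrable_time D_def
      by eventually_elim (rule Bochner_Integration.integrable_add, blast+)
    then have "AE \<omega> in M. \<forall>k::nat. set_integrable lborel {0..real k} (\<lambda>s. D s \<omega>)" by (simp add: AE_all_countable)
    with AE_space show ?thesis by eventually_elim (simp add: G_def)
  qed
  \<comment> \<open>\<open>J\<close> is defined from the norm and the drift rather than as a limit,
    so that its paths are visibly continuous and the asserted decomposition holds on
    \<open>G\<close> by definition. Off \<open>G\<close> it is \<open>0\<close>.\<close>
  define J where "J t \<omega> = (if \<omega> \<in> G then norm (Y t \<omega>) - norm (Y 0 \<omega>) - (LINT s:{0..t}|lborel. D s \<omega>) else 0)" for t \<omega>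
  let ?J' = "\<lambda>t \<omega>. norm (Y t \<omega>) - norm (Y 0 \<omega>) - tint t ?R1 \<omega> - tint t ?R2 \<omega>"
  have J': "l2int t (\<lambda>s \<omega>. \<sigma> s \<omega> *\<^sub>R sgn (Y s \<omega>)) (?J' t)" if t: "0 \<le> t" for t
  proof -
    obtain R where R: "AE \<omega> in M. norm (Y t \<omega>) \<le> R" using bound[OF t] by blast
    show ?thesis by (rule ito_norm(2)[OF t a(1) a(2) Ic a(3) Y \<beta> \<beta>fin[OF t] dec_t nz[OF t] R dim])
  qed
  have JJ': "AE \<omega> in M. ?J' t \<omega> = J t \<omega>" if t: "0 \<le> t" for t
    using AEG int_ae[OF t]
  proof eventually_elim
    case (elim \<omega>)
    have "(LINT s:{0..t}|lborel. D s \<omega>) = tint t ?R1 \<omega> + tint t ?R2 \<omega>"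
      unfolding tint_eq_LINT[symmetric] using elim(2) unfolding tint_def D_def by (intro Bochner_Integration.integral_add) auto
    then show ?case using elim(1) by (simp add: J_def)
  qed
  have JF: "J t \<in> borel_measurable (F t)" if t: "0 \<le> t" for t
  proof (rule borel_measurable_F_AE_limit[OF t, where u="\<lambda>_. ?J' t"])
    show "?J' t \<in> borel_measurable (F t)" by (rule l2int_adapted[OF J'[OF t] t])
    show "AE \<omega> in M. (\<lambda>j. ?J' t \<omega>) \<longlonglongrightarrow> J t \<omega>" using JJ'[OF t] by eventually_elim simp
  qed
  have Jc: "continuous_adapted M F J"
    unfolding continuous_adapted_def
  proof (intro conjI allI impI ballI JF)
    fix \<omega> assume \<omega>: "\<omega> \<in> space M"
    show "continuous_on {0..} (\<lambda>t. J t \<omega>)"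
    proof (cases "\<omega> \<in> G")
      case True
      then have "\<And>k::nat. set_integrable lborel {0..real k} (\<lambda>s. D s \<omega>)" by (simp add: G_def)
      note continuous_indefinite_LINT[OF this]
      then have "continuous_on {0..} (\<lambda>t. norm (Y t \<omega>) - norm (Y 0 \<omega>) - (LINT s:{0..t}|lborel. D s \<omega>))"
        by (intro continuous_on_diff continuous_on_norm Yc \<omega> continuous_on_const)
      then show ?thesis using True by (simp add: J_def)
    qed (simp add: J_def)
  qed
  have p\<sigma>e: "path_measurable (\<lambda>s \<omega>. \<sigma> s \<omega> *\<^sub>R e s \<omega>)" by (rule path_measurable_scaleR[OF a(1) pe])
  have p\<sigma>s: "path_measurable (\<lambda>s \<omega>. \<sigma> s \<omega> *\<^sub>R sgn (Y s \<omega>))" by (rule path_measurable_scaleR[OF a(1) psg])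
  have lJ: "l2int t (\<lambda>s \<omega>. \<sigma> s \<omega> *\<^sub>R e s \<omega>) (J t)" if t: "0 \<le> t" for t
  proof (rule l2int_closure[OF p\<sigma>e measurable_F_M[OF t JF[OF t]] t])
    fix \<eta> :: real assume "0 < \<eta>"
    have "qnorm t (\<lambda>s \<omega>. \<sigma> s \<omega> *\<^sub>R e s \<omega> - \<sigma> s \<omega> *\<^sub>R sgn (Y s \<omega>)) = (\<integral>\<^sup>+z. 0 \<partial>Q t)"
      unfolding qnorm_Q[OF path_measurable_diff[OF p\<sigma>e p\<sigma>s]]
      by (rule nn_integral_cong_AE, use nz[OF t] in eventually_elim) (simp add: e_def u_def)
    then have "qnorm t (\<lambda>s \<omega>. \<sigma> s \<omega> *\<^sub>R e s \<omega> - \<sigma> s \<omega> *\<^sub>R sgn (Y s \<omega>)) \<le> ennreal \<eta>" by simp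
    moreover have "(\<integral>\<^sup>+\<omega>. ennreal \<bar>J t \<omega> - ?J' t \<omega>\<bar> \<partial>M) = (\<integral>\<^sup>+\<omega>. 0 \<partial>M)"
    proof (rule nn_integral_cong_AE, use JJ'[OF t] in eventually_elim)
      case (elim \<omega>) show ?case unfolding elim by simp
    qed
    then have "(\<integral>\<^sup>+\<omega>. ennreal \<bar>J t \<omega> - ?J' t \<omega>\<bar> \<partial>M) \<le> ennreal \<eta>" by simp
    ultimately show "\<exists>\<Theta>' J''. l2int t \<Theta>' J'' \<and> qnorm t (\<lambda>s \<omega>. \<sigma> s \<omega> *\<^sub>R e s \<omega> - \<Theta>' s \<omega>) \<le> ennreal \<eta> \<and>
        (\<integral>\<^sup>+\<omega>. ennreal \<bar>J t \<omega> - J'' \<omega>\<bar> \<partial>M) \<le> ennreal \<eta>" using J'[OF t] by blast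
  qed
  have prog: "progressive F \<sigma>" using I unfolding ito_integral_def by blast
  have e1: "norm (e s \<omega>) = 1" for s \<omega> by (simp add: e_def u1)
  have ito: "ito_integral M F B \<sigma> J"
  proof (rule ito_integral_rotated[OF prog a(2) e1 Jc lJ])
    show "l2int t (\<lambda>s \<omega>. H s \<omega> *\<^sub>R e s \<omega>) (step_integral n H B t)" if "stepwise n H" "0 \<le> t" for n H t
      by (rule l2int_rotated_step[OF pe E elim_q[OF that(2)] B(3) that])
  qed
  have "AE \<omega> in M. \<forall>t\<ge>0. set_integrable lebesgue {0..t} (\<lambda>s. D s \<omega>) \<and>
       norm (Y t \<omega>) = norm (Y 0 \<omega>) + J t \<omega> + (LINT s:{0..t}|lebesgue. D s \<omega>)"
    using AEG
  proof eventually_elim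
    case (elim \<omega>)
    show ?case
    proof (intro allI impI)
      fix t :: real assume "0 \<le> t"
      obtain k where k: "t \<le> real k" using real_arch_simple by blast
      have "set_integrable lborel {0..real k} (\<lambda>s. D s \<omega>)" using elim by (simp add: G_def)
      then have "set_integrable lborel {0..t} (\<lambda>s. D s \<omega>)" by (rule set_integrable_subset) (use k in auto)
      note * = set_integral_lebesgue_lborel[OF this]
      show "set_integrable lebesgue {0..t} (\<lambda>s. D s \<omega>) \<and>
         norm (Y t \<omega>) = norm (Y 0 \<omega>) + J t \<omega> + (LINT s:{0..t}|lebesgue. D s \<omega>)"
        unfolding *(2) using *(1) elim by (simp add: J_def)
    qed
  qed
  with ito have "has_ito_differential M F (\<lambda>t \<omega>. norm (Y t \<omega>)) B \<sigma> D"
    unfolding has_ito_differential_def by blast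
  with BM show ?thesis unfolding D_def by blast
qed

end

section \<open>The generator and the coefficients\<close>

lemma grad_eq: "GDERIV f y :> g \<Longrightarrow> grad f y = g"
  unfolding grad_def gderiv_def
  by (simp add: frechet_derivative_at[symmetric] inner_commute[of _ g] euclidean_representation)

lemma dvg_eq: "(G has_derivative G') (at y) \<Longrightarrow> dvg G y = (\<Sum>b\<in>Basis. G' b \<bullet> b)"
  unfolding dvg_def by (simp add: frechet_derivative_at[symmetric])

lemma gderiv_transform_within_open:
  "GDERIV f y :> g \<Longrightarrow> open N \<Longrightarrow> y \<in> N \<Longrightarrow> (\<And>z. z \<in> N \<Longrightarrow> f z = h z) \<Longrightarrow> GDERIV h y :> g"
  unfolding gderiv_def by (rule has_derivative_transform_within_open)

lemma gderiv_norm_diff: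
  fixes y c :: "'a::euclidean_space"
  assumes "y \<noteq> c" shows "GDERIV (\<lambda>z. norm (z - c)) y :> sgn (y - c)"
proof -
  have "(norm has_derivative (\<lambda>h. h \<bullet> sgn (y - c))) (at (y - c))"
    by (rule has_derivative_norm) (use assms in simp)
  moreover have "((\<lambda>z. z - c) has_derivative (\<lambda>h. h)) (at y)" by (auto intro!: derivative_eq_intros)
  ultimately show ?thesis unfolding gderiv_def
    using has_derivative_compose[of "\<lambda>z. z - c" "\<lambda>h. h" y UNIV norm] by simp
qed

text \<open>Product rule for \<open>z - c\<close> and the inverse of its length. The derivative is
  the orthogonal projection onto the complement of \<open>y - c\<close>, divided by the
  distance.\<close>

lemma has_derivative_sgn_diff:
  fixes y c :: "'a::euclidean_space"
  assumes "y \<noteq> c"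
  shows "((\<lambda>z. sgn (z - c)) has_derivative
    (\<lambda>h. inverse (norm (y - c)) *\<^sub>R h - ((h \<bullet> sgn (y - c)) / (norm (y - c))\<^sup>2) *\<^sub>R (y - c))) (at y)"
proof -
  have "((\<lambda>z. inverse (norm (z - c))) has_derivative
      (\<lambda>h. - (inverse (norm (y - c)) * (h \<bullet> sgn (y - c)) * inverse (norm (y - c))))) (at y)"
    by (rule Deriv.has_derivative_inverse[OF _ gderiv_norm_diff[OF assms, unfolded gderiv_def]]) (use assms in simp)
  moreover have "((\<lambda>z. z - c) has_derivative (\<lambda>h. h)) (at y)" by (auto intro!: derivative_eq_intros)
  ultimately have "((\<lambda>z. inverse (norm (z - c)) *\<^sub>R (z - c)) has_derivative
      (\<lambda>h. inverse (norm (y - c)) *\<^sub>R h + (- (inverse (norm (y - c)) * (h \<bullet> sgn (y - c)) * inverse (norm (y - c)))) *\<^sub>R (y - c))) (at y)"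
    by (rule has_derivative_scaleR)
  moreover have "inverse (norm (y - c)) * k * inverse (norm (y - c)) = k / (norm (y - c))\<^sup>2" for k
    by (simp add: power2_eq_square divide_inverse)
  ultimately show ?thesis by (simp add: sgn_div_norm)
qed

text \<open>The projection leaves \<open>DIM('a) - 1\<close> directions; this trace is the origin of
  the factor \<open>real DIM('a) - 1\<close> in the drift.\<close>

lemma dvg_sgn_trace:
  fixes v :: "'a::euclidean_space"
  assumes "v \<noteq> 0"
  shows "(\<Sum>b\<in>Basis. (inverse (norm v) *\<^sub>R b - ((b \<bullet> sgn v) / (norm v)\<^sup>2) *\<^sub>R v) \<bullet> b) = (real DIM('a) - 1) / norm v"
proof -
  have "(\<Sum>b\<in>Basis. (inverse (norm v) *\<^sub>R b - ((b \<bullet> sgn v) / (norm v)\<^sup>2) *\<^sub>R v) \<bullet> b)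
      = (\<Sum>b\<in>(Basis::'a set). inverse (norm v) - (v \<bullet> b)\<^sup>2 / (norm v)^3)"
    by (rule sum.cong) (simp_all add: inner_diff_left inner_diff_right inner_Basis sgn_div_norm inner_commute mult_ac power2_eq_square power3_eq_cube divide_inverse)
  also have "\<dots> = real DIM('a) * inverse (norm v) - (\<Sum>b\<in>Basis. (v \<bullet> b)\<^sup>2) / (norm v)^3"
    by (simp add: sum_subtractf sum_divide_distrib)
  also have "(\<Sum>b\<in>Basis. (v \<bullet> b)\<^sup>2) = (norm v)\<^sup>2"
    unfolding power2_norm_eq_inner euclidean_inner[of v v] by (simp add: power2_eq_square)
  also have "(norm v)\<^sup>2 / (norm v)^3 = inverse (norm v)"
    using assms by (simp add: power2_eq_square power3_eq_cube field_simps)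
  finally show ?thesis by (simp add: divide_inverse algebra_simps)
qed

text \<open>Both terms contain \<open>div (n \<nabla>\<alpha>)\<close>; what remains is \<open>div (\<alpha> \<nabla>n)\<close>, so the second derivatives of \<open>\<alpha>\<close> cancel.\<close>

lemma radial_generator:
  fixes x o\<^sub>0 y :: "'a::euclidean_space"
  assumes N: "open N" "y \<in> N" "\<And>z. z \<in> N \<Longrightarrow> z \<noteq> x \<and> z \<noteq> o\<^sub>0"
    and \<alpha>: "\<And>z. z \<in> N \<Longrightarrow> \<alpha> z = \<phi> (norm (z - x))"
    and \<phi>: "\<And>z. z \<in> N \<Longrightarrow> (\<phi> has_real_derivative \<phi>' (norm (z - x))) (at (norm (z - x)))"
    and \<phi>': "(\<phi>' has_real_derivative \<phi>'') (at (norm (y - x)))"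
  shows "laplace (\<lambda>z. \<alpha> z * norm (z - o\<^sub>0)) y - dvg (\<lambda>z. norm (z - o\<^sub>0) *\<^sub>R grad \<alpha> z) y
    = \<phi> (norm (y - x)) * ((real DIM('a) - 1) / norm (y - o\<^sub>0)) + \<phi>' (norm (y - x)) * (sgn (y - x) \<bullet> sgn (y - o\<^sub>0))"
proof -
  let ?n = "\<lambda>z. norm (z - o\<^sub>0)" and ?r = "\<lambda>z. norm (z - x)"
  have y: "y \<noteq> x" "y \<noteq> o\<^sub>0" using N by auto
  have g\<alpha>: "GDERIV \<alpha> z :> \<phi>' (?r z) *\<^sub>R sgn (z - x)" if z: "z \<in> N" for z
    by (rule gderiv_transform_within_open[OF GDERIV_DERIV_compose[OF gderiv_norm_diff \<phi>[OF z]] N(1) z])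
      (use N z \<alpha> in auto)
  have gn: "GDERIV ?n z :> sgn (z - o\<^sub>0)" if "z \<in> N" for z by (rule gderiv_norm_diff) (use N that in auto)
  let ?G = "\<lambda>z. ?n z *\<^sub>R (\<phi>' (?r z) *\<^sub>R sgn (z - x))" and ?H = "\<lambda>z. \<phi> (?r z) *\<^sub>R sgn (z - o\<^sub>0)"
  have g1: "grad (\<lambda>z. \<alpha> z * ?n z) z = ?H z + ?G z" if z: "z \<in> N" for z
    using grad_eq[OF GDERIV_mult[OF g\<alpha>[OF z] gn[OF z]]] \<alpha>[OF z] by simp
  have g2: "?n z *\<^sub>R grad \<alpha> z = ?G z" if z: "z \<in> N" for z
    using grad_eq[OF g\<alpha>[OF z]] by simp
  note s = has_derivative_sgn_diff[OF y(1)] has_derivative_sgn_diff[OF y(2)]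
  have r': "((\<lambda>z. \<phi>' (?r z)) has_derivative (\<lambda>h. h \<bullet> \<phi>'' *\<^sub>R sgn (y - x))) (at y)"
    using GDERIV_DERIV_compose[OF gderiv_norm_diff[OF y(1)] \<phi>'] unfolding gderiv_def .
  have r: "((\<lambda>z. \<phi> (?r z)) has_derivative (\<lambda>h. h \<bullet> \<phi>' (?r y) *\<^sub>R sgn (y - x))) (at y)"
    using GDERIV_DERIV_compose[OF gderiv_norm_diff[OF y(1)] \<phi>[OF N(2)]] unfolding gderiv_def .
  obtain G' where G': "(?G has_derivative G') (at y)"
    using has_derivative_scaleR[OF gn[OF N(2), unfolded gderiv_def] has_derivative_scaleR[OF r' s(1)]] by blast
  note H' = has_derivative_scaleR[OF r s(2)]
  let ?H' = "\<lambda>h. \<phi> (?r y) *\<^sub>R (inverse (?n y) *\<^sub>R h - ((h \<bullet> sgn (y - o\<^sub>0)) / (?n y)\<^sup>2) *\<^sub>R (y - o\<^sub>0))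
      + (h \<bullet> \<phi>' (?r y) *\<^sub>R sgn (y - x)) *\<^sub>R sgn (y - o\<^sub>0)"
  have "laplace (\<lambda>z. \<alpha> z * ?n z) y = (\<Sum>b\<in>Basis. (?H' b + G' b) \<bullet> b)"
    unfolding laplace_def
    by (rule dvg_eq, rule has_derivative_transform_within_open[OF has_derivative_add[OF H' G'] N(1,2)]) (simp add: g1)
  moreover have "dvg (\<lambda>z. ?n z *\<^sub>R grad \<alpha> z) y = (\<Sum>b\<in>Basis. G' b \<bullet> b)"
    by (rule dvg_eq, rule has_derivative_transform_within_open[OF G' N(1,2)]) (simp add: g2)
  ultimately have "laplace (\<lambda>z. \<alpha> z * ?n z) y - dvg (\<lambda>z. ?n z *\<^sub>R grad \<alpha> z) y = (\<Sum>b\<in>Basis. ?H' b \<bullet> b)"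
    by (simp add: inner_add_left sum.distrib)
  also have "\<dots> = \<phi> (?r y) * (\<Sum>b\<in>Basis. (inverse (?n y) *\<^sub>R b - ((b \<bullet> sgn (y - o\<^sub>0)) / (?n y)\<^sup>2) *\<^sub>R (y - o\<^sub>0)) \<bullet> b)
      + \<phi>' (?r y) * (\<Sum>b\<in>Basis. (sgn (y - x) \<bullet> b) * (sgn (y - o\<^sub>0) \<bullet> b))"
    unfolding inner_add_left sum.distrib sum_distrib_left inner_scaleR_left
    by (simp add: inner_commute mult.assoc)
  also have "(\<Sum>b\<in>Basis. (sgn (y - x) \<bullet> b) * (sgn (y - o\<^sub>0) \<bullet> b)) = sgn (y - x) \<bullet> sgn (y - o\<^sub>0)"
    by (rule euclidean_inner[symmetric])
  also have "(\<Sum>b\<in>Basis. (inverse (?n y) *\<^sub>R b - ((b \<bullet> sgn (y - o\<^sub>0)) / (?n y)\<^sup>2) *\<^sub>R (y - o\<^sub>0)) \<bullet> b) = (real DIM('a) - 1) / ?n y"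
    by (rule dvg_sgn_trace) (use y in simp)
  finally show ?thesis .
qed

section \<open>The coefficients in closed form\<close>

locale barenblatt_parameters =
  fixes d :: nat and p m :: real
  assumes p: "1 < p" and m: "0 < m" and mp: "1 < m * (p - 1)"
begin

lemma beta_pos: "0 < bb_beta d p m"
  unfolding bb_beta_def using p mp by (intro add_pos_nonneg mult_nonneg_nonneg) auto

lemma gamma_pos: "0 < bb_gamma p m"
  unfolding bb_gamma_def using p mp by simp

lemma kappa_pos: "0 < bb_kappa d p m"
  unfolding bb_kappa_def using p m mp beta_pos by (intro mult_pos_pos divide_pos_pos) auto

text \<open>With \<open>\<theta> = t powr (- 1 / \<beta>) * r\<close>, the exponents of \<open>S\<close> in \<open>a\<close> add up to \<open>1\<close> and
  \<open>a\<close> is a constant times \<open>\<theta> powr ((p - 2) / (p - 1)) * S\<close> inside the support.\<close>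

definition bb_S :: "real \<Rightarrow> real \<Rightarrow> real" where
  "bb_S t r = bb_C d p m - bb_kappa d p m * (t powr (- 1 / bb_beta d p m) * r) powr (p / (p - 1))"

text \<open>The part of the radial derivative of the profile that depends on time alone, up to sign;
  see \<open>deriv_bb_U\<close>.\<close>

definition slope_factor :: "real \<Rightarrow> real" where
  "slope_factor t = t powr (- real d / bb_beta d p m) * (bb_gamma p m * (bb_kappa d p m * (p / (p - 1) * t powr (- 1 / bb_beta d p m))))"

definition coeff_factor :: "real \<Rightarrow> real" where
  "coeff_factor t = m powr (p - 1) * slope_factor t powr (p - 2) * (t powr (- real d / bb_beta d p m)) powr ((m - 1) * (p - 1))"

definition radial_a :: "real \<Rightarrow> real \<Rightarrow> real" where
  "radial_a t r = coeff_factor t * ((t powr (- 1 / bb_beta d p m) * r) powr ((p - 2) / (p - 1)) * bb_S t r)"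

text \<open>The product rule applied to \<open>radial_a\<close>, written out so that it can be
  differentiated once more and is visibly measurable.\<close>

definition radial_ar :: "real \<Rightarrow> real \<Rightarrow> real" where
  "radial_ar t r = coeff_factor t *
    ((p - 2) / (p - 1) * (t powr (- 1 / bb_beta d p m) * r) powr ((p - 2) / (p - 1) - 1) * t powr (- 1 / bb_beta d p m) * bb_S t r
     + (t powr (- 1 / bb_beta d p m) * r) powr ((p - 2) / (p - 1)) *
       - (bb_kappa d p m * (p / (p - 1) * (t powr (- 1 / bb_beta d p m) * r) powr (p / (p - 1) - 1) * t powr (- 1 / bb_beta d p m))))"

lemma DERIV_scaled_powr:
  fixes \<tau> r e :: real
  assumes "0 < \<tau>" "0 < r"
  shows "((\<lambda>r. (\<tau> * r) powr e) has_real_derivative e * (\<tau> * r) powr (e - 1) * \<tau>) (at r)"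
proof -
  have "((\<lambda>r. \<tau> * r) has_real_derivative \<tau>) (at r)" by (auto intro!: derivative_eq_intros)
  from DERIV_chain2[OF has_real_derivative_powr this, of e] show ?thesis using assms by simp
qed

end

text \<open>\<open>bb_C\<close> is a definite description. Its positivity is isolated as a locale
  assumption, to be discharged from the existence of a solution.\<close>

locale barenblatt_profile = barenblatt_parameters +
  assumes C_pos: "0 < bb_C d p m"
begin

text \<open>In the scaled variable the support ends at \<open>bb_rho d p m\<close>, and
  \<open>bb_rho d p m powr (p / (p - 1))\<close> equals
  \<open>bb_C d p m / bb_kappa d p m\<close>.\<close>

lemma bb_S_pos:
  assumes "0 < t" "0 < r" "r < bb_radius d p m t"
  shows "0 < bb_S t r"
proof -
  let ?\<tau> = "t powr (- 1 / bb_beta d p m)" and ?C = "bb_C d p m" and ?k = "bb_kappa d p m"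
  have tt: "?\<tau> * t powr (1 / bb_beta d p m) = 1" using assms(1) by (simp add: powr_add[symmetric])
  have "?\<tau> * r < ?\<tau> * (bb_rho d p m * t powr (1 / bb_beta d p m))"
    using assms by (intro mult_strict_left_mono) (auto simp: bb_radius_def)
  also have "\<dots> = bb_rho d p m * (?\<tau> * t powr (1 / bb_beta d p m))" by (simp only: mult_ac)
  also have "\<dots> = bb_rho d p m" unfolding tt by simp
  finally have lt: "?\<tau> * r < bb_rho d p m" .
  have pos: "0 < ?\<tau> * r" using assms by simp
  have "(?\<tau> * r) powr (p / (p - 1)) < bb_rho d p m powr (p / (p - 1))"
    by (rule powr_less_mono2) (use lt pos p in auto)
  also have "\<dots> = ?C / ?k" unfolding bb_rho_def powr_powr using p C_pos kappa_pos by simp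
  finally show ?thesis unfolding bb_S_def using kappa_pos by (simp add: field_simps)
qed

lemma DERIV_bb_S:
  assumes "0 < t" "0 < r"
  shows "(bb_S t has_real_derivative
    - (bb_kappa d p m * (p / (p - 1) * (t powr (- 1 / bb_beta d p m) * r) powr (p / (p - 1) - 1) * t powr (- 1 / bb_beta d p m)))) (at r)"
proof -
  have "((\<lambda>r. bb_C d p m - bb_kappa d p m * (t powr (- 1 / bb_beta d p m) * r) powr (p / (p - 1))) has_real_derivative
    0 - bb_kappa d p m * (p / (p - 1) * (t powr (- 1 / bb_beta d p m) * r) powr (p / (p - 1) - 1) * t powr (- 1 / bb_beta d p m))) (at r)"
    by (rule DERIV_diff[OF DERIV_const DERIV_cmult[OF DERIV_scaled_powr]]) (use assms in auto)
  then show ?thesis by (simp add: bb_S_def[abs_def])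
qed

lemma bb_U_eq:
  assumes "0 < t" "0 < r" "r < bb_radius d p m t"
  shows "bb_U d p m t r = t powr (- real d / bb_beta d p m) * bb_S t r powr bb_gamma p m"
  using bb_S_pos[OF assms] unfolding bb_U_def profile_def bb_S_def by (simp add: max_def)

lemma deriv_bb_U:
  assumes "0 < t" "0 < r" "r < bb_radius d p m t"
  shows "deriv (bb_U d p m t) r
    = - (slope_factor t * (bb_S t r powr (bb_gamma p m - 1) * (t powr (- 1 / bb_beta d p m) * r) powr (1 / (p - 1))))"
proof (rule DERIV_imp_deriv)
  have e: "p / (p - 1) - 1 = 1 / (p - 1)" using p by (simp add: field_simps)
  note S = DERIV_bb_S[OF assms(1,2)]
  have "((\<lambda>r. t powr (- real d / bb_beta d p m) * bb_S t r powr bb_gamma p m) has_real_derivative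
     t powr (- real d / bb_beta d p m) * (bb_gamma p m * bb_S t r powr (bb_gamma p m - 1) *
       - (bb_kappa d p m * (p / (p - 1) * (t powr (- 1 / bb_beta d p m) * r) powr (p / (p - 1) - 1) * t powr (- 1 / bb_beta d p m))))) (at r)"
    by (rule DERIV_cmult[OF DERIV_chain2[OF has_real_derivative_powr[OF bb_S_pos[OF assms]] S]])
  then have "((\<lambda>r. t powr (- real d / bb_beta d p m) * bb_S t r powr bb_gamma p m) has_real_derivative
     - (slope_factor t * (bb_S t r powr (bb_gamma p m - 1) * (t powr (- 1 / bb_beta d p m) * r) powr (1 / (p - 1))))) (at r)"
    unfolding slope_factor_def e by (simp only: mult_ac mult_minus_left mult_minus_right)
  then show "(bb_U d p m t has_real_derivative
     - (slope_factor t * (bb_S t r powr (bb_gamma p m - 1) * (t powr (- 1 / bb_beta d p m) * r) powr (1 / (p - 1))))) (at r)"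
    by (rule has_field_derivative_transform_within_open[where S="{0<..<bb_radius d p m t}"])
      (use assms bb_U_eq[OF assms(1)] in auto)
qed

lemma coeff_a_eq:
  assumes "0 < t" "0 < r" "r < bb_radius d p m t"
  shows "coeff_a d p m t r = radial_a t r"
proof -
  let ?S = "bb_S t r" and ?\<theta> = "t powr (- 1 / bb_beta d p m) * r" and ?\<gamma> = "bb_gamma p m"
  have S: "0 < ?S" by (rule bb_S_pos[OF assms])
  have K: "0 < slope_factor t" unfolding slope_factor_def
    using assms(1) gamma_pos kappa_pos p by (intro mult_pos_pos) auto
  have "(?\<gamma> - 1) * (p - 2) + ?\<gamma> * ((m - 1) * (p - 1)) = ?\<gamma> * (m * (p - 1) - 1) - (p - 2)"
    by (simp add: algebra_simps)
  \<comment> \<open>By the choice of \<open>bb_gamma\<close>, the product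
    \<open>?\<gamma> * (m * (p - 1) - 1)\<close> equals \<open>p - 1\<close>.\<close>
  also have "\<dots> = 1" using mp by (simp add: bb_gamma_def)
  finally have e: "(?\<gamma> - 1) * (p - 2) + ?\<gamma> * ((m - 1) * (p - 1)) = 1" .
  have U': "\<bar>deriv (bb_U d p m t) r\<bar> = slope_factor t * (?S powr (?\<gamma> - 1) * ?\<theta> powr (1 / (p - 1)))"
    unfolding deriv_bb_U[OF assms] using K by (simp add: abs_mult)
  have "coeff_a d p m t r = m powr (p - 1) * (slope_factor t * (?S powr (?\<gamma> - 1) * ?\<theta> powr (1 / (p - 1)))) powr (p - 2)
      * (t powr (- real d / bb_beta d p m) * ?S powr ?\<gamma>) powr ((m - 1) * (p - 1))"
    unfolding coeff_a_def U' bb_U_eq[OF assms] using assms by simp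
  also have "\<dots> = m powr (p - 1) * (slope_factor t powr (p - 2) * (?S powr ((?\<gamma> - 1) * (p - 2)) * ?\<theta> powr (1 / (p - 1) * (p - 2))))
      * ((t powr (- real d / bb_beta d p m)) powr ((m - 1) * (p - 1)) * ?S powr (?\<gamma> * ((m - 1) * (p - 1))))"
    unfolding powr_mult[of "slope_factor t"] powr_mult[of "?S powr (?\<gamma> - 1)"] powr_mult[of "t powr (- real d / bb_beta d p m)"]
      powr_powr[of ?S] powr_powr[of ?\<theta>] ..
  also have "\<dots> = coeff_factor t * (?\<theta> powr ((p - 2) / (p - 1)) * (?S powr ((?\<gamma> - 1) * (p - 2)) * ?S powr (?\<gamma> * ((m - 1) * (p - 1)))))"
    unfolding coeff_factor_def by (simp only: mult_ac times_divide_eq_left times_divide_eq_right mult_1_left)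
  also have "\<dots> = radial_a t r"
    unfolding powr_add[symmetric] e radial_a_def using S by simp
  finally show ?thesis .
qed

lemma DERIV_radial_a:
  assumes "0 < t" "0 < r"
  shows "(radial_a t has_real_derivative radial_ar t r) (at r)"
proof -
  have "(radial_a t has_real_derivative
      coeff_factor t *
    ((p - 2) / (p - 1) * (t powr (- 1 / bb_beta d p m) * r) powr ((p - 2) / (p - 1) - 1) * t powr (- 1 / bb_beta d p m) * bb_S t r
     + - (bb_kappa d p m * (p / (p - 1) * (t powr (- 1 / bb_beta d p m) * r) powr (p / (p - 1) - 1) * t powr (- 1 / bb_beta d p m)))
      * (t powr (- 1 / bb_beta d p m) * r) powr ((p - 2) / (p - 1)))) (at r)"
    unfolding radial_a_def[abs_def]
    by (rule DERIV_cmult[OF DERIV_mult[OF DERIV_scaled_powr DERIV_bb_S]]) (use assms in auto)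
  then show ?thesis unfolding radial_ar_def by (simp only: mult_ac)
qed

text \<open>The closed form holds on an open interval of radii around \<open>r\<close>, so it may be
  differentiated there.\<close>

lemma coeff_ar_eq:
  assumes "0 < t" "0 < r" "r < bb_radius d p m t"
  shows "coeff_ar d p m t r = radial_ar t r"
proof -
  have "(coeff_a d p m t has_real_derivative radial_ar t r) (at r)"
    by (rule has_field_derivative_transform_within_open[OF DERIV_radial_a[OF assms(1,2)], where S="{0<..<bb_radius d p m t}"])
      (use assms coeff_a_eq[OF assms(1)] in auto)
  then show ?thesis using assms by (simp add: coeff_ar_def DERIV_imp_deriv)
qed

text \<open>The value of the second derivative is left open because it cancels in
  \<open>radial_generator\<close>.\<close>

lemma DERIV_radial_ar:
  assumes "0 < t" "0 < r"
  shows "\<exists>D. (radial_ar t has_real_derivative D) (at r)"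
proof -
  have 0: "0 < t powr (- 1 / bb_beta d p m)" using assms by simp
  note P = DERIV_scaled_powr[OF 0 assms(2)]
  show ?thesis
    unfolding radial_ar_def[abs_def]
    by (rule exI, rule DERIV_cmult, rule DERIV_add, rule DERIV_mult[OF _ DERIV_bb_S[OF assms]],
        rule DERIV_cmult_right, rule DERIV_cmult, rule P, rule DERIV_mult, rule P, rule DERIV_minus,
        rule DERIV_cmult, rule DERIV_cmult_right, rule DERIV_cmult, rule P)
qed

text \<open>Off \<open>x\<close>, \<open>o\<^sub>0\<close> and the free boundary, a neighbourhood of
  \<open>y\<close> lies either inside the support, where the closed form is smooth, or outside,
  where the coefficient vanishes identically; \<open>radial_generator\<close> applies in both
  cases.\<close>

lemma generator_norm:
  fixes x o\<^sub>0 y :: "'a::euclidean_space"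
  assumes d: "d = DIM('a)" and t: "0 < t" and y: "y \<noteq> x" "y \<noteq> o\<^sub>0" "norm (y - x) \<noteq> bb_radius d p m t"
  shows "generator p m x t (\<lambda>z. norm (z - o\<^sub>0)) y
    = coeff_a d p m t (norm (y - x)) * ((real d - 1) / norm (y - o\<^sub>0))
      + coeff_ar d p m t (norm (y - x)) * (sgn (y - x) \<bullet> sgn (y - o\<^sub>0))"
proof (cases "norm (y - x) < bb_radius d p m t")
  case True
  let ?N = "ball x (bb_radius d p m t) - {x, o\<^sub>0}"
  have N: "0 < norm (z - x)" "norm (z - x) < bb_radius d p m t" if "z \<in> ?N" for z
    using that by (auto simp: dist_norm norm_minus_commute)
  have yN: "y \<in> ?N" using True y by (simp add: dist_norm norm_minus_commute)
  obtain D where D: "(radial_ar t has_real_derivative D) (at (norm (y - x)))"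
    using DERIV_radial_ar[OF t] N[OF yN] by blast
  have "laplace (\<lambda>z. coeff_a d p m t (norm (z - x)) * norm (z - o\<^sub>0)) y
      - dvg (\<lambda>z. norm (z - o\<^sub>0) *\<^sub>R grad (\<lambda>z'. coeff_a d p m t (norm (z' - x))) z) y
    = radial_a t (norm (y - x)) * ((real DIM('a) - 1) / norm (y - o\<^sub>0))
      + radial_ar t (norm (y - x)) * (sgn (y - x) \<bullet> sgn (y - o\<^sub>0))"
  proof (rule radial_generator[OF _ yN _ _ _ D])
    show "open ?N" by (intro open_Diff) auto
  qed (use coeff_a_eq[OF t] DERIV_radial_a[OF t] N in auto)
  then show ?thesis
    unfolding generator_def d[symmetric] coeff_a_eq[OF t N[OF yN]] coeff_ar_eq[OF t N[OF yN]] by simp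
next
  case False
  let ?N = "- cball x (bb_radius d p m t) - {x, o\<^sub>0}"
  have yN: "y \<in> ?N" using False y by (simp add: dist_norm norm_minus_commute)
  have "laplace (\<lambda>z. coeff_a d p m t (norm (z - x)) * norm (z - o\<^sub>0)) y
      - dvg (\<lambda>z. norm (z - o\<^sub>0) *\<^sub>R grad (\<lambda>z'. coeff_a d p m t (norm (z' - x))) z) y
    = 0 * ((real DIM('a) - 1) / norm (y - o\<^sub>0)) + 0 * (sgn (y - x) \<bullet> sgn (y - o\<^sub>0))"
  proof (rule radial_generator[where \<phi>="\<lambda>_. 0" and \<phi>'="\<lambda>_. 0" and \<phi>''=0, OF _ yN])
    show "open ?N" by (intro open_Diff open_Compl) auto
  qed (auto simp: coeff_a_def dist_norm norm_minus_commute)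
  then show ?thesis
    unfolding generator_def d[symmetric] using False by (simp add: coeff_a_def coeff_ar_def)
qed

end

section \<open>Laws of the solution\<close>

lemma distributed_AE_notin:
  fixes Y :: "'w \<Rightarrow> 'a::euclidean_space"
  assumes D: "distributed M lborel Y f" and A: "A \<in> sets borel" and 0: "AE y in lborel. y \<in> A \<longrightarrow> f y = 0"
  shows "AE \<omega> in M. Y \<omega> \<notin> A"
proof (rule AE_I[where N="Y -` A \<inter> space M"])
  have "emeasure M (Y -` A \<inter> space M) = (\<integral>\<^sup>+y. f y * indicator A y \<partial>lborel)"
    using A by (intro distributed_emeasure[OF D]) simp
  also have "\<dots> = (\<integral>\<^sup>+y. 0 \<partial>(lborel :: 'a measure))"
  proof (rule nn_integral_cong_AE)
    show "AE y in lborel. f y * indicator A y = 0" using 0 by eventually_elim (auto simp: indicator_def)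
  qed
  finally show "emeasure M (Y -` A \<inter> space M) = 0" by simp
  show "Y -` A \<inter> space M \<in> sets M"
    using A by (intro measurable_sets[OF distributed_measurable[OF D]]) simp
qed auto

lemma sphere_null_sets: "sphere (c::'a::euclidean_space) r \<in> null_sets lborel"
  using negligible_sphere[of c r] by (simp add: negligible_iff_null_sets null_sets_completion_iff)

text \<open>If the constant were not positive, the profile would vanish identically, and a zero
  density cannot belong to a probability law.\<close>

lemma (in barenblatt_parameters) bb_C_pos:
  fixes Y :: "'w \<Rightarrow> 'a::euclidean_space"
  assumes d: "d = DIM('a)" and M: "prob_space M"
    and D: "distributed M lborel Y (\<lambda>y. ennreal (barenblatt p m x 1 y))"
  shows "0 < bb_C d p m"
proof (rule ccontr)
  interpret prob_space M by (rule M)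
  assume "\<not> 0 < bb_C d p m"
  then have "bb_C d p m - bb_kappa d p m * r powr q \<le> 0" for r q :: real
    using kappa_pos mult_nonneg_nonneg[OF less_imp_le[OF kappa_pos] powr_ge_zero[of r q]] by linarith
  then have "barenblatt p m x 1 y = 0" for y :: 'a
    unfolding barenblatt_def bb_U_def profile_def d[symmetric] by (simp add: max_absorb2)
  then have "AE \<omega> in M. Y \<omega> \<notin> UNIV" by (intro distributed_AE_notin[OF D]) auto
  then show False by simp
qed

context barenblatt_profile
begin

lemma barenblatt_outside_support:
  fixes x y :: "'a::euclidean_space"
  assumes d: "d = DIM('a)" and t: "0 < t" and y: "bb_radius d p m t \<le> norm (y - x)"
  shows "barenblatt p m x t y = 0"
proof -
  let ?\<tau> = "t powr (- 1 / bb_beta d p m)" and ?C = "bb_C d p m" and ?k = "bb_kappa d p m"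
  have tt: "?\<tau> * t powr (1 / bb_beta d p m) = 1" using t by (simp add: powr_add[symmetric])
  have "bb_rho d p m = bb_rho d p m * (?\<tau> * t powr (1 / bb_beta d p m))" unfolding tt by simp
  also have "\<dots> = ?\<tau> * (bb_rho d p m * t powr (1 / bb_beta d p m))" by (simp only: mult_ac)
  also have "\<dots> \<le> ?\<tau> * norm (y - x)" using y by (intro mult_left_mono) (auto simp: bb_radius_def)
  finally have le: "bb_rho d p m \<le> ?\<tau> * norm (y - x)" .
  have "?C / ?k = bb_rho d p m powr (p / (p - 1))" unfolding bb_rho_def powr_powr using p C_pos kappa_pos by simp
  also have "\<dots> \<le> (?\<tau> * norm (y - x)) powr (p / (p - 1))"
    by (rule powr_mono2) (use le p in \<open>auto simp: bb_rho_def\<close>)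
  finally have "?C - ?k * (?\<tau> * norm (y - x)) powr (p / (p - 1)) \<le> 0" using kappa_pos by (simp add: field_simps)
  then show ?thesis unfolding barenblatt_def bb_U_def profile_def d[symmetric] by (simp add: max_absorb2)
qed

lemma coeff_a_nonneg: "0 \<le> coeff_a d p m t r"
  by (simp add: coeff_a_def)

text \<open>The definition of \<open>coeff_ar\<close> through \<open>deriv\<close> does not exhibit
  measurability in time and radius, the closed form does. At \<open>t = 0\<close> the radius is
  \<open>0\<close>, since powers of \<open>0\<close> under \<open>powr\<close> are \<open>0\<close>,
  and the coefficient vanishes there too.\<close>

lemma coeff_ar_eq_if:
  assumes "0 \<le> t"
  shows "coeff_ar d p m t r = (if 0 < t \<and> 0 < r \<and> r < bb_radius d p m t then radial_ar t r else 0)"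
proof (cases "t = 0")
  case True
  then show ?thesis by (simp add: coeff_ar_def bb_radius_def)
next
  case False
  then show ?thesis using assms coeff_ar_eq[of t r] by (auto simp: coeff_ar_def)
qed

end

context brownian_basis
begin

lemma path_measurable_coeff_ar:
  fixes Z :: "real \<Rightarrow> 'w \<Rightarrow> real"
  assumes "barenblatt_profile d p m" and Z: "path_measurable Z"
  shows "path_measurable (\<lambda>s \<omega>. coeff_ar d p m s (Z s \<omega>))"
proof -
  interpret barenblatt_profile d p m by (rule assms(1))
  let ?f = "\<lambda>s r. if 0 < s \<and> 0 < r \<and> r < bb_radius d p m s then radial_ar s r else 0"
  have f: "(\<lambda>z. ?f (fst z) (snd z)) \<in> borel_measurable (borel \<Otimes>\<^sub>M borel)"
    unfolding radial_ar_def coeff_factor_def slope_factor_def bb_S_def bb_radius_def by measurable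
  have "(\<lambda>z. (fst z, Z (fst z) (snd z))) \<in> (restrict_space borel {0..} \<Otimes>\<^sub>M M) \<rightarrow>\<^sub>M (borel \<Otimes>\<^sub>M borel)"
    using Z unfolding path_measurable_def
    by (intro measurable_Pair measurable_compose[OF measurable_fst measurable_ident_sets[OF refl, THEN measurable_restrict_space1]])
  from measurable_compose[OF this f] have "path_measurable (\<lambda>s \<omega>. ?f s (Z s \<omega>))"
    unfolding path_measurable_def by (simp only: fst_conv snd_conv)
  then show ?thesis by (rule path_measurable_cong) (rule coeff_ar_eq_if)
qed

text \<open>Fubini's theorem in both orders: what holds almost surely at each positive time holds
  almost everywhere in \<open>Q T\<close>, and along almost every path at almost every time. The
  time \<open>0\<close>, where the law may be singular, is a single point.\<close>

lemma AE_path_law: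
  assumes G: "{z \<in> space (Q T). G (fst z) (snd z)} \<in> sets (Q T)"
    and AE: "\<And>s. 0 < s \<Longrightarrow> AE \<omega> in M. G s \<omega>"
  shows "AE z in Q T. G (fst z) (snd z)" and "AE \<omega> in M. AE s in lborel. s \<in> {0<..T} \<longrightarrow> G s \<omega>"
proof -
  interpret pair_sigma_finite "restrict_space lborel {0..T}" M by (rule pair_Q)
  have "AE s in lborel. s \<noteq> (0::real)" by (rule AE_lborel_singleton)
  then have "AE s in restrict_space lborel {0..T}. AE \<omega> in M. G s \<omega>"
    by (subst AE_restrict_space_iff) (auto elim!: eventually_mono intro: AE)
  then have 1: "AE s in restrict_space lborel {0..T}. AE \<omega> in M. G s \<omega>" .
  then show "AE z in Q T. G (fst z) (snd z)"
    using AE_pair_iff[OF G[unfolded Q_def]] unfolding Q_def by blast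
  have "AE \<omega> in M. AE s in restrict_space lborel {0..T}. G s \<omega>"
    using 1 AE_commute[OF G[unfolded Q_def]] by blast
  then show "AE \<omega> in M. AE s in lborel. s \<in> {0<..T} \<longrightarrow> G s \<omega>"
    by (auto simp: AE_restrict_space_iff elim!: eventually_mono)
qed

end

text \<open>The first conjunct gives the drift \<open>generator\<close> its meaning: at almost all
  times it is evaluated at a point near which the functions involved are smooth. One Brownian motion
  serves both forms of the differential.\<close>

theorem theorem3p7:
  fixes p m :: real and o\<^sub>0 x :: "'a::euclidean_space"
    and M :: "'w measure" and F :: "real \<Rightarrow> 'w measure" and X :: "real \<Rightarrow> 'w \<Rightarrow> 'a"
  assumes "DIM('a) \<ge> 2" and "p > 1" and "m > 0"
    and "m * (p - 1) > 1" and "real DIM('a) * p > real DIM('a) + 1"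
    and "x \<noteq> o\<^sub>0"
    and "weak_solution p m x M F X"
  shows "(AE \<omega> in M. AE s in lebesgue. 0 < s \<longrightarrow>
            X s \<omega> \<noteq> x \<and> X s \<omega> \<noteq> o\<^sub>0 \<and> norm (X s \<omega> - x) \<noteq> bb_radius DIM('a) p m s) \<and>
         (\<exists>B :: real \<Rightarrow> 'w \<Rightarrow> real. brownian_motion M F B \<and>
            has_ito_differential M F (\<lambda>t \<omega>. norm (X t \<omega> - o\<^sub>0)) B
              (\<lambda>t \<omega>. sqrt (2 * coeff_a DIM('a) p m t (norm (X t \<omega> - x))))
              (\<lambda>t \<omega>. coeff_a DIM('a) p m t (norm (X t \<omega> - x))
                        * ((real DIM('a) - 1) / norm (X t \<omega> - o\<^sub>0))
                      + coeff_ar DIM('a) p m t (norm (X t \<omega> - x))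
                        * (sgn (X t \<omega> - x) \<bullet> sgn (X t \<omega> - o\<^sub>0))) \<and>
            has_ito_differential M F (\<lambda>t \<omega>. norm (X t \<omega> - o\<^sub>0)) B
              (\<lambda>t \<omega>. sqrt (2 * coeff_a DIM('a) p m t (norm (X t \<omega> - x))))
              (\<lambda>t \<omega>. generator p m x t (\<lambda>y. norm (y - o\<^sub>0)) (X t \<omega>)))"
proof -
  let ?d = "DIM('a)"
  define \<sigma> where "\<sigma> s \<omega> = sqrt (2 * coeff_a ?d p m s (norm (X s \<omega> - x)))" for s \<omega>
  define \<beta> where "\<beta> s \<omega> = coeff_ar ?d p m s (norm (X s \<omega> - x)) *\<^sub>R sgn (X s \<omega> - x)" for s \<omega>
  define Y where "Y s \<omega> = X s \<omega> - o\<^sub>0" for s \<omega>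
  have basis: "stochastic_basis M F" and X: "continuous_adapted M F X"
    and fin: "\<And>t. 0 < t \<Longrightarrow> (\<integral>\<^sup>+\<omega>. (\<integral>\<^sup>+s\<in>{0..t}. ennreal \<bar>coeff_ar ?d p m s (norm (X s \<omega> - x))\<bar> \<partial>lborel) \<partial>M) < \<infinity>"
    and law: "\<And>t. 0 < t \<Longrightarrow> distributed M lborel (X t) (\<lambda>y. ennreal (barenblatt p m x t y))"
    using assms(7) unfolding weak_solution_def by blast+
  obtain W :: "real \<Rightarrow> 'w \<Rightarrow> 'a" where W: "brownian_motion M F W" and dX: "has_ito_differential M F X W \<sigma> \<beta>"
    using assms(7) unfolding weak_solution_def \<sigma>_def[abs_def] \<beta>_def[abs_def] by blast
  interpret stochastic_basis M F by (rule basis)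
  interpret brownian_basis M F W by unfold_locales (rule W)
  interpret bp: barenblatt_parameters ?d p m by unfold_locales (use assms in auto)
  \<comment> \<open>The solution has the Barenblatt density at time \<open>1\<close>, which forces
    the constant to be positive.\<close>
  interpret barenblatt_profile ?d p m
    by unfold_locales (rule bp.bb_C_pos[OF refl prob_space_axioms law], simp)
  have profile: "barenblatt_profile ?d p m" by unfold_locales
  have XM: "X s \<in> borel_measurable M" if "0 \<le> s" for s
    using X that measurable_F_M unfolding continuous_adapted_def by blast
  have XF: "X s \<in> borel_measurable (F s)" if "0 \<le> s" for s
    using X that unfolding continuous_adapted_def by blast
  have Xc: "continuous_on {0..} (\<lambda>s. X s \<omega>)" if "\<omega> \<in> space M" for \<omega>
    using X that unfolding continuous_adapted_def by blast
  have pX: "path_measurable X" by (rule path_measurable_continuous[OF XM Xc])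
  have Y: "continuous_adapted M F Y"
    unfolding continuous_adapted_def Y_def[abs_def]
    by (intro conjI allI impI ballI borel_measurable_diff borel_measurable_const XF continuous_on_diff Xc continuous_on_const)
  have pn: "path_measurable (\<lambda>s \<omega>. norm (X s \<omega> - x))" by (rule path_measurable_compose[OF pX]) simp
  have pb: "path_measurable \<beta>"
    unfolding \<beta>_def[abs_def]
    by (rule path_measurable_scaleR[OF path_measurable_coeff_ar[OF profile pn] path_measurable_compose[OF pX]])
      (simp add: sgn_div_norm[abs_def])
  have bfin: "(\<integral>\<^sup>+z. ennreal (norm (\<beta> (fst z) (snd z))) \<partial>Q t) < \<infinity>" if t: "0 \<le> t" for t
  proof -
    have "(\<integral>\<^sup>+z. ennreal (norm (\<beta> (fst z) (snd z))) \<partial>Q t) = (\<integral>\<^sup>+\<omega>. (\<integral>\<^sup>+s\<in>{0..t}. ennreal (norm (\<beta> s \<omega>)) \<partial>lborel) \<partial>M)"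
      using path_measurable_Q[OF pb, of t] by (subst nn_integral_Q) auto
    \<comment> \<open>The moment condition is stated for positive times; passing to
      \<open>t + 1\<close> includes \<open>t = 0\<close>.\<close>
    also have "\<dots> \<le> (\<integral>\<^sup>+\<omega>. (\<integral>\<^sup>+s\<in>{0..t+1}. ennreal \<bar>coeff_ar ?d p m s (norm (X s \<omega> - x))\<bar> \<partial>lborel) \<partial>M)"
    proof (intro nn_integral_mono mult_mono ennreal_leI)
      fix s \<omega>
      show "norm (\<beta> s \<omega>) \<le> \<bar>coeff_ar ?d p m s (norm (X s \<omega> - x))\<bar>"
        by (simp add: \<beta>_def norm_sgn)
    qed (auto simp: indicator_def)
    also have "\<dots> < \<infinity>" using t by (intro fin) simp
    finally show ?thesis .
  qed
  define G where "G s \<omega> \<longleftrightarrow> X s \<omega> \<noteq> x \<and> X s \<omega> \<noteq> o\<^sub>0 \<and> norm (X s \<omega> - x) \<noteq> bb_radius ?d p m s" for s \<omega>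
  have GQ: "{z \<in> space (Q T). G (fst z) (snd z)} \<in> sets (Q T)" for T
  proof -
    have [measurable]: "fst \<in> borel_measurable (Q T)"
      unfolding Q_def by (rule measurable_compose[OF measurable_fst measurable_restrict_space1]) simp
    note [measurable] = path_measurable_Q[OF pX, of T]
    show ?thesis unfolding G_def bb_radius_def by measurable
  qed
  have GAE: "AE \<omega> in M. G s \<omega>" if s: "0 < s" for s
  proof -
    \<comment> \<open>Finite sets and spheres are Lebesgue null, hence missed almost surely by a law
      with density.\<close>
    have "{x, o\<^sub>0} \<union> sphere x (bb_radius ?d p m s) \<in> null_sets lborel"
      by (intro null_sets.Un sphere_null_sets finite_imp_null_set_lborel) simp
    then have null: "AE y in lborel. y \<in> {x, o\<^sub>0} \<union> sphere x (bb_radius ?d p m s) \<longrightarrow> ennreal (barenblatt p m x s y) = 0"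
      by (rule eventually_mono[OF AE_not_in]) blast
    have "AE \<omega> in M. X s \<omega> \<notin> {x, o\<^sub>0} \<union> sphere x (bb_radius ?d p m s)"
      by (rule distributed_AE_notin[OF law[OF s] _ null]) (intro borel_closed closed_Un; simp)
    then show ?thesis by eventually_elim (auto simp: G_def dist_norm norm_minus_commute)
  qed
  have first: "AE \<omega> in M. AE s in lebesgue. 0 < s \<longrightarrow> G s \<omega>"
  proof -
    have "AE \<omega> in M. \<forall>k::nat. AE s in lborel. s \<in> {0<..real k} \<longrightarrow> G s \<omega>"
      unfolding AE_all_countable by (intro allI AE_path_law(2)[OF GQ GAE])
    then show ?thesis
    proof eventually_elim
      case (elim \<omega>)
      then have "AE s in lborel. \<forall>k::nat. s \<in> {0<..real k} \<longrightarrow> G s \<omega>" unfolding AE_all_countable .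
      then have "AE s in lborel. 0 < s \<longrightarrow> G s \<omega>"
      proof eventually_elim
        case (elim s)
        obtain k where "s \<le> real k" using real_arch_simple by blast
        then show ?case using elim by auto
      qed
      then show ?case by (rule AE_completion)
    qed
  qed
  have nz: "AE z in Q t. Y (fst z) (snd z) \<noteq> 0" for t
  proof -
    have "AE z in Q t. G (fst z) (snd z)" by (rule AE_path_law(1)[OF GQ]) (rule GAE)
    then show ?thesis by eventually_elim (simp add: G_def Y_def)
  qed
  have ball: "AE \<omega> in M. norm (X s \<omega> - x) \<le> bb_radius ?d p m s" if s: "0 < s" for s
  proof -
    have "AE \<omega> in M. X s \<omega> \<notin> - ball x (bb_radius ?d p m s)"
      by (rule distributed_AE_notin[OF law[OF s]])
        (auto simp: barenblatt_outside_support[OF refl s] dist_norm norm_minus_commute)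
    then show ?thesis by eventually_elim (auto simp: dist_norm norm_minus_commute)
  qed
  have bound: "\<exists>R. AE \<omega> in M. norm (Y t \<omega>) \<le> R" if t: "0 \<le> t" for t
  proof -
    have "\<exists>R. AE \<omega> in M. norm (X t \<omega> - x) \<le> R"
    proof (cases "t = 0")
      case False
      then show ?thesis using ball[of t] t by auto
    next
      \<comment> \<open>No density is given at time \<open>0\<close>. The bound comes from the times
        \<open>1 / (k + 1)\<close>, at which the support has radius at most \<open>bb_rho\<close>,
        and from continuity of the paths.\<close>
      case True
      let ?h = "\<lambda>k. inverse (real (Suc k))"
      have rad: "bb_radius ?d p m (?h k) \<le> bb_rho ?d p m" for k
      proof -
        have "?h k powr (1 / bb_beta ?d p m) \<le> 1 powr (1 / bb_beta ?d p m)"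
          by (rule powr_mono2) (use bp.beta_pos in \<open>auto simp: inverse_le_1_iff\<close>)
        then have "bb_rho ?d p m * ?h k powr (1 / bb_beta ?d p m) \<le> bb_rho ?d p m * 1"
          by (intro mult_left_mono) (auto simp: bb_rho_def)
        then show ?thesis by (simp add: bb_radius_def)
      qed
      have "AE \<omega> in M. norm (X (?h k) \<omega> - x) \<le> bb_rho ?d p m" for k
      proof -
        have "0 < ?h k" by simp
        from ball[OF this] show ?thesis by eventually_elim (rule order_trans[OF _ rad])
      qed
      then have "AE \<omega> in M. \<forall>k. norm (X (?h k) \<omega> - x) \<le> bb_rho ?d p m" unfolding AE_all_countable by blast
      with AE_space have "AE \<omega> in M. norm (X 0 \<omega> - x) \<le> bb_rho ?d p m"
      proof eventually_elim
        case (elim \<omega>)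
        have "(\<lambda>k. X (?h k) \<omega>) \<longlonglongrightarrow> X 0 \<omega>"
          by (rule continuous_on_tendsto_compose[OF Xc[OF elim(1)] LIMSEQ_inverse_real_of_nat]) auto
        then have "(\<lambda>k. norm (X (?h k) \<omega> - x)) \<longlonglongrightarrow> norm (X 0 \<omega> - x)" by (intro tendsto_intros)
        then show ?case by (rule LIMSEQ_le_const2) (use elim(2) in auto)
      qed
      then show ?thesis unfolding True by blast
    qed
    then obtain R where "AE \<omega> in M. norm (X t \<omega> - x) \<le> R" by blast
    then have "AE \<omega> in M. norm (Y t \<omega>) \<le> R + norm (x - o\<^sub>0)"
    proof eventually_elim
      case (elim \<omega>)
      have "norm (Y t \<omega>) \<le> norm (X t \<omega> - x) + norm (x - o\<^sub>0)"
        using norm_triangle_ineq[of "X t \<omega> - x" "x - o\<^sub>0"] by (simp add: Y_def)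
      with elim show ?case by simp
    qed
    then show ?thesis by blast
  qed
  obtain I where I: "ito_integral M F W \<sigma> I" and XI: "AE \<omega> in M. \<forall>t\<ge>0. set_integrable lebesgue {0..t} (\<lambda>s. \<beta> s \<omega>) \<and>
      X t \<omega> = X 0 \<omega> + I t \<omega> + (LINT s:{0..t}|lebesgue. \<beta> s \<omega>)"
    using dX unfolding has_ito_differential_def by blast
  \<comment> \<open>\<open>has_ito_differential\<close> integrates over the completed measure; the
    jointly Borel measurable \<open>\<beta>\<close> is also integrable for \<open>lborel\<close>, so
    the two integrals agree.\<close>
  have "AE \<omega> in M. \<forall>k::nat. set_integrable lborel {0..real k} (\<lambda>s. \<beta> s \<omega>)"
    unfolding AE_all_countable set_integrable_time by (intro allI AE_path_integrable pb bfin) simp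
  with XI have decomp: "AE \<omega> in M. \<forall>t\<ge>0. Y t \<omega> = Y 0 \<omega> + I t \<omega> + (LINT s:{0..t}|lborel. \<beta> s \<omega>)"
  proof eventually_elim
    case (elim \<omega>)
    show ?case
    proof (intro allI impI)
      fix t :: real assume "0 \<le> t"
      with elim(1) have X': "X t \<omega> = X 0 \<omega> + I t \<omega> + (LINT s:{0..t}|lebesgue. \<beta> s \<omega>)" by blast
      obtain k where k: "t \<le> real k" using real_arch_simple by blast
      have "set_integrable lborel {0..real k} (\<lambda>s. \<beta> s \<omega>)" using elim(2) by blast
      then have "set_integrable lborel {0..t} (\<lambda>s. \<beta> s \<omega>)" by (rule set_integrable_subset) (use k in auto)
      note * = set_integral_lebesgue_lborel(2)[OF this]
      show "Y t \<omega> = Y 0 \<omega> + I t \<omega> + (LINT s:{0..t}|lborel. \<beta> s \<omega>)"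
        unfolding Y_def X' * by (simp only: add_diff_eq diff_add_eq)
    qed
  qed
  obtain B where B: "brownian_motion M F B" and "has_ito_differential M F (\<lambda>t \<omega>. norm (Y t \<omega>)) B \<sigma>
      (\<lambda>s \<omega>. (\<sigma> s \<omega>)\<^sup>2 / 2 * ((real ?d - 1) / norm (Y s \<omega>)) + sgn (Y s \<omega>) \<bullet> \<beta> s \<omega>)"
    using norm_ito_differential[OF I Y pb bfin decomp nz bound assms(1)] by blast
  \<comment> \<open>Since the coefficient \<open>a\<close> is nonnegative, the square undoes the
    root and \<open>\<sigma>\<^sup>2 / 2\<close> is \<open>a\<close>.\<close>
  moreover have "(\<lambda>s \<omega>. (\<sigma> s \<omega>)\<^sup>2 / 2 * ((real ?d - 1) / norm (Y s \<omega>)) + sgn (Y s \<omega>) \<bullet> \<beta> s \<omega>)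
    = (\<lambda>t \<omega>. coeff_a ?d p m t (norm (X t \<omega> - x)) * ((real ?d - 1) / norm (X t \<omega> - o\<^sub>0))
        + coeff_ar ?d p m t (norm (X t \<omega> - x)) * (sgn (X t \<omega> - x) \<bullet> sgn (X t \<omega> - o\<^sub>0)))"
    unfolding \<sigma>_def \<beta>_def Y_def fun_eq_iff
    using coeff_a_nonneg by (simp add: inner_commute)
  ultimately have dY: "has_ito_differential M F (\<lambda>t \<omega>. norm (X t \<omega> - o\<^sub>0)) B \<sigma>
      (\<lambda>t \<omega>. coeff_a ?d p m t (norm (X t \<omega> - x)) * ((real ?d - 1) / norm (X t \<omega> - o\<^sub>0))
        + coeff_ar ?d p m t (norm (X t \<omega> - x)) * (sgn (X t \<omega> - x) \<bullet> sgn (X t \<omega> - o\<^sub>0)))"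
    unfolding Y_def by simp
  moreover have "has_ito_differential M F (\<lambda>t \<omega>. norm (X t \<omega> - o\<^sub>0)) B \<sigma>
      (\<lambda>t \<omega>. generator p m x t (\<lambda>y. norm (y - o\<^sub>0)) (X t \<omega>))"
  proof (rule has_ito_differential_cong_drift[OF dY])
    show "AE \<omega> in M. AE s in lebesgue. 0 < s \<longrightarrow>
        coeff_a ?d p m s (norm (X s \<omega> - x)) * ((real ?d - 1) / norm (X s \<omega> - o\<^sub>0))
        + coeff_ar ?d p m s (norm (X s \<omega> - x)) * (sgn (X s \<omega> - x) \<bullet> sgn (X s \<omega> - o\<^sub>0))
        = generator p m x s (\<lambda>y. norm (y - o\<^sub>0)) (X s \<omega>)"
      using first
    proof eventually_elim
      case (elim \<omega>)
      then show ?case by eventually_elim (simp add: G_def generator_norm[OF refl])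
    qed
  qed
  ultimately show ?thesis using first B unfolding G_def \<sigma>_def[abs_def] by blast
qed

end
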